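(* Let $P$ be an ergodic fractal distribution on $\mathbb{R}^d$ and let $\pi\in\Pi_{d,k}$. Then the push-forward $Q$ of $P$ by the ($P$-a.e. defined) map $\mu\mapsto(\mu_{[0]_{\pi}})^{*}$ is an ergodic fractal distribution (on $[0]_\pi=\ker\pi$, identified with a Euclidean space), and this map is a factor map from $(P,S^{*})$ to $(Q,S^{*})$. In particular, for $P$-a.e. $\mu$ the conditional measure $\mu_{[0]_{\pi}}$ is well defined, as are $\mu_{[x]_{\pi}}$ for $\mu$-a.e. $x$, and these measures are exact dimensional and their dimension is a.s. independent of $\mu$ and $x$.
   Context: $\mathbb{R}^d$ carries the sup-norm; $B_r(x)$ is the closed ball, $B_R=B_R(0)$, $B_1=[-1,1]^d$. $\mathcal{M}$ is the space of Radon measures on $\mathbb{R}^d$ with the weak topology (tested against continuous compactly supported functions). "Distribution" means a Borel probability measure on a space of measures. For $\mu(B_1)>0$ put $\mu^*=\frac{1}{\mu(B_1)}\mu$, and $\mathcal{M}^*=\{\mu:\mu(B_1)=1\}$. For $0<\mu(A)<\infty$, $\mu_A=\frac1{\mu(A)}\mu|_A$. Let $T_x(y)=y-x$, $S_t(y)=e^t y$; maps act on measures by push-forward; $T_x^*\mu=(T_x\mu)^*$, $S_t^*\mu=(S_t\mu)^*$. $S^*=(S^*_t)_{t\in\mathbb{R}}$ acts on $\{\mu\in\mathcal{M}^*:0\in\operatorname{supp}\mu\}$; $S^*$-invariant distributions are understood to be concentrated on this set. Fractal distribution (FD): a probability distribution $P$ on $\mathcal{M}^*$ that is $S^*$-invariant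 and quasi-Palm, i.e. for every bounded open neighborhood $U$ of $0$, $P\sim\int\int_U\delta_{T_x^*\mu}\,d\mu(x)\,dP(\mu)$ ($\sim$: same null sets). EFD (ergodic fractal distribution): an $S^*$-ergodic FD. FDs on a linear subspace $V\subseteq \mathbb{R}^d$ are defined in the same way, with $V$ in place of $\mathbb{R}^d$ and $B_1\cap V$ in place of $B_1$. $\Pi_{d,k}$ is the space of linear maps $\mathbb{R}^d\to\mathbb{R}^k$. For $\pi\in\Pi_{d,k}$, $[x]_\pi=\pi^{-1}(\pi(x))$. For $\mu\in\mathcal{P}(\mathbb{R}^d)$, $\{\mu_{[x]_\pi}\}$ is the disintegration of $\mu$ over the fibers of $\pi$: $x\mapsto\mu_{[x]_\pi}$ is measurable with respect to $\{\pi^{-1}(E):E \text{ Borel}\}$, $\mu_{[x]_\pi}$ is a probability measure supported on $[x]_\pi$ for $\mu$-a.e. $x$, and $\mu=\int\mu_{[x]_\pi}\,d\mu(x)$. For general $\mu\in\mathcal{M}$, the measures $(\mu_{B_R})_{[x]_\pi}$ are, for $\mu$-a.e. $x\in B_R$ and $R'>R$, consistent up to scalars ($(\mu_{B_{R'}})_{[x]_\pi}|_{B_R}$ is proportional to $(\mu_{B_R})_{[x]_\pi}$), and gluing them gives a Radon measure $\mu_{[x]_\pi}$ on $[x]_\pi$, well defined up to a positive scalar. At a specified point $x$ (such as $x=0$), $\mu_{[x]_\pi}$ is said to be defined if for all large integers $R$ the weak limit $\eta_R=\lim_{\varepsilon\to0}\mu_{B_R\cap[x]_\pi^{(\varepsilon)}}$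 exists ($A^{(\varepsilon)}$ the $\varepsilon$-neighborhood of $A$) and the $\eta_R$ are consistent up to scalars, meaning that for all large integers $R'>R$ the restriction $\eta_{R'}|_{B_R}$ is proportional to $\eta_R$; $\mu_{[x]_\pi}$ is then their gluing, and this agrees with the disintegration at $\mu$-a.e. $x$. The measure $(\mu_{[0]_\pi})^*$ does not depend on the scalar. A measure $\nu$ is exact dimensional with dimension $\alpha$ if $\lim_{r\searrow0}\frac{\log\nu(B_r(y))}{\log r}=\alpha$ for $\nu$-a.e. $y$. A factor map is a measurable measure-preserving map intertwining the actions. *)

theory Defs
  imports "HOL-Probability.Probability"
begin

section \<open>Radon measures and distributions\<close>

text \<open>
  \<open>infnorm\<close> is the sup-norm of \<open>real ^ 'd\<close>; \<open>norm\<close> and \<open>dist\<close> are Euclidean and are not used below.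
\<close>

definition sup_cball :: "real \<Rightarrow> real ^ 'd \<Rightarrow> (real ^ 'd) set" where
  "sup_cball r x = {y. infnorm (y - x) \<le> r}"

definition sup_nhd :: "(real ^ 'd) set \<Rightarrow> real \<Rightarrow> (real ^ 'd) set" where
  "sup_nhd A \<epsilon> = {y. \<exists>a\<in>A. infnorm (y - a) < \<epsilon>}"

text \<open>
  For closed \<open>A\<close>, a Radon measure on \<open>A\<close> is represented by the Borel measure on the ambient space
  that extends it by 0 outside \<open>A\<close>. In particular \<open>B\<^sub>1 \<inter> V\<close> and \<open>B\<^sub>1\<close> have the same mass for
  Radon measures on a linear subspace \<open>V\<close>.
\<close>

definition radon_on :: "(real ^ 'd) set \<Rightarrow> (real ^ 'd) measure set" where
  "radon_on A = {\<mu>. sets \<mu> = sets borel \<and> (\<forall>K. compact K \<longrightarrow> emeasure \<mu> K < \<infinity>)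
                     \<and> emeasure \<mu> (- A) = 0}"

text \<open>
  The weak topology. For closed \<open>A\<close> the restrictions to \<open>A\<close> of the compactly supported continuous
  functions on the ambient space are exactly the compactly supported continuous functions on \<open>A\<close>.
\<close>

definition weak_topology :: "(real ^ 'd) set \<Rightarrow> (real ^ 'd) measure topology" where
  "weak_topology A = topology_generated_by
     {{\<mu> \<in> radon_on A. (\<integral>x. f x \<partial>\<mu>) \<in> W} | (f :: real ^ 'd \<Rightarrow> real) (W :: real set).
        continuous_on UNIV f \<and> compact (closure {x. f x \<noteq> 0}) \<and> open W}"

definition radon_borel :: "(real ^ 'd) set \<Rightarrow> (real ^ 'd) measure measure" where
  "radon_borel A = sigma (radon_on A) {U. openin (weak_topology A) U}"

definition msupp :: "(real ^ 'd) measure \<Rightarrow> (real ^ 'd) set" where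
  "msupp \<mu> = {x. \<forall>U. open U \<longrightarrow> x \<in> U \<longrightarrow> emeasure \<mu> U > 0}"

text \<open>
  The normalization \<open>\<mu>\<^sup>*\<close>. Since \<open>1 / 0 = 0\<close> for reals, it is the zero measure if \<open>\<mu>(B\<^sub>1) = 0\<close>; thus
  \<open>star\<close>, \<open>trans_star\<close> and \<open>scale_star\<close> are total functions on Radon measures.
\<close>

definition star :: "(real ^ 'd) measure \<Rightarrow> (real ^ 'd) measure" where
  "star \<mu> = scale_measure (ennreal (1 / measure \<mu> (sup_cball 1 0))) \<mu>"

definition trans_star :: "real ^ 'd \<Rightarrow> (real ^ 'd) measure \<Rightarrow> (real ^ 'd) measure" where
  "trans_star x \<mu> = star (distr \<mu> borel (\<lambda>y. y - x))"

definition scale_star :: "real \<Rightarrow> (real ^ 'd) measure \<Rightarrow> (real ^ 'd) measure" where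
  "scale_star t \<mu> = star (distr \<mu> borel (\<lambda>y. exp t *\<^sub>R y))"

text \<open>The space \<open>{\<mu> \<in> \<M>\<^sup>*. 0 \<in> supp \<mu>}\<close> on which \<open>S\<^sup>*\<close> acts.\<close>

definition star_space :: "(real ^ 'd) set \<Rightarrow> (real ^ 'd) measure set" where
  "star_space V = {\<mu> \<in> radon_on V. emeasure \<mu> (sup_cball 1 0) = 1 \<and> 0 \<in> msupp \<mu>}"


section \<open>Fractal distributions\<close>

definition S_invariant :: "(real ^ 'd) set \<Rightarrow> (real ^ 'd) measure measure \<Rightarrow> bool" where
  "S_invariant V P \<longleftrightarrow>
     (AE \<mu> in P. \<mu> \<in> star_space V) \<and> (\<forall>t. distr P (radon_borel V) (scale_star t) = P)"

definition quasi_palm :: "(real ^ 'd) set \<Rightarrow> (real ^ 'd) measure measure \<Rightarrow> bool" where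
  "quasi_palm V P \<longleftrightarrow>
     (\<forall>U. openin (top_of_set V) U \<longrightarrow> bounded U \<longrightarrow> 0 \<in> U \<longrightarrow>
        (\<forall>A\<in>sets P. emeasure P A = 0 \<longleftrightarrow>
           (\<integral>\<^sup>+\<mu>. (\<integral>\<^sup>+x\<in>U. indicator A (trans_star x \<mu>) \<partial>\<mu>) \<partial>P) = 0))"

text \<open>In the following, \<open>V\<close> is meant to be a linear subspace.\<close>

definition fractal_distribution ::
    "(real ^ 'd) set \<Rightarrow> (real ^ 'd) measure measure \<Rightarrow> bool" where
  "fractal_distribution V P \<longleftrightarrow>
     prob_space P \<and> sets P = sets (radon_borel V) \<and> S_invariant V P \<and> quasi_palm V P"

definition S_ergodic :: "(real ^ 'd) set \<Rightarrow> (real ^ 'd) measure measure \<Rightarrow> bool" where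
  "S_ergodic V P \<longleftrightarrow>
     (\<forall>A\<in>sets P. A \<subseteq> star_space V \<longrightarrow> (\<forall>t. scale_star t -` A \<inter> star_space V = A) \<longrightarrow>
        emeasure P A = 0 \<or> emeasure P A = 1)"

definition ergodic_fractal_distribution ::
    "(real ^ 'd) set \<Rightarrow> (real ^ 'd) measure measure \<Rightarrow> bool" where
  "ergodic_fractal_distribution V P \<longleftrightarrow> fractal_distribution V P \<and> S_ergodic V P"

text \<open>
  Factor maps are only defined almost everywhere, so measurability is understood modulo null sets,
  i.e. with respect to the completion of \<open>P\<close>.
\<close>

definition factor_map :: "(real ^ 'd) measure measure \<Rightarrow> (real ^ 'd) measure measure \<Rightarrow>
    ((real ^ 'd) measure \<Rightarrow> (real ^ 'd) measure) \<Rightarrow> bool" where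
  "factor_map P Q F \<longleftrightarrow>
     F \<in> completion P \<rightarrow>\<^sub>M Q \<and> distr (completion P) Q F = Q \<and>
     (AE \<mu> in P. \<forall>t. F (scale_star t \<mu>) = scale_star t (F \<mu>))"


section \<open>Conditional measures on the fibers of a linear map\<close>

definition fiber :: "(real ^ 'd \<Rightarrow> real ^ 'k) \<Rightarrow> real ^ 'd \<Rightarrow> (real ^ 'd) set" where
  "fiber \<pi> x = \<pi> -` {\<pi> x}"

definition restr :: "(real ^ 'd) measure \<Rightarrow> (real ^ 'd) set \<Rightarrow> (real ^ 'd) measure" where
  "restr \<mu> A = density \<mu> (indicator A)"

definition proportional :: "(real ^ 'd) measure \<Rightarrow> (real ^ 'd) measure \<Rightarrow> bool" where
  "proportional \<mu> \<nu> \<longleftrightarrow> (\<exists>c::real. c > 0 \<and> \<mu> = scale_measure (ennreal c) \<nu>)"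

text \<open>
  \<open>\<eta>\<close> is the weak limit of \<open>\<mu>\<close> conditioned on \<open>B\<^sub>R \<inter> [x]\<^sub>\<pi>\<^sup>(\<^sup>\<epsilon>\<^sup>)\<close> as \<open>\<epsilon> \<rightarrow> 0\<close>. The conditioning makes
  sense only if these sets have positive mass, which is therefore part of the condition.
\<close>

definition tube_limit :: "(real ^ 'd \<Rightarrow> real ^ 'k) \<Rightarrow> (real ^ 'd) measure \<Rightarrow> real ^ 'd \<Rightarrow> nat \<Rightarrow>
    (real ^ 'd) measure \<Rightarrow> bool" where
  "tube_limit \<pi> \<mu> x R \<eta> \<longleftrightarrow>
     (\<forall>\<epsilon>>0. emeasure \<mu> (sup_cball (real R) 0 \<inter> sup_nhd (fiber \<pi> x) \<epsilon>) > 0) \<and>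
     limitin (weak_topology UNIV)
       (\<lambda>\<epsilon>. uniform_measure \<mu> (sup_cball (real R) 0 \<inter> sup_nhd (fiber \<pi> x) \<epsilon>)) \<eta> (at_right 0)"

definition tube_limits_from :: "(real ^ 'd \<Rightarrow> real ^ 'k) \<Rightarrow> (real ^ 'd) measure \<Rightarrow> real ^ 'd \<Rightarrow>
    nat \<Rightarrow> (nat \<Rightarrow> (real ^ 'd) measure) \<Rightarrow> bool" where
  "tube_limits_from \<pi> \<mu> x R\<^sub>0 \<eta> \<longleftrightarrow>
     (\<forall>R\<ge>R\<^sub>0. tube_limit \<pi> \<mu> x R (\<eta> R)) \<and>
     (\<forall>R\<ge>R\<^sub>0. \<forall>R'>R. proportional (restr (\<eta> R') (sup_cball (real R) 0)) (\<eta> R))"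

definition fiber_measure_defined ::
    "(real ^ 'd \<Rightarrow> real ^ 'k) \<Rightarrow> (real ^ 'd) measure \<Rightarrow> real ^ 'd \<Rightarrow> bool" where
  "fiber_measure_defined \<pi> \<mu> x \<longleftrightarrow> (\<exists>R\<^sub>0 \<eta>. tube_limits_from \<pi> \<mu> x R\<^sub>0 \<eta>)"

definition glued_fiber_measure :: "(real ^ 'd \<Rightarrow> real ^ 'k) \<Rightarrow> (real ^ 'd) measure \<Rightarrow> real ^ 'd \<Rightarrow>
    (real ^ 'd) measure \<Rightarrow> bool" where
  "glued_fiber_measure \<pi> \<mu> x \<nu> \<longleftrightarrow>
     \<nu> \<in> radon_on (fiber \<pi> x) \<and>
     (\<exists>R\<^sub>0 \<eta>. tube_limits_from \<pi> \<mu> x R\<^sub>0 \<eta> \<and>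
        (\<forall>R\<ge>R\<^sub>0. proportional (restr \<nu> (sup_cball (real R) 0)) (\<eta> R)))"

text \<open>
  The measure \<open>\<mu>\<close> conditioned on \<open>[x]\<^sub>\<pi>\<close>. The gluing is unique up to a positive scalar, and the
  choice operator fixes the scalar arbitrarily. Where the conditional measure is undefined, the zero
  measure is used as a dummy value.
\<close>

definition fiber_measure ::
    "(real ^ 'd \<Rightarrow> real ^ 'k) \<Rightarrow> (real ^ 'd) measure \<Rightarrow> real ^ 'd \<Rightarrow> (real ^ 'd) measure" where
  "fiber_measure \<pi> \<mu> x =
     (if fiber_measure_defined \<pi> \<mu> x then (SOME \<nu>. glued_fiber_measure \<pi> \<mu> x \<nu>)
      else null_measure borel)"

text \<open>
  \<open>vimage_algebra UNIV \<pi> borel\<close> is the \<open>\<sigma>\<close>-algebra of the sets \<open>\<pi> -` E\<close> with \<open>E\<close> Borel.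
\<close>

definition fiber_disintegration :: "(real ^ 'd \<Rightarrow> real ^ 'k) \<Rightarrow> (real ^ 'd) measure \<Rightarrow>
    (real ^ 'd \<Rightarrow> (real ^ 'd) measure) \<Rightarrow> bool" where
  "fiber_disintegration \<pi> \<mu> \<kappa> \<longleftrightarrow>
     \<kappa> \<in> vimage_algebra UNIV \<pi> borel \<rightarrow>\<^sub>M prob_algebra borel \<and>
     (AE x in \<mu>. emeasure (\<kappa> x) (fiber \<pi> x) = 1) \<and>
     (\<forall>A\<in>sets borel. emeasure \<mu> A = (\<integral>\<^sup>+x. emeasure (\<kappa> x) A \<partial>\<mu>))"

text \<open>\<open>\<nu>\<close> is obtained by gluing the disintegrations of the probability measures \<open>\<mu>\<^bsub>B\<^sub>R\<^esub>\<close>.\<close>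

definition glued_disintegration :: "(real ^ 'd \<Rightarrow> real ^ 'k) \<Rightarrow> (real ^ 'd) measure \<Rightarrow>
    (real ^ 'd \<Rightarrow> (real ^ 'd) measure) \<Rightarrow> bool" where
  "glued_disintegration \<pi> \<mu> \<nu> \<longleftrightarrow>
     (AE x in \<mu>. \<nu> x \<in> radon_on (fiber \<pi> x)) \<and>
     (\<forall>R::nat. emeasure \<mu> (sup_cball (real R) 0) > 0 \<longrightarrow>
        (\<exists>\<kappa>. fiber_disintegration \<pi> (uniform_measure \<mu> (sup_cball (real R) 0)) \<kappa> \<and>
             (AE x in \<mu>. x \<in> sup_cball (real R) 0 \<longrightarrow>
                proportional (restr (\<nu> x) (sup_cball (real R) 0)) (\<kappa> x))))"

text \<open>The map \<open>\<mu> \<mapsto> (\<mu>\<^bsub>[0]\<^esub>)\<^sup>*\<close> and the push-forward of \<open>P\<close> by it.\<close>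

definition fiber_map ::
    "(real ^ 'd \<Rightarrow> real ^ 'k) \<Rightarrow> (real ^ 'd) measure \<Rightarrow> (real ^ 'd) measure" where
  "fiber_map \<pi> \<mu> = star (fiber_measure \<pi> \<mu> 0)"

definition fiber_distribution :: "(real ^ 'd \<Rightarrow> real ^ 'k) \<Rightarrow> (real ^ 'd) measure measure \<Rightarrow>
    (real ^ 'd) measure measure" where
  "fiber_distribution \<pi> P = distr (completion P) (radon_borel (fiber \<pi> 0)) (fiber_map \<pi>)"


section \<open>Exact dimensionality\<close>

definition exact_dimensional :: "(real ^ 'd) measure \<Rightarrow> real \<Rightarrow> bool" where
  "exact_dimensional \<nu> \<alpha> \<longleftrightarrow>
     (AE y in \<nu>. ((\<lambda>r. ln (measure \<nu> (sup_cball r y)) / ln r) \<longlongrightarrow> \<alpha>) (at_right 0))"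

end

theory Submission
  imports Defs
begin

text \<open>
  Write \<open>V\<close> for the kernel of \<open>\<pi>\<close>. The tubes around the fibers of \<open>\<pi>\<close> satisfy a Vitali-type maximal
  inequality, so for every Radon measure \<open>\<mu>\<close> and \<open>\<mu>\<close>-a.e. \<open>x\<close> the normalized restrictions of \<open>\<mu>\<close> to
  thin tubes around \<open>x\<close> converge vaguely to the conditional measure on the fiber of \<open>x\<close>. The
  quasi-Palm property moves this from a typical point to the origin of a \<open>P\<close>-typical \<open>\<mu>\<close>. Existence
  of the limit is invariant under \<open>S\<^sup>*\<close> and the limit map commutes with \<open>S\<^sup>*\<close> and with translations
  along \<open>V\<close>; hence the push-forward is an ergodic fractal distribution on \<open>V\<close>. A density argument
  shows that typical measures do not charge spheres around \<open>0\<close>, so vague limits restrict to weak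
  limits on balls. Finally \<open>- ln \<nu>(B\<^sub>r)\<close>, \<open>r = exp (- n)\<close>, is an additive cocycle along the orbit of
  \<open>S\<^sup>*\<close>, and the ergodic theorem for it gives the dimension at \<open>0\<close>, hence at typical points.
\<close>

text \<open>The conditional measure at the origin is defined by weak limits on balls of integer
  radius. This notion is awkward to transport: scalings do not preserve the integer radii,
  translations move the balls, and mass on the boundary of a ball can destroy convergence. The proof
  therefore works with \<open>fconv\<close>, vague convergence of the restrictions to tubes after
  multiplication by arbitrary positive constants. It involves no balls, determines its limit up to a
  scalar, and is carried along by translations and scalings. The comparison with the definition by
  balls comes last: it requires that spheres around the origin are null for the limit measure, and
  this is proved from the fact that the push-forward is already known to be a fractal distribution.
  For the same reason there are two maps. \<open>F0\<close>, built from \<open>fconv\<close>, is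
  Borel and carries the whole argument; \<open>fiber_map\<close> is only shown to agree with it
  almost everywhere, which suffices for measurability with respect to the completion of
  \<open>P\<close>.\<close>

abbreviation (input) em where "em == emeasure"
abbreviation (input) bm where "bm == borel_measurable"
abbreviation (input) at0 where "at0 == at_right (0 :: real)"
abbreviation (input) rs where "rs n == 1 / real (Suc n)"
abbreviation (input) cb where "cb n == sup_cball (real n) 0"
lemmas mcs = measurable_cong_sets

section \<open>Sup-norm balls and compactly supported test functions\<close>

lemma mem_sup_cball: "y \<in> sup_cball r x \<longleftrightarrow> infnorm (y - x) <= r"
 by (simp add: sup_cball_def)

lemma infnorm_0_vec [simp]: "infnorm (0 :: real ^ 'd) = 0"
 by (rule infnorm_0)

lemma closed_sup_cball [simp, intro]: "closed (sup_cball r x)"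
 unfolding sup_cball_def by (intro closed_Collect_le continuous_intros)

lemma compact_sup_cball [simp, intro]: "compact (sup_cball r (x :: real ^ 'd))"
proof -
 have "norm y <= norm x + sqrt (real DIM(real ^ 'd)) * r" if "y \<in> sup_cball r x" for y
 proof -
  have "norm (y - x) <= sqrt (real DIM(real ^ 'd)) * infnorm (y - x)" by (rule norm_le_infnorm)
  also have "... <= sqrt (real DIM(real ^ 'd)) * r"
   using that by (intro mult_left_mono) (auto simp: mem_sup_cball)
  finally show ?thesis using norm_triangle_sub[of y x] by linarith
 qed
 thus ?thesis by (auto simp: compact_eq_bounded_closed bounded_iff)
qed

lemma sup_cball_borel [measurable]: "sup_cball r x \<in> sets borel"
 by (rule borel_closed) simp

lemma sup_cball_mono: "r <= s ==> sup_cball r x \<subseteq> sup_cball s x"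
 by (auto simp: sup_cball_def)

lemma UN_sup_cball: "(\<Union>n::nat. sup_cball (real n) (x :: real ^ 'd)) = UNIV"
 using real_arch_simple by (fastforce simp: mem_sup_cball)

lemma infnorm_borel [measurable]: "infnorm \<in> bm (borel :: (real ^ 'd) measure)"
 by (intro borel_measurable_continuous_onI continuous_intros)

lemma bounded_subset_sup_cball:
 assumes "bounded (S :: (real ^ 'd) set)"
 obtains N :: nat where "S \<subseteq> cb N"
proof -
 obtain b where b: "!!x. x \<in> S ==> norm x <= b" using assms by (auto simp: bounded_iff)
 obtain N :: nat where N: "b <= real N" using real_arch_simple by blast
 have "S \<subseteq> cb N"
  using b N infnorm_le_norm order_trans by (fastforce simp: mem_sup_cball)
 thus ?thesis by (rule that)
qed

definition Cc :: "(real ^ 'd => real) set" where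
 "Cc = {f. continuous_on UNIV f & compact (closure {x. f x ~= 0})}"

lemma Cc_iff: "f \<in> Cc \<longleftrightarrow> continuous_on UNIV f & (EX N::nat. ALL x. f x ~= 0 --> infnorm x <= real N)"
proof
 assume f: "f \<in> Cc"
 hence "bounded {x. f x ~= 0}"
  using bounded_closure_image compact_imp_bounded bounded_subset closure_subset unfolding Cc_def by blast
 then obtain N :: nat where "{x. f x ~= 0} \<subseteq> cb N"
  by (rule bounded_subset_sup_cball)
 with f show "continuous_on UNIV f & (EX N::nat. ALL x. f x ~= 0 --> infnorm x <= real N)"
  unfolding Cc_def subset_eq mem_Collect_eq mem_sup_cball by (auto intro!: exI[of _ N])
next
 assume r: "continuous_on UNIV f & (EX N::nat. ALL x. f x ~= 0 --> infnorm x <= real N)"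
 then obtain N :: nat where "ALL x. f x ~= 0 --> infnorm x <= real N" by blast
 hence "{x. f x ~= 0} \<subseteq> cb N" by (auto simp: mem_sup_cball)
 hence "closure {x. f x ~= 0} \<subseteq> cb N" by (intro closure_minimal) auto
 hence "compact (closure {x. f x ~= 0})"
  using compact_sup_cball compact_eq_bounded_closed bounded_subset by (metis closed_closure)
 with r show "f \<in> Cc" by (simp add: Cc_def)
qed

lemma CcI: "continuous_on UNIV f ==> (!!x. infnorm x > r ==> f x = 0) ==> f \<in> Cc"
proof -
 assume a: "continuous_on UNIV f" "!!x. infnorm x > r ==> f x = 0"
 obtain N :: nat where N: "r <= real N" using real_arch_simple by blast
 have "ALL x. f x ~= 0 --> infnorm x <= real N" using a(2) N by (metis le_less_linear order_trans)
 with a show ?thesis by (auto simp: Cc_iff)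
qed

lemma Cc_support:
 assumes "f \<in> Cc" obtains N :: nat where "!!x. infnorm x > real N ==> f x = 0"
 using assms unfolding Cc_iff by (auto simp: not_le[symmetric])

lemma Cc_cont: "f \<in> Cc ==> continuous_on UNIV f"
 by (simp add: Cc_iff)

lemma Cc_borel: "f \<in> Cc ==> f \<in> bm borel"
 by (intro borel_measurable_continuous_onI Cc_cont)

lemma Cc_bounded: assumes "f \<in> Cc" obtains B where "B > 0" "!!x. \<bar>f x\<bar> <= B"
proof -
 obtain N :: nat where N: "!!x. infnorm x > real N ==> f x = 0" using Cc_support[OF assms] by blast
 have "compact (f ` cb N)"
  using Cc_cont[OF assms] by (intro compact_continuous_image) (auto intro: continuous_on_subset)
 then obtain B where B: "!!x. x \<in> cb N ==> \<bar>f x\<bar> <= B"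
  using compact_imp_bounded[of "f ` cb N"] unfolding bounded_iff by auto
 have "\<bar>f x\<bar> <= \<bar>B\<bar> + 1" for x
  using N[of x] B[of x] by (cases "infnorm x > real N") (auto simp: mem_sup_cball)
 thus ?thesis by (intro that[of "\<bar>B\<bar> + 1"]) auto
qed

lemma Cc_mult: "f \<in> Cc ==> continuous_on UNIV g ==> (%x. f x * g x) \<in> Cc"
 by (auto simp: Cc_iff intro!: continuous_intros)

lemma Cc_scale: "f \<in> Cc ==> (%x. c * f x) \<in> Cc"
 by (auto simp: Cc_iff intro!: continuous_intros)

lemma Cc_comp_affine:
 fixes f :: "real ^ 'd => real"
 assumes "f \<in> Cc" "c ~= 0" shows "(%x. f (c *\<^sub>R x + a)) \<in> Cc"
proof -
 obtain N :: nat where N: "!!x. infnorm x > real N ==> f x = 0" using Cc_support[OF assms(1)] by blast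
 show ?thesis
 proof (rule CcI[where r = "(real N + infnorm a) / \<bar>c\<bar>"])
  show "continuous_on UNIV (%x. f (c *\<^sub>R x + a))"
   by (rule continuous_on_compose2[OF Cc_cont[OF assms(1)]]) (auto intro!: continuous_intros)
  fix x :: "real ^ 'd" assume "infnorm x > (real N + infnorm a) / \<bar>c\<bar>"
  hence "real N + infnorm a < \<bar>c\<bar> * infnorm x" using assms(2) by (simp add: field_simps)
  moreover have "infnorm (c *\<^sub>R x) <= infnorm (c *\<^sub>R x + a) + infnorm (- a)"
   using infnorm_triangle[of "c *\<^sub>R x + a" "- a"] by simp
  ultimately show "f (c *\<^sub>R x + a) = 0" by (intro N) (simp add: infnorm_mul infnorm_neg)
 qed
qed

definition tent :: "real => real ^ 'd => real" where "tent r x = max 0 (r - infnorm x)"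

text \<open>A continuous stand-in for the indicator of a ball: multiplying by it keeps functions in
  \<open>Cc\<close>, so that localisation commutes with vague limits.\<close>

definition cut :: "nat => real ^ 'd => real" where "cut N x = min 1 (tent (real N + 1) x)"

lemma tent_Cc: "tent r \<in> Cc"
 unfolding tent_def by (rule CcI[where r=r]) (auto intro!: continuous_intros)

lemma tent_nonneg [simp]: "tent r x >= 0" and tent_pos: "tent r x > 0 \<longleftrightarrow> infnorm x < r"
 by (auto simp: tent_def)

lemma cut_Cc: "cut N \<in> Cc"
 unfolding cut_def tent_def by (rule CcI[where r="real N + 1"]) (auto intro!: continuous_intros)

lemma cut_nonneg [simp]: "cut N x >= 0" and cut_le1 [simp]: "cut N x <= 1"
 and cut_eq1: "infnorm x <= real N ==> cut N x = 1"
 and cut_eq0: "infnorm x >= real N + 1 ==> cut N x = 0"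
 by (auto simp: cut_def tent_def)

section \<open>Radon measures and their determination by test functions\<close>

lemma radon_sets: "mu \<in> radon_on A ==> sets mu = sets borel"
 and radon_space: "mu \<in> radon_on A ==> space mu = UNIV"
 using sets_eq_imp_space_eq[of mu borel] by (auto simp: radon_on_def)

lemma radon_compact: "mu \<in> radon_on A ==> compact K ==> em mu K < \<infinity>"
 by (simp add: radon_on_def)

lemma radon_ball: "mu \<in> radon_on A ==> em mu (sup_cball r x) < \<infinity>"
 by (rule radon_compact[OF _ compact_sup_cball])

lemma radon_bounded: "mu \<in> radon_on A ==> bounded S ==> em mu S < \<infinity>"
proof -
 assume a: "mu \<in> radon_on A" "bounded S"
 note [simp] = radon_sets[OF a(1)]
 obtain N :: nat where "S \<subseteq> cb N" using a(2) by (rule bounded_subset_sup_cball)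
 hence "em mu S <= em mu (cb N)" using a(1) by (intro emeasure_mono) auto
 thus ?thesis using radon_ball[OF a(1)] by (rule order_le_less_trans)
qed

lemma radon_UNIV: "mu \<in> radon_on A ==> mu \<in> radon_on UNIV"
 by (auto simp: radon_on_def)

lemma radon_onI:
 assumes "sets mu = sets borel" "!!N::nat. em mu (cb N) < \<infinity>" "em mu (- A) = 0"
 shows "mu \<in> radon_on A"
proof -
 have "em mu K < \<infinity>" if K: "compact K" for K
 proof -
  obtain N :: nat where "K \<subseteq> cb N"
   using bounded_subset_sup_cball[OF compact_imp_bounded[OF K]] by blast
  hence "em mu K <= em mu (cb N)" using assms(1) by (intro emeasure_mono) auto
  thus ?thesis using assms(2) by (rule order_le_less_trans)
 qed
 thus ?thesis using assms by (simp add: radon_on_def)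
qed

lemma radon_AE: assumes "mu \<in> radon_on A" "A \<in> sets borel" shows "AE x in mu. x \<in> A"
 by (rule AE_I[where N="- A"]) (use assms in \<open>auto simp: radon_on_def\<close>)

lemma Cc_integrable: assumes "mu \<in> radon_on A" "f \<in> Cc" shows "integrable mu f"
proof -
 note [simp] = radon_sets[OF assms(1)]
 obtain B where B: "!!x. \<bar>f x\<bar> <= B" using Cc_bounded[OF assms(2)] by blast
 obtain N :: nat where N: "!!x. infnorm x > real N ==> f x = 0" using Cc_support[OF assms(2)] by blast
 have "integrable mu (%x. B * indicator (cb N) x)"
  using radon_ball[OF assms(1)] by (intro integrable_mult_right integrable_real_indicator) auto
 thus ?thesis
 proof (rule Bochner_Integration.integrable_bound)
  show "f \<in> bm mu" using Cc_borel[OF assms(2)] assms(1) by (simp cong: mcs)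
  show "AE x in mu. norm (f x) <= norm (B * indicator (cb N) x)"
  proof (rule AE_I2)
   fix x
   show "norm (f x) <= norm (B * indicator (cb N) x)"
   using B[of x] N[of x] abs_ge_self[of B] by (cases "infnorm x <= real N") (auto simp: mem_sup_cball)
  qed
 qed
qed

text \<open>The functions fall linearly from 1 on \<open>K\<close> to 0 at distance
  \<open>1 / n\<close>. The index 0 is excluded because \<open>g 0\<close> is constantly 1; from
  \<open>n = 1\<close> on, \<open>g 1\<close> dominates and serves as the majorant for dominated
  convergence.\<close>

lemma compact_approx_Cc:
 assumes "compact (K :: (real ^ 'd) set)" "K ~= {}"
 defines "g \<equiv> %n::nat. %x. max 0 (1 - real n * infdist x K)"
 shows "!!n. n >= 1 ==> g n \<in> Cc" "!!x. (%n. g n x) \<longlonglongrightarrow> indicator K x" "!!n x. 0 <= g n x & g n x <= 1"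
  "!!n x. n >= 1 ==> g n x <= g 1 x" "!!n x. x \<in> K ==> g n x = 1"
proof -
 show b: "0 <= g n x & g n x <= 1" for n x by (auto simp: g_def infdist_nonneg)
 show "n >= 1 ==> g n x <= g 1 x" for n x
  using mult_right_mono[of 1 "real n" "infdist x K"] by (auto simp: g_def infdist_nonneg)
 show "g n x = 1" if "x \<in> K" for n x using that by (simp add: g_def)
 show "g n \<in> Cc" if "n >= 1" for n
 proof -
  obtain N :: nat where N: "K \<subseteq> cb N"
   using bounded_subset_sup_cball[OF compact_imp_bounded[OF assms(1)]] by blast
  show ?thesis
  proof (rule CcI[where r="real N + 1"])
   show "continuous_on UNIV (g n)" unfolding g_def
   by (intro continuous_intros)
   fix x :: "real ^ 'd" assume x: "real N + 1 < infnorm x"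
   have "infdist x K >= 1"
   unfolding infdist_notempty[OF assms(2)]
   proof (rule cINF_greatest[OF assms(2)])
   fix y assume "y \<in> K"
   hence "infnorm y <= real N" using N by (auto simp: mem_sup_cball)
   thus "1 <= dist x y"
   using x infnorm_triangle[of "x - y" y] infnorm_le_norm[of "x - y"] by (simp add: dist_norm)
   qed
   hence "1 <= real n * infdist x K" using that by (metis mult_mono mult_1 of_nat_1 of_nat_le_iff of_nat_0_le_iff zero_le_one)
   thus "g n x = 0" by (simp add: g_def)
  qed
 qed
 show "(%n. g n x) \<longlonglongrightarrow> indicator K x" for x
 proof (cases "x \<in> K")
  case True thus ?thesis by (simp add: g_def)
 next
  case False
  hence p: "infdist x K > 0"
   using assms compact_imp_closed in_closed_iff_infdist_zero infdist_nonneg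
   by (metis less_eq_real_def)
  obtain m :: nat where m: "1 / infdist x K <= real m" using real_arch_simple by blast
  have "g n x = 0" if "n >= m" for n
  proof -
   have "1 / infdist x K <= real n" using m that by linarith
   hence "1 <= real n * infdist x K" using p by (simp add: field_simps)
   thus ?thesis by (simp add: g_def)
  qed
  hence "eventually (%n. g n x = 0) sequentially" by (auto simp: eventually_sequentially)
  thus ?thesis using False by (simp add: tendsto_eventually)
 qed
qed

lemma compact_integral_lim:
 assumes "compact (K :: (real ^ 'd) set)" "K ~= {}" "mu \<in> radon_on A"
 shows "(%n. \<integral>x. max 0 (1 - real (Suc n) * infdist x K) \<partial>mu) \<longlonglongrightarrow> measure mu K"
proof -
 note [simp] = radon_sets[OF assms(3)] radon_space[OF assms(3)]
 let ?g = "%n::nat. %x. max 0 (1 - real n * infdist x K)"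
 note g = compact_approx_Cc[OF assms(1,2)]
 have "(%n. \<integral>x. ?g (Suc n) x \<partial>mu) \<longlonglongrightarrow> (LINT x|mu. indicator K x)"
 proof (rule integral_dominated_convergence[where w="?g 1"])
  show "integrable mu (?g 1)" by (rule Cc_integrable[OF assms(3) g(1)]) simp
  show "indicator K \<in> bm mu"
   using borel_compact[OF assms(1)] by (intro borel_measurable_indicator) auto
  show "?g (Suc n) \<in> bm mu" for n
   by (rule borel_measurable_integrable[OF Cc_integrable[OF assms(3) g(1)]]) simp
  show "AE x in mu. (%n. ?g (Suc n) x) \<longlonglongrightarrow> indicator K x" using g(2) LIMSEQ_Suc by blast
  show "AE x in mu. norm (?g (Suc n) x) <= ?g 1 x" for n
   using g(3,4)[of "Suc n"] by (intro AE_I2) auto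
 qed
 thus ?thesis using borel_compact[OF assms(1)] by simp
qed

text \<open>Integrals of test functions give the masses of compact sets by approximation from above,
  and the compact sets form an intersection-stable generator of the Borel sets that contains an
  exhausting sequence of finite mass.\<close>

lemma radon_eqI:
 assumes "mu \<in> radon_on A" "nu \<in> radon_on B" "!!f. f \<in> Cc ==> (LINT x|mu. f x) = (LINT x|nu. f x)"
 shows "mu = (nu :: (real ^ 'd) measure)"
proof (rule measure_eqI_generator_eq[where \<Omega>=UNIV and E="Collect compact" and A="%n. cb n"])
 show "Int_stable (Collect compact :: (real ^ 'd) set set)" by (auto simp: Int_stable_def)
 have "sigma_sets UNIV (Collect compact) = (sets borel :: (real ^ 'd) set set)"
 proof
  show "sigma_sets UNIV (Collect compact) \<subseteq> (sets borel :: (real ^ 'd) set set)"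
   by (metis (no_types, lifting) borel_compact mem_Collect_eq sets.sigma_sets_subset space_borel subsetI)
  have "C \<in> sigma_sets UNIV (Collect compact)" if "closed C" for C :: "(real ^ 'd) set"
  proof -
   have "C = (\<Union>n. C Int cb n)" using UN_sup_cball[of "0 :: real ^ 'd"] by auto
   also have "... \<in> sigma_sets UNIV (Collect compact)"
   using that by (intro sigma_sets.Union) (auto intro!: sigma_sets.Basic)
   finally show ?thesis .
  qed
  hence "sigma_sets UNIV (Collect closed) \<subseteq> sigma_sets UNIV (Collect compact :: (real ^ 'd) set set)"
   by (intro sigma_sets_mono) auto
  thus "(sets borel :: (real ^ 'd) set set) \<subseteq> sigma_sets UNIV (Collect compact)"
   by (simp add: borel_eq_closed sets_measure_of)
 qed
 thus "sets mu = sigma_sets UNIV (Collect compact)" "sets nu = sigma_sets UNIV (Collect compact)"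
  using radon_sets[OF assms(1)] radon_sets[OF assms(2)] by auto
 show "(\<Union>n. cb n) = (UNIV :: (real ^ 'd) set)" by (rule UN_sup_cball)
 show "em mu (sup_cball (real i) 0) ~= \<infinity>" for i using radon_ball[OF assms(1)] by (auto simp: less_top[symmetric])
 fix K :: "(real ^ 'd) set" assume "K \<in> Collect compact"
 hence K: "compact K" by simp
 show "em mu K = em nu K"
 proof (cases "K = {}")
  case False
  have "(LINT x|mu. max 0 (1 - real (Suc n) * infdist x K)) = (LINT x|nu. max 0 (1 - real (Suc n) * infdist x K))" for n
   by (rule assms(3)[OF compact_approx_Cc(1)[OF K False]]) simp
  hence "measure mu K = measure nu K"
   using compact_integral_lim[OF K False assms(1)] compact_integral_lim[OF K False assms(2)] LIMSEQ_unique by auto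
  thus ?thesis
   using radon_compact[OF assms(1) K] radon_compact[OF assms(2) K] by (simp add: emeasure_eq_ennreal_measure less_top[symmetric])
 qed simp
qed auto

section \<open>A countable dense set of test functions\<close>

datatype 'd rat_expr = Coord 'd | Const rat | Add "'d rat_expr" "'d rat_expr" | Mul "'d rat_expr" "'d rat_expr"

instance rat_expr :: (countable) countable
 by countable_datatype

fun rat_eval :: "'d rat_expr => real ^ 'd => real" where
 "rat_eval (Coord i) x = x $ i"
| "rat_eval (Const q) x = of_rat q"
| "rat_eval (Add a b) x = rat_eval a x + rat_eval b x"
| "rat_eval (Mul a b) x = rat_eval a x * rat_eval b x"

lemma continuous_rat_eval: "continuous_on UNIV (rat_eval e)"
 by (induction e) (auto intro!: continuous_intros simp: rat_eval.simps[abs_def])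

text \<open>Functions that are approximable on \<open>K\<close> form an algebra containing the
  constants and the coordinates, so the induction over polynomial functions goes through. Continuity
  is carried along in \<open>ap\<close> because the product step needs bounds on the compact
  set.\<close>

lemma rat_eval_dense:
 assumes "compact (K :: (real ^ 'd) set)" "real_polynomial_function f" "e > 0"
 shows "EX a. ALL x:K. \<bar>f x - rat_eval a x\<bar> < e"
proof -
 define ap where "ap f \<longleftrightarrow> continuous_on UNIV f & (ALL e>0. EX a. ALL x:K. \<bar>f x - rat_eval a x\<bar> < e)" for f :: "real ^ 'd => real"
 have ap_const: "ap (%x. c)" for c
 proof -
  have "EX a. ALL x:K. \<bar>c - rat_eval a x\<bar> < e" if "e > 0" for e
  proof -
   obtain q where q: "c < of_rat q" "of_rat q < c + e" using of_rat_dense[of c "c + e"] \<open>e > 0\<close> by auto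
   hence "ALL x:K. \<bar>c - rat_eval (Const q) x\<bar> < e" by auto
   thus ?thesis by blast
  qed
  thus ?thesis by (auto simp: ap_def)
 qed
 have ap_coord: "ap (%x. x $ i)" for i
 proof -
  have "EX a. ALL x:K. \<bar>x $ i - rat_eval a x\<bar> < e" if "e > 0" for e
   using that by (intro exI[of _ "Coord i"]) auto
  thus ?thesis by (auto simp: ap_def intro!: continuous_intros)
 qed
 have ap_add: "ap (%x. f x + g x)" if "ap f" "ap g" for f g
 proof -
  have "EX a. ALL x:K. \<bar>f x + g x - rat_eval a x\<bar> < e" if "e > 0" for e
  proof -
   obtain a b where "ALL x:K. \<bar>f x - rat_eval a x\<bar> < e / 2" "ALL x:K. \<bar>g x - rat_eval b x\<bar> < e / 2"
   using \<open>ap f\<close> \<open>ap g\<close> \<open>e > 0\<close> unfolding ap_def by (meson half_gt_zero)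
   hence "ALL x:K. \<bar>f x + g x - rat_eval (Add a b) x\<bar> < e"
   by (auto simp: abs_if split: if_splits) (smt (verit) field_sum_of_halves)+
   thus ?thesis by blast
  qed
  with that show ?thesis by (auto simp: ap_def intro!: continuous_intros)
 qed
 have ap_mult: "ap (%x. f x * g x)" if "ap f" "ap g" for f g
 proof -
  have bd: "EX B>0. ALL x:K. \<bar>h x\<bar> <= B" if "ap h" for h
  proof -
   have "compact (h ` K)" using that assms(1) unfolding ap_def
   by (intro compact_continuous_image) (auto intro: continuous_on_subset)
   then obtain B where "ALL x:K. \<bar>h x\<bar> <= B" using compact_imp_bounded[of "h ` K"] by (auto simp: bounded_iff)
   thus ?thesis by (intro exI[of _ "\<bar>B\<bar> + 1"]) fastforce
  qed
  have "EX a. ALL x:K. \<bar>f x * g x - rat_eval a x\<bar> < e" if e: "e > 0" for e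
  proof -
   obtain B where B: "B > 0" "ALL x:K. \<bar>g x\<bar> <= B" using bd[OF \<open>ap g\<close>] by blast
   obtain C where C: "C > 0" "ALL x:K. \<bar>f x\<bar> <= C" using bd[OF \<open>ap f\<close>] by blast
   \<comment> \<open>The product error splits as \<open>(f - a) * g + a * (g - b)\<close>. The bound
     1 keeps the approximant of \<open>f\<close> below \<open>C + 1\<close>; the other one makes
     \<open>d * B + (C + 1) * d\<close> at most \<open>e / 2\<close>.\<close>
   define d where "d = min 1 (e / (2 * (B + C + 1)))"
   have d: "d > 0" using e B C by (auto simp: d_def)
   obtain a b where ab: "ALL x:K. \<bar>f x - rat_eval a x\<bar> < d" "ALL x:K. \<bar>g x - rat_eval b x\<bar> < d"
   using \<open>ap f\<close> \<open>ap g\<close> d unfolding ap_def by meson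
   have "\<bar>f x * g x - rat_eval (Mul a b) x\<bar> < e" if x: "x \<in> K" for x
   proof -
   have "f x * g x - rat_eval (Mul a b) x = (f x - rat_eval a x) * g x + rat_eval a x * (g x - rat_eval b x)"
   by (simp add: algebra_simps)
   also have "\<bar>...\<bar> <= \<bar>f x - rat_eval a x\<bar> * \<bar>g x\<bar> + \<bar>rat_eval a x\<bar> * \<bar>g x - rat_eval b x\<bar>"
   by (metis abs_mult abs_triangle_ineq)
   also have "... <= d * B + (C + 1) * d"
   proof (intro add_mono mult_mono)
   show "\<bar>rat_eval a x\<bar> <= C + 1" using ab(1) C x d_def by (smt (verit) min.cobounded1)
   qed (use ab B C d x in \<open>auto intro: less_imp_le\<close>)
   also have "... = d * (B + C + 1)" by (simp add: algebra_simps)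
   also have "... <= (e / (2 * (B + C + 1))) * (B + C + 1)"
   using B C by (intro mult_right_mono) (auto simp: d_def)
   also have "... = e / 2" using B C by (simp add: field_simps)
   also have "... < e" using e by simp
   finally show ?thesis .
   qed
   thus ?thesis by blast
  qed
  with that show ?thesis by (auto simp: ap_def intro!: continuous_intros)
 qed
 have ap_sum: "ap (%x. \<Sum>i\<in>I. c i * x $ i)" if "finite I" for I and c :: "'d => real"
  using that by (induction I) (auto intro!: ap_add ap_mult ap_const ap_coord)
 have "ap f" using assms(2)
 proof induction
  case (linear f)
  have "f x = (\<Sum>i\<in>UNIV. f (axis i 1) * x $ i)" for x
  proof -
   have "x = (\<Sum>i\<in>UNIV. x $ i *\<^sub>R axis i 1)"
   using basis_expansion[of x] by (simp add: scalar_mult_eq_scaleR)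
   hence "f x = f (\<Sum>i\<in>UNIV. x $ i *\<^sub>R axis i 1)" by simp
   also have "... = (\<Sum>i\<in>UNIV. x $ i * f (axis i 1))"
   using linear by (simp add: linear_sum bounded_linear.linear linear_scale)
   finally show ?thesis by (simp add: mult.commute)
  qed
  hence eq: "(%x. \<Sum>i\<in>UNIV. f (axis i 1) * x $ i) = f" by (intro ext) (rule sym)
  show ?case using ap_sum[of UNIV "%i. f (axis i 1)"] unfolding eq by simp
 qed (auto intro: ap_const ap_add ap_mult)
 thus ?thesis using assms(3) by (auto simp: ap_def)
qed

text \<open>Polynomials with rational coefficients, coded by the countable datatype
  \<open>rat_expr\<close> and cut off. Countability is the point: a property that holds almost
  everywhere for each function holds almost everywhere for all of them.\<close>

definition Dc :: "(real ^ 'd => real) set" where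
 "Dc = range (%(N, e) x. cut N x * rat_eval e x)"

lemma countable_Dc: "countable (Dc :: (real ^ 'd => real) set)"
 unfolding Dc_def by (intro countable_image) auto

lemma Dc_Cc: "f \<in> Dc ==> f \<in> Cc"
 by (auto simp: Dc_def intro!: Cc_mult cut_Cc continuous_rat_eval)

lemma cut_Dc: "cut N \<in> Dc"
proof -
 have "cut N = (%(N, e) x. cut N x * rat_eval e x) (N, Const 1)" by auto
 thus ?thesis unfolding Dc_def by blast
qed

text \<open>The error is measured by \<open>e * cut N\<close> rather than by \<open>e\<close>: this
  is integrable against every Radon measure, so that uniformly close functions have close
  integrals.\<close>

lemma Dc_dense:
 assumes "f \<in> Cc"
 obtains N :: nat where "!!e. e > 0 ==> EX g:Dc. ALL x. \<bar>f x - g x\<bar> <= e * cut N x"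
proof -
 obtain N :: nat where "ALL x. infnorm x > real N --> f x = 0"
  using assms by (elim Cc_support) auto
 hence N: "!!x. infnorm x > real N ==> f x = 0" by blast
 have "EX g:Dc. ALL x. \<bar>f x - g x\<bar> <= e * cut N x" if e0: "e > 0" for e
 proof -
  let ?K = "sup_cball (real N + 1) 0 :: (real ^ 'a) set"
  obtain h where h: "real_polynomial_function h" "!!x. x \<in> ?K ==> \<bar>f x - h x\<bar> < e / 2"
   using Stone_Weierstrass_real_polynomial_function[OF compact_sup_cball
   continuous_on_subset[OF Cc_cont[OF assms] subset_UNIV] half_gt_zero[OF e0]] by metis
  obtain a where a: "ALL x:?K. \<bar>h x - rat_eval a x\<bar> < e / 2"
   using rat_eval_dense[OF compact_sup_cball h(1) half_gt_zero[OF e0]] by blast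
  let ?g = "%x. cut N x * rat_eval a x"
  have "\<bar>f x - ?g x\<bar> <= e * cut N x" for x
  proof (cases "infnorm x <= real N + 1")
   case True
   have fc: "f x = cut N x * f x" using N[of x] cut_eq1[of x N] by (cases "infnorm x <= real N") auto
   have "\<bar>f x - ?g x\<bar> = cut N x * \<bar>f x - rat_eval a x\<bar>"
   by (subst fc) (simp add: abs_mult flip: right_diff_distrib)
   also have "... <= cut N x * e"
   proof (intro mult_left_mono)
   have "x \<in> ?K" using True by (simp add: mem_sup_cball)
   hence "\<bar>f x - h x\<bar> < e / 2" "\<bar>h x - rat_eval a x\<bar> < e / 2" using h(2) a by auto
   thus "\<bar>f x - rat_eval a x\<bar> <= e" by linarith
   qed simp
   finally show ?thesis by (simp add: mult.commute)
  next
   case False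
   thus ?thesis using N[of x] cut_eq0[of N x] by auto
  qed
  moreover have "?g \<in> Dc" unfolding Dc_def by (rule image_eqI[of _ _ "(N, a)"]) auto
  ultimately show ?thesis by (intro bexI[of _ ?g]) auto
 qed
 thus ?thesis by (rule that)
qed

lemma Cc_integral_diff:
 assumes "mu \<in> radon_on A" "f \<in> Cc" "g \<in> Cc" "h \<in> Cc" "!!x. \<bar>f x - g x\<bar> <= e * h x"
 shows "\<bar>(LINT x|mu. f x) - (LINT x|mu. g x)\<bar> <= e * (LINT x|mu. h x)"
proof -
 note i = Cc_integrable[OF assms(1)]
 have "\<bar>(LINT x|mu. f x) - (LINT x|mu. g x)\<bar> = \<bar>\<integral>x. f x - g x \<partial>mu\<bar>"
  using i assms by simp
 also have "... <= (LINT x|mu. e * h x)"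
  using i[OF assms(2)] i[OF assms(3)] i[OF assms(4)] assms(5)
  by (intro order_trans[OF integral_abs_bound] integral_mono) auto
 finally show ?thesis by simp
qed

section \<open>The weak topology and measurability of maps into spaces of measures\<close>

lemma topspace_weak [simp]: "topspace (weak_topology A) = radon_on A"
proof -
 have "(%x. 0) \<in> (Cc :: (real ^ 'a => real) set)" by (rule CcI[where r=0]) auto
 hence "radon_on A \<in> {{mu \<in> radon_on A. (LINT x|mu. f x) \<in> W} | (f :: real ^ 'a => real) (W :: real set).
   continuous_on UNIV f & compact (closure {x. f x ~= 0}) & open W}"
  by (auto simp: Cc_def intro!: exI[of _ "%x. 0 :: real"] exI[of _ "UNIV :: real set"])
 thus ?thesis unfolding weak_topology_def topology_generated_by_topspace by blast
qed

lemma openin_weak_basic: "f \<in> Cc ==> open W ==> openin (weak_topology A) {mu \<in> radon_on A. (LINT x|mu. f x) \<in> W}"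
 unfolding weak_topology_def by (rule topology_generated_by_Basis) (auto simp: Cc_def)

lemma openin_weak_induct [consumes 1, case_names Empty Int UN Basis]:
 assumes "openin (weak_topology A) U" "Q {}" "!!a b. Q a ==> Q b ==> Q (a Int b)"
  "!!K. (!!k. k \<in> K ==> Q k) ==> Q (\<Union>K)"
  "!!f W. f \<in> Cc ==> open W ==> Q {mu \<in> radon_on A. (LINT x|mu. f x) \<in> W}"
 shows "Q U"
 using assms(1) unfolding weak_topology_def openin_topology_generated_by_iff
proof (induction rule: generate_topology_on.induct)
 case (Basis s)
 thus ?case using assms(5) by (auto simp: Cc_def)
qed (use assms(2-4) in auto)

lemma limitin_weak_iff:
 "limitin (weak_topology A) m nu F \<longleftrightarrow> nu \<in> radon_on A & eventually (%ep. m ep \<in> radon_on A) F &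
   (ALL f:Cc. ((%ep. \<integral>x. f x \<partial>m ep) \<longlongrightarrow> (LINT x|nu. f x)) F)" (is "?L \<longleftrightarrow> ?R")
proof
 assume L: ?L
 have "eventually (%ep. m ep \<in> radon_on A) F"
  using L openin_topspace[of "weak_topology A"] unfolding limitin_def by auto
 moreover have "((%ep. \<integral>x. f x \<partial>m ep) \<longlongrightarrow> (LINT x|nu. f x)) F" if f: "f \<in> Cc" for f
 proof (rule topological_tendstoI)
  fix S :: "real set" assume "open S" "(LINT x|nu. f x) \<in> S"
  hence "eventually (%ep. m ep \<in> {mu \<in> radon_on A. (LINT x|mu. f x) \<in> S}) F"
   using L openin_weak_basic[OF f, of S A] unfolding limitin_def by auto
  thus "eventually (%ep. (LINT x|m ep. f x) \<in> S) F" by eventually_elim simp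
 qed
 ultimately show ?R using L unfolding limitin_def by auto
next
 assume R: ?R
 have "nu \<in> U --> eventually (%ep. m ep \<in> U) F" if "openin (weak_topology A) U" for U
  using that
 proof (induction rule: openin_weak_induct)
  case (Int a b) thus ?case by (auto intro: eventually_conj)
 next
  case (UN K)
  show ?case
  proof
   assume "nu \<in> \<Union>K"
   then obtain X where "X \<in> K" "nu \<in> X" by blast
   hence "eventually (%ep. m ep \<in> X) F" using UN by blast
   thus "eventually (%ep. m ep \<in> \<Union>K) F" using \<open>X \<in> K\<close> by (auto elim: eventually_mono)
  qed
 next
  case (Basis f W)
  show ?case
  proof
   assume "nu \<in> {mu \<in> radon_on A. (LINT x|mu. f x) \<in> W}"
   hence "eventually (%ep. (LINT x|m ep. f x) \<in> W) F"
   using R Basis topological_tendstoD by blast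
   with R show "\<forall>\<^sub>F ep in F. m ep \<in> {mu \<in> radon_on A. (LINT x|mu. f x) \<in> W}"
   by (auto elim: eventually_elim2)
  qed
 qed auto
 with R show ?L by (auto simp: limitin_def)
qed

lemma space_radon_borel [simp]: "space (radon_borel A) = radon_on A"
 unfolding radon_borel_def by (rule space_measure_of) (use openin_subset in fastforce)

lemma sets_radon_borel: "sets (radon_borel A) = sigma_sets (radon_on A) {U. openin (weak_topology A) U}"
 unfolding radon_borel_def by (rule sets_measure_of) (use openin_subset in fastforce)

lemma Cc_integral_measurable: "f \<in> Cc ==> (%mu. \<integral>x. f x \<partial>mu) \<in> bm (radon_borel A)"
proof (rule borel_measurableI)
 fix S :: "real set" assume f: "f \<in> Cc" and "open S"
 hence "openin (weak_topology A) {mu \<in> radon_on A. (LINT x|mu. f x) \<in> S}" by (rule openin_weak_basic)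
 moreover have "(%mu. \<integral>x. f x \<partial>mu) -` S Int space (radon_borel A) = {mu \<in> radon_on A. (LINT x|mu. f x) \<in> S}" by auto
 ultimately show "(%mu. \<integral>x. f x \<partial>mu) -` S Int space (radon_borel A) \<in> sets (radon_borel A)"
  by (simp add: sets_radon_borel sigma_sets.Basic)
qed

definition weak_base :: "(real ^ 'd) set => ((real ^ 'd => real) \<times> rat \<times> rat) set => (real ^ 'd) measure set" where
 "weak_base A F = {mu \<in> radon_on A. ALL (g, a, b):F. of_rat a < (LINT x|mu. g x) & (LINT x|mu. g x) < of_rat b}"

text \<open>Second countability: finitely many conditions with functions from \<open>Dc\<close> and
  rational bounds already describe a base.\<close>

lemma weak_base_open:
 assumes "openin (weak_topology A) U" "mu \<in> U"
 shows "EX F. finite F & F \<subseteq> Dc \<times> UNIV & mu \<in> weak_base A F & weak_base A F \<subseteq> U"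
 using assms
proof (induction arbitrary: mu rule: openin_weak_induct)
 case (Int a b)
 then obtain F G where "finite F & F \<subseteq> Dc \<times> UNIV & mu \<in> weak_base A F & weak_base A F \<subseteq> a"
  "finite G & G \<subseteq> Dc \<times> UNIV & mu \<in> weak_base A G & weak_base A G \<subseteq> b" by (metis Int_iff)
 moreover have "weak_base A (F \<union> G) = weak_base A F Int weak_base A G"
  unfolding weak_base_def ball_Un by blast
 ultimately show ?case by (intro exI[of _ "F \<union> G"]) auto
next
 case (UN K)
 then obtain k where "k \<in> K" "mu \<in> k" by blast
 thus ?case using UN.IH[of k mu] by blast
next
 case (Basis f W)
 hence mu: "mu \<in> radon_on A" and "(LINT x|mu. f x) \<in> W" by auto
 then obtain e where e: "e > 0" "!!y. \<bar>y - (LINT x|mu. f x)\<bar> < e ==> y \<in> W"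
  using Basis(2) unfolding open_dist dist_real_def by blast
 obtain N where N: "!!e. e > 0 ==> EX g:Dc. ALL x. \<bar>f x - g x\<bar> <= e * cut N x" using Dc_dense[OF Basis(1)] by blast
 let ?c = "\<integral>x. cut N x \<partial>mu"
 obtain M where M: "?c < of_rat M" using of_rat_dense[of ?c "?c + 1"] by auto
 obtain M0 where M0: "of_rat M0 < ?c" using of_rat_dense[of "?c - 1" ?c] by auto
 have c0: "?c >= 0" by simp
 have Mp: "0 < (of_rat M :: real)" using M c0 by linarith
 define d where "d = e / (4 * of_rat M)"
 have d: "d > 0" using e(1) Mp unfolding d_def by (intro divide_pos_pos mult_pos_pos) auto
 obtain g where g: "g \<in> Dc" "!!x. \<bar>f x - g x\<bar> <= d * cut N x" using N[OF d] by blast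
 let ?g = "\<integral>x. g x \<partial>mu"
 obtain a where a: "?g - e / 4 < of_rat a" "of_rat a < ?g" using of_rat_dense[of "?g - e/4" ?g] e by auto
 obtain b where b: "?g < of_rat b" "of_rat b < ?g + e / 4" using of_rat_dense[of ?g "?g + e/4"] e by auto
 \<comment> \<open>The condition on \<open>cut N\<close> bounds the mass near the support of
   \<open>f\<close> throughout the neighbourhood, which makes the replacement of \<open>f\<close> by
   \<open>g\<close> uniform in the measure. \<open>M0\<close> only completes the rational
   interval.\<close>
 let ?F = "{(g, a, b), (cut N, M0, M)}"
 have "weak_base A ?F \<subseteq> {mu \<in> radon_on A. (LINT x|mu. f x) \<in> W}"
 proof
  fix nu assume nu: "nu \<in> weak_base A ?F"
  hence r: "nu \<in> radon_on A" and n: "(LINT x|nu. cut N x) < of_rat M" "of_rat a < (LINT x|nu. g x)" "(LINT x|nu. g x) < of_rat b"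
   by (auto simp: weak_base_def)
  have "d * (LINT x|nu. cut N x) <= d * of_rat M" "d * ?c <= d * of_rat M" using n M d by (auto intro!: mult_left_mono)
  moreover have "d * of_rat M = e / 4" using Mp by (simp add: d_def)
  moreover have "\<bar>(LINT x|nu. f x) - (LINT x|nu. g x)\<bar> <= d * (LINT x|nu. cut N x)"
   by (rule Cc_integral_diff[OF r Basis(1) Dc_Cc[OF g(1)] cut_Cc g(2)])
  moreover have "\<bar>(LINT x|mu. f x) - ?g\<bar> <= d * ?c"
   by (rule Cc_integral_diff[OF mu Basis(1) Dc_Cc[OF g(1)] cut_Cc g(2)])
  ultimately have "\<bar>(LINT x|nu. f x) - (LINT x|mu. f x)\<bar> < e" using n a b e(1) by linarith
  thus "nu \<in> {mu \<in> radon_on A. (LINT x|mu. f x) \<in> W}" using e(2) r by auto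
 qed
 moreover have "mu \<in> weak_base A ?F" using mu a b M M0 by (simp add: weak_base_def)
 ultimately show ?case using g(1) cut_Dc[of N] by (intro exI[of _ ?F]) auto
qed auto

text \<open>An open set is a countable union of basic sets, and each of these is described by
  finitely many integrals. All later measurability statements for maps into spaces of measures go
  through this criterion.\<close>

lemma measurable_radon_borelI:
 assumes "!!om. om \<in> space M ==> G om \<in> radon_on A"
  and m: "!!g. g \<in> Cc ==> (%om. \<integral>x. g x \<partial>G om) \<in> bm M"
 shows "G \<in> M \<rightarrow>\<^sub>M radon_borel A"
 unfolding radon_borel_def
proof (rule measurable_measure_of)
 show "{U. openin (weak_topology A) U} \<subseteq> Pow (radon_on A)" using openin_subset by fastforce
 show "G \<in> space M \<rightarrow> radon_on A" using assms(1) by auto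
 fix U assume "U \<in> {U. openin (weak_topology A) U}"
 hence U: "openin (weak_topology A) U" by simp
 let ?S = "{F. finite F & F \<subseteq> Dc \<times> UNIV & weak_base A F \<subseteq> U}"
 have "countable {F :: ((real ^ 'b => real) \<times> rat \<times> rat) set. finite F & F \<subseteq> Dc \<times> UNIV}"
  by (intro countable_Collect_finite_subset countable_SIGMA countable_Dc) auto
 hence c: "countable ?S" by (rule countable_subset[rotated]) auto
 have Ueq: "(\<Union>F\<in>?S. weak_base A F) = U"
 proof (intro equalityI subsetI)
  fix mu assume "mu \<in> U"
  from weak_base_open[OF U this] obtain F where "F \<in> ?S" "mu \<in> weak_base A F" by auto
  thus "mu \<in> (\<Union>F\<in>?S. weak_base A F)" by (rule UN_I)
 next
  fix mu assume "mu \<in> (\<Union>F\<in>?S. weak_base A F)"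
  then obtain F where "F \<in> ?S" "mu \<in> weak_base A F" by (rule UN_E)
  thus "mu \<in> U" by auto
 qed
 have "G -` (\<Union>F\<in>?S. weak_base A F) Int space M = (\<Union>F\<in>?S. G -` weak_base A F Int space M)"
  by (simp only: vimage_UN UN_simps)
 also have "... \<in> sets M"
 proof (rule sets.countable_UN''[OF c])
  fix F assume F: "F \<in> ?S"
  have "G -` weak_base A F Int space M = {om\<in>space M. ALL p:F. of_rat (fst (snd p)) < (LINT x|G om. fst p x) & (LINT x|G om. fst p x) < of_rat (snd (snd p))}"
   using assms(1) by (auto simp: weak_base_def split: prod.splits)
  also have "... \<in> sets M"
  proof (rule sets.sets_Collect_finite_All)
   fix p assume "p \<in> F"
   hence [measurable]: "(%om. \<integral>x. fst p x \<partial>G om) \<in> bm M" using F by (intro m Dc_Cc) auto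
   show "{om\<in>space M. of_rat (fst (snd p)) < (LINT x|G om. fst p x) & (LINT x|G om. fst p x) < of_rat (snd (snd p))} \<in> sets M"
   by measurable
  qed (use F in auto)
  finally show "G -` weak_base A F Int space M \<in> sets M" .
 qed
 finally show "G -` U Int space M \<in> sets M" by (simp only: Ueq)
qed

lemma sets_radon [measurable_cong]: "mu \<in> space (radon_borel A) ==> sets mu = sets borel"
 using radon_sets by auto

lemma emeasure_compact_measurable:
 assumes "compact (K :: (real ^ 'd) set)"
 shows "(%mu. em mu K) \<in> bm (radon_borel A)"
proof (cases "K = {}")
 case False
 have "(%mu. measure mu K) \<in> bm (radon_borel A)"
 proof (rule borel_measurable_LIMSEQ_real)
  show "(%n. \<integral>x. max 0 (1 - real (Suc n) * infdist x K) \<partial>mu) \<longlonglongrightarrow> measure mu K"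
   if "mu \<in> space (radon_borel A)" for mu
   using compact_integral_lim[OF assms False, of mu A] that by simp
  show "(%mu. \<integral>x. max 0 (1 - real (Suc n) * infdist x K) \<partial>mu) \<in> bm (radon_borel A)" for n
   by (rule Cc_integral_measurable[OF compact_approx_Cc(1)[OF assms False]]) simp
 qed
 hence "(%mu. ennreal (measure mu K)) \<in> bm (radon_borel A)" by measurable
 also have "?this \<longleftrightarrow> ?thesis"
  using radon_compact[OF _ assms] by (intro measurable_cong) (auto simp: emeasure_eq_ennreal_measure less_top[symmetric])
 finally show ?thesis .
qed simp

text \<open>The ball keeps all masses finite, which the complement step of the induction needs for
  subtraction.\<close>

lemma emeasure_ball_measurable:
 fixes B :: "(real ^ 'd) set"
 assumes "B \<in> sets borel"
 shows "(%mu. em mu (B Int cb N)) \<in> bm (radon_borel A)"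
proof -
 let ?C = "sup_cball (real N) (0 :: real ^ 'd)"
 have ist: "Int_stable (Collect closed :: (real ^ 'd) set set)" by (auto simp: Int_stable_def)
 have pw: "(Collect closed :: (real ^ 'd) set set) \<subseteq> Pow UNIV" by simp
 have "B \<in> sigma_sets UNIV (Collect closed)" using assms by (simp add: borel_eq_closed sets_measure_of)
 with ist pw show ?thesis
 proof (induction rule: sigma_sets_induct_disjoint)
  case (basic S)
  hence "compact (S Int ?C)" using closed_Int_compact compact_sup_cball by blast
  thus ?case by (rule emeasure_compact_measurable)
 next
  case (compl S)
  have S: "S \<in> sets borel" using compl(1) by (simp add: borel_eq_closed sets_measure_of)
  have "em mu ((UNIV - S) Int ?C) = em mu ?C - em mu (S Int ?C)" if "mu \<in> radon_on A" for mu
  proof -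
   note [simp] = radon_sets[OF that]
   have "em mu (S Int ?C) <= em mu ?C" using S by (intro emeasure_mono) auto
   hence "em mu (S Int ?C) ~= \<infinity>" using radon_ball[OF that, of "real N" 0] by (auto simp: top_unique)
   hence "em mu (?C - S Int ?C) = em mu ?C - em mu (S Int ?C)"
   using S by (intro emeasure_Diff) auto
   moreover have "?C - S Int ?C = (UNIV - S) Int ?C" by auto
   ultimately show ?thesis by simp
  qed
  moreover have "(%mu. em mu ?C - em mu (S Int ?C)) \<in> bm (radon_borel A)"
  proof -
   note [measurable] = compl(2) emeasure_compact_measurable[OF compact_sup_cball, of "real N" 0 A]
   show ?thesis by measurable
  qed
  ultimately show ?case by (subst measurable_cong) auto
 next
  case (union F)
  have F: "F i \<in> sets borel" for i using union(2) by (auto simp: borel_eq_closed sets_measure_of)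
  have "em mu (\<Union>(range F) Int ?C) = (\<Sum>i. em mu (F i Int ?C))" if "mu \<in> radon_on A" for mu
  proof -
   note [simp] = radon_sets[OF that]
   have "(\<Sum>i. em mu (F i Int ?C)) = em mu (\<Union>i. F i Int ?C)"
   using union(1) F by (intro suminf_emeasure) (auto simp: disjoint_family_on_def)
   thus ?thesis by (simp add: Int_UN_distrib2 UN_simps)
  qed
  moreover have "(%mu. \<Sum>i. em mu (F i Int ?C)) \<in> bm (radon_borel A)"
  proof -
   note [measurable] = union(3)
   show ?thesis by measurable
  qed
  ultimately show ?case by (subst measurable_cong) auto
 qed auto
qed

lemma radon_SUP_ball:
 assumes "mu \<in> radon_on A" "B \<in> sets borel"
 shows "em mu B = (SUP N. em mu (B Int cb N))"
proof -
 note [simp] = radon_sets[OF assms(1)]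
 have "(SUP N. em mu (B Int cb N)) = em mu (\<Union>N. B Int cb N)"
 proof (rule SUP_emeasure_incseq)
  show "incseq (%N. B Int cb N)"
   unfolding incseq_def by (intro allI impI Int_mono order_refl sup_cball_mono) simp
  show "range (%N. B Int cb N) \<subseteq> sets mu" using assms(2) by auto
 qed
 also have "(\<Union>N. B Int cb N) = B" using UN_sup_cball[of "0 :: real ^ 'a"] by auto
 finally show ?thesis by simp
qed

lemma emeasure_radon_measurable:
 assumes "B \<in> sets borel" shows "(%mu. em mu B) \<in> bm (radon_borel A)"
proof -
 have "(%mu. SUP N. em mu (B Int cb N)) \<in> bm (radon_borel A)"
  using emeasure_ball_measurable[OF assms] by (intro borel_measurable_SUP) auto
 also have "?this \<longleftrightarrow> ?thesis" using radon_SUP_ball[OF _ assms] by (intro measurable_cong) simp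
 finally show ?thesis .
qed

lemma measurable_emeasure_radon [measurable (raw)]:
 "G \<in> M \<rightarrow>\<^sub>M radon_borel A ==> B \<in> sets borel ==> (%om. em (G om) B) \<in> bm M"
 by (rule measurable_compose[OF _ emeasure_radon_measurable])

lemma measurable_measure_radon [measurable (raw)]:
 "G \<in> M \<rightarrow>\<^sub>M radon_borel A ==> B \<in> sets borel ==> (%om. measure (G om) B) \<in> bm M"
 unfolding measure_def by measurable

text \<open>Measurable dependence of integrals on a parameter is known for subprobability kernels.
  Restricting to a ball and dividing by \<open>c\<close> produces one; multiplying back and letting
  the ball grow recovers the original integral.\<close>

lemma nn_integral_radon_kernel:
 fixes G :: "'w => (real ^ 'd) measure"
 assumes g [measurable]: "(%(om, y). g om y) \<in> bm (M \<Otimes>\<^sub>M borel)"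
  and G [measurable]: "G \<in> M \<rightarrow>\<^sub>M radon_borel A"
 shows "(%om. \<integral>\<^sup>+y. g om y \<partial>G om) \<in> bm M"
proof -
 let ?B = "%N. sup_cball (real N) (0 :: real ^ 'd)"
 have Gr: "G om \<in> radon_on A" if "om \<in> space M" for om using measurable_space[OF G that] by simp
 have gm: "g om \<in> bm borel" if "om \<in> space M" for om
  using measurable_compose[OF measurable_Pair1'[OF that] g] by simp
 have N: "(%om. \<integral>\<^sup>+y. indicator (?B N) y * g om y \<partial>G om) \<in> bm M" for N
 proof -
  \<comment> \<open>The summand 1 rules out division by zero and still leaves total mass at most
    1.\<close>
  define c where "c om = 1 + em (G om) (?B N)" for om
  have [measurable]: "c \<in> bm M" unfolding c_def by measurable
  define L where "L om = scale_measure (inverse (c om)) (density (G om) (indicator (?B N)))" for om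
  have cf: "c om < \<top>" "c om >= 1" if "om \<in> space M" for om
   using radon_ball[OF Gr[OF that], of "real N" 0] by (auto simp: c_def)
  have em: "em (L om) X = inverse (c om) * em (G om) (?B N Int X)" if "om \<in> space M" "X \<in> sets borel" for om X
   using that by (simp add: L_def radon_sets[OF Gr] emeasure_restricted)
  have [measurable]: "L \<in> M \<rightarrow>\<^sub>M subprob_algebra borel"
  proof (rule measurable_subprob_algebra)
   fix om assume w: "om \<in> space M"
   show "sets (L om) = sets borel" using w by (simp add: L_def radon_sets[OF Gr])
   have "space (L om) = UNIV" using w by (simp add: L_def radon_space[OF Gr] space_scale_measure)
   moreover have "inverse (c om) * em (G om) (?B N) <= inverse (c om) * c om"
   by (intro mult_left_mono) (auto simp: c_def)
   moreover have "inverse (c om) * c om = 1"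
   using cf[OF w] by (metis ennreal_divide_self divide_ennreal_def mult.commute infinity_ennreal_def less_top not_one_le_zero)
   ultimately show "subprob_space (L om)" using em[OF w, of UNIV] by (intro subprob_spaceI) auto
  next
   fix X :: "(real ^ 'd) set" assume [measurable]: "X \<in> sets borel"
   have "(%om. inverse (c om) * em (G om) (?B N Int X)) \<in> bm M" by measurable
   thus "(%om. em (L om) X) \<in> bm M" by (subst measurable_cong[OF em]) auto
  qed
  have "(%om. c om * (\<integral>\<^sup>+y. g om y \<partial>L om)) \<in> bm M"
   using nn_integral_measurable_subprob_algebra2[OF g] by measurable
  moreover have "c om * (\<integral>\<^sup>+y. g om y \<partial>L om) = (\<integral>\<^sup>+y. indicator (?B N) y * g om y \<partial>G om)" if "om \<in> space M" for om
  proof -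
   have [measurable]: "g om \<in> bm (G om)" using gm[OF that] radon_sets[OF Gr[OF that]] by (simp cong: mcs)
   have [measurable]: "?B N \<in> sets (G om)" using radon_sets[OF Gr[OF that]] by simp
   have "(\<integral>\<^sup>+y. g om y \<partial>L om) = inverse (c om) * (\<integral>\<^sup>+y. indicator (?B N) y * g om y \<partial>G om)"
   unfolding L_def by (subst nn_integral_scale_measure) (auto simp: nn_integral_density)
   moreover have "c om * inverse (c om) = 1"
   using cf[OF that] by (metis ennreal_divide_self divide_ennreal_def infinity_ennreal_def less_top not_one_le_zero)
   ultimately show ?thesis by (simp flip: mult.assoc)
  qed
  ultimately show ?thesis by (subst measurable_cong[symmetric]) auto
 qed
 have "(\<integral>\<^sup>+y. g om y \<partial>G om) = (SUP N. \<integral>\<^sup>+y. indicator (?B N) y * g om y \<partial>G om)" if "om \<in> space M" for om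
 proof -
  have [measurable]: "g om \<in> bm (G om)" using gm[OF that] radon_sets[OF Gr[OF that]] by (simp cong: mcs)
  have [measurable]: "?B N \<in> sets (G om)" for N using radon_sets[OF Gr[OF that]] by simp
  have "(SUP N. \<integral>\<^sup>+y. indicator (?B N) y * g om y \<partial>G om) = (\<integral>\<^sup>+y. (SUP N. indicator (?B N) y * g om y) \<partial>G om)"
   by (rule nn_integral_monotone_convergence_SUP[symmetric])
   (auto simp: incseq_def le_fun_def mem_sup_cball split: split_indicator)
  also have "... = (\<integral>\<^sup>+y. g om y \<partial>G om)"
  proof (rule nn_integral_cong)
   fix y :: "real ^ 'd"
   obtain n where n: "y \<in> ?B n" using UN_sup_cball[of 0] by blast
   show "(SUP N. indicator (?B N) y * g om y) = g om y"
   by (rule antisym[OF SUP_least SUP_upper2[of n]]) (use n in \<open>auto split: split_indicator\<close>)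
  qed
  finally show ?thesis by simp
 qed
 with N show ?thesis by (subst measurable_cong) auto
qed

lemma measurable_radon_borelI_nn:
 assumes "!!om. om \<in> space M ==> G om \<in> radon_on A"
  and m: "!!g. g \<in> Cc ==> (!!x. g x >= 0) ==> (%om. \<integral>\<^sup>+x. ennreal (g x) \<partial>G om) \<in> bm M"
 shows "G \<in> M \<rightarrow>\<^sub>M radon_borel A"
proof (rule measurable_radon_borelI[OF assms(1)])
 fix g :: "real ^ 'b => real" assume g: "g \<in> Cc"
 have p: "(%x. max 0 (g x)) \<in> Cc" "(%x. max 0 (- g x)) \<in> Cc"
  using g by (auto simp: Cc_iff intro!: continuous_on_max continuous_intros) (auto simp: max_def split: if_splits)
 have e: "ennreal (max 0 r) = ennreal r" for r by (simp add: max_def ennreal_neg)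
 have [measurable]: "(%om. \<integral>\<^sup>+x. ennreal (g x) \<partial>G om) \<in> bm M" 
  "(%om. \<integral>\<^sup>+x. ennreal (- g x) \<partial>G om) \<in> bm M"
  using m[OF p(1)] m[OF p(2)] unfolding e by auto
 have "(%om. enn2real (\<integral>\<^sup>+x. ennreal (g x) \<partial>G om) - enn2real (\<integral>\<^sup>+x. ennreal (- g x) \<partial>G om)) \<in> bm M"
  by measurable
 also have "?this \<longleftrightarrow> (%om. \<integral>x. g x \<partial>G om) \<in> bm M"
  by (intro measurable_cong) (simp only: real_lebesgue_integral_def[OF Cc_integrable[OF assms(1) g]])
 finally show "(%om. \<integral>x. g x \<partial>G om) \<in> bm M" .
qed

section \<open>Measurability of normalisation, scaling and translation\<close>

lemma scale_measure_density: "scale_measure c M = density M (%_. c)"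
 by (rule measure_eqI) (auto simp: emeasure_density nn_integral_cmult)

lemma integral_scale_measure:
 fixes f :: "'a => real"
 assumes "c >= 0" "f \<in> bm M"
 shows "(LINT x|scale_measure (ennreal c) M. f x) = c * (LINT x|M. f x)"
 unfolding scale_measure_density using assms by (subst integral_density) auto

lemma radon_scale: "mu \<in> radon_on A ==> c < \<top> ==> scale_measure c mu \<in> radon_on A"
 by (auto simp: radon_on_def ennreal_mult_less_top)

lemma star_radon: "mu \<in> radon_on A ==> star mu \<in> radon_on A"
 unfolding star_def by (rule radon_scale) auto

lemma star_measurable [measurable]: "star \<in> radon_borel A \<rightarrow>\<^sub>M radon_borel A"
proof (rule measurable_radon_borelI_nn)
 fix g :: "real ^ 'a => real" assume g: "g \<in> Cc"
 have [measurable]: "g \<in> bm borel" by (rule Cc_borel[OF g])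
 have [measurable]: "(%mu. \<integral>\<^sup>+x. ennreal (g x) \<partial>mu) \<in> bm (radon_borel A)"
  by (rule nn_integral_radon_kernel[where G="%x. x" and A=A]) auto
 have "(%mu. ennreal (1 / measure mu (sup_cball 1 0)) * (\<integral>\<^sup>+x. ennreal (g x) \<partial>mu)) \<in> bm (radon_borel A)"
  by measurable
 also have "?this \<longleftrightarrow> (%mu. \<integral>\<^sup>+x. ennreal (g x) \<partial>star mu) \<in> bm (radon_borel A)"
 proof (intro measurable_cong)
  fix mu :: "(real ^ 'a) measure" assume "mu \<in> space (radon_borel A)"
  hence "(%x. ennreal (g x)) \<in> bm mu" using radon_sets[of mu A] by (simp cong: mcs)
  thus "ennreal (1 / measure mu (sup_cball 1 0)) * (\<integral>\<^sup>+x. ennreal (g x) \<partial>mu) = (\<integral>\<^sup>+x. ennreal (g x) \<partial>star mu)"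
   unfolding star_def by (subst nn_integral_scale_measure) auto
 qed
 finally show "(%mu. \<integral>\<^sup>+x. ennreal (g x) \<partial>star mu) \<in> bm (radon_borel A)" .
qed (auto simp: star_radon)

lemma distr_kernel_measurable:
 fixes G :: "'w => (real ^ 'd) measure" and h :: "'w => real ^ 'd => real ^ 'c"
 assumes G [measurable]: "G \<in> M \<rightarrow>\<^sub>M radon_borel A"
  and h [measurable]: "(%(om, y). h om y) \<in> (M \<Otimes>\<^sub>M borel) \<rightarrow>\<^sub>M borel"
  and r: "!!om. om \<in> space M ==> distr (G om) borel (h om) \<in> radon_on B"
 shows "(%om. distr (G om) borel (h om)) \<in> M \<rightarrow>\<^sub>M radon_borel B"
proof (rule measurable_radon_borelI_nn[OF r])
 fix g :: "real ^ 'c => real" assume g: "g \<in> Cc"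
 have [measurable]: "g \<in> bm borel" by (rule Cc_borel[OF g])
 have "(%om. \<integral>\<^sup>+y. ennreal (g (h om y)) \<partial>G om) \<in> bm M"
  by (rule nn_integral_radon_kernel[OF _ G]) measurable
 also have "?this \<longleftrightarrow> (%om. \<integral>\<^sup>+x. ennreal (g x) \<partial>distr (G om) borel (h om)) \<in> bm M"
 proof (intro measurable_cong)
  fix om assume w: "om \<in> space M"
  have "h om \<in> bm borel" using measurable_compose[OF measurable_Pair1'[OF w] h] by simp
  hence "h om \<in> G om \<rightarrow>\<^sub>M borel" using measurable_space[OF G w] radon_sets[of "G om" A] by (simp cong: mcs)
  thus "(\<integral>\<^sup>+y. ennreal (g (h om y)) \<partial>G om) = (\<integral>\<^sup>+x. ennreal (g x) \<partial>distr (G om) borel (h om))"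
   by (subst nn_integral_distr) auto
 qed
 finally show "(%om. \<integral>\<^sup>+x. ennreal (g x) \<partial>distr (G om) borel (h om)) \<in> bm M" .
qed

lemma distr_affine_radon:
 fixes mu :: "(real ^ 'd) measure"
 assumes "mu \<in> radon_on A" "c ~= 0" "!!y. y \<in> A ==> c *\<^sub>R y + a \<in> B" "B \<in> sets borel" "A \<in> sets borel"
 shows "distr mu borel (%y. c *\<^sub>R y + a) \<in> radon_on B"
proof (rule radon_onI)
 note [simp] = radon_sets[OF assms(1)] radon_space[OF assms(1)]
 have m [measurable]: "(%y. c *\<^sub>R y + a) \<in> mu \<rightarrow>\<^sub>M borel" by (simp cong: mcs)
 show "sets (distr mu borel (%y. c *\<^sub>R y + a)) = sets borel" by simp
 show "em (distr mu borel (%y. c *\<^sub>R y + a)) (cb N) < \<infinity>" for N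
 proof -
  have "(%y. c *\<^sub>R y + a) -` cb N \<subseteq> sup_cball ((real N + infnorm a) / \<bar>c\<bar>) 0"
  proof
   fix y assume "y \<in> (%y. c *\<^sub>R y + a) -` cb N"
   hence "infnorm (c *\<^sub>R y + a) <= real N" by (simp add: mem_sup_cball)
   moreover have "infnorm (c *\<^sub>R y) <= infnorm (c *\<^sub>R y + a) + infnorm (- a)"
   using infnorm_triangle[of "c *\<^sub>R y + a" "- a"] by simp
   ultimately show "y \<in> sup_cball ((real N + infnorm a) / \<bar>c\<bar>) 0"
   using assms(2) by (simp add: mem_sup_cball infnorm_neg infnorm_mul field_simps)
  qed
  hence "em mu ((%y. c *\<^sub>R y + a) -` cb N) <= em mu (sup_cball ((real N + infnorm a) / \<bar>c\<bar>) 0)"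
   by (intro emeasure_mono) auto
  also have "... < \<infinity>" by (rule radon_ball[OF assms(1)])
  finally show ?thesis by (simp add: emeasure_distr[OF m])
 qed
 have "(%y. c *\<^sub>R y + a) -` (- B) \<subseteq> - A" using assms(3) by auto
 moreover have "- A \<in> sets mu" using assms(5) by simp
 ultimately have "em mu ((%y. c *\<^sub>R y + a) -` (- B)) <= em mu (- A)" by (rule emeasure_mono)
 thus "em (distr mu borel (%y. c *\<^sub>R y + a)) (- B) = 0"
  using assms(1,4) by (simp add: emeasure_distr[OF m] radon_on_def)
qed

lemma scale_star_measurable:
 assumes "subspace (V :: (real ^ 'd) set)"
 shows "scale_star t \<in> radon_borel V \<rightarrow>\<^sub>M radon_borel V"
proof -
 have V: "V \<in> sets borel" by (intro borel_closed closed_subspace assms)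
 have "(%mu. distr mu borel (%y. exp t *\<^sub>R y)) \<in> radon_borel V \<rightarrow>\<^sub>M radon_borel V"
  using distr_affine_radon[of _ V "exp t" 0 V] V assms
  by (intro distr_kernel_measurable[where A=V]) (auto simp: subspace_scale)
 thus ?thesis unfolding scale_star_def[abs_def] by measurable
qed

lemma trans_star_measurable:
 assumes "subspace (V :: (real ^ 'd) set)" and [measurable]: "h \<in> M \<rightarrow>\<^sub>M borel" "G \<in> M \<rightarrow>\<^sub>M radon_borel V"
  and "!!om. om \<in> space M ==> h om \<in> V"
 shows "(%om. trans_star (h om) (G om)) \<in> M \<rightarrow>\<^sub>M radon_borel V"
proof -
 have V: "V \<in> sets borel" by (intro borel_closed closed_subspace assms)
 have "(%om. distr (G om) borel (%y. y - h om)) \<in> M \<rightarrow>\<^sub>M radon_borel V"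
 proof (rule distr_kernel_measurable[OF assms(3)])
  show "(%(om, y). y - h om) \<in> bm (M \<Otimes>\<^sub>M borel)" by measurable
  fix om assume w: "om \<in> space M"
  hence "G om \<in> radon_on V" using measurable_space[OF assms(3) w] by simp
  thus "distr (G om) borel (%y. y - h om) \<in> radon_on V"
   using distr_affine_radon[of "G om" V 1 "- h om" V] V assms(1) assms(4)[OF w] by (simp add: subspace_diff)
 qed
 thus ?thesis unfolding trans_star_def by measurable
qed

section \<open>Compactness for vague convergence\<close>

text \<open>Schoenberg's space-filling curve transports Helly's selection theorem from the line to cubes, which yields the compactness needed in place of a Riesz representation theorem.\<close>

definition schoenberg :: "real => real" where
 "schoenberg u = max 0 (min 1 (1 / 2 - cos (pi * u)))"

lemma schoenberg_cont: "continuous_on UNIV (%t. schoenberg (c * t))"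
 unfolding schoenberg_def by (intro continuous_intros)

lemma schoenberg_bounds: "0 <= schoenberg u" "schoenberg u <= 1"
 by (auto simp: schoenberg_def)

text \<open>For \<open>u\<close> in the first third of the unit interval the cosine of
  \<open>pi * u\<close> is at least 1/2, in the last third at most -1/2. The truncation in
  \<open>schoenberg\<close> turns this into the exact values 0 and 1, and the period 2 removes
  \<open>2 * m\<close>.\<close>

lemma schoenberg_digit:
 assumes "0 <= s" "s <= 1 / 3" "b \<in> {0, 1}"
 shows "schoenberg (2 * of_int m + 2 * of_nat b / 3 + s) = of_nat b"
proof -
 have "cos (pi * (2 * of_int m + 2 * of_nat b / 3 + s)) = cos (pi * (2 * of_nat b / 3 + s) + of_int m * (2 * pi))"
  by (simp add: algebra_simps)
 also have "... = cos (pi * (2 * of_nat b / 3 + s))"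
  by (rule conjunct2[OF iffD2[OF sin_cos_eq_iff]], rule exI[of _ m]) simp
 finally have c: "cos (pi * (2 * of_int m + 2 * of_nat b / 3 + s)) = cos (pi * (2 * of_nat b / 3 + s))" .
 show ?thesis
 proof (cases "b = 0")
  case True
  have "cos (pi * s) >= cos (pi / 3)"
   using assms mult_left_mono[of s "1/3" pi] by (intro cos_monotone_0_pi_le) auto
  thus ?thesis using c True by (simp add: schoenberg_def cos_60)
 next
  case False
  hence b: "b = 1" using assms by auto
  have "pi * (2 / 3 + s) = pi - pi * (1 / 3 - s)" by (simp add: algebra_simps)
  hence "cos (pi * (2 / 3 + s)) = - cos (pi * (1 / 3 - s))" by simp
  moreover have "cos (pi * (1 / 3 - s)) >= cos (pi / 3)"
   using assms mult_left_mono[of "1/3 - s" "1/3" pi] by (intro cos_monotone_0_pi_le) auto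
  ultimately show ?thesis using c b by (simp add: schoenberg_def cos_60)
 qed
qed

text \<open>The partial sums are \<open>\<lfloor>2 ^ N * x\<rfloor> / 2 ^ N\<close>, and the digits
  are the parities of these floors.\<close>

lemma binary_expansion:
 fixes x :: real
 assumes "0 <= x" "x < 1"
 obtains b :: "nat => nat" where "!!n. b n \<in> {0, 1}" "(%n. of_nat (b n) * (1 / 2) ^ Suc n) sums x"
proof -
 define b where "b n = nat (\<lfloor>2 ^ Suc n * x\<rfloor> mod 2)" for n :: nat
 have b01: "b n \<in> {0, 1}" for n by (auto simp: b_def)
 have part: "(\<Sum>n<N. of_nat (b n) * (1 / 2 :: real) ^ Suc n) = of_int \<lfloor>2 ^ N * x\<rfloor> / 2 ^ N" for N
 proof (induction N)
  case 0
  have "\<lfloor>x\<rfloor> = 0" using assms by linarith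
  thus ?case by simp
 next
  case (Suc N)
  have "\<lfloor>2 ^ Suc N * x\<rfloor> div 2 = \<lfloor>2 ^ N * x\<rfloor>"
   using floor_divide_real_eq_div[of 2 "2 ^ Suc N * x"] by simp
  hence d: "\<lfloor>2 ^ Suc N * x\<rfloor> = 2 * \<lfloor>2 ^ N * x\<rfloor> + \<lfloor>2 ^ Suc N * x\<rfloor> mod 2"
   using mult_div_mod_eq[of 2 "\<lfloor>2 ^ Suc N * x\<rfloor>"] by simp
  have "real (b N) = of_int (\<lfloor>2 ^ Suc N * x\<rfloor> mod 2)" by (simp add: b_def)
  with Suc show ?case by (subst d) (simp add: field_simps)
 qed
 have "(%N. of_int \<lfloor>2 ^ N * x\<rfloor> / 2 ^ N) \<longlonglongrightarrow> x"
 proof (rule tendsto_sandwich)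
  show "\<forall>\<^sub>F N in sequentially. x - (1 / 2) ^ N <= of_int \<lfloor>2 ^ N * x\<rfloor> / 2 ^ N"
  proof (rule always_eventually, rule allI)
   fix N :: nat
   have "2 ^ N * x - 1 <= of_int \<lfloor>2 ^ N * x\<rfloor>" by linarith
   hence "(2 ^ N * x - 1) / 2 ^ N <= of_int \<lfloor>2 ^ N * x\<rfloor> / 2 ^ N" by (rule divide_right_mono) simp
   thus "x - (1 / 2) ^ N <= of_int \<lfloor>2 ^ N * x\<rfloor> / 2 ^ N" by (simp add: diff_divide_distrib power_one_over)
  qed
  show "\<forall>\<^sub>F N in sequentially. of_int \<lfloor>2 ^ N * x\<rfloor> / 2 ^ N <= x"
   by (rule always_eventually) (auto simp: field_simps)
  have "(%N. x - (1 / 2) ^ N) \<longlonglongrightarrow> x - 0" by (intro tendsto_intros LIMSEQ_power_zero) auto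
  thus "(%N. x - (1 / 2) ^ N) \<longlonglongrightarrow> x" by simp
 qed auto
 hence "(%n. of_nat (b n) * (1 / 2) ^ Suc n) sums x" unfolding sums_def part .
 with b01 show ?thesis by (rule that)
qed

text \<open>\<open>t\<close> is the Cantor point with ternary digits \<open>2 * b j\<close>.
  Multiplication by \<open>3 ^ k\<close> moves the first \<open>k\<close> digits into an even
  integer, which the period 2 of \<open>schoenberg\<close> ignores, and leaves digit
  \<open>k\<close> in front of a remainder of at most 1/3.\<close>

lemma schoenberg_surj:
 assumes "!!k. (b :: nat => nat) k \<in> {0, 1}"
 obtains t where "t \<in> {0..1}" "!!k. schoenberg (3 ^ k * t) = of_nat (b k)"
proof -
 let ?a = "%j. 2 * of_nat (b j) * (1 / 3) ^ Suc j :: real"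
 have ab: "0 <= ?a j" "?a j <= 2 * (1 / 3) ^ Suc j" for j using assms[of j] by auto
 have gs: "(%j. 2 * (1 / 3) ^ Suc (j + k)) sums ((1 / 3) ^ k :: real)" for k
  using sums_mult[OF geometric_sums[of "1/3 :: real"], of "2 / 3 * (1/3) ^ k"] by (simp add: power_add mult_ac)
 have sm: "summable (%j. ?a (j + k))" for k
  by (rule summable_comparison_test'[OF sums_summable[OF gs[of k]], of 0]) (use ab in \<open>simp\<close>)
 define t where "t = suminf ?a"
 have tail: "0 <= (\<Sum>j. ?a (j + k))" "(\<Sum>j. ?a (j + k)) <= (1 / 3) ^ k" for k
  using suminf_nonneg[OF sm[of k]] ab suminf_le[OF ab(2) sm[of k] sums_summable[OF gs[of k]]] sums_unique[OF gs[of k]] by auto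
 have "schoenberg (3 ^ k * t) = of_nat (b k)" for k
 proof -
  define m where "m = (\<Sum>j<k. int (b j) * 3 ^ (k - Suc j))"
  define s where "s = 3 ^ k * (\<Sum>j. ?a (j + Suc k))"
  have "t = (\<Sum>j. ?a (j + Suc k)) + (\<Sum>j<Suc k. ?a j)"
   unfolding t_def using suminf_split_initial_segment[OF sm[of 0], of "Suc k"] by simp
  hence dec: "3 ^ k * t = s + 3 ^ k * ?a k + (\<Sum>j<k. 3 ^ k * ?a j)"
   by (simp add: s_def algebra_simps sum_distrib_left)
  have d1: "3 ^ k * ?a k = 2 * of_nat (b k) / 3" by (simp add: power_one_over)
  have d2: "(\<Sum>j<k. 3 ^ k * ?a j) = 2 * of_int m"
   unfolding m_def of_int_sum sum_distrib_left
  proof (rule sum.cong)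
   fix j assume "j \<in> {..<k}"
   hence "(3 :: real) ^ k = 3 ^ (k - Suc j) * 3 ^ Suc j" by (simp flip: power_add del: power_Suc)
   thus "3 ^ k * ?a j = 2 * of_int (int (b j) * 3 ^ (k - Suc j))" by (simp add: power_one_over field_simps)
  qed simp
  have s: "0 <= s" "s <= 1 / 3"
  proof -
   show "0 <= s" unfolding s_def using tail(1)[of "Suc k"] by simp
   have "s <= 3 ^ k * (1 / 3) ^ Suc k" unfolding s_def by (intro mult_left_mono tail) auto
   also have "... = 1 / 3" by (simp add: power_one_over)
   finally show "s <= 1 / 3" .
  qed
  have "3 ^ k * t = 2 * of_int m + 2 * of_nat (b k) / 3 + s" using dec d1 d2 by linarith
  thus ?thesis using schoenberg_digit[OF s assms[of k]] by (simp only:)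
 qed
 moreover have "t \<in> {0..1}" using tail[of 0] by (simp add: t_def)
 ultimately show ?thesis by (intro that)
qed

text \<open>The bits of all coordinates are interleaved by \<open>prod_encode\<close> into one bit
  sequence; \<open>schoenberg\<close> reads bit \<open>k\<close> of a Cantor point and interpolates
  continuously elsewhere.\<close>

definition space_fill :: "real => real ^ 'd" where
 "space_fill t = (\<chi> i. \<Sum>n. (1 / 2) ^ Suc n * schoenberg (3 ^ prod_encode (to_nat i, n) * t))"

lemma space_fill_cont: "continuous_on UNIV (space_fill :: real => real ^ 'd)"
proof -
 have "continuous_on UNIV (%t. \<Sum>n. (1 / 2) ^ Suc n * schoenberg (3 ^ prod_encode (to_nat i, n) * t))" for i :: 'd
 proof (rule uniform_limit_theorem[where F=sequentially])
  show "uniform_limit UNIV (%N t. \<Sum>n<N. (1 / 2) ^ Suc n * schoenberg (3 ^ prod_encode (to_nat i, n) * t))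
   (%t. \<Sum>n. (1 / 2) ^ Suc n * schoenberg (3 ^ prod_encode (to_nat i, n) * t)) sequentially"
  proof (rule Weierstrass_m_test)
   show "summable (%n. (1 / 2 :: real) ^ Suc n)" by (simp add: summable_geometric)
   show "norm ((1 / 2) ^ Suc n * schoenberg (3 ^ prod_encode (to_nat i, n) * t)) <= (1 / 2) ^ Suc n" for n t
   using schoenberg_bounds[of "3 ^ prod_encode (to_nat i, n) * t"] mult_left_le by (simp add: abs_mult)
  qed
  show "\<forall>\<^sub>F N in sequentially. continuous_on UNIV (%t. \<Sum>n<N. (1 / 2) ^ Suc n * schoenberg (3 ^ prod_encode (to_nat i, n) * t))"
   by (intro always_eventually allI continuous_intros schoenberg_cont)
 qed simp
 thus ?thesis unfolding space_fill_def by (intro continuous_on_vec_lambda)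
qed

lemma space_fill_surj:
 fixes x :: "real ^ 'd"
 assumes "!!i. 0 <= x $ i & x $ i < 1"
 shows "EX t:{0..1}. space_fill t = x"
proof -
 have "ALL i. EX b :: nat => nat. (ALL n. b n \<in> {0, 1}) & (%n. of_nat (b n) * (1 / 2) ^ Suc n) sums (x $ i)"
  using assms by (metis binary_expansion)
 then obtain b :: "'d => nat => nat" where b: "!!i n. b i n \<in> {0, 1}" "!!i. (%n. of_nat (b i n) * (1 / 2) ^ Suc n) sums (x $ i)"
  by metis
 obtain t where t: "t \<in> {0..1}" "!!k. schoenberg (3 ^ k * t) = of_nat ((%(j, n). b (from_nat j) n) (prod_decode k))"
  using schoenberg_surj[of "%k. (%(j, n). b (from_nat j) n) (prod_decode k)"] b(1) by (auto simp: split_beta)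
 have "space_fill t $ i = x $ i" for i
 proof -
  have "space_fill t $ i = (\<Sum>n. of_nat (b i n) * (1 / 2) ^ Suc n)"
   unfolding space_fill_def vec_lambda_beta t(2) by (intro suminf_cong) simp
  thus ?thesis using sums_unique[OF b(2)[of i]] by (simp only:)
 qed
 hence "space_fill t = x" by (simp add: vec_eq_iff)
 with t show ?thesis by blast
qed

text \<open>Taking the least parameter makes every sublevel set the continuous image of a compact
  interval, up to the default value 0 off the curve; hence the section is Borel.\<close>

definition fill_section :: "real ^ 'd => real" where
 "fill_section x = (if x \<in> space_fill ` {0..1} then Inf {t \<in> {0..1}. space_fill t = x} else 0)"

lemma fill_section:
 assumes "x \<in> space_fill ` {0..1}"
 shows "fill_section x \<in> {0..1}" "space_fill (fill_section x) = x"
proof -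
 let ?S = "{t \<in> {0..1}. space_fill t = x}"
 have "closed ?S"
  using continuous_closed_preimage_constant[OF continuous_on_subset[OF space_fill_cont subset_UNIV], of "{0..1}" x] by simp
 moreover have "?S ~= {}" "bdd_below ?S" using assms by (auto intro: bdd_belowI[of _ 0])
 ultimately have "Inf ?S \<in> ?S" by (intro closed_contains_Inf)
 thus "fill_section x \<in> {0..1}" "space_fill (fill_section x) = x"
  using assms by (auto simp: fill_section_def)
qed

lemma fill_section_borel [measurable]: "fill_section \<in> bm borel"
proof (rule borel_measurableI_le)
 fix a :: real
 let ?K = "space_fill ` {0..1} :: (real ^ 'a) set"
 have c: "compact (space_fill ` (S :: real set) :: (real ^ 'a) set)" if "compact S" for S
  using that space_fill_cont continuous_on_subset by (intro compact_continuous_image) blast+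
 have le: "fill_section x <= t" if "t \<in> {0..1}" "x = space_fill t" for x :: "real ^ 'a" and t
  using that unfolding fill_section_def by (auto intro!: cInf_lower bdd_belowI[of _ 0])
 have f1: "x \<in> space_fill ` ({0..1} Int {..a})" if "x \<in> ?K" "fill_section x <= a" for x
  using fill_section[OF that(1)] that(2) by (intro image_eqI[of _ _ "fill_section x"]) auto
 have f2: "fill_section x <= a" if "x \<in> space_fill ` ({0..1} Int {..a})" for x :: "real ^ 'a"
  using le that by fastforce
 have f3: "fill_section x = 0" if "x \<notin> ?K" for x using that by (simp add: fill_section_def)
 have f4: "space_fill ` ({0..1} Int {..a}) \<subseteq> ?K" by blast
 have eq: "{x \<in> space borel. fill_section x <= a} = space_fill ` ({0..1} Int {..a}) \<union> (if 0 <= a then - ?K else {})"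
 proof (intro set_eqI)
  fix x :: "real ^ 'a"
  show "x \<in> {x \<in> space borel. fill_section x <= a} \<longleftrightarrow> x \<in> space_fill ` ({0..1} Int {..a}) \<union> (if 0 <= a then - ?K else {})"
  proof (cases "x \<in> ?K")
   case True
   hence "fill_section x <= a \<longleftrightarrow> x \<in> space_fill ` ({0..1} Int {..a})" using f1 f2 by blast
   thus ?thesis using True
   by (cases "0 <= a") (simp_all only: if_True if_False Un_iff mem_Collect_eq space_borel Compl_iff UNIV_I simp_thms empty_iff)
  next
   case False
   hence "x \<notin> space_fill ` ({0..1} Int {..a})" using f4 by blast
   thus ?thesis using False f3[OF False]
   by (cases "0 <= a") (simp_all only: if_True if_False Un_iff mem_Collect_eq space_borel Compl_iff UNIV_I simp_thms empty_iff)
  qed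
 qed
 have "compact ({0..1} Int {..a})" by (intro compact_Int_closed) auto
 thus "{x \<in> space borel. (fill_section x :: real) <= a} \<in> sets (borel :: (real ^ 'a) measure)"
  unfolding eq using borel_compact[OF c[OF compact_Icc]] borel_compact[OF c] by (intro sets.Un) auto
qed

text \<open>The Borel section carries the measures to the line, where tightness gives a weakly
  convergent subsequence, and the curve carries the limit back. A discontinuous section does no
  harm, since test functions are composed with the continuous curve only.\<close>

lemma prokhorov_cube:
 fixes M :: "nat => (real ^ 'd) measure"
 assumes p: "!!n. prob_space (M n)" and s: "!!n. sets (M n) = sets borel"
  and c: "!!n. AE x in M n. ALL i. 0 <= x $ i & x $ i < 1"
 obtains r nu where "strict_mono (r :: nat => nat)" "prob_space nu" "sets nu = sets borel"
  "ALL f :: real ^ 'd => real. ALL B. continuous_on UNIV f --> (ALL x. \<bar>f x\<bar> <= B) --> (%n. \<integral>x. f x \<partial>M (r n)) \<longlonglongrightarrow> (LINT x|nu. f x)"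
proof -
 have sm [measurable]: "fill_section \<in> bm (M n)" for n
  by (subst mcs[OF s refl]) measurable
 define D where "D n = distr (M n) borel fill_section" for n
 have rd: "real_distribution (D n)" for n
  unfolding D_def by (rule prob_space.real_distribution_distr[OF p sm])
 \<comment> \<open>Tightness is phrased with intervals that are open on the left, so the left end
   lies strictly below 0.\<close>
 have one: "measure (D n) {-1<..1} = 1" for n
 proof -
  interpret prob_space "M n" by (rule p)
  have "measure (D n) {-1<..1} = measure (M n) (fill_section -` {-1<..1} Int space (M n))"
   unfolding D_def by (rule measure_distr) auto
  also have "fill_section -` {-1<..1} Int space (M n) = space (M n)"
  proof -
   have "fill_section x \<in> {-1<..1}" for x :: "real ^ 'd"
   using fill_section(1)[of x] by (cases "x \<in> space_fill ` {0..1}") (auto simp: fill_section_def)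
   thus ?thesis by auto
  qed
  finally show ?thesis by (simp add: prob_space)
 qed
 have "tight D"
  unfolding tight_def
 proof (intro conjI allI impI rd)
  fix e :: real assume "0 < e"
  thus "EX a b. a < b & (ALL n. 1 - e < measure (D n) {a<..b})"
   using one by (intro exI[of _ "-1 :: real"] exI[of _ "1 :: real"]) simp
 qed
 then obtain r q where r: "strict_mono (r :: nat => nat)" and q: "real_distribution q" and w: "weak_conv_m (D \<circ> id \<circ> r) q"
  using tight_imp_convergent_subsubsequence[of D id] by (auto simp: strict_mono_id)
 interpret q: real_distribution q by (rule q)
 have fm [measurable]: "space_fill \<in> bm (borel :: real measure)"
  by (rule borel_measurable_continuous_onI[OF space_fill_cont])
 have fq: "space_fill \<in> q \<rightarrow>\<^sub>M borel" by (subst mcs[OF q.events_eq_borel refl]) (rule fm)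
 define nu where "nu = distr q borel (space_fill :: real => real ^ 'd)"
 have "prob_space nu" unfolding nu_def by (rule q.prob_space_distr[OF fq])
 moreover have "(%n. \<integral>x. f x \<partial>M (r n)) \<longlonglongrightarrow> (LINT x|nu. f x)"
  if f: "continuous_on UNIV f" "!!x. \<bar>f x\<bar> <= B" for f :: "real ^ 'd => real" and B
 proof -
  have fb [measurable]: "f \<in> bm borel" by (rule borel_measurable_continuous_onI[OF f(1)])
  have "continuous_on UNIV (%t. f (space_fill t))"
   by (rule continuous_on_compose2[OF f(1) space_fill_cont]) auto
  hence ic: "isCont (%t. f (space_fill t)) t" for t by (simp add: continuous_on_eq_continuous_at)
  have "(%n. \<integral>t. f (space_fill t) \<partial>(D \<circ> id \<circ> r) n) \<longlonglongrightarrow> (LINT t|q. f (space_fill t))"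
   by (rule weak_conv_imp_integral_bdd_continuous_conv[OF _ q w, where B=B]) (use rd ic f in auto)
  moreover have "(LINT t|(D \<circ> id \<circ> r) n. f (space_fill t)) = (LINT x|M (r n). f x)" for n
  proof -
   have "(LINT t|(D \<circ> id \<circ> r) n. f (space_fill t)) = (LINT x|M (r n). f (space_fill (fill_section x)))"
   unfolding D_def o_def id_def by (rule integral_distr) measurable
   also have "... = (LINT x|M (r n). f x)"
   proof (rule integral_cong_AE)
   show "(%x. f (space_fill (fill_section x))) \<in> bm (M (r n))" by measurable
   show "f \<in> bm (M (r n))" by (subst mcs[OF s refl]) measurable
   show "AE x in M (r n). f (space_fill (fill_section x)) = f x"
   using c[of "r n"]
   proof eventually_elim
   case (elim x)
   hence "x \<in> space_fill ` {0..1}" using space_fill_surj[of x] by auto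
   thus ?case using fill_section(2) by metis
   qed
   qed
   finally show ?thesis .
  qed
  moreover have "(LINT t|q. f (space_fill t)) = (LINT x|nu. f x)"
   unfolding nu_def by (rule integral_distr[OF fq fb, symmetric])
  ultimately show ?thesis by simp
 qed
 ultimately show ?thesis using r by (intro that[of r nu]) (auto simp: nu_def)
qed

lemma prokhorov_ball:
 fixes M :: "nat => (real ^ 'd) measure"
 assumes p: "!!n. prob_space (M n)" and s: "!!n. sets (M n) = sets borel"
  and c: "!!n. AE x in M n. infnorm x <= R"
 obtains r nu where "strict_mono (r :: nat => nat)" "prob_space nu" "sets nu = sets borel"
  "ALL f :: real ^ 'd => real. ALL B. continuous_on UNIV f --> (ALL x. \<bar>f x\<bar> <= B) --> (%n. \<integral>x. f x \<partial>M (r n)) \<longlonglongrightarrow> (LINT x|nu. f x)"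
proof -
 \<comment> \<open>Chosen so that \<open>c * \<bar>R\<bar> < 1 / 2\<close> strictly: the image has
   to lie in the half-open cube.\<close>
 define c where "c = 1 / (2 * \<bar>R\<bar> + 2)"
 have c0: "c > 0" by (simp add: c_def)
 define b :: "real ^ 'd" where "b = (\<chi> i. 1 / 2)"
 define a where "a x = c *\<^sub>R x + b" for x
 define a' where "a' y = (1 / c) *\<^sub>R (y - b)" for y
 have aa: "a' (a x) = x" for x using c0 by (simp add: a_def a'_def)
 have ac: "continuous_on UNIV a" "continuous_on UNIV a'" unfolding a_def a'_def by (intro continuous_intros)+
 hence [measurable]: "a \<in> bm borel" "a' \<in> bm borel"
  by (auto intro: borel_measurable_continuous_onI)
 have am [measurable]: "a \<in> M n \<rightarrow>\<^sub>M borel" for n by (subst mcs[OF s refl]) measurable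
 have AE: "AE x in distr (M n) borel a. ALL i. 0 <= x $ i & x $ i < 1" for n
 proof (subst AE_distr_iff[OF am])
  show "AE x in M n. ALL i. 0 <= a x $ i & a x $ i < 1"
   using assms(3)[of n]
  proof eventually_elim
   case (elim x)
   show ?case
   proof
   fix i
   have "\<bar>x $ i\<bar> <= \<bar>R\<bar>" using component_le_infnorm_cart[of x i] elim by linarith
   hence "c * \<bar>x $ i\<bar> <= c * \<bar>R\<bar>" using c0 by simp
   also have "... < 1 / 2" by (simp add: c_def field_simps)
   finally have "\<bar>c * x $ i\<bar> < 1 / 2" using c0 by (simp add: abs_mult)
   thus "0 <= a x $ i & a x $ i < 1" by (auto simp: a_def b_def abs_if split: if_splits)
   qed
  qed
 qed simp
 obtain r nu where r: "strict_mono (r :: nat => nat)" "prob_space nu" "sets nu = sets borel"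
  "ALL f :: real ^ 'd => real. ALL B. continuous_on UNIV f --> (ALL x. \<bar>f x\<bar> <= B) --> (%n. \<integral>x. f x \<partial>distr (M (r n)) borel a) \<longlonglongrightarrow> (LINT x|nu. f x)"
 proof (rule prokhorov_cube[of "%n. distr (M n) borel a"])
  show "prob_space (distr (M n) borel a)" for n by (rule prob_space.prob_space_distr[OF p am])
  show "AE x in distr (M n) borel a. ALL i. 0 <= x $ i & x $ i < 1" for n by (rule AE)
 qed (simp, blast)
 have an: "a' \<in> nu \<rightarrow>\<^sub>M borel" by (subst mcs[OF r(3) refl]) measurable
 have "(%n. \<integral>x. f x \<partial>M (r n)) \<longlonglongrightarrow> (LINT x|distr nu borel a'. f x)"
  if f: "continuous_on UNIV f" "!!x. \<bar>f x\<bar> <= B" for f :: "real ^ 'd => real" and B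
 proof -
  have [measurable]: "f \<in> bm borel" by (rule borel_measurable_continuous_onI[OF f(1)])
  have "(%n. \<integral>x. f (a' x) \<partial>distr (M (r n)) borel a) \<longlonglongrightarrow> (LINT x|nu. f (a' x))"
   using continuous_on_compose2[OF f(1) ac(2)] f(2) by (intro r(4)[rule_format]) auto
  moreover have "(LINT x|distr (M (r n)) borel a. f (a' x)) = (LINT x|M (r n). f x)" for n
   by (subst integral_distr[OF am]) (auto simp: aa)
  moreover have "(LINT x|nu. f (a' x)) = (LINT x|distr nu borel a'. f x)"
   by (subst integral_distr[OF an]) auto
  ultimately show ?thesis by simp
 qed
 thus ?thesis using r prob_space.prob_space_distr[OF r(2) an] by (intro that[of r "distr nu borel a'"]) auto
qed

text \<open>Using \<open>nu n\<close> on the shell \<open>?S n\<close> only makes countable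
  additivity automatic; consistency enters afterwards, to identify the sum on each ball.\<close>

lemma glue_measures:
 fixes nu :: "nat => (real ^ 'd) measure"
 assumes s: "!!n. sets (nu n) = sets borel" and fin: "!!n. em (nu n) (cb n) < \<infinity>"
  and eq: "!!n A. A \<in> sets borel ==> A \<subseteq> cb n ==> em (nu (Suc n)) A = em (nu n) A"
 obtains mu where "mu \<in> radon_on UNIV"
  "ALL n. ALL A:sets borel. A \<subseteq> cb n --> em mu A = em (nu n) A"
proof -
 let ?B = "%n. sup_cball (real n) (0 :: real ^ 'd)"
 let ?S = "disjointed ?B"
 have S: "?S n \<in> sets borel" "?S n \<subseteq> ?B n" for n
 proof -
  show "?S n \<in> sets borel" unfolding disjointed_def by (intro sets.Diff sets.finite_UN) simp_all
  show "?S n \<subseteq> ?B n" by (rule disjointed_subset)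
 qed
 have eq': "em (nu (n + k)) A = em (nu n) A" if "A \<in> sets borel" "A \<subseteq> ?B n" for n k A
 proof (induction k)
  case (Suc k)
  have "?B n \<subseteq> ?B (n + k)" by (rule sup_cball_mono) simp
  thus ?case using eq[of A "n + k"] that Suc by auto
 qed simp
 define mu where "mu = measure_of UNIV (sets (borel :: (real ^ 'd) measure)) (%A. \<Sum>n. em (nu n) (A Int ?S n))"
 have sm: "sets mu = sets borel"
  using sets.sigma_sets_eq[of "borel :: (real ^ 'd) measure"] by (simp add: mu_def)
 have em: "em mu A = (\<Sum>n. em (nu n) (A Int ?S n))" if "A \<in> sets borel" for A
 proof (rule emeasure_measure_of[OF mu_def])
  show "sets borel \<subseteq> Pow (UNIV :: (real ^ 'd) set)" by simp
  show "positive (sets mu) (%A. \<Sum>n. em (nu n) (A Int ?S n))" by (simp add: positive_def)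
  show "A \<in> sets mu" using that by (simp add: sm)
  show "countably_additive (sets mu) (%A. \<Sum>n. em (nu n) (A Int ?S n))"
  proof (rule countably_additiveI)
   fix F :: "nat => (real ^ 'd) set"
   assume F: "range F \<subseteq> sets mu" "disjoint_family F"
   hence Fb: "F i \<in> sets borel" for i by (auto simp: sm)
   have "(\<Sum>i. \<Sum>n. em (nu n) (F i Int ?S n)) = (\<Sum>i. \<integral>\<^sup>+n. em (nu n) (F i Int ?S n) \<partial>count_space UNIV)"
   by (simp add: nn_integral_count_space_nat)
   also have "... = (\<integral>\<^sup>+n. (\<Sum>i. em (nu n) (F i Int ?S n)) \<partial>count_space UNIV)"
   by (rule nn_integral_suminf[symmetric]) simp
   also have "... = (\<integral>\<^sup>+n. em (nu n) ((\<Union>i. F i) Int ?S n) \<partial>count_space UNIV)"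
   proof (rule nn_integral_cong)
   fix n
   have "(\<Sum>i. em (nu n) (F i Int ?S n)) = em (nu n) (\<Union>i. F i Int ?S n)"
   using F(2) Fb S s by (intro suminf_emeasure) (auto simp: disjoint_family_on_def)
   thus "(\<Sum>i. em (nu n) (F i Int ?S n)) = em (nu n) ((\<Union>i. F i) Int ?S n)" by simp
   qed
   finally show "(\<Sum>i. \<Sum>n. em (nu n) (F i Int ?S n)) = (\<Sum>n. em (nu n) (\<Union> (range F) Int ?S n))"
   by (simp add: nn_integral_count_space_nat)
  qed
 qed
 have main: "em mu A = em (nu N) A" if A: "A \<in> sets borel" "A \<subseteq> ?B N" for N A
 proof -
  have "em (nu n) (A Int ?S n) = em (nu N) (A Int ?S n)" for n
  proof (cases "n <= N")
   case True
   have "A Int ?S n \<subseteq> ?B n" using S(2)[of n] by blast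
   moreover have "A Int ?S n \<in> sets borel" using A S by auto
   ultimately show ?thesis using True eq'[of "A Int ?S n" n "N - n"] by simp
  next
   case False
   hence "?B N Int ?S n = {}" by (auto simp: disjointed_def)
   hence "A Int ?S n = {}" using A by auto
   thus ?thesis by simp
  qed
  hence "em mu A = (\<Sum>n. em (nu N) (A Int ?S n))" using em A by simp
  also have "... = em (nu N) (\<Union>n. A Int ?S n)"
  proof (rule suminf_emeasure)
   show "range (%n. A Int ?S n) \<subseteq> sets (nu N)" using A S s by auto
   show "disjoint_family (%n. A Int ?S n)"
   using disjoint_family_disjointed[of ?B] unfolding disjoint_family_on_def by blast
  qed
  also have "(\<Union>n. A Int ?S n) = A" using UN_disjointed_eq[of ?B] UN_sup_cball[of "0 :: real ^ 'd"] by auto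
  finally show ?thesis .
 qed
 have "mu \<in> radon_on UNIV"
  by (rule radon_onI) (use main[OF sup_cball_borel order_refl] fin sm in auto)
 thus ?thesis using main by (intro that[of mu]) auto
qed

text \<open>The approximation error is controlled by integrals of \<open>cut N\<close>. This
  function lies in \<open>Dc\<close> itself, so these integrals converge and stay bounded.\<close>

lemma vague_upgrade:
 fixes m :: "'e => (real ^ 'd) measure"
 assumes nu: "nu \<in> radon_on A" and m: "eventually (%e. m e \<in> radon_on B) F"
  and D: "!!g. g \<in> Dc ==> ((%e. \<integral>x. g x \<partial>m e) \<longlongrightarrow> (LINT x|nu. g x)) F" and f: "f \<in> Cc"
 shows "((%e. \<integral>x. f x \<partial>m e) \<longlongrightarrow> (LINT x|nu. f x)) F"
proof (rule tendstoI)
 fix e :: real assume e: "e > 0"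
 obtain N where N: "!!e. e > 0 ==> EX g:Dc. ALL x. \<bar>f x - g x\<bar> <= e * cut N x" using Dc_dense[OF f] by blast
 define C where "C = (LINT x|nu. cut N x)"
 have C: "C >= 0" by (simp add: C_def)
 define d where "d = e / (3 * (C + 1))"
 have "C + 1 > 0" using C by linarith
 hence d: "d > 0" "d * (C + 1) = e / 3"
  using e unfolding d_def by (simp_all only: times_divide_eq_left nonzero_divide_eq_eq) (auto simp: field_simps)
 obtain g where g: "g \<in> Dc" "!!x. \<bar>f x - g x\<bar> <= d * cut N x" using N[OF d(1)] by blast
 have "eventually (%e'. dist (LINT x|m e'. g x) (LINT x|nu. g x) < e / 3) F"
  by (rule tendstoD[OF D[OF g(1)]]) (use e in simp)
 moreover have "eventually (%e'. (LINT x|m e'. cut N x) < C + 1) F"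
  by (rule order_tendstoD(2)[OF D[OF cut_Dc]]) (simp add: C_def)
 ultimately show "eventually (%e'. dist (LINT x|m e'. f x) (LINT x|nu. f x) < e) F"
  using m
 proof eventually_elim
  case (elim e')
  have "\<bar>(LINT x|m e'. f x) - (LINT x|m e'. g x)\<bar> <= d * (LINT x|m e'. cut N x)"
   by (rule Cc_integral_diff[OF elim(3) f Dc_Cc[OF g(1)] cut_Cc g(2)])
  moreover have "d * (LINT x|m e'. cut N x) <= d * (C + 1)" using elim d by simp
  moreover have "\<bar>(LINT x|nu. f x) - (LINT x|nu. g x)\<bar> <= d * C" unfolding C_def
   by (rule Cc_integral_diff[OF nu f Dc_Cc[OF g(1)] cut_Cc g(2)])
  moreover have "d * C <= d * (C + 1)" using d by simp
  ultimately show ?case using elim(1) d(2) e unfolding dist_real_def by linarith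
 qed
qed

lemma vague_convergent_Cc:
 fixes m :: "nat => (real ^ 'd) measure"
 assumes m: "!!n. m n \<in> radon_on B" and D: "!!g. g \<in> Dc ==> convergent (%n. \<integral>x. g x \<partial>m n)" and f: "f \<in> Cc"
 shows "convergent (%n. \<integral>x. f x \<partial>m n)"
proof -
 obtain N where N: "!!e. e > 0 ==> EX g:Dc. ALL x. \<bar>f x - g x\<bar> <= e * cut N x" using Dc_dense[OF f] by blast
 have "Bseq (%n. \<integral>x. cut N x \<partial>m n)" by (rule convergent_imp_Bseq[OF D[OF cut_Dc]])
 then obtain C where C: "C > 0" "!!n. \<bar>\<integral>x. cut N x \<partial>m n\<bar> <= C" by (auto elim: BseqE)
 have "Cauchy (%n. \<integral>x. f x \<partial>m n)"
 proof (rule metric_CauchyI)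
  fix e :: real assume e: "e > 0"
  define d where "d = e / (3 * C)"
  have d: "d > 0" "d * C = e / 3" using e C by (auto simp: d_def)
  obtain g where g: "g \<in> Dc" "!!x. \<bar>f x - g x\<bar> <= d * cut N x" using N[OF d(1)] by blast
  have b: "\<bar>(LINT x|m n. f x) - (LINT x|m n. g x)\<bar> <= e / 3" for n
  proof -
   have "\<bar>(LINT x|m n. f x) - (LINT x|m n. g x)\<bar> <= d * (LINT x|m n. cut N x)"
   by (rule Cc_integral_diff[OF m f Dc_Cc[OF g(1)] cut_Cc g(2)])
   also have "... <= d * C" using C(2)[of n] d by (intro mult_left_mono) auto
   finally show ?thesis using d by simp
  qed
  have "Cauchy (%n. \<integral>x. g x \<partial>m n)" by (rule convergent_Cauchy[OF D[OF g(1)]])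
  then obtain M where M: "!!i j. i >= M ==> j >= M ==> dist (LINT x|m i. g x) (LINT x|m j. g x) < e / 3"
   using e unfolding Cauchy_def by (metis divide_pos_pos zero_less_numeral)
  show "EX M. ALL i>=M. ALL j>=M. dist (LINT x|m i. f x) (LINT x|m j. f x) < e"
  proof (intro exI allI impI)
   fix i j assume "M <= i" "M <= j"
   thus "dist (LINT x|m i. f x) (LINT x|m j. f x) < e"
   using M[of i j] b[of i] b[of j] unfolding dist_real_def by linarith
  qed
 qed
 thus ?thesis by (simp add: Cauchy_convergent_iff)
qed

lemma integral_density_Cc:
 assumes "mu \<in> radon_on A" "g \<in> Cc" "!!x. g x >= 0" "f \<in> bm borel"
 shows "(LINT x|density mu (%x. ennreal (g x)). f x) = (LINT x|mu. g x * f x)"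
proof -
 have "g \<in> bm mu" "f \<in> bm mu"
  using Cc_borel[OF assms(2)] assms(4) radon_sets[OF assms(1)] by (simp_all cong: mcs)
 thus ?thesis using assms(3) by (subst integral_density) auto
qed

lemma density_cut_radon:
 assumes "mu \<in> radon_on A"
 shows "density mu (%x. ennreal (cut N x)) \<in> radon_on UNIV"
  "em (density mu (%x. ennreal (cut N x))) UNIV = ennreal (LINT x|mu. cut N x)"
proof -
 note [simp] = radon_sets[OF assms] radon_space[OF assms]
 have [measurable]: "cut N \<in> bm mu" using Cc_borel[OF cut_Cc] by (simp cong: mcs)
 show e: "em (density mu (%x. ennreal (cut N x))) UNIV = ennreal (LINT x|mu. cut N x)"
  using Cc_integrable[OF assms cut_Cc[of N]] by (subst emeasure_density) (auto simp: nn_integral_eq_integral)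
 have "em (density mu (%x. ennreal (cut N x))) X < \<infinity>" for X
  using emeasure_mono[of X UNIV "density mu (%x. ennreal (cut N x))"] e by (auto simp: less_top[symmetric] top_unique)
 thus "density mu (%x. ennreal (cut N x)) \<in> radon_on UNIV" by (auto simp: radon_on_def)
qed

text \<open>Convergence of the integrals is given; what has to be found is a measure behind the
  limit functional \<open>\<Lambda>\<close>. Subsequential limits of the normalised measures cut off
  by \<open>cut N\<close> represent \<open>\<Lambda>\<close> on functions multiplied by
  \<open>cut N\<close>, and these pieces are glued.\<close>

lemma vague_seq_limit:
 fixes m :: "nat => (real ^ 'd) measure"
 assumes m: "!!n. m n \<in> radon_on B" and D: "!!g. g \<in> Dc ==> convergent (%n. \<integral>x. g x \<partial>m n)"
 obtains nu where "nu \<in> radon_on UNIV" "ALL f:Cc. (%n. \<integral>x. f x \<partial>m n) \<longlonglongrightarrow> (LINT x|nu. f x)"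
proof -
 define \<Lambda> where "\<Lambda> f = lim (%n. \<integral>x. f x \<partial>m n)" for f :: "real ^ 'd => real"
 have \<Lambda>: "(%n. \<integral>x. f x \<partial>m n) \<longlonglongrightarrow> \<Lambda> f" if "f \<in> Cc" for f
  using vague_convergent_Cc[OF m D that] by (simp add: \<Lambda>_def convergent_LIMSEQ_iff)
 have part: "EX nu. nu \<in> radon_on UNIV & (ALL f:Cc. (LINT x|nu. f x) = \<Lambda> (%x. cut N x * f x))" for N
 proof -
  let ?m = "%n. density (m n) (%x. ennreal (cut N x))"
  let ?c = "%n. \<integral>x. cut N x \<partial>m n"
  \<comment> \<open>The Dirac measure is a placeholder for the case that the cut-off measure
    vanishes; it is later multiplied by \<open>?c n = 0\<close>.\<close>
  define M where "M n = (if ?c n > 0 then scale_measure (ennreal (1 / ?c n)) (?m n) else return borel 0)" for n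
  have sM: "sets (M n) = sets borel" for n using radon_sets[OF m] by (simp add: M_def)
  have pM: "prob_space (M n)" for n
  proof (cases "?c n > 0")
   case True
   have "em (M n) UNIV = 1"
   using True density_cut_radon(2)[OF m, of n N] by (simp add: M_def flip: ennreal_mult)
   thus ?thesis using sets_eq_imp_space_eq[OF sM[of n]] by (intro prob_spaceI) simp
  qed (auto simp: M_def intro!: prob_space_return)
  have bM: "AE x in M n. infnorm x <= real N + 1" for n
  proof (cases "?c n > 0")
   case True
   have c: "cut N \<in> bm (m n)" using Cc_borel[OF cut_Cc] radon_sets[OF m] by (simp cong: mcs)
   have "AE x in ?m n. infnorm x <= real N + 1"
   proof (subst AE_density)
   show "AE x in m n. 0 < ennreal (cut N x) --> infnorm x <= real N + 1"
   proof (intro AE_I2 impI)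
   fix x assume "0 < ennreal (cut N x)"
   thus "infnorm x <= real N + 1" using cut_eq0[of N x] by (cases "infnorm x <= real N + 1") auto
   qed
   qed (use c in simp)
   thus ?thesis using True unfolding M_def scale_measure_density by (simp add: AE_density)
  next
   case False
   thus ?thesis unfolding M_def by (auto simp: AE_return)
  qed
  obtain r nu where r: "strict_mono (r :: nat => nat)" "prob_space nu" "sets nu = sets borel"
   "ALL f :: real ^ 'd => real. ALL B. continuous_on UNIV f --> (ALL x. \<bar>f x\<bar> <= B) --> (%n. \<integral>x. f x \<partial>M (r n)) \<longlonglongrightarrow> (LINT x|nu. f x)"
   by (rule prokhorov_ball[OF pM sM bM])
  interpret nu: prob_space nu by (rule r(2))
  have nur: "nu \<in> radon_on UNIV" using r(3) nu.emeasure_le_1 by (auto simp: radon_on_def less_top[symmetric] top_unique)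
  have l0: "\<Lambda> (cut N) >= 0" by (rule LIMSEQ_le_const[OF \<Lambda>[OF cut_Cc]]) auto
  have "(LINT x|scale_measure (ennreal (\<Lambda> (cut N))) nu. f x) = \<Lambda> (%x. cut N x * f x)" if f: "f \<in> Cc" for f
  proof -
   have fb: "f \<in> bm borel" "f \<in> bm nu" using Cc_borel[OF f] r(3) by (simp_all cong: mcs)
   obtain K where K: "!!x. \<bar>f x\<bar> <= K" using Cc_bounded[OF f] by blast
   have eq: "?c n * (LINT x|M n. f x) = (LINT x|m n. cut N x * f x)" for n
   proof (cases "?c n > 0")
   case True
   have "f \<in> bm (?m n)" using fb radon_sets[OF m] by (simp cong: mcs)
   thus ?thesis using True
   by (simp add: M_def integral_scale_measure integral_density_Cc[OF m cut_Cc cut_nonneg fb(1)])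
   next
   case False
   moreover have "?c n >= 0" by simp
   ultimately have c0: "?c n = 0" by linarith
   have "\<bar>(LINT x|m n. cut N x * f x) - (LINT x|m n. 0 * cut N x)\<bar> <= K * (LINT x|m n. cut N x)"
   proof (rule Cc_integral_diff[OF m Cc_mult[OF cut_Cc Cc_cont[OF f]] Cc_scale[OF cut_Cc] cut_Cc])
   fix x :: "real ^ 'd"
   show "\<bar>cut N x * f x - 0 * cut N x\<bar> <= K * cut N x"
   using mult_right_mono[OF K[of x] cut_nonneg[of N x]] by (simp add: abs_mult mult.commute)
   qed
   thus ?thesis using c0 by simp
   qed
   have "(%n. ?c (r n) * (LINT x|M (r n). f x)) \<longlonglongrightarrow> \<Lambda> (cut N) * (LINT x|nu. f x)"
   using LIMSEQ_subseq_LIMSEQ[OF \<Lambda>[OF cut_Cc] r(1)] r(4)[rule_format, OF Cc_cont[OF f] K]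
   by (intro tendsto_mult) (auto simp: o_def)
   moreover have "(%n. \<integral>x. cut N x * f x \<partial>m (r n)) \<longlonglongrightarrow> \<Lambda> (%x. cut N x * f x)"
   using LIMSEQ_subseq_LIMSEQ[OF \<Lambda>[OF Cc_mult[OF cut_Cc Cc_cont[OF f]]] r(1)] by (simp add: o_def)
   ultimately have "\<Lambda> (cut N) * (LINT x|nu. f x) = \<Lambda> (%x. cut N x * f x)"
   unfolding eq by (rule LIMSEQ_unique)
   thus ?thesis using integral_scale_measure[OF l0 fb(2)] by simp
  qed
  thus ?thesis using radon_scale[OF nur, of "ennreal (\<Lambda> (cut N))"] by auto
 qed
 then obtain nu where nu: "!!N. nu N \<in> radon_on UNIV" "!!N f. f \<in> Cc ==> (LINT x|nu N. f x) = \<Lambda> (%x. cut N x * f x)"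
  by metis
 \<comment> \<open>\<open>cut (Suc N)\<close> is 1 wherever \<open>cut N\<close> does not vanish, so
   cutting off by both is cutting off by \<open>cut N\<close>.\<close>
 have eq: "density (nu (Suc N)) (%x. ennreal (cut N x)) = nu N" for N
 proof (rule radon_eqI[OF density_cut_radon(1)[OF nu(1)] nu(1)])
  fix f :: "real ^ 'd => real" assume f: "f \<in> Cc"
  have "(%x. cut (Suc N) x * (cut N x * f x)) = (%x. cut N x * f x)"
  proof
   fix x :: "real ^ 'd"
   show "cut (Suc N) x * (cut N x * f x) = cut N x * f x"
   using cut_eq1[of x "Suc N"] cut_eq0[of N x] by (cases "infnorm x <= real (Suc N)") auto
  qed
  thus "(LINT x|density (nu (Suc N)) (%x. ennreal (cut N x)). f x) = (LINT x|nu N. f x)"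
   using integral_density_Cc[OF nu(1) cut_Cc cut_nonneg Cc_borel[OF f], of "Suc N" N]
   nu(2)[OF Cc_mult[OF cut_Cc Cc_cont[OF f]], of "Suc N" N] nu(2)[OF f, of N] by simp
 qed
 have eq': "em (nu (Suc N)) X = em (nu N) X" if X: "X \<in> sets borel" "X \<subseteq> cb N" for N X
 proof -
  have [measurable]: "cut N \<in> bm (nu (Suc N))" using Cc_borel[OF cut_Cc] radon_sets[OF nu(1)] by (simp cong: mcs)
  have [simp]: "X \<in> sets (nu (Suc N))" using X radon_sets[OF nu(1)] by auto
  have "em (nu N) X = (\<integral>\<^sup>+x. ennreal (cut N x) * indicator X x \<partial>nu (Suc N))"
   by (subst eq[symmetric], rule emeasure_density) auto
  also have "... = (\<integral>\<^sup>+x. indicator X x \<partial>nu (Suc N))"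
   using X cut_eq1[of _ N] by (intro nn_integral_cong) (auto simp: mem_sup_cball subset_eq split: split_indicator)
  finally show ?thesis by simp
 qed
 obtain mu where mu: "mu \<in> radon_on UNIV"
  "ALL n. ALL A:sets borel. A \<subseteq> cb n --> em mu A = em (nu n) A"
  by (rule glue_measures[of nu, OF radon_sets[OF nu(1)] radon_ball[OF nu(1)] eq'])
 have "(LINT x|mu. f x) = \<Lambda> f" if f: "f \<in> Cc" for f
 proof -
  obtain N :: nat where "ALL x. real N < infnorm x --> f x = 0" using f by (elim Cc_support) auto
  hence N: "!!x. real N < infnorm x ==> f x = 0" by blast
  let ?B = "sup_cball (real N) (0 :: real ^ 'd)"
  have "density mu (indicator ?B) = density (nu N) (indicator ?B)"
  proof (rule measure_eqI)
   fix A assume "A \<in> sets (density mu (indicator ?B))"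
   hence A: "A \<in> sets borel" using radon_sets[OF mu(1)] by simp
   thus "em (density mu (indicator ?B)) A = em (density (nu N) (indicator ?B)) A"
   using mu(2)[rule_format, of "?B Int A" N] radon_sets[OF mu(1)] radon_sets[OF nu(1)] by (simp add: emeasure_restricted)
  qed (simp add: radon_sets[OF mu(1)] radon_sets[OF nu(1)])
  moreover have "(LINT x|density \<sigma> (indicator ?B). f x) = (LINT x|\<sigma>. f x)" if "\<sigma> \<in> radon_on UNIV" for \<sigma>
  proof -
   have [measurable]: "f \<in> bm \<sigma>" "?B \<in> sets \<sigma>"
   using Cc_borel[OF f] radon_sets[OF that] by (simp_all cong: mcs)
   have "(LINT x|density \<sigma> (%x. ennreal (indicator ?B x)). f x) = (LINT x|\<sigma>. indicator ?B x *\<^sub>R f x)"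
   by (rule integral_density) auto
   also have "... = (LINT x|\<sigma>. f x)"
   using N by (intro Bochner_Integration.integral_cong) (auto simp: mem_sup_cball split: split_indicator)
   finally show ?thesis by (simp add: ennreal_indicator)
  qed
  ultimately have "(LINT x|mu. f x) = (LINT x|nu N. f x)" using mu(1) nu(1) by metis
  also have "... = \<Lambda> (%x. cut N x * f x)" by (rule nu(2)[OF f])
  also have "(%x. cut N x * f x) = f"
  proof
   fix x :: "real ^ 'd"
   show "cut N x * f x = f x" using N[of x] cut_eq1[of x N] by (cases "infnorm x <= real N") auto
  qed
  finally show ?thesis .
 qed
 thus ?thesis using mu(1) \<Lambda> by (intro that[of mu]) auto
qed

text \<open>The limits along \<open>at_right 0\<close> exist by assumption, so the measure may be
  found along the sequence \<open>1 / (n + 1)\<close> alone.\<close>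

lemma vague_limit_exists:
 fixes m :: "real => (real ^ 'd) measure"
 assumes m: "!!e. e > 0 ==> m e \<in> radon_on B"
  and D: "!!g. g \<in> Dc ==> EX l. ((%e. \<integral>x. g x \<partial>m e) \<longlongrightarrow> l) at0"
 obtains nu where "nu \<in> radon_on UNIV" "ALL f:Cc. ((%e. \<integral>x. f x \<partial>m e) \<longlongrightarrow> (LINT x|nu. f x)) at0"
proof -
 have s: "filterlim (%n. rs n) at0 sequentially"
  using LIMSEQ_inverse_real_of_nat by (auto simp: filterlim_at inverse_eq_divide intro!: always_eventually)
 have c: "(%n. \<integral>x. g x \<partial>m (rs n)) \<longlonglongrightarrow> l" if "((%e. \<integral>x. g x \<partial>m e) \<longlongrightarrow> l) at0" for g l
  by (rule filterlim_compose[OF that s])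
 obtain nu where nu: "nu \<in> radon_on UNIV" "ALL f:Cc. (%n. \<integral>x. f x \<partial>m (rs n)) \<longlonglongrightarrow> (LINT x|nu. f x)"
  using vague_seq_limit[of "%n. m (rs n)" B] m D c unfolding convergent_def
  by (metis of_nat_0_less_iff zero_less_Suc zero_less_divide_1_iff)
 have "((%e. \<integral>x. g x \<partial>m e) \<longlongrightarrow> (LINT x|nu. g x)) at0" if g: "g \<in> Dc" for g
 proof -
  obtain l where l: "((%e. \<integral>x. g x \<partial>m e) \<longlongrightarrow> l) at0" using D[OF g] by blast
  have "l = (LINT x|nu. g x)" using LIMSEQ_unique[OF c[OF l]] nu(2) Dc_Cc[OF g] by blast
  thus ?thesis using l by simp
 qed
 moreover have "eventually (%e. m e \<in> radon_on B) at0"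
  using m by (auto simp: eventually_at_filter)
 ultimately have "ALL f:Cc. ((%e. \<integral>x. f x \<partial>m e) \<longlongrightarrow> (LINT x|nu. f x)) at0"
  using vague_upgrade[OF nu(1)] by blast
 with nu(1) show ?thesis by (rule that)
qed

section \<open>Tubes around fibers and their covering properties\<close>

definition qn :: "(real ^ 'd => real ^ 'k) => real ^ 'd => real" where
 "qn pj z = (INF v\<in>{v. pj v = 0}. infnorm (z - v))"

definition tube :: "(real ^ 'd => real ^ 'k) => real ^ 'd => real => (real ^ 'd) set" where
 "tube pj x r = sup_nhd (fiber pj x) r"

abbreviation (input) tI where "tI \<pi> x r y == indicator (tube \<pi> x r) y"

lemma mem_fiber: "y \<in> fiber pj x \<longleftrightarrow> pj y = pj x"
 by (simp add: fiber_def)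

context
 fixes pj :: "real ^ 'd => real ^ 'k"
 assumes lin: "linear pj"
begin

lemma qn_bdd: "bdd_below ((%v. infnorm (z - v)) ` {v. pj v = 0})"
 by (rule bdd_belowI[of _ 0]) (auto simp: infnorm_pos_le)

lemma qn_le: "pj v = 0 ==> qn pj z <= infnorm (z - v)"
 unfolding qn_def by (rule cINF_lower[OF qn_bdd]) simp

lemma qn_greatest: "(!!v. pj v = 0 ==> c <= infnorm (z - v)) ==> c <= qn pj z"
 unfolding qn_def using linear_0[OF lin] by (intro cINF_greatest) auto

lemma qn_nonneg: "0 <= qn pj z"
 by (rule qn_greatest) (rule infnorm_pos_le)

lemma qn_le_infnorm: "qn pj z <= infnorm z"
 using qn_le[of 0 z] linear_0[OF lin] by simp

lemma qn_less: assumes "qn pj z < c" obtains v where "pj v = 0" "infnorm (z - v) < c"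
 using assms qn_greatest[of c z] by (meson not_le)

lemma qn_triangle: "qn pj (a + b) <= qn pj a + qn pj b"
proof (rule field_le_epsilon)
 fix e :: real assume e: "e > 0"
 obtain v where v: "pj v = 0" "infnorm (a - v) < qn pj a + e / 2" using qn_less[of a "qn pj a + e / 2"] e by auto
 obtain w where w: "pj w = 0" "infnorm (b - w) < qn pj b + e / 2" using qn_less[of b "qn pj b + e / 2"] e by auto
 have "qn pj (a + b) <= infnorm (a + b - (v + w))" using v w lin by (intro qn_le) (simp add: linear_add)
 also have "... <= infnorm (a - v) + infnorm (b - w)"
  using infnorm_triangle[of "a - v" "b - w"] by (simp add: algebra_simps)
 finally show "qn pj (a + b) <= qn pj a + qn pj b + e" using v w by linarith
qed

lemma qn_scale_le: "c ~= 0 ==> qn pj (c *\<^sub>R a) <= \<bar>c\<bar> * qn pj a"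
proof -
 assume c: "c ~= 0"
 have "qn pj (c *\<^sub>R a) / \<bar>c\<bar> <= qn pj a"
 proof (rule qn_greatest)
  fix v assume "pj v = 0"
  hence "qn pj (c *\<^sub>R a) <= infnorm (c *\<^sub>R a - c *\<^sub>R v)" using lin by (intro qn_le) (simp add: linear_scale)
  also have "... = \<bar>c\<bar> * infnorm (a - v)" by (simp add: infnorm_mul flip: scaleR_diff_right)
  finally show "qn pj (c *\<^sub>R a) / \<bar>c\<bar> <= infnorm (a - v)" using c by (simp add: field_simps)
 qed
 thus ?thesis using c by (simp add: field_simps)
qed

lemma qn_scale: "qn pj (c *\<^sub>R a) = \<bar>c\<bar> * qn pj a"
proof (cases "c = 0")
 case True
 thus ?thesis using qn_le_infnorm[of 0] qn_nonneg[of 0] by simp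
next
 case False
 have "qn pj ((1 / c) *\<^sub>R c *\<^sub>R a) <= \<bar>1 / c\<bar> * qn pj (c *\<^sub>R a)" using False by (intro qn_scale_le) auto
 hence "\<bar>c\<bar> * qn pj a <= qn pj (c *\<^sub>R a)" using False by (simp add: field_simps)
 thus ?thesis using qn_scale_le[OF False, of a] by simp
qed

lemma qn_minus: "qn pj (- a) = qn pj a"
 using qn_scale[of "-1" a] by simp

lemma qn_commute: "qn pj (a - b) = qn pj (b - a)"
 using qn_minus[of "a - b"] by simp

lemma qn_ker: "pj v = 0 ==> qn pj (a + v) = qn pj a"
 using qn_le[of v v] qn_nonneg[of v] qn_triangle[of a v] qn_triangle[of "a + v" "- v"] qn_minus[of v] by simp

lemma qn_diff: "qn pj a - qn pj b <= qn pj (a - b)"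
 using qn_triangle[of "a - b" b] by simp

lemma qn_cont: "continuous_on UNIV (%z. qn pj z)"
proof (rule continuous_onI)
 fix x e :: real assume "0 < e"
 fix x :: "real ^ 'd"
 show "EX d>0. ALL x':UNIV. dist x' x < d --> dist (qn pj x') (qn pj x) <= e"
 proof (intro exI conjI ballI impI)
  fix x' assume "dist x' x < e"
  hence "infnorm (x' - x) <= e" using infnorm_le_norm[of "x' - x"] by (simp add: dist_norm)
  thus "dist (qn pj x') (qn pj x) <= e"
   using qn_diff[of x' x] qn_diff[of x x'] qn_commute[of x x'] qn_le_infnorm[of "x' - x"]
   unfolding dist_real_def by linarith
 qed fact
qed

text \<open>This identifies tubes with the balls of the quotient of the sup-norm by the kernel. From
  here on the geometry of tubes is that of balls in a finite-dimensional normed space.\<close>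

lemma mem_tube: "y \<in> tube pj x r \<longleftrightarrow> qn pj (y - x) < r"
proof
 assume "y \<in> tube pj x r"
 then obtain a where a: "pj a = pj x" "infnorm (y - a) < r" by (auto simp: tube_def sup_nhd_def mem_fiber)
 have "qn pj (y - x) <= infnorm (y - x - (a - x))" using a lin by (intro qn_le) (simp add: linear_diff)
 thus "qn pj (y - x) < r" using a by simp
next
 assume "qn pj (y - x) < r"
 then obtain v where v: "pj v = 0" "infnorm (y - x - v) < r" by (rule qn_less)
 hence "x + v \<in> fiber pj x" "infnorm (y - (x + v)) < r" using lin by (auto simp: mem_fiber linear_add algebra_simps)
 thus "y \<in> tube pj x r" unfolding tube_def sup_nhd_def by blast
qed

lemma tube_cong: "pj x = pj y ==> tube pj x r = tube pj y r"
 by (simp add: tube_def fiber_def)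

lemma tube_invariant: assumes "pj y = pj z" shows "y \<in> tube pj x r \<longleftrightarrow> z \<in> tube pj x r"
proof -
 have "y - x = (z - x) + (y - z)" by simp
 moreover have "pj (y - z) = 0" using assms lin by (simp add: linear_diff)
 ultimately show ?thesis unfolding mem_tube using qn_ker[of "y - z" "z - x"] by simp
qed

lemma tube_self: "r > 0 ==> x \<in> tube pj x r"
 using qn_le_infnorm[of 0] by (simp add: mem_tube)

lemma tube_mono: "r <= s ==> tube pj x r \<subseteq> tube pj x s"
 by (auto simp: mem_tube)

lemma tube_rel_open: "open {(x, y). y \<in> tube pj x r}"
proof -
 have "continuous_on UNIV (%p :: (real ^ 'd) \<times> (real ^ 'd). qn pj (snd p - fst p))"
  by (rule continuous_on_compose2[OF qn_cont]) (auto intro!: continuous_intros)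
 hence "open {p. qn pj (snd p - fst p) < r}" by (intro open_Collect_less continuous_intros) auto
 also have "{p. qn pj (snd p - fst p) < r} = {(x, y). y \<in> tube pj x r}" by (auto simp: mem_tube)
 finally show ?thesis .
qed

lemma open_tube: "open (tube pj x r)"
proof -
 have "continuous_on UNIV (%y. qn pj (y - x))"
  by (rule continuous_on_compose2[OF qn_cont]) (auto intro!: continuous_intros)
 hence "open {y. qn pj (y - x) < r}" by (intro open_Collect_less continuous_intros) auto
 also have "{y. qn pj (y - x) < r} = tube pj x r" by (auto simp: mem_tube)
 finally show ?thesis .
qed

lemma tube_borel [measurable]: "tube pj x r \<in> sets borel"
 by (rule borel_open[OF open_tube])

text \<open>The strict inequality in \<open>mem_tube\<close> makes tubes left-continuous in the
  radius, which later reduces all radii to rational ones.\<close>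

lemma tube_left: "tube pj x r = (\<Union>n. tube pj x (r - rs n))"
proof (intro equalityI subsetI)
 fix y assume "y \<in> tube pj x r"
 hence "r - qn pj (y - x) > 0" by (simp add: mem_tube)
 then obtain n where "rs n < r - qn pj (y - x)" using nat_approx_posE by blast
 thus "y \<in> (\<Union>n. tube pj x (r - rs n))" by (auto simp: mem_tube intro!: exI[of _ n])
next
 fix y assume "y \<in> (\<Union>n. tube pj x (r - rs n))"
 then obtain n where "qn pj (y - x) < r - rs n" by (auto simp: mem_tube)
 moreover have "rs n > 0" by simp
 ultimately show "y \<in> tube pj x r" unfolding mem_tube by linarith
qed

text \<open>The Besicovitch condition: no centre lies in the tube of another pair.\<close>

definition separated :: "((real ^ 'd) \<times> real) set => bool" where
 "separated S \<longleftrightarrow> (ALL p:S. ALL q:S. p ~= q --> max (snd p) (snd q) <= qn pj (fst p - fst q))"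

lemma infnorm_net:
 assumes "e > 0" "bounded (B :: (real ^ 'd) set)"
 obtains K where "finite K" "ALL w:B. EX k:K. infnorm (w - k) < e"
proof -
 have "compact (closure B)" using assms(2) by simp
 then obtain K where K: "finite K" "closure B \<subseteq> (\<Union>x\<in>K. ball x e)"
  using assms(1) unfolding compact_eq_totally_bounded by meson
 have "ALL w:B. EX k:K. infnorm (w - k) < e"
 proof
  fix w assume "w \<in> B"
  hence "w \<in> (\<Union>x\<in>K. ball x e)" using K(2) closure_subset by blast
  then obtain k where "k \<in> K" "dist k w < e" by auto
  thus "EX k:K. infnorm (w - k) < e"
   using infnorm_le_norm[of "w - k"] by (intro bexI[of _ k]) (auto simp: dist_norm norm_minus_commute)
 qed
 with K(1) show ?thesis by (rule that)
qed

text \<open>Pigeonhole: two points at distance at least \<open>e\<close> cannot both be within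
  \<open>e / 2\<close> of the same net point.\<close>

lemma net_card:
 assumes "finite K" "ALL w:B. EX k:K. infnorm (w - k) < e / 2" "f ` S \<subseteq> B"
  "!!p q. p \<in> S ==> q \<in> S ==> p ~= q ==> e <= infnorm (f p - f q)"
 shows "finite S & card S <= card (K :: (real ^ 'd) set)"
proof -
 have "ALL p:S. EX k:K. infnorm (f p - k) < e / 2" using assms(2,3) by blast
 then obtain k where k: "!!p. p \<in> S ==> k p \<in> K & infnorm (f p - k p) < e / 2" by metis
 have inj: "inj_on k S"
 proof (rule inj_onI, rule ccontr)
  fix p q assume pq: "p \<in> S" "q \<in> S" "k p = k q" "p ~= q"
  have "infnorm (f p - f q) <= infnorm (f p - k p) + infnorm (k p - f q)"
   using infnorm_triangle[of "f p - k p" "k p - f q"] by simp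
  thus False using k[OF pq(1)] k[OF pq(2)] assms(4)[OF pq(1,2,4)] pq(3) infnorm_sub[of "k q" "f q"] by simp
 qed
 moreover have "k ` S \<subseteq> K" using k by blast
 ultimately show ?thesis using assms(1) by (meson card_inj_on_le inj_on_finite)
qed

text \<open>Besicovitch's argument: seen from the common point \<open>z\<close>, the centres of
  separated tubes lie in directions that are at least 1 apart in the quotient, and the unit sphere
  of a finite-dimensional space holds only boundedly many such directions.\<close>

lemma overlap_bound:
 "EX C::nat. ALL S z. separated S --> (ALL p:S. z \<in> tube pj (fst p) (snd p)) --> finite S & card S <= C"
proof -
 have "bounded (sup_cball 2 (0 :: real ^ 'd))" by (simp add: compact_imp_bounded)
 then obtain K where K: "finite K" "ALL w:sup_cball 2 (0 :: real ^ 'd). EX k:K. infnorm (w - k) < 1 / 2"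
  using infnorm_net[of "1 / 2" "sup_cball 2 (0 :: real ^ 'd)"] by auto
 have "finite S & card S <= max 1 (card K)" if S: "separated S" and z: "ALL p:S. z \<in> tube pj (fst p) (snd p)" for S z
 \<comment> \<open>A single tube may be centred on the fiber of \<open>z\<close>, where no direction
   exists. As soon as two tubes occur, separation keeps every centre off that fiber.\<close>
 proof (cases "EX p. S \<subseteq> {p}")
  case True
  then obtain p where "S \<subseteq> {p}" by blast
  hence "finite S" "card S <= card {p}" using finite_subset[of S "{p}"] card_mono[of "{p}" S] by auto
  thus ?thesis by simp
 next
  case False
  define a where "a p = fst p - z" for p :: "(real ^ 'd) \<times> real"
  have ar: "qn pj (a p) < snd p" if "p \<in> S" for p
   using z that qn_commute[of z "fst p"] by (auto simp: a_def mem_tube)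
  have sep: "qn pj (a p - a q) > qn pj (a p)" "qn pj (a p - a q) > qn pj (a q)" if "p \<in> S" "q \<in> S" "p ~= q" for p q
   using S that ar[of p] ar[of q] unfolding separated_def a_def by force+
  have pos: "qn pj (a p) > 0" if p: "p \<in> S" for p
  proof -
   obtain q where q: "q \<in> S" "q ~= p" using False p by blast
   have "qn pj (a p - a q) <= qn pj (a p) + qn pj (a q)" using qn_triangle[of "a p" "- a q"] qn_minus by simp
   thus ?thesis using sep(2)[OF p q(1)] q by auto
  qed
  define u where "u p = (1 / qn pj (a p)) *\<^sub>R a p" for p
  have half: "1 <= qn pj (u p - u q)" if pq: "p \<in> S" "q \<in> S" "p ~= q" and le: "qn pj (a p) <= qn pj (a q)" for p q
  proof -
   let ?A = "qn pj (a p)" and ?B = "qn pj (a q)"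
   \<comment> \<open>Pulling \<open>a q\<close> back to the sphere of radius \<open>?A\<close> moves
     it by \<open>?B - ?A\<close>, while \<open>a p\<close> and \<open>a q\<close> are more than
     \<open>?B\<close> apart.\<close>
   have "?A *\<^sub>R (u p - u q) = (a p - a q) + (1 - ?A / ?B) *\<^sub>R a q"
   using pos[OF pq(1)] by (simp add: u_def algebra_simps)
   hence "?A * qn pj (u p - u q) = qn pj ((a p - a q) + (1 - ?A / ?B) *\<^sub>R a q)"
   using qn_scale[of ?A "u p - u q"] pos[OF pq(1)] by simp
   moreover have "qn pj (a p - a q) <= qn pj ((a p - a q) + (1 - ?A / ?B) *\<^sub>R a q) + qn pj (- ((1 - ?A / ?B) *\<^sub>R a q))"
   using qn_triangle[of "(a p - a q) + (1 - ?A / ?B) *\<^sub>R a q" "- ((1 - ?A / ?B) *\<^sub>R a q)"] by simp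
   moreover have "qn pj (- ((1 - ?A / ?B) *\<^sub>R a q)) = ?B - ?A"
   using le pos[OF pq(2)] by (simp add: qn_minus qn_scale field_simps)
   ultimately have "?A * 1 <= ?A * qn pj (u p - u q)" using sep(2)[OF pq] by linarith
   thus ?thesis using pos[OF pq(1)] by (rule mult_left_le_imp_le)
  qed
  have usep: "1 <= qn pj (u p - u q)" if pq: "p \<in> S" "q \<in> S" "p ~= q" for p q
   using half[OF pq] half[OF pq(2,1)] pq qn_commute[of "u p" "u q"] by (cases "qn pj (a p) <= qn pj (a q)") auto
  \<comment> \<open>Kernel vectors are subtracted to bring the directions into a bounded set, where
    the finite net \<open>K\<close> counts them; \<open>qn\<close> does not see the change.\<close>
  have "EX v. pj v = 0 & infnorm (u p - v) < 2" if p: "p \<in> S" for p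
  proof -
   have "qn pj (u p) = 1" using pos[OF p] by (simp add: u_def qn_scale)
   thus ?thesis using qn_less[of "u p" 2] by auto
  qed
  then obtain v where v: "!!p. p \<in> S ==> pj (v p) = 0 & infnorm (u p - v p) < 2" by metis
  have "finite S & card S <= card K"
  proof (rule net_card[OF K(1), where e=1 and B="sup_cball 2 0" and f="%p. u p - v p"])
   show "(%p. u p - v p) ` S \<subseteq> sup_cball 2 0" using v by (auto simp: mem_sup_cball less_imp_le)
   fix p q assume pq: "p \<in> S" "q \<in> S" "p ~= q"
   have "pj (v q - v p) = 0" using v pq lin by (simp add: linear_diff)
   hence "qn pj (u p - u q) = qn pj ((u p - v p) - (u q - v q))"
   using qn_ker[of "v q - v p" "u p - u q"] by (simp add: algebra_simps)
   thus "1 <= infnorm ((u p - v p) - (u q - v q))"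
   using usep[OF pq] qn_le_infnorm[of "(u p - v p) - (u q - v q)"] by linarith
  qed (use K in auto)
  thus ?thesis by auto
 qed
 thus ?thesis by blast
qed

text \<open>Covering follows from maximality: an uncovered point could be added. A maximal set
  exists because a finite net of spacing \<open>b / 2\<close> bounds all cardinalities.\<close>

lemma max_separated:
 assumes "bounded T" "b > 0"
 obtains X where "finite X" "X \<subseteq> T" "separated (X \<times> {b})" "ALL t:T. EX x:X. t \<in> tube pj x b"
proof -
 obtain K where K: "finite K" "ALL w:T. EX k:K. infnorm (w - k) < b / 2"
  using infnorm_net[of "b / 2" T] assms by auto
 let ?P = "%X. finite X & X \<subseteq> T & separated (X \<times> {b})"
 have bd: "ALL X. ?P X --> card X < Suc (card K)"
 proof (intro allI impI)
  fix X assume X: "?P X"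
  have "finite X & card X <= card K"
  proof (rule net_card[OF K, where f="%x. x"])
   fix p q assume pq: "p \<in> X" "q \<in> X" "p ~= q"
   hence "b <= qn pj (p - q)" using X unfolding separated_def by force
   thus "b <= infnorm (p - q)" using qn_le_infnorm[of "p - q"] by linarith
  qed (use X in auto)
  thus "card X < Suc (card K)" by simp
 qed
 have P0: "?P {}" by (simp add: separated_def)
 from ex_has_greatest_nat[of ?P "{}" card, OF P0 bd]
 obtain X where "?P X & (ALL Y. ?P Y --> card Y <= card X)" by (elim exE)
 hence X: "?P X" "ALL Y. ?P Y --> card Y <= card X" by (rule conjunct1, rule conjunct2)
 have "EX x:X. t \<in> tube pj x b" if t: "t \<in> T" for t
 proof (rule ccontr)
  assume n: "\<not> (EX x:X. t \<in> tube pj x b)"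
  hence far: "b <= qn pj (t - x)" if "x \<in> X" for x using that by (auto simp: mem_tube not_less)
  have "t \<notin> X" using n tube_self[OF assms(2)] by auto
  have "separated (insert t X \<times> {b})"
   using X(1) far qn_commute[of t] unfolding separated_def by auto
  hence "?P (insert t X)" using X(1) t by simp
  hence "card (insert t X) <= card X" using X(2) by blast
  thus False using X(1) \<open>t \<notin> X\<close> by simp
 qed
 thus ?thesis using X(1) by (intro that[of X]) auto
qed

text \<open>The greedy choice by decreasing radius: the induction adds the smallest radius last and
  places its centres only at points not yet covered, so separation from the earlier, larger tubes is
  automatic.\<close>

lemma selection:
 assumes "finite Rs" "ALL r:Rs. r > 0" "bounded B" "ALL r:Rs. A r \<subseteq> B"
 shows "EX S. finite S & (ALL p:S. snd p \<in> Rs & fst p \<in> A (snd p)) & separated S &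
  (ALL r:Rs. ALL x:A r. EX p:S. x \<in> tube pj (fst p) (snd p))"
 using assms(1,2,4)
proof (induction Rs rule: finite_linorder_min_induct)
 case empty
 thus ?case by (intro exI[of _ "{}"]) (auto simp: separated_def)
next
 case (insert b Rs)
 then obtain S where S: "finite S" "ALL p:S. snd p \<in> Rs & fst p \<in> A (snd p)" "separated S"
  "ALL r:Rs. ALL x:A r. EX p:S. x \<in> tube pj (fst p) (snd p)" by auto
 let ?T = "A b - (\<Union>p\<in>S. tube pj (fst p) (snd p))"
 have bT: "bounded ?T" using insert.prems(2) by (intro bounded_subset[OF assms(3)]) auto
 have b0: "b > 0" using insert.prems(1) by simp
 obtain X where X: "finite X" "X \<subseteq> ?T" "separated (X \<times> {b})" "ALL t:?T. EX x:X. t \<in> tube pj x b"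
  by (rule max_separated[OF bT b0])
 have cross: "max (snd p) b <= qn pj (fst p - x)" if "p \<in> S" "x \<in> X" for p x
 proof -
  have "x \<notin> tube pj (fst p) (snd p)" using X(2) that by blast
  hence "snd p <= qn pj (fst p - x)" using qn_commute[of x "fst p"] by (simp add: mem_tube)
  moreover have "b < snd p" using S(2) insert.hyps(2) that by blast
  ultimately show ?thesis by simp
 qed
 have s1: "max (snd p) (snd q) <= qn pj (fst p - fst q)" if "p \<in> S" "q \<in> S" "p ~= q" for p q
  using S(3) that unfolding separated_def by blast
 have s2: "max (snd p) (snd q) <= qn pj (fst p - fst q)" if "p \<in> X \<times> {b}" "q \<in> X \<times> {b}" "p ~= q" for p q
  using X(3) that unfolding separated_def by blast
 have "separated (S \<union> X \<times> {b})"
  unfolding separated_def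
 proof (intro ballI impI)
  fix p q assume p: "p \<in> S \<union> X \<times> {b}" and q: "q \<in> S \<union> X \<times> {b}" and "p ~= q"
  then consider "p \<in> S" "q \<in> S" | "p \<in> X \<times> {b}" "q \<in> X \<times> {b}" | "p \<in> S" "q \<in> X \<times> {b}" | "p \<in> X \<times> {b}" "q \<in> S" by blast
  thus "max (snd p) (snd q) <= qn pj (fst p - fst q)"
  proof cases
   case 3 thus ?thesis using cross[of p "fst q"] by auto
  next
   case 4 thus ?thesis using cross[of q "fst p"] qn_commute[of "fst p" "fst q"] by (auto simp: max.commute)
  next
   case 1 thus ?thesis using s1 \<open>p ~= q\<close> by blast
  next
   case 2 thus ?thesis using s2 \<open>p ~= q\<close> by blast
  qed
 qed
 moreover have "EX p:S \<union> X \<times> {b}. x \<in> tube pj (fst p) (snd p)" if "r \<in> insert b Rs" "x \<in> A r" for r x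
 proof (cases "r \<in> Rs")
  case True thus ?thesis using S(4) that by blast
 next
  case False
  hence "r = b" using that by simp
  thus ?thesis using X(4) that by (cases "x \<in> ?T") force+
 qed
 ultimately show ?case using S(1,2) X(1,2) by (intro exI[of _ "S \<union> X \<times> {b}"]) auto
qed

text \<open>The weak-type inequality for the maximal function. The selected tubes cover the
  exceptional set and overlap at most \<open>C\<close> times, where \<open>C\<close> depends on
  \<open>pj\<close> alone. Having finitely many radii allows the choice by decreasing
  radius.\<close>

lemma maximal_finite:
 "EX C::nat. ALL (m :: (real ^ 'd) measure) (F :: real ^ 'd => ennreal) (B :: (real ^ 'd) set) Rs l. sets m = sets borel --> F \<in> bm borel --> bounded B -->
   finite Rs --> (ALL r:Rs. r > 0) -->
   l * em m {x\<in>B. EX r:Rs. l * em m (tube pj x r) < (\<integral>\<^sup>+y. tI pj x r y * F y \<partial>m)} <= of_nat C * (\<integral>\<^sup>+y. F y \<partial>m)"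
proof -
 obtain C :: nat where C: "!!S z. separated S ==> ALL p:S. z \<in> tube pj (fst p) (snd p) ==> finite S & card S <= C"
  using overlap_bound by blast
 show ?thesis
 proof (intro exI[of _ C] allI impI)
  fix m :: "(real ^ 'd) measure" and F :: "real ^ 'd => ennreal" and B :: "(real ^ 'd) set" and Rs l
  assume m: "sets m = sets borel" and F [measurable]: "F \<in> bm borel" and B: "bounded B"
   and Rs: "finite Rs" "ALL r:Rs. r > (0 :: real)"
  define A where "A r = {x\<in>B. l * em m (tube pj x r) < (\<integral>\<^sup>+y. tI pj x r y * F y \<partial>m)}" for r
  have [measurable]: "F \<in> bm m" "tube pj x r \<in> sets m" for x r using m by (auto cong: mcs)
  have "ALL r:Rs. A r \<subseteq> B" by (auto simp: A_def)
  from selection[OF Rs B this] obtain S where S: "finite S" "ALL p:S. snd p \<in> Rs & fst p \<in> A (snd p)" "separated S"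
   "ALL r:Rs. ALL x:A r. EX p:S. x \<in> tube pj (fst p) (snd p)" by auto
  let ?t = "%p. tube pj (fst p) (snd p)"
  have "{x\<in>B. EX r:Rs. l * em m (tube pj x r) < (\<integral>\<^sup>+y. tI pj x r y * F y \<partial>m)} \<subseteq> (\<Union>p\<in>S. ?t p)"
   using S(4) by (auto simp: A_def)
  hence "l * em m {x\<in>B. EX r:Rs. l * em m (tube pj x r) < (\<integral>\<^sup>+y. tI pj x r y * F y \<partial>m)} <= l * em m (\<Union>p\<in>S. ?t p)"
   using S(1) by (intro mult_left_mono emeasure_mono) auto
  also have "... <= l * (\<Sum>p\<in>S. em m (?t p))"
   using S(1) by (intro mult_left_mono emeasure_subadditive_finite) auto
  also have "... = (\<Sum>p\<in>S. l * em m (?t p))" by (simp add: sum_distrib_left)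
  also have "... <= (\<Sum>p\<in>S. \<integral>\<^sup>+y. indicator (?t p) y * F y \<partial>m)"
   using S(2) by (intro sum_mono) (auto simp: A_def less_imp_le)
  also have "... = (\<integral>\<^sup>+y. (\<Sum>p\<in>S. indicator (?t p) y * F y) \<partial>m)"
   by (rule nn_integral_sum[symmetric]) measurable
  also have "... <= (\<integral>\<^sup>+y. of_nat C * F y \<partial>m)"
  proof (rule nn_integral_mono)
   fix y
   let ?S = "{p\<in>S. y \<in> ?t p}"
   have sS: "separated ?S" using S(3) by (auto simp: separated_def)
   have "ALL p:?S. y \<in> ?t p" by simp
   from C[OF sS this] have c: "card ?S <= C" by (rule conjunct2)
   have "(\<Sum>p\<in>S. indicator (?t p) y * F y) = (\<Sum>p\<in>S. indicator (?t p) y) * F y" by (simp add: sum_distrib_right)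
   also have "(\<Sum>p\<in>S. indicator (?t p) y :: ennreal) = (\<Sum>p\<in>?S. 1)"
   using S(1) by (intro sum.mono_neutral_cong_right) (auto simp: indicator_def)
   also have "... = of_nat (card ?S)" by simp
   also have "... * F y <= of_nat C * F y" using c by (intro mult_right_mono) auto
   finally show "(\<Sum>p\<in>S. indicator (?t p) y * F y) <= of_nat C * F y" .
  qed
  also have "... = of_nat C * (\<integral>\<^sup>+y. F y \<partial>m)" by (rule nn_integral_cmult) measurable
  finally show "l * em m {x\<in>B. EX r:Rs. l * em m (tube pj x r) < (\<integral>\<^sup>+y. tI pj x r y * F y \<partial>m)} <= of_nat C * (\<integral>\<^sup>+y. F y \<partial>m)" .
 qed
qed

end

lemma open_infnorm_ball:
 fixes U :: "(real ^ 'd) set"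
 assumes "open U" "x \<in> U" obtains d where "d > 0" "ALL y. infnorm (y - x) < d --> y \<in> U"
proof -
 obtain e where e: "e > 0" "ball x e \<subseteq> U" using assms open_contains_ball by blast
 let ?s = "sqrt (real DIM(real ^ 'd))"
 have s: "?s > 0" by simp
 have "y \<in> U" if "infnorm (y - x) < e / ?s" for y
 proof -
  have "norm (y - x) <= ?s * infnorm (y - x)" by (rule norm_le_infnorm)
  also have "... < ?s * (e / ?s)" using that s by (intro mult_strict_left_mono)
  also have "... = e" using s by simp
  finally show ?thesis using e(2) by (auto simp: dist_norm norm_minus_commute)
 qed
 moreover have "e / ?s > 0" using e s by simp
 ultimately show ?thesis by (intro that[of "e / ?s"]) auto
qed

section \<open>Differentiation along tubes\<close>

definition VA :: "(real ^ 'd => real ^ 'k) => (real ^ 'd) measure" where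
 "VA pj = vimage_algebra UNIV pj borel"

definition tavg :: "(real ^ 'd => real ^ 'k) => (real ^ 'd) measure => (real ^ 'd => real) => real ^ 'd => real => real" where
 "tavg pj m F x r = (LINT y|m. tI pj x r y * F y) / measure m (tube pj x r)"

lemma space_VA [simp]: "space (VA pj) = UNIV"
 by (simp add: VA_def)

lemma sets_VA: "sets (VA pj) = {pj -` A | A. A \<in> sets borel}"
 unfolding VA_def by (subst sets_vimage_algebra2) auto

context
 fixes pj :: "real ^ 'd => real ^ 'k"
 assumes lin: "linear pj"
begin

lemma lin_borel [measurable]: "pj \<in> bm borel"
 by (intro borel_measurable_continuous_onI linear_continuous_on linear_conv_bounded_linear[THEN iffD1] lin)

lemma VA_sub: "A \<in> sets (VA pj) ==> A \<in> sets borel"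
 by (auto simp: sets_VA intro!: measurable_sets_borel[OF lin_borel])

lemma lin_section: obtains s :: "real ^ 'k => real ^ 'd" where "s \<in> bm borel" "ALL x. pj (s (pj x)) = pj x"
proof -
 obtain s where s: "linear s" "ALL v:range pj. pj (s v) = v"
  using linear_exists_right_inverse_on[OF lin subspace_UNIV] by blast
 have "s \<in> bm borel"
  by (intro borel_measurable_continuous_onI linear_continuous_on linear_conv_bounded_linear[THEN iffD1] s)
 with s show ?thesis by (intro that[of s]) auto
qed

text \<open>A linear section of \<open>pj\<close> exhibits a function that is constant on fibers as
  a Borel function of \<open>pj x\<close>.\<close>

lemma VA_measurable:
 assumes "u \<in> borel \<rightarrow>\<^sub>M N" "!!x y. pj x = pj y ==> u x = u y"
 shows "u \<in> VA pj \<rightarrow>\<^sub>M N"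
proof -
 obtain s :: "real ^ 'k => real ^ 'd" where s: "s \<in> bm borel" "ALL x. pj (s (pj x)) = pj x" by (rule lin_section)
 have "pj \<in> VA pj \<rightarrow>\<^sub>M borel" unfolding VA_def by (rule measurable_vimage_algebra1) auto
 hence "(%x. u (s (pj x))) \<in> VA pj \<rightarrow>\<^sub>M N"
  by (intro measurable_compose[OF _ assms(1)] measurable_compose[OF _ s(1)])
 moreover have "u (s (pj x)) = u x" for x using s(2) by (intro assms(2)) auto
 ultimately show ?thesis by simp
qed

lemma VA_set: assumes "X \<in> sets borel" "!!x y. pj x = pj y ==> x \<in> X \<longleftrightarrow> y \<in> X" shows "X \<in> sets (VA pj)"
proof -
 have "(%x. x \<in> X) \<in> VA pj \<rightarrow>\<^sub>M count_space UNIV"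
 proof (rule VA_measurable)
  show "(%x. x \<in> X) \<in> borel \<rightarrow>\<^sub>M count_space UNIV" using assms(1) by simp
  show "(x \<in> X) = (y \<in> X)" if "pj x = pj y" for x y by (rule assms(2)[OF that])
 qed
 hence "{x\<in>space (VA pj). x \<in> X} \<in> sets (VA pj)" by measurable
 thus ?thesis by simp
qed

lemma VA_borel_measurable: "u \<in> VA pj \<rightarrow>\<^sub>M N ==> u \<in> borel \<rightarrow>\<^sub>M N"
 by (rule measurable_from_subalg[rotated]) (auto simp: subalgebra_def VA_sub)

lemma tube_VA: "tube pj x r \<in> sets (VA pj)"
 by (rule VA_set[OF tube_borel[OF lin]]) (rule tube_invariant[OF lin])

lemma tube_in_open:
 assumes "open W" "pj x \<in> W" obtains d where "d > 0" "ALL r<d. tube pj x r \<subseteq> pj -` W"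
proof -
 have "open (pj -` W)"
  using assms(1) linear_continuous_at[OF linear_conv_bounded_linear[THEN iffD1, OF lin]] by (intro continuous_open_vimage) auto
 then obtain d where d: "d > 0" "ALL y. infnorm (y - x) < d --> y \<in> pj -` W"
  using open_infnorm_ball[of "pj -` W" x] assms(2) by auto
 have "tube pj x r \<subseteq> pj -` W" if "r < d" for r
 proof
  fix y assume "y \<in> tube pj x r"
  hence "qn pj (y - x) < r" using mem_tube[OF lin] by simp
  then obtain v where v: "pj v = 0" "infnorm (y - x - v) < r" by (rule qn_less[OF lin])
  hence "y - v \<in> pj -` W" using d(2) that by (auto simp: algebra_simps)
  thus "y \<in> pj -` W" using v(1) lin by (simp add: linear_diff)
 qed
 with d(1) show ?thesis by (intro that[of d]) auto
qed

lemma tube_nn_measurable: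
 assumes m: "finite_measure m" "sets m = sets borel" and [measurable]: "F \<in> bm borel"
 shows "(%x. \<integral>\<^sup>+y. tI pj x r y * F y \<partial>m) \<in> bm borel"
proof -
 interpret finite_measure m by fact
 have "{(x, y). y \<in> tube pj x r} \<in> sets (borel \<Otimes>\<^sub>M borel)"
  unfolding borel_prod by (rule borel_open[OF tube_rel_open[OF lin]])
 hence [measurable]: "{(x, y). y \<in> tube pj x r} \<in> sets (borel \<Otimes>\<^sub>M m)"
  by (subst sets_pair_measure_cong[OF refl m(2)])
 have [measurable]: "F \<in> bm m" using m(2) by (simp cong: mcs)
 have "(%x. \<integral>\<^sup>+y. indicator {(x, y). y \<in> tube pj x r} (x, y) * F y \<partial>m) \<in> bm borel"
  by measurable
 also have "(%x. \<integral>\<^sup>+y. indicator {(x, y). y \<in> tube pj x r} (x, y) * F y \<partial>m) = (%x. \<integral>\<^sup>+y. tI pj x r y * F y \<partial>m)"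
  by (intro ext nn_integral_cong) (auto simp: indicator_def)
 finally show ?thesis .
qed

lemma emeasure_tube_measurable:
 assumes m: "finite_measure m" "sets m = sets borel"
 shows "(%x. em m (tube pj x r)) \<in> bm borel"
proof -
 have "(\<integral>\<^sup>+y. tI pj x r y * 1 \<partial>m) = em m (tube pj x r)" for x
  using tube_borel[OF lin] m(2) by simp
 thus ?thesis using tube_nn_measurable[OF m, of "%_. 1" r] by simp
qed

lemma emeasure_tube_left:
 assumes m: "sets m = sets borel" and F: "F \<in> bm borel"
 shows "(SUP n. \<integral>\<^sup>+y. indicator (tube pj x (r - rs n)) y * F y \<partial>m) = (\<integral>\<^sup>+y. tI pj x r y * F y \<partial>m)"
proof -
 have [measurable]: "F \<in> bm m" "tube pj x s \<in> sets m" for s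
  using m F tube_borel[OF lin] by (auto cong: mcs)
 have inc: "tube pj x (r - rs i) \<subseteq> tube pj x (r - rs j)" if "i <= j" for i j
  using that by (intro tube_mono[OF lin] diff_left_mono frac_le) auto
 have "(SUP n. \<integral>\<^sup>+y. indicator (tube pj x (r - rs n)) y * F y \<partial>m)
   = (\<integral>\<^sup>+y. (SUP n. indicator (tube pj x (r - rs n)) y * F y) \<partial>m)"
 proof (rule nn_integral_monotone_convergence_SUP[symmetric])
  show "incseq (%n y. indicator (tube pj x (r - rs n)) y * F y)"
   using inc by (auto simp: incseq_def le_fun_def indicator_def)
 qed measurable
 also have "... = (\<integral>\<^sup>+y. tI pj x r y * F y \<partial>m)"
 proof (rule nn_integral_cong)
  fix y
  show "(SUP n. indicator (tube pj x (r - rs n)) y * F y) = tI pj x r y * F y"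
  proof (cases "y \<in> tube pj x r")
   case True
   then obtain n where n: "y \<in> tube pj x (r - rs n)" using tube_left[OF lin, of x r] by blast
   show ?thesis
   by (rule antisym[OF SUP_least SUP_upper2[of n]]) (use n True in \<open>auto split: split_indicator\<close>)
  next
   case False
   hence "y \<notin> tube pj x (r - rs n)" for n using tube_left[OF lin, of x r] by blast
   thus ?thesis using False by simp
  qed
 qed
 finally show ?thesis .
qed

text \<open>Left-continuity in the radius reduces the condition to rational radii, and these are
  exhausted by finite sets. The exceptional set is merely enclosed in a Borel set \<open>G\<close>;
  its own measurability is not claimed.\<close>

lemma maximal_all:
 "EX C::nat. ALL (m :: (real ^ 'd) measure) (F :: real ^ 'd => ennreal) (B :: (real ^ 'd) set) l.
   finite_measure m --> sets m = sets borel --> F \<in> bm borel --> bounded B --> B \<in> sets borel --> l < \<top> -->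
   (EX G:sets borel. {x\<in>B. EX r>0. l * em m (tube pj x r) < (\<integral>\<^sup>+y. tI pj x r y * F y \<partial>m)} \<subseteq> G &
   l * em m G <= of_nat C * (\<integral>\<^sup>+y. F y \<partial>m))"
proof -
 from maximal_finite[OF lin] obtain C :: nat where C: "ALL (m :: (real ^ 'd) measure) (F :: real ^ 'd => ennreal) B Rs l. sets m = sets borel --> F \<in> bm borel --> bounded B -->
   finite Rs --> (ALL r:Rs. r > 0) -->
   l * em m {x\<in>B. EX r:Rs. l * em m (tube pj x r) < (\<integral>\<^sup>+y. tI pj x r y * F y \<partial>m)} <= of_nat C * (\<integral>\<^sup>+y. F y \<partial>m)"
  by (elim exE)
 show ?thesis
 proof (intro exI[of _ C] allI impI)
  fix m :: "(real ^ 'd) measure" and F :: "real ^ 'd => ennreal" and B :: "(real ^ 'd) set" and l :: ennreal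
  assume m: "finite_measure m" "sets m = sets borel" and F: "F \<in> bm borel"
   and B: "bounded B" and [measurable]: "B \<in> sets borel" and l: "l < \<top>"
  let ?Q = "{r\<in>\<rat>. r > (0::real)}"
  define \<rho> where "\<rho> = from_nat_into ?Q"
  have Q: "countable ?Q" by (rule countable_subset[OF _ countable_rat]) auto
  have "1 \<in> ?Q" by simp
  hence Qr: "range \<rho> = ?Q" unfolding \<rho>_def using Q by (intro range_from_nat_into) auto
  let ?P = "%x r. l * em m (tube pj x r) < (\<integral>\<^sup>+y. tI pj x r y * F y \<partial>m)"
  define A where "A n = {x\<in>B. EX r:\<rho> ` {..<n}. ?P x r}" for n
  note [measurable] = tube_nn_measurable[OF m F] emeasure_tube_measurable[OF m]
  have Am: "A n \<in> sets borel" for n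
  proof -
   have "{x\<in>space borel. x \<in> B & (EX i:{..<n}. ?P x (\<rho> i))} \<in> sets borel" by measurable
   thus ?thesis by (simp add: A_def)
  qed
  have Ainc: "incseq A" by (auto simp: incseq_def A_def)
  have Ale: "l * em m (A n) <= of_nat C * (\<integral>\<^sup>+y. F y \<partial>m)" for n
   unfolding A_def using Qr by (intro C[rule_format] m F B) auto
  show "EX G:sets borel. {x\<in>B. EX r>0. ?P x r} \<subseteq> G & l * em m G <= of_nat C * (\<integral>\<^sup>+y. F y \<partial>m)"
  proof (intro bexI conjI)
   show "(\<Union>n. A n) \<in> sets borel" using Am by auto
   have "l * em m (\<Union>n. A n) = l * (SUP n. em m (A n))"
   using Am m(2) Ainc by (subst SUP_emeasure_incseq) auto
   also have "... = (SUP n. l * em m (A n))" by (rule SUP_mult_left_ennreal) 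
   also have "... <= of_nat C * (\<integral>\<^sup>+y. F y \<partial>m)" by (rule SUP_least) (rule Ale)
   finally show "l * em m (\<Union>n. A n) <= of_nat C * (\<integral>\<^sup>+y. F y \<partial>m)" .
   show "{x\<in>B. EX r>0. ?P x r} \<subseteq> (\<Union>n. A n)"
   proof
   fix x assume "x \<in> {x\<in>B. EX r>0. ?P x r}"
   then obtain r where x: "x \<in> B" "r > 0" "?P x r" by blast
   have "l * em m (tube pj x r) < (SUP n. \<integral>\<^sup>+y. indicator (tube pj x (r - rs n)) y * F y \<partial>m)"
   using x(3) by (simp only: emeasure_tube_left[OF m(2) F])
   then obtain n where n: "l * em m (tube pj x r) < (\<integral>\<^sup>+y. indicator (tube pj x (r - rs n)) y * F y \<partial>m)"
   unfolding less_SUP_iff by blast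
   have "max 0 (r - rs n) < r" using x(2) by simp
   then obtain q where q: "q \<in> \<rat>" "max 0 (r - rs n) < q" "q < r" using Rats_dense_in_real by blast
   have tm: "tube pj x s \<in> sets m" for s using tube_borel[OF lin] m(2) by auto
   have "l * em m (tube pj x q) <= l * em m (tube pj x r)"
   using q tube_mono[OF lin, of q r x] tm by (intro mult_left_mono emeasure_mono) auto
   also note n
   also have "(\<integral>\<^sup>+y. indicator (tube pj x (r - rs n)) y * F y \<partial>m) <= (\<integral>\<^sup>+y. indicator (tube pj x q) y * F y \<partial>m)"
   using q tube_mono[OF lin, of "r - rs n" q x] by (intro nn_integral_mono) (auto split: split_indicator)
   finally have "?P x q" .
   moreover have "q \<in> range \<rho>" using q Qr by auto
   then obtain i where "q = \<rho> i" by blast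
   ultimately show "x \<in> (\<Union>n. A n)" using x(1) unfolding A_def by (intro UN_I[of "Suc i"]) auto
   qed
  qed
 qed
qed

text \<open>Tubes are open, so by Lindelof countably many null tubes cover the union of all of
  them.\<close>

lemma tube_positive_AE:
 assumes m: "sets m = sets borel"
 shows "AE x in m. ALL r>0. em m (tube pj x r) > 0"
proof -
 let ?F = "{tube pj x r | x r. em m (tube pj x r) = 0}"
 have "!!S. S \<in> ?F ==> open S" using open_tube[OF lin] by auto
 then obtain F' where F': "F' \<subseteq> ?F" "countable F'" "\<Union>F' = \<Union>?F" by (rule Lindelof)
 have "(\<Union>S\<in>F'. S) \<in> null_sets m"
 proof (rule null_sets_UN'[OF F'(2)])
  fix S assume "S \<in> F'"
  then obtain x r where "S = tube pj x r" "em m S = 0" using F'(1) by auto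
  thus "S \<in> null_sets m" using tube_borel[OF lin] m by (auto simp: null_sets_def)
 qed
 hence "\<Union>?F \<in> null_sets m" using F'(3) by simp
 moreover have "{x\<in>space m. \<not> (ALL r>0. em m (tube pj x r) > 0)} \<subseteq> \<Union>?F"
  using tube_self[OF lin] by (auto simp: zero_less_iff_neq_zero)
 ultimately show ?thesis by (rule AE_I')
qed

text \<open>Lebesgue's density theorem for unions of fibers: the maximal inequality is applied to
  the indicator of the difference between \<open>E\<close> and a slightly larger open set, whose
  mass is below \<open>e\<close>.\<close>

lemma tube_density:
 assumes m: "finite_measure m" "sets m = sets borel" and E: "E \<in> sets (VA pj)"
 shows "AE x in m. x \<in> E --> (ALL et>0. eventually (%r. measure m (tube pj x r - E) <= et * measure m (tube pj x r)) at0)"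
proof -
 interpret finite_measure m by fact
 note sp = sets_eq_imp_space_eq[OF m(2), simplified]
 from maximal_all obtain C :: nat where CC: "ALL (m :: (real ^ 'd) measure) (F :: real ^ 'd => ennreal) (B :: (real ^ 'd) set) l.
   finite_measure m --> sets m = sets borel --> F \<in> bm borel --> bounded B --> B \<in> sets borel --> l < \<top> -->
   (EX G:sets borel. {x\<in>B. EX r>0. l * em m (tube pj x r) < (\<integral>\<^sup>+y. tI pj x r y * F y \<partial>m)} \<subseteq> G &
   l * em m G <= of_nat C * (\<integral>\<^sup>+y. F y \<partial>m))" by (elim exE)
 note C = CC[rule_format, OF m]
 obtain C0 where C0: "E = pj -` C0" "C0 \<in> sets borel" using E by (auto simp: sets_VA)
 have Eb: "E \<in> sets borel" by (rule VA_sub[OF E])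
 have pm [measurable]: "pj \<in> m \<rightarrow>\<^sub>M borel" using m(2) by (simp cong: mcs)
 define Bad where "Bad et = {x\<in>E. ALL d>0. EX r>0. r < d & measure m (tube pj x r - E) > et * measure m (tube pj x r)}" for et
 have null: "EX Z:null_sets m. Bad et Int cb N \<subseteq> Z" if et: "et > 0" for et N
 proof -
  have "EX G:sets borel. Bad et Int cb N \<subseteq> G & ennreal et * em m G <= of_nat C * ennreal e" if e: "e > 0" for e
  proof -
   \<comment> \<open>Outer regularity is used for the image measure: the preimage of an open set
     contains every sufficiently thin tube around its points, even though fibers are unbounded in
     general.\<close>
   let ?D = "distr m borel pj"
   interpret D: finite_measure ?D by (rule finite_measure_distr) measurable
   have oreg: "em ?D C0 = (INF U \<in> {U. C0 \<subseteq> U & open U}. em ?D U)"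
   by (rule outer_regular) (use C0 D.emeasure_finite in auto)
   have "em ?D C0 + 0 < em ?D C0 + ennreal e"
   using e D.emeasure_finite[of C0] by (subst ennreal_add_left_cancel_less) auto
   hence "(INF U \<in> {U. C0 \<subseteq> U & open U}. em ?D U) < em ?D C0 + ennreal e"
   by (simp only: oreg[symmetric] add_0_right)
   then obtain U where U: "C0 \<subseteq> U" "open U" "em ?D U < em ?D C0 + ennreal e"
   unfolding INF_less_iff by blast
   let ?X = "pj -` U - E"
   have Ub: "pj -` U \<in> sets borel" using borel_open[OF U(2)] lin_borel measurable_sets_borel by blast
   have "em m (pj -` U) < em m E + ennreal e"
   using U(2,3) C0 pm by (simp add: emeasure_distr sp)
   moreover have "em m (pj -` U) = em m E + em m ?X"
   proof -
   have "pj -` U = E \<union> ?X" using U(1) C0(1) by auto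
   thus ?thesis using plus_emeasure[of E m ?X] Ub Eb m(2) by auto
   qed
   ultimately have X: "em m ?X < ennreal e"
   using emeasure_finite[of E] by (simp add: ennreal_add_left_cancel_less)
   have Xb: "?X \<in> sets borel" using Ub Eb by auto
   obtain G where G: "G \<in> sets borel"
   "{x\<in>cb N. EX r>0. ennreal et * em m (tube pj x r) < (\<integral>\<^sup>+y. tI pj x r y * indicator ?X y \<partial>m)} \<subseteq> G"
   "ennreal et * em m G <= of_nat C * (\<integral>\<^sup>+y. indicator ?X y \<partial>m)"
   using C[of "indicator ?X" "cb N" "ennreal et"] Xb compact_imp_bounded[OF compact_sup_cball] by auto
   have "Bad et Int cb N \<subseteq> G"
   proof
   fix x assume x: "x \<in> Bad et Int cb N"
   hence "pj x \<in> U" using U(1) C0(1) by (auto simp: Bad_def)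
   from tube_in_open[OF U(2) this] obtain d where d: "d > 0" "ALL r<d. tube pj x r \<subseteq> pj -` U" by blast
   from x d(1) obtain r where r: "r > 0" "r < d" "measure m (tube pj x r - E) > et * measure m (tube pj x r)"
   unfolding Bad_def by blast
   have eq: "tube pj x r - E = tube pj x r Int ?X" using d r by blast
   have tm: "tube pj x r \<in> sets m" "?X \<in> sets m" using tube_borel[OF lin] m(2) Xb by auto
   have "(\<integral>\<^sup>+y. tI pj x r y * indicator ?X y \<partial>m) = em m (tube pj x r Int ?X)"
   using tm by (simp flip: indicator_inter_arith)
   also have "... > ennreal et * em m (tube pj x r)"
   using r(3) et unfolding eq[symmetric] emeasure_eq_measure by (simp add: ennreal_less_iff flip: ennreal_mult)
   finally show "x \<in> G" using G(2) x r(1) by blast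
   qed
   moreover have "(\<integral>\<^sup>+y. indicator ?X y \<partial>m) <= ennreal e" using X Xb m(2) by simp
   hence "ennreal et * em m G <= of_nat C * ennreal e"
   using G(3) by (meson mult_left_mono order_trans zero_le)
   ultimately show ?thesis using G(1) by blast
  qed
  \<comment> \<open>Errors \<open>1 / (i + 1)\<close> are used and the enclosing sets intersected,
    since \<open>Bad\<close> itself is not known to be measurable.\<close>
  hence "ALL i::nat. EX G:sets borel. Bad et Int cb N \<subseteq> G & ennreal et * em m G <= of_nat C * ennreal (rs i)"
   by simp
  then obtain G where G: "!!i::nat. G i \<in> sets borel & Bad et Int cb N \<subseteq> G i & ennreal et * em m (G i) <= of_nat C * ennreal (rs i)"
   by metis
  have "measure m (\<Inter>i. G i) * et <= real C * (rs i)" for i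
  proof -
   have "measure m (\<Inter>i. G i) <= measure m (G i)" using G m(2) by (intro finite_measure_mono) auto
   hence "et * measure m (\<Inter>i. G i) <= et * measure m (G i)" using et by (intro mult_left_mono) auto
   moreover have "ennreal (et * measure m (G i)) <= ennreal (real C * (rs i))"
   proof -
   have "ennreal (et * measure m (G i)) = ennreal et * em m (G i)"
   using et by (simp add: emeasure_eq_measure ennreal_mult)
   also have "... <= of_nat C * ennreal (rs i)" using G by blast
   also have "... = ennreal (real C * (rs i))"
   by (subst ennreal_mult) (auto simp: ennreal_of_nat_eq_real_of_nat)
   finally show ?thesis .
   qed
   hence "et * measure m (G i) <= real C * (rs i)" by (subst (asm) ennreal_le_iff) auto
   ultimately have "et * measure m (\<Inter>i. G i) <= real C * (rs i)" by linarith
   thus ?thesis by (simp only: mult.commute)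
  qed
  moreover have "(%i. real C * (rs i)) \<longlonglongrightarrow> real C * 0"
   by (intro tendsto_intros LIMSEQ_Suc lim_1_over_n)
  ultimately have "measure m (\<Inter>i. G i) * et <= real C * 0" by (intro LIMSEQ_le_const) auto
  hence "measure m (\<Inter>i. G i) <= 0" using et by (simp add: mult_le_0_iff)
  hence "measure m (\<Inter>i. G i) = 0" using measure_nonneg by (rule antisym)
  hence "(\<Inter>i. G i) \<in> null_sets m" using G m(2) by (auto simp: null_sets_def emeasure_eq_measure)
  moreover have "Bad et Int cb N \<subseteq> (\<Inter>i. G i)" using G by blast
  ultimately show ?thesis by blast
 qed
 have "AE x in m. x \<notin> Bad (rs j) Int cb N" for j N
 proof -
  obtain Z where Z: "Z \<in> null_sets m" "Bad (rs j) Int cb N \<subseteq> Z"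
   using null[of "rs j" N] by auto
  show ?thesis by (rule AE_I'[OF Z(1)]) (use Z(2) in blast)
 qed
 hence "AE x in m. ALL j N. x \<notin> Bad (rs j) Int cb N" unfolding AE_all_countable by blast
 thus ?thesis
 proof eventually_elim
  case (elim x)
  show ?case
  proof (intro impI allI)
   fix et :: real assume x: "x \<in> E" and "et > 0"
   then obtain j where j: "rs j < et" using nat_approx_posE by blast
   obtain N where "x \<in> cb N" using UN_sup_cball[of "0 :: real ^ 'd"] by blast
   hence nb: "x \<notin> Bad (rs j)" using elim by blast
   have "\<not> (ALL d>0. EX r>0. r < d & measure m (tube pj x r - E) > rs j * measure m (tube pj x r))"
   using nb x unfolding Bad_def mem_Collect_eq by (simp only: simp_thms)
   then obtain d where d0: "d > 0" "\<not> (EX r>0. r < d & measure m (tube pj x r - E) > rs j * measure m (tube pj x r))"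
   by blast
   hence d: "d > 0" "ALL r>0. r < d --> measure m (tube pj x r - E) <= rs j * measure m (tube pj x r)"
   by (auto simp only: not_less)
   have "measure m (tube pj x r - E) <= et * measure m (tube pj x r)" if "r > 0" "r < d" for r
   proof -
   have "measure m (tube pj x r - E) <= rs j * measure m (tube pj x r)" using d(2) that by blast
   also have "... <= et * measure m (tube pj x r)" using j by (intro mult_right_mono) auto
   finally show ?thesis .
   qed
   thus "eventually (%r. measure m (tube pj x r - E) <= et * measure m (tube pj x r)) at0"
   using d(1) unfolding eventually_at_right_field by auto
  qed
 qed
qed

end

text \<open>Existence of the limit is a Cauchy condition, and left-continuity lets rational
  parameters decide it; that leaves countably many conditions.\<close>

lemma lim_at_right_measurable:
 fixes g :: "real => 'w => real"
 assumes g: "!!r. r > 0 ==> g r \<in> bm M"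
  and left: "!!om r. om \<in> space M ==> r > 0 ==> ((%s. g s om) \<longlongrightarrow> g r om) (at_left r)"
 shows "{om\<in>space M. EX l. ((%r. g r om) \<longlongrightarrow> l) at0} \<in> sets M"
proof -
 \<comment> \<open>Indexing by the countable type of rationals, with value 0 off the positive ones,
   makes all these functions measurable.\<close>
 define G where "G q om = (if (q :: rat) > 0 then g (of_rat q) om else 0)" for q om
 have [measurable]: "G q \<in> bm M" for q
  using g[of "of_rat q"] by (cases "q > 0") (simp_all add: G_def[abs_def])
 let ?C = "{om\<in>space M. ALL k::nat. EX n::nat. ALL q q'. 0 < q & of_rat q < rs n & 0 < q' & of_rat q' < rs n
   --> \<bar>G q om - G q' om\<bar> <= rs k}"
 have "?C \<in> sets M" by measurable
 moreover have "(EX l. ((%r. g r om) \<longlongrightarrow> l) at0) \<longleftrightarrow> om \<in> ?C" if w: "om \<in> space M" for om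
 proof
  assume "EX l. ((%r. g r om) \<longlongrightarrow> l) at0"
  then obtain l where l: "((%r. g r om) \<longlongrightarrow> l) at0" by blast
  have "EX n::nat. ALL q q'. 0 < q & of_rat q < rs n & 0 < q' & of_rat q' < rs n --> \<bar>G q om - G q' om\<bar> <= rs k" for k :: nat
  proof -
   have "eventually (%r. dist (g r om) l < rs k / 2) at0" by (rule tendstoD[OF l]) simp
   then obtain d where d: "d > 0" "!!r. 0 < r ==> r < d ==> dist (g r om) l < rs k / 2"
   unfolding eventually_at_right_field by auto
   obtain n where n: "rs n < d" using nat_approx_posE[OF d(1)] by blast
   show ?thesis
   proof (intro exI[of _ n] allI impI)
   fix q q' :: rat assume q: "0 < q & of_rat q < rs n & 0 < q' & of_rat q' < rs n"
   hence "dist (g (of_rat q) om) l < rs k / 2" "dist (g (of_rat q') om) l < rs k / 2"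
   proof -
   have "of_rat q < d" "of_rat q' < d" using q n by linarith+
   thus "dist (g (of_rat q) om) l < rs k / 2" "dist (g (of_rat q') om) l < rs k / 2"
   using q by (simp_all only: d(2) zero_less_of_rat_iff)
   qed
   moreover have "G q om = g (of_rat q) om" "G q' om = g (of_rat q') om" using q by (simp_all add: G_def)
   ultimately show "\<bar>G q om - G q' om\<bar> <= rs k"
   proof -
   have tri: "\<bar>a - b\<bar> <= e" if "dist a l < e / 2" "dist b l < e / 2" for a b e :: real
   using that unfolding dist_real_def by linarith
   assume "dist (g (of_rat q) om) l < rs k / 2" "dist (g (of_rat q') om) l < rs k / 2"
   "G q om = g (of_rat q) om" "G q' om = g (of_rat q') om"
   thus ?thesis by (simp only: tri)
   qed
   qed
  qed
  thus "om \<in> ?C" using w by blast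
 next
  assume C: "om \<in> ?C"
  have approx: "EX q. 0 < q & of_rat q < r & \<bar>g (of_rat q) om - g r om\<bar> < e" if r: "r > 0" and e: "e > 0" for r e
  proof -
   have "eventually (%s. dist (g s om) (g r om) < e) (at_left r)" by (rule tendstoD[OF left[OF w r] e])
   then obtain b where b: "b < r" "!!y. b < y ==> y < r ==> dist (g y om) (g r om) < e"
   unfolding eventually_at_left_field by auto
   obtain q where q: "max b 0 < of_rat q" "of_rat q < r" using of_rat_dense[of "max b 0" r] b r by auto
   thus ?thesis using b(2)[of "of_rat q"] by (intro exI[of _ q]) (auto simp: dist_real_def)
  qed
  have Cr: "EX n::nat. ALL r r'. 0 < r & r < rs n & 0 < r' & r' < rs n --> \<bar>g r om - g r' om\<bar> <= rs k" for k :: nat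
  proof -
   from C obtain n :: nat where n: "ALL q q'. 0 < q & of_rat q < rs n & 0 < q' & of_rat q' < rs n --> \<bar>G q om - G q' om\<bar> <= rs k"
   by blast
   have "\<bar>g r om - g r' om\<bar> <= rs k" if r: "0 < r" "r < rs n" "0 < r'" "r' < rs n" for r r'
   proof (rule field_le_epsilon)
   fix e :: real assume "e > 0"
   hence e2: "e / 2 > 0" by simp
   obtain q where q: "0 < q" "of_rat q < r" "\<bar>g (of_rat q) om - g r om\<bar> < e / 2" using approx[OF r(1) e2] by blast
   obtain q' where q': "0 < q'" "of_rat q' < r'" "\<bar>g (of_rat q') om - g r' om\<bar> < e / 2" using approx[OF r(3) e2] by blast
   have "\<bar>G q om - G q' om\<bar> <= rs k" using n q q' r by (meson order_less_trans)
   hence "\<bar>g (of_rat q) om - g (of_rat q') om\<bar> <= rs k" using q(1) q'(1) by (simp add: G_def)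
   thus "\<bar>g r om - g r' om\<bar> <= rs k + e" using q(3) q'(3) by linarith
   qed
   thus ?thesis by blast
  qed
  have "Cauchy (%j. g (1 / real (Suc (Suc j))) om)"
  proof (rule metric_CauchyI)
   fix e :: real assume "e > 0"
   then obtain k where k: "rs k < e" using nat_approx_posE by blast
   obtain n :: nat where n: "ALL r r'. 0 < r & r < rs n & 0 < r' & r' < rs n --> \<bar>g r om - g r' om\<bar> <= rs k"
   using Cr[of k] by blast
   have "dist (g (1 / real (Suc (Suc i))) om) (g (1 / real (Suc (Suc j))) om) < e" if "i >= n" "j >= n" for i j
   proof -
   have "1 / real (Suc (Suc i)) < rs n" "1 / real (Suc (Suc j)) < rs n"
   using that by (auto intro!: divide_strict_left_mono)
   hence "\<bar>g (1 / real (Suc (Suc i))) om - g (1 / real (Suc (Suc j))) om\<bar> <= rs k"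
   using n by simp
   thus ?thesis using k unfolding dist_real_def by linarith
   qed
   thus "EX M. ALL m>=M. ALL n>=M. dist (g (1 / real (Suc (Suc m))) om) (g (1 / real (Suc (Suc n))) om) < e" by blast
  qed
  then obtain l where l: "(%j. g (1 / real (Suc (Suc j))) om) \<longlonglongrightarrow> l" using Cauchy_convergent_iff convergent_def by blast
  have "((%r. g r om) \<longlongrightarrow> l) at0"
  proof (rule tendstoI)
   fix e :: real assume e: "e > 0"
   then obtain k where k: "rs k < e / 2" using nat_approx_posE[of "e/2"] by auto
   obtain n :: nat where n: "ALL r r'. 0 < r & r < rs n & 0 < r' & r' < rs n --> \<bar>g r om - g r' om\<bar> <= rs k"
   using Cr[of k] by blast
   obtain J where J: "!!j. j >= J ==> dist (g (1 / real (Suc (Suc j))) om) l < e / 2"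
   using l e unfolding lim_sequentially by (meson half_gt_zero)
   let ?j = "max J n"
   have j: "1 / real (Suc (Suc ?j)) < rs n" by (auto intro!: divide_strict_left_mono)
   have "dist (g r om) l < e" if "0 < r" "r < rs n" for r
   proof -
   have "\<bar>g r om - g (1 / real (Suc (Suc ?j))) om\<bar> <= rs k" using n that j by simp
   thus ?thesis using J[of ?j] k unfolding dist_real_def by (smt (verit) field_sum_of_halves max.cobounded1)
   qed
   thus "eventually (%r. dist (g r om) l < e) at0"
   unfolding eventually_at_right_field by (intro exI[of _ "rs n"]) auto
  qed
  thus "EX l. ((%r. g r om) \<longlongrightarrow> l) at0" by blast
 qed
 hence "{om\<in>space M. EX l. ((%r. g r om) \<longlongrightarrow> l) at0} = ?C" by blast
 ultimately show ?thesis by simp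
qed

lemma inverse_Suc_at_right: "filterlim (%n. rs n) at0 sequentially"
 using LIMSEQ_inverse_real_of_nat by (auto simp: filterlim_at inverse_eq_divide intro!: always_eventually)

text \<open>For a null set \<open>T\<close> both sides are 0, the right one by the convention on
  division by zero.\<close>

lemma integral_uniform_measure:
 fixes f :: "'a => real"
 assumes T: "T \<in> sets m" "em m T < \<infinity>" and [measurable]: "f \<in> bm m"
 shows "(LINT x|uniform_measure m T. f x) = (LINT x|m. indicator T x * f x) / measure m T"
proof (cases "em m T = 0")
 case True
 hence "em (uniform_measure m T) (space m) = 0" using T sets.sets_into_space[OF T(1)] by (simp add: Int_absorb2)
 hence "AE x in uniform_measure m T. False" by (intro AE_I[of _ _ "space m"]) auto
 hence "AE x in uniform_measure m T. f x = 0" by eventually_elim simp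
 hence "(LINT x|uniform_measure m T. f x) = 0" by (rule integral_eq_zero_AE)
 thus ?thesis using True by (simp add: measure_def)
next
 case False
 hence p: "measure m T > 0" using T by (simp add: measure_def enn2real_positive_iff zero_less_iff_neq_zero less_top[symmetric])
 have "indicator T x / em m T = ennreal (indicator T x / measure m T)" for x
  using T p divide_ennreal[of 1 "measure m T"]
  by (simp add: emeasure_eq_ennreal_measure less_top[symmetric] indicator_def)
 hence "uniform_measure m T = density m (%x. ennreal (indicator T x / measure m T))"
  unfolding uniform_measure_def by simp
 hence "(LINT x|uniform_measure m T. f x) = (LINT x|m. (indicator T x / measure m T) *\<^sub>R f x)"
  using T by (simp add: integral_density)
 thus ?thesis by simp
qed

lemma uniform_measure_radon:
 assumes "sets m = sets borel" "T \<in> sets borel"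
 shows "uniform_measure m T \<in> radon_on UNIV"
proof -
 have "em (uniform_measure m T) X < \<infinity>" if "X \<in> sets borel" for X
 proof -
  have "em m (T Int X) <= em m T" using assms that by (intro emeasure_mono) auto
  hence "em m (T Int X) / em m T <= em m T / em m T" by (rule divide_right_mono_ennreal)
  also have "... <= 1"
  proof (cases "em m T = 0 \<or> em m T = \<top>")
   case False
   hence "em m T ~= 0" "em m T < \<top>" by (auto simp: less_top[symmetric])
   thus ?thesis by (simp add: ennreal_divide_self)
  qed auto
  finally show ?thesis using assms that by (auto simp: less_top[symmetric] top_unique)
 qed
 thus ?thesis using assms by (auto simp: radon_on_def borel_compact)
qed

context
 fixes pj :: "real ^ 'd => real ^ 'k"
 assumes lin: "linear pj"
begin

lemma tube_integral_left:
 fixes F :: "real ^ 'd => real"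
 assumes m: "sets m = sets borel" and F: "integrable m F"
 shows "((%s. \<integral>y. tI pj x s y * F y \<partial>m) \<longlongrightarrow> (LINT y|m. tI pj x r y * F y)) (at_left r)"
proof (rule tendsto_at_left_sequentially[of "r - 1"])
 fix S :: "nat => real" assume S: "!!n. S n < r" "S \<longlonglongrightarrow> r"
 have [measurable]: "tube pj x s \<in> sets m" for s using tube_borel[OF lin] m by auto
 have [measurable]: "F \<in> bm m" using F by auto
 show "(%n. \<integral>y. indicator (tube pj x (S n)) y * F y \<partial>m) \<longlonglongrightarrow> (LINT y|m. tI pj x r y * F y)"
 proof (rule integral_dominated_convergence[where w="%y. \<bar>F y\<bar>"])
  show "integrable m (%y. \<bar>F y\<bar>)" using F by simp
  show "AE y in m. (%n. indicator (tube pj x (S n)) y * F y) \<longlonglongrightarrow> tI pj x r y * F y"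
  proof (rule AE_I2)
   fix y
   show "(%n. indicator (tube pj x (S n)) y * F y) \<longlonglongrightarrow> tI pj x r y * F y"
   proof (cases "y \<in> tube pj x r")
   case True
   hence "eventually (%n. qn pj (y - x) < S n) sequentially"
   using S(2) mem_tube[OF lin] by (intro order_tendstoD(1)) auto
   hence "eventually (%n. indicator (tube pj x (S n)) y * F y = tI pj x r y * F y) sequentially"
   by eventually_elim (use True mem_tube[OF lin] in auto)
   thus ?thesis by (rule tendsto_eventually)
   next
   case False
   hence "y \<notin> tube pj x (S n)" for n using S(1)[of n] tube_mono[OF lin, of "S n" r x] by auto
   thus ?thesis using False by simp
   qed
  qed
  show "AE y in m. norm (indicator (tube pj x (S n)) y * F y) <= \<bar>F y\<bar>" for n
   by (intro AE_I2) (auto simp: indicator_def)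
 qed measurable
qed simp

text \<open>When the denominator vanishes at \<open>r\<close> it vanishes for all smaller radii,
  because \<open>H\<close> is nonnegative, and the quotient is constantly 0 there.\<close>

lemma tube_ratio_left:
 fixes F H :: "real ^ 'd => real"
 assumes m: "sets m = sets borel" and F: "integrable m F" and H: "integrable m H" "!!x. H x >= 0"
 shows "((%s. (LINT y|m. tI pj x s y * F y) / (LINT y|m. tI pj x s y * H y)) \<longlongrightarrow>
  (LINT y|m. tI pj x r y * F y) / (LINT y|m. tI pj x r y * H y)) (at_left r)"
proof (cases "(LINT y|m. tI pj x r y * H y) = 0")
 case False
 thus ?thesis by (intro tendsto_divide tube_integral_left assms)
next
 case True
 have [measurable]: "tube pj x s \<in> sets m" for s using tube_borel[OF lin] m by auto
 have i: "integrable m (%y. tI pj x s y * H y)" for s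
  using integrable_mult_indicator[OF _ H(1), of "tube pj x s"] by simp
 have "(LINT y|m. tI pj x s y * H y) = 0" if "s < r" for s
 proof (rule antisym)
  have "(LINT y|m. tI pj x s y * H y) <= (LINT y|m. tI pj x r y * H y)"
   using i H(2) tube_mono[OF lin, of s r x] that by (intro integral_mono) (auto simp: indicator_def)
  thus "(LINT y|m. tI pj x s y * H y) <= 0" using True by simp
  show "0 <= (LINT y|m. tI pj x s y * H y)" by (rule Bochner_Integration.integral_nonneg) (simp add: H(2))
 qed
 hence "eventually (%s. (LINT y|m. tI pj x s y * F y) / (LINT y|m. tI pj x s y * H y) = 0) (at_left r)"
  unfolding eventually_at_left_field by (intro exI[of _ "r - 1"]) auto
 thus ?thesis using True by (simp add: tendsto_eventually)
qed

lemma tavg_left: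
 assumes m: "finite_measure m" "sets m = sets borel" and F: "integrable m F"
 shows "((%s. tavg pj m F x s) \<longlongrightarrow> tavg pj m F x r) (at_left r)"
proof -
 interpret finite_measure m by fact
 have "measure m (tube pj x s) = (LINT y|m. tI pj x s y * 1)" for s
  using tube_borel[OF lin] m(2) by simp
 thus ?thesis using tube_ratio_left[OF m(2) F, of "%_. 1" x r] unfolding tavg_def by simp
qed

text \<open>One half of the differentiation theorem. If \<open>c < q < h x\<close>, then
  \<open>{x. h x > q}\<close> fills the tubes around \<open>x\<close> up to a small proportion, and
  nonnegativity of \<open>h\<close> makes the rest harmless. Tubes are themselves unions of fibers,
  so \<open>F\<close> may be exchanged for \<open>h\<close> on them.\<close>

lemma tube_lower:
 fixes F h :: "real ^ 'd => real"
 assumes m: "finite_measure m" "sets m = sets borel" and F: "integrable m F" "!!x. F x >= 0"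
  and h: "h \<in> bm (VA pj)" "integrable m h" "AE x in m. h x >= 0"
  and eq: "!!A. A \<in> sets (VA pj) ==> (LINT y|m. indicator A y * F y) = (LINT y|m. indicator A y * h y)"
 shows "AE x in m. ALL c<h x. eventually (%r. c < tavg pj m F x r) at0"
proof -
 interpret finite_measure m by fact
 have [measurable]: "A \<in> sets m" if "A \<in> sets (VA pj)" for A using VA_sub[OF lin that] m by simp
 have Eq: "{x. h x > q} \<in> sets (VA pj)" for q
 proof -
  have "{x\<in>space (VA pj). q < h x} \<in> sets (VA pj)" using h(1) by measurable
  thus ?thesis by simp
 qed
 have "AE x in m. ALL q:\<rat>. x \<in> {x. h x > q} --> (ALL et>0. eventually (%r. measure m (tube pj x r - {x. h x > q}) <= et * measure m (tube pj x r)) at0)"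
  using tube_density[OF lin m Eq] by (subst AE_ball_countable[OF countable_rat]) blast
 thus ?thesis using tube_positive_AE[OF lin m(2)]
 proof eventually_elim
  case (elim x)
  show ?case
  proof (intro allI impI)
   fix c assume c: "c < h x"
   have pos: "measure m (tube pj x r) > 0" if "r > 0" for r
   using elim(2) that by (simp add: emeasure_eq_measure)
   have F0: "(LINT y|m. tI pj x r y * F y) >= 0" for r by (rule Bochner_Integration.integral_nonneg) (simp add: F(2))
   show "eventually (%r. c < tavg pj m F x r) at0"
   proof (cases "c < 0")
   case True
   have "c < tavg pj m F x r" for r using True F0[of r] unfolding tavg_def by (smt (verit) divide_nonneg_nonneg measure_nonneg)
   thus ?thesis by simp
   next
   case False
   obtain q where q: "q \<in> \<rat>" "c < q" "q < h x" using Rats_dense_in_real[OF c] by blast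
   hence q0: "q > 0" using False by linarith
   define E where "E = {x. h x > q}"
   have EV: "E \<in> sets (VA pj)" using Eq by (simp add: E_def)
   \<comment> \<open>With this proportion \<open>q * (1 - et)\<close> is the midpoint of
     \<open>c\<close> and \<open>q\<close>.\<close>
   define et where "et = (q - c) / (2 * q)"
   have et: "et > 0" "q * (1 - et) > c" using q q0 by (auto simp: et_def field_simps)
   have "eventually (%r. measure m (tube pj x r - E) <= et * measure m (tube pj x r)) at0"
   using elim(1) q et(1) unfolding E_def by blast
   moreover have "eventually (%r :: real. r > 0) at0" by (rule eventually_at_right_less)
   ultimately show ?thesis
   proof eventually_elim
   case (elim r)
   let ?T = "tube pj x r"
   have TV: "?T \<in> sets (VA pj)" by (rule tube_VA[OF lin])
   have "measure m ?T = measure m (?T Int E) + measure m (?T - E)"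
   proof -
   have "measure m ((?T Int E) \<union> (?T - E)) = measure m (?T Int E) + measure m (?T - E)"
   using TV EV by (intro finite_measure_Union) auto
   moreover have "(?T Int E) \<union> (?T - E) = ?T" by auto
   ultimately show ?thesis by simp
   qed
   hence mE: "(1 - et) * measure m ?T <= measure m (?T Int E)" using elim(1) by (simp add: algebra_simps)
   have "c * measure m ?T < q * (1 - et) * measure m ?T" using et(2) pos[OF elim(2)] by simp
   also have "... <= q * measure m (?T Int E)" using mE q0 by (simp add: mult.assoc)
   also have "... = (LINT y|m. indicator (?T Int E) y * q)" using TV EV by simp
   also have "... <= (LINT y|m. indicator ?T y * h y)"
   proof (rule integral_mono_AE)
   show "integrable m (%y. indicator (?T Int E) y * q)" using TV EV by (intro integrable_mult_left integrable_real_indicator) (auto simp: less_top[symmetric])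
   show "integrable m (%y. indicator ?T y * h y)" using integrable_mult_indicator[OF _ h(2), of ?T] TV by simp
   show "AE y in m. indicator (?T Int E) y * q <= indicator ?T y * h y"
   using h(3) by eventually_elim (auto simp: indicator_def E_def)
   qed
   also have "... = (LINT y|m. indicator ?T y * F y)" using eq[OF TV] by simp
   finally show ?case using pos[OF elim(2)] by (simp add: tavg_def pos_less_divide_eq)
   qed
   qed
  qed
 qed
qed

text \<open>\<open>tube_lower\<close> is applied to the nonnegative functions \<open>F + K\<close>
  and \<open>- F + K\<close>; the second application supplies the upper bound.\<close>

lemma tube_differentiation:
 fixes F h :: "real ^ 'd => real"
 assumes m: "finite_measure m" "sets m = sets borel" and F: "F \<in> bm borel" "!!x. \<bar>F x\<bar> <= K"
  and h: "h \<in> bm (VA pj)" "integrable m h"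
  and eq: "!!A. A \<in> sets (VA pj) ==> (LINT y|m. indicator A y * F y) = (LINT y|m. indicator A y * h y)"
 shows "AE x in m. ((%r. tavg pj m F x r) \<longlongrightarrow> h x) at0"
proof -
 interpret finite_measure m by fact
 have sub: "subalgebra m (VA pj)"
  using sets_eq_imp_space_eq[OF m(2)] VA_sub[OF lin] m(2) by (auto simp: subalgebra_def)
 interpret S: finite_measure_subalgebra m "VA pj" by unfold_locales (rule sub)
 have As [measurable]: "A \<in> sets m" if "A \<in> sets (VA pj)" for A using VA_sub[OF lin that] m by simp
 have [measurable]: "F \<in> bm m" using F m(2) by (simp cong: mcs)
 have Fi: "integrable m F" using F(2) by (intro integrable_const_bound[of _ K]) auto
 have ai: "integrable m (%y. indicator A y * g y)" if "A \<in> sets (VA pj)" "integrable m g" for A and g :: "real ^ 'd => real"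
  using integrable_mult_indicator[OF As[OF that(1)] that(2)] by simp
 have main: "AE x in m. ALL c<a * h x + K. eventually (%r. c < tavg pj m (%y. a * F y + K) x r) at0" if a: "\<bar>a\<bar> = 1" for a
 proof (rule tube_lower[OF m])
  show nn: "0 <= a * F x + K" for x using F(2)[of x] a by (auto simp: abs_if split: if_splits)
  show i: "integrable m (%y. a * F y + K)" using Fi by simp
  show hm: "(%x. a * h x + K) \<in> bm (VA pj)" using h(1) by measurable
  show ih: "integrable m (%x. a * h x + K)" using h(2) by simp
  show e: "(LINT y|m. indicator A y * (a * F y + K)) = (LINT y|m. indicator A y * (a * h y + K))" if A: "A \<in> sets (VA pj)" for A
  proof -
   have "(LINT y|m. indicator A y * (a * g y + K)) = a * (LINT y|m. indicator A y * g y) + (LINT y|m. indicator A y * K)"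
   if g: "integrable m g" for g :: "real ^ 'd => real"
   proof -
   have "(LINT y|m. indicator A y * (a * g y + K)) = (LINT y|m. a * (indicator A y * g y) + indicator A y * K)"
   by (simp add: algebra_simps)
   thus ?thesis using ai[OF A g] ai[OF A, of "%_. K"] by simp
   qed
   thus ?thesis using eq[OF A] Fi h(2) by simp
  qed
  have "AE x in m. real_cond_exp m (VA pj) (%y. a * F y + K) x = a * h x + K"
   using e by (intro S.real_cond_exp_charact i ih hm) (simp add: set_lebesgue_integral_def)
  moreover have "AE x in m. real_cond_exp m (VA pj) (%y. a * F y + K) x >= 0"
   using nn i by (intro S.real_cond_exp_pos) auto
  ultimately show "AE x in m. 0 <= a * h x + K" by eventually_elim simp
 qed
 have "AE x in m. ALL c<1 * h x + K. eventually (%r. c < tavg pj m (%y. 1 * F y + K) x r) at0"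
  "AE x in m. ALL c<(- 1) * h x + K. eventually (%r. c < tavg pj m (%y. (- 1) * F y + K) x r) at0"
  by (rule main, simp)+
 thus ?thesis using tube_positive_AE[OF lin m(2)]
 proof eventually_elim
  case (elim x)
  have pos: "measure m (tube pj x r) > 0" if "r > 0" for r
   using elim(3) that by (simp add: emeasure_eq_measure)
  have tv: "tavg pj m (%y. a * F y + K) x r = a * tavg pj m F x r + K" if "r > 0" for r a
  proof -
   let ?T = "tube pj x r"
   have "(LINT y|m. indicator ?T y * (a * F y + K)) = (LINT y|m. a * (indicator ?T y * F y) + K * indicator ?T y)"
   by (simp add: algebra_simps)
   also have "... = a * (LINT y|m. indicator ?T y * F y) + K * measure m ?T"
   using ai[OF tube_VA[OF lin] Fi, of x r] As[OF tube_VA[OF lin], of x r] by (simp add: less_top[symmetric])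
   finally show ?thesis using pos[OF that] by (simp add: tavg_def field_simps)
  qed
  have ev: "eventually (%r :: real. r > 0) at0" by (rule eventually_at_right_less)
  show ?case
  proof (rule order_tendstoI)
   fix a assume "a < h x"
   hence "eventually (%r. a + K < tavg pj m (%y. 1 * F y + K) x r) at0" using elim(1) by simp
   thus "eventually (%r. a < tavg pj m F x r) at0" using ev
   by eventually_elim (use tv[of _ 1] in simp)
  next
   fix a assume "h x < a"
   hence "eventually (%r. - a + K < tavg pj m (%y. - 1 * F y + K) x r) at0" using elim(2) by simp
   thus "eventually (%r. tavg pj m F x r < a) at0" using ev
   by eventually_elim (use tv[of _ "- 1"] in simp)
  qed
 qed
qed

end

section \<open>Disintegration of finite measures\<close>

lemma radon_eqI_nn:
 assumes "mu \<in> radon_on A" "nu \<in> radon_on B"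
  "!!f. f \<in> Cc ==> (!!x. f x >= 0) ==> (\<integral>\<^sup>+x. ennreal (f x) \<partial>mu) = (\<integral>\<^sup>+x. ennreal (f x) \<partial>nu)"
 shows "mu = (nu :: (real ^ 'd) measure)"
proof (rule radon_eqI[OF assms(1,2)])
 fix g :: "real ^ 'd => real" assume g: "g \<in> Cc"
 have p: "(%x. max 0 (g x)) \<in> Cc" "(%x. max 0 (- g x)) \<in> Cc"
  using g by (auto simp: Cc_iff intro!: continuous_on_max continuous_intros) (auto simp: max_def split: if_splits)
 have e: "ennreal (max 0 r) = ennreal r" for r by (simp add: max_def ennreal_neg)
 show "(LINT x|mu. g x) = (LINT x|nu. g x)"
  using assms(3)[OF p(1)] assms(3)[OF p(2)] unfolding e
  by (simp add: real_lebesgue_integral_def[OF Cc_integrable[OF assms(1) g]] real_lebesgue_integral_def[OF Cc_integrable[OF assms(2) g]])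
qed

lemma finite_radon:
 assumes "finite_measure m" "sets m = sets borel" shows "m \<in> radon_on UNIV"
 using assms finite_measure.emeasure_finite[OF assms(1)] by (auto simp: radon_on_def less_top[symmetric])

context
 fixes pj :: "real ^ 'd => real ^ 'k"
 assumes lin: "linear pj"
begin

lemma closed_fiber: "closed (fiber pj x)"
proof -
 have "closed (pj -` {pj x})"
  using linear_continuous_at[OF linear_conv_bounded_linear[THEN iffD1, OF lin]] by (intro continuous_closed_vimage) auto
 thus ?thesis by (simp add: fiber_def)
qed

lemma fiber_borel [measurable]: "fiber pj x \<in> sets borel"
 by (rule borel_closed[OF closed_fiber])

lemma fiber_qn: "y \<in> fiber pj x \<longleftrightarrow> qn pj (y - x) = 0"
proof
 assume "y \<in> fiber pj x"
 thus "qn pj (y - x) = 0"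
  using qn_le[OF lin, of "y - x" "y - x"] qn_nonneg[OF lin, of "y - x"] lin by (simp add: mem_fiber linear_diff)
next
 assume q: "qn pj (y - x) = 0"
 show "y \<in> fiber pj x"
 proof (rule ccontr)
  assume "y \<notin> fiber pj x"
  hence "y \<in> - fiber pj x" "open (- fiber pj x)" using closed_fiber by auto
  then obtain d where d: "d > 0" "ALL z. infnorm (z - y) < d --> z \<in> - fiber pj x" using open_infnorm_ball by blast
  obtain v where v: "pj v = 0" "infnorm (y - x - v) < d" using qn_less[OF lin, of "y - x" d] q d(1) by auto
  have "infnorm ((x + v) - y) < d" using v(2) infnorm_sub[of "x + v" y] by (simp add: algebra_simps)
  hence "x + v \<notin> fiber pj x" using d(2) by blast
  thus False using v(1) lin by (simp add: mem_fiber linear_add)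
 qed
qed

lemma fiber_support:
 assumes nu: "nu \<in> radon_on UNIV"
  and z: "!!f d. f \<in> Cc ==> d > 0 ==> (!!y. f y >= 0) ==> (!!y. y \<in> tube pj x d ==> f y = 0) ==> (LINT y|nu. f y) = 0"
 shows "nu \<in> radon_on (fiber pj x)"
proof -
 note [simp] = radon_sets[OF nu] radon_space[OF nu]
 \<comment> \<open>Each of these functions vanishes on a tube, as the hypothesis requires, and every
   point off the fiber has one of them positive.\<close>
 let ?f = "%n :: nat. %y. cut n y * max 0 (qn pj (y - x) - rs n)"
 have fC: "?f n \<in> Cc" for n
  by (intro Cc_mult cut_Cc continuous_intros continuous_on_compose2[OF qn_cont[OF lin]]) auto
 have "(LINT y|nu. ?f n y) = 0" for n
  by (rule z[OF fC, of "rs n"]) (auto simp: mem_tube[OF lin] max_def)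
 hence "AE y in nu. ?f n y = 0" for n
  using integral_nonneg_eq_0_iff_AE[OF Cc_integrable[OF nu fC], of n] by simp
 hence "AE y in nu. ALL n. ?f n y = 0" by (simp add: AE_all_countable)
 hence "AE y in nu. y \<in> fiber pj x"
 proof eventually_elim
  case (elim y)
  show ?case
  proof (rule ccontr)
   assume "y \<notin> fiber pj x"
   hence p: "qn pj (y - x) > 0" using fiber_qn[of y x] qn_nonneg[OF lin, of "y - x"] by linarith
   obtain n where n: "rs n < qn pj (y - x)" using nat_approx_posE[OF p] by blast
   obtain k :: nat where k: "infnorm y <= real k" using real_arch_simple by blast
   let ?j = "max n k"
   have "1 / real (Suc ?j) <= rs n" by (intro divide_left_mono) auto
   hence "qn pj (y - x) - 1 / real (Suc ?j) > 0" using n by linarith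
   moreover have "cut ?j y = 1" using k by (intro cut_eq1) auto
   ultimately have "?f ?j y > 0" by simp
   thus False using elim by (metis less_irrefl)
  qed
 qed
 hence "em nu (- fiber pj x) = 0"
  using AE_iff_measurable[of "- fiber pj x" nu "%y. y \<in> fiber pj x"] by auto
 thus ?thesis using nu by (simp add: radon_on_def)
qed

lemma tavg_uniform:
 assumes m: "finite_measure m" "sets m = sets borel" and f: "f \<in> bm borel"
 shows "(LINT y|uniform_measure m (tube pj x r). f y) = tavg pj m f x r"
 unfolding tavg_def
 using finite_measure.emeasure_finite[OF m(1), of "tube pj x r"] m f tube_borel[OF lin]
 by (intro integral_uniform_measure) (auto simp: less_top[symmetric] cong: mcs)

text \<open>A vague limit can lose mass at infinity, so only the bound by 1 is obtained for the
  individual \<open>x\<close>. That no mass is lost for almost every \<open>x\<close> comes out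
  later by integrating.\<close>

lemma tavg_limit_measure:
 assumes m: "finite_measure m" "sets m = sets borel"
  and l: "!!g. g \<in> Dc ==> EX l. ((%r. tavg pj m g x r) \<longlongrightarrow> l) at0"
 shows "EX nu. nu \<in> radon_on (fiber pj x) & em nu UNIV <= 1 & (ALL f:Cc. ((%r. tavg pj m f x r) \<longlongrightarrow> (LINT y|nu. f y)) at0)"
proof -
 interpret finite_measure m by fact
 have t: "(LINT y|uniform_measure m (tube pj x r). f y) = tavg pj m f x r" if "f \<in> Cc" for f r
  by (rule tavg_uniform[OF m Cc_borel[OF that]])
 obtain nu where nu: "nu \<in> radon_on UNIV" "ALL f:Cc. ((%r. \<integral>y. f y \<partial>uniform_measure m (tube pj x r)) \<longlongrightarrow> (LINT y|nu. f y)) at0"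
 proof (rule vague_limit_exists)
  show "uniform_measure m (tube pj x e) \<in> radon_on UNIV" for e
   by (rule uniform_measure_radon[OF m(2) tube_borel[OF lin]])
  show "EX l. ((%r. \<integral>y. g y \<partial>uniform_measure m (tube pj x r)) \<longlongrightarrow> l) at0" if "g \<in> Dc" for g
   using l[OF that] t[OF Dc_Cc[OF that]] by simp
 qed blast
 have lim: "((%r. tavg pj m f x r) \<longlongrightarrow> (LINT y|nu. f y)) at0" if "f \<in> Cc" for f
  using nu(2)[rule_format, OF that] unfolding t[OF that] .
 have "nu \<in> radon_on (fiber pj x)"
 proof (rule fiber_support[OF nu(1)])
  fix f and d :: real assume f: "f \<in> Cc" "d > 0" "!!y. y \<in> tube pj x d ==> f y = 0"
  have "tavg pj m f x r = 0" if "r < d" for r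
  proof -
   have "tI pj x r y * f y = 0" for y
   using f(3)[of y] tube_mono[OF lin, of r d x] that by (auto simp: indicator_def)
   hence "(%y. tI pj x r y * f y) = (%_. 0)" by (intro ext)
   thus ?thesis unfolding tavg_def by (simp only: integral_zero div_0)
  qed
  hence "eventually (%r. tavg pj m f x r = 0) at0"
   using f(2) unfolding eventually_at_right_field by auto
  hence "((%r. tavg pj m f x r) \<longlongrightarrow> 0) at0" by (rule tendsto_eventually)
  thus "(LINT y|nu. f y) = 0" using tendsto_unique[OF _ lim[OF f(1)]] by simp
 qed
 moreover have "em nu UNIV <= 1"
 proof -
  have "em nu (cb N) <= 1" for N
  proof -
   have i: "integrable m (%y. tI pj x r y * g y)" if "integrable m g" for g :: "real ^ 'd => real" and r
   using integrable_mult_indicator[of "tube pj x r" m g] tube_borel[OF lin] m(2) that by simp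
   have "tavg pj m (cut N) x r <= 1" for r
   proof -
   have "(LINT y|m. tI pj x r y * cut N y) <= (LINT y|m. tI pj x r y * 1)"
   using i[OF Cc_integrable[OF finite_radon[OF m] cut_Cc]] i[of "%_. 1"]
   by (intro integral_mono) (auto simp: indicator_def)
   hence "(LINT y|m. tI pj x r y * cut N y) <= measure m (tube pj x r)"
   using tube_borel[OF lin] m(2) by simp
   thus ?thesis unfolding tavg_def using measure_nonneg[of m "tube pj x r"]
   by (cases "measure m (tube pj x r) = 0") (auto simp: divide_le_eq)
   qed
   hence le: "(LINT y|nu. cut N y) <= 1" by (intro tendsto_upperbound[OF lim[OF cut_Cc]]) auto
   have [simp]: "sets nu = sets borel" by (rule radon_sets[OF nu(1)])
   have "measure nu (cb N) = (LINT y|nu. indicator (cb N) y)" by simp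
   also have "... <= (LINT y|nu. cut N y)"
   using radon_ball[OF nu(1), of "real N" 0]
   by (intro integral_mono integrable_real_indicator Cc_integrable[OF nu(1) cut_Cc]) (auto simp: indicator_def mem_sup_cball cut_eq1)
   finally have "measure nu (cb N) <= 1" using le by linarith
   thus ?thesis using radon_ball[OF nu(1), of "real N" 0] by (simp add: emeasure_eq_ennreal_measure less_top[symmetric])
  qed
  thus ?thesis using radon_SUP_ball[OF nu(1), of UNIV] by (simp add: SUP_le_iff)
 qed
 ultimately show ?thesis using lim by blast
qed

lemma tavg_measurable:
 assumes m: "finite_measure m" "sets m = sets borel" and F [measurable]: "F \<in> bm borel"
 shows "(%x. tavg pj m F x r) \<in> bm borel"
proof -
 interpret finite_measure m by fact
 have "{(x, y). y \<in> tube pj x r} \<in> sets (borel \<Otimes>\<^sub>M borel)"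
  unfolding borel_prod by (rule borel_open[OF tube_rel_open[OF lin]])
 hence [measurable]: "{(x, y). y \<in> tube pj x r} \<in> sets (borel \<Otimes>\<^sub>M m)"
  by (subst sets_pair_measure_cong[OF refl m(2)])
 have [measurable]: "F \<in> bm m" using m(2) by (simp cong: mcs)
 have "(%x. \<integral>y. indicator {(x, y). y \<in> tube pj x r} (x, y) * F y \<partial>m) \<in> bm borel"
  by measurable
 also have "(%x. \<integral>y. indicator {(x, y). y \<in> tube pj x r} (x, y) * F y \<partial>m) = (%x. \<integral>y. tI pj x r y * F y \<partial>m)"
  by (intro ext Bochner_Integration.integral_cong) (auto simp: indicator_def)
 finally have "(%x. \<integral>y. tI pj x r y * F y \<partial>m) \<in> bm borel" .
 moreover have "(%x. measure m (tube pj x r)) \<in> bm borel"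
  unfolding measure_def using emeasure_tube_measurable[OF lin m] by measurable
 ultimately show ?thesis unfolding tavg_def by measurable
qed

text \<open>The kernel is the tube limit itself. Differentiation identifies its integrals of test
  functions with conditional expectations, and the disintegration formula becomes an equality of two
  finite measures that is tested on such functions.\<close>

theorem disintegration:
 assumes m: "finite_measure m" "sets m = sets borel"
 shows "EX ka. ka \<in> VA pj \<rightarrow>\<^sub>M prob_algebra borel & (AE x in m. em (ka x) (fiber pj x) = 1) &
  (ALL A:sets (VA pj). ALL X:sets borel. (\<integral>\<^sup>+x. indicator A x * em (ka x) X \<partial>m) = em m (A Int X))"
proof -
 interpret finite_measure m by fact
 note mr = finite_radon[OF m]
 have sp: "space m = UNIV" using sets_eq_imp_space_eq[OF m(2)] by simp
 have sub: "subalgebra m (VA pj)" using sp VA_sub[OF lin] m(2) by (auto simp: subalgebra_def)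
 interpret S: finite_measure_subalgebra m "VA pj" by unfold_locales (rule sub)
 have idm: "u \<in> m \<rightarrow>\<^sub>M N" if "u \<in> VA pj \<rightarrow>\<^sub>M N" for u N
  using VA_borel_measurable[OF lin that] m(2) by (simp cong: mcs)
 \<comment> \<open>The domain of the limit is a Borel union of fibers; off it the kernel gets the
   zero measure, which keeps it measurable with respect to \<open>VA pj\<close>.\<close>
 define C where "C = {x. ALL g:Dc. EX l. ((%r. tavg pj m g x r) \<longlongrightarrow> l) at0}"
 have tinv: "tavg pj m g x = tavg pj m g y" if "pj x = pj y" for g x y
  using tube_cong[OF lin that] by (simp add: tavg_def fun_eq_iff)
 have CV: "C \<in> sets (VA pj)"
 proof (rule VA_set[OF lin])
  have "C = (\<Inter>g\<in>Dc. {x\<in>space borel. EX l. ((%r. tavg pj m g x r) \<longlongrightarrow> l) at0})" by (auto simp: C_def)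
  also have "... \<in> sets borel"
  proof (rule sets.countable_INT''[OF _ countable_Dc])
   fix g :: "real ^ 'd => real" assume "g \<in> Dc"
   thus "{x\<in>space borel. EX l. ((%r. tavg pj m g x r) \<longlongrightarrow> l) at0} \<in> sets borel"
   by (intro lim_at_right_measurable tavg_measurable[OF m] tavg_left[OF lin m] Cc_borel Cc_integrable[OF mr] Dc_Cc)
  qed simp
  finally show "C \<in> sets borel" .
  show "x \<in> C \<longleftrightarrow> y \<in> C" if "pj x = pj y" for x y using tinv[OF that] by (simp add: C_def)
 qed
 have ce: "AE x in m. ((%r. tavg pj m g x r) \<longlongrightarrow> real_cond_exp m (VA pj) g x) at0" if g: "g \<in> Cc" for g
 proof -
  obtain K where K: "!!x. \<bar>g x\<bar> <= K" using Cc_bounded[OF g] by blast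
  have gi: "integrable m g" by (rule Cc_integrable[OF mr g])
  show ?thesis
  proof (rule tube_differentiation[OF lin m Cc_borel[OF g] K])
   show "real_cond_exp m (VA pj) g \<in> bm (VA pj)" by simp
   show "integrable m (real_cond_exp m (VA pj) g)" by (rule S.real_cond_exp_int(1)[OF gi])
   show "(LINT y|m. indicator A y * g y) = (LINT y|m. indicator A y * real_cond_exp m (VA pj) g y)" if "A \<in> sets (VA pj)" for A
   using S.real_cond_exp_intA[OF gi that] by (simp add: set_lebesgue_integral_def)
  qed
 qed
 have CAE: "AE x in m. x \<in> C"
 proof -
  have "AE x in m. ALL g:Dc. ((%r. tavg pj m g x r) \<longlongrightarrow> real_cond_exp m (VA pj) g x) at0"
   using ce[OF Dc_Cc] by (subst AE_ball_countable[OF countable_Dc]) blast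
  thus ?thesis by eventually_elim (auto simp: C_def)
 qed
 define Q where "Q x nu \<longleftrightarrow> nu \<in> radon_on (fiber pj x) & em nu UNIV <= 1 & (ALL f:Cc. ((%r. tavg pj m f x r) \<longlongrightarrow> (LINT y|nu. f y)) at0)" for x nu
 define k0 where "k0 x = (if x \<in> C then SOME nu. Q x nu else null_measure borel)" for x
 have Qk: "Q x (k0 x)" if "x \<in> C" for x
 proof -
  have "EX nu. Q x nu" unfolding Q_def using that by (intro tavg_limit_measure[OF m]) (auto simp: C_def)
  thus ?thesis using that unfolding k0_def by (simp add: someI_ex)
 qed
 have nr: "null_measure borel \<in> radon_on A" for A :: "(real ^ 'd) set" by (simp add: radon_on_def)
 have k0r: "k0 x \<in> radon_on UNIV" "em (k0 x) UNIV <= 1" for x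
  using Qk[of x] radon_UNIV nr[of UNIV] by (cases "x \<in> C"; force simp: Q_def k0_def)+
 have k0lim: "(%n. tavg pj m f x (rs n)) \<longlonglongrightarrow> (LINT y|k0 x. f y)" if "x \<in> C" "f \<in> Cc" for x f
  using Qk[OF that(1)] that(2) unfolding Q_def by (intro filterlim_compose[OF _ inverse_Suc_at_right]) blast
 have k0m: "k0 \<in> VA pj \<rightarrow>\<^sub>M radon_borel UNIV"
 proof (rule measurable_radon_borelI[OF k0r(1)])
  fix f :: "real ^ 'd => real" assume f: "f \<in> Cc"
  have tm [measurable]: "(%x. tavg pj m f x r) \<in> bm (VA pj)" for r
   using tinv by (intro VA_measurable[OF lin] tavg_measurable[OF m Cc_borel[OF f]]) metis
  have "(%x. \<integral>y. f y \<partial>k0 x) \<in> bm (VA pj)"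
  proof (rule borel_measurable_LIMSEQ_real)
   show "(%x. if x \<in> C then tavg pj m f x (rs n) else 0) \<in> bm (VA pj)" for n
   using CV by measurable
   show "(%n. if x \<in> C then tavg pj m f x (rs n) else 0) \<longlonglongrightarrow> (LINT y|k0 x. f y)" for x
   proof (cases "x \<in> C")
   case True thus ?thesis using k0lim[OF True f] by simp
   next
   case False
   have "AE y in null_measure borel. f y = 0" by (rule AE_I[of _ _ UNIV]) auto
   hence "(LINT y|k0 x. f y) = 0" using False unfolding k0_def by (simp add: integral_eq_zero_AE)
   thus ?thesis using False by simp
   qed
  qed
  thus "(%x. \<integral>y. f y \<partial>k0 x) \<in> bm (VA pj)" .
 qed
 have k0sp: "subprob_space (k0 x)" for x
  using k0r[of x] radon_space[OF k0r(1)] by (intro subprob_spaceI) auto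
 have k0s: "k0 \<in> VA pj \<rightarrow>\<^sub>M subprob_algebra borel"
  by (rule measurable_subprob_algebra) (auto intro!: k0sp radon_sets[OF k0r(1)] measurable_emeasure_radon[OF k0m])
 have k0int: "AE x in m. (LINT y|k0 x. f y) = real_cond_exp m (VA pj) f x" if f: "f \<in> Cc" for f
  using ce[OF f] CAE
 proof eventually_elim
  case (elim x)
  thus ?case using Qk[of x] f unfolding Q_def by (intro tendsto_unique[OF _ _ elim(1)]) auto
 qed
 have main: "(\<integral>\<^sup>+x. indicator A x * em (k0 x) X \<partial>m) = em m (A Int X)" if A: "A \<in> sets (VA pj)" and X: "X \<in> sets borel" for A X
 proof -
  have Am [measurable]: "A \<in> sets m" using VA_sub[OF lin A] m(2) by simp
  \<comment> \<open>Weighting \<open>m\<close> by \<open>A\<close> first lets the formula for all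
    \<open>X\<close> be read as the single equality \<open>?M \<bind> k0 = ?M\<close>.\<close>
  let ?M = "density m (indicator A)"
  have sM: "sets ?M = sets borel" using m(2) by simp
  have spM: "space ?M ~= {}" using sp by simp
  have k0M: "k0 \<in> ?M \<rightarrow>\<^sub>M subprob_algebra borel" using idm[OF k0s] by (simp cong: mcs)
  let ?B = "?M \<bind> k0"
  have sB: "sets ?B = sets borel" by (rule sets_bind[OF _ spM]) (use sets_kernel[OF k0M] in auto)
  have emB: "em ?B Y = (\<integral>\<^sup>+x. indicator A x * em (k0 x) Y \<partial>m)" if "Y \<in> sets borel" for Y
  proof -
   have [measurable]: "(%x. em (k0 x) Y) \<in> bm m" by (rule idm[OF measurable_emeasure_radon[OF k0m that]])
   have "em ?B Y = (\<integral>\<^sup>+x. em (k0 x) Y \<partial>?M)" by (rule emeasure_bind[OF spM k0M that])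
   thus ?thesis by (simp add: nn_integral_density)
  qed
  have "?B = ?M"
  proof (rule radon_eqI_nn)
   have fM: "finite_measure ?M"
   proof
   show "em ?M (space ?M) ~= \<infinity>" using emeasure_finite[of "A Int space m"] by (simp add: emeasure_restricted)
   qed
   show "?M \<in> radon_on UNIV" by (rule finite_radon[OF fM sM])
   have "finite_measure ?B"
   proof
   have "indicator A x * em (k0 x) UNIV <= 1" for x using k0r(2)[of x] by (cases "x \<in> A") auto
   hence "em ?B UNIV <= (\<integral>\<^sup>+x. 1 \<partial>m)"
   proof -
   have "(UNIV :: (real ^ 'd) set) \<in> sets borel" by simp
   note e = emB[OF this]
   assume "!!x. indicator A x * em (k0 x) UNIV <= 1"
   thus ?thesis unfolding e by (intro nn_integral_mono)
   qed
   also have "... < \<top>" using emeasure_finite[of "space m"] by (simp add: less_top[symmetric])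
   finally show "em ?B (space ?B) ~= \<infinity>" using sets_eq_imp_space_eq[OF sB] by (simp add: less_top[symmetric])
   qed
   thus "?B \<in> radon_on UNIV" using sB by (rule finite_radon)
   fix f :: "real ^ 'd => real" assume f: "f \<in> Cc" "!!x. f x >= 0"
   have fb: "(%x. ennreal (f x)) \<in> bm borel" using Cc_borel[OF f(1)] by measurable
   have fi: "integrable m f" by (rule Cc_integrable[OF mr f(1)])
   have ri: "integrable m (real_cond_exp m (VA pj) f)" by (rule S.real_cond_exp_int(1)[OF fi])
   have ii: "integrable m (%y. indicator A y * g y)" if "integrable m g" for g :: "real ^ 'd => real"
   using integrable_mult_indicator[OF Am that] by simp
   have fm: "(%x. ennreal (f x)) \<in> bm m" using fb m(2) by (simp cong: mcs)
   have km: "(%x. \<integral>\<^sup>+y. ennreal (f y) \<partial>k0 x) \<in> bm m"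
   by (rule idm, rule nn_integral_radon_kernel[OF _ k0m]) (use fb in measurable)
   have "(\<integral>\<^sup>+x. ennreal (f x) \<partial>?B) = (\<integral>\<^sup>+x. \<integral>\<^sup>+y. ennreal (f y) \<partial>k0 x \<partial>?M)"
   by (rule nn_integral_bind[OF fb k0M])
   also have "... = (\<integral>\<^sup>+x. indicator A x * (\<integral>\<^sup>+y. ennreal (f y) \<partial>k0 x) \<partial>m)"
   using km by (simp add: nn_integral_density)
   also have "... = (\<integral>\<^sup>+x. indicator A x * ennreal (real_cond_exp m (VA pj) f x) \<partial>m)"
   using k0int[OF f(1)]
   by (intro nn_integral_cong_AE) (auto elim!: eventually_mono simp: nn_integral_eq_integral[OF Cc_integrable[OF k0r(1) f(1)]] f(2))
   also have "... = (\<integral>\<^sup>+x. ennreal (indicator A x * real_cond_exp m (VA pj) f x) \<partial>m)"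
   by (intro nn_integral_cong) (auto simp: indicator_def)
   also have "... = ennreal (LINT x|m. indicator A x * real_cond_exp m (VA pj) f x)"
   proof (rule nn_integral_eq_integral[OF ii[OF ri]])
   have "AE x in m. real_cond_exp m (VA pj) f x >= 0" using f(2) fi by (intro S.real_cond_exp_pos) auto
   thus "AE x in m. 0 <= indicator A x * real_cond_exp m (VA pj) f x" by eventually_elim simp
   qed
   also have "(LINT x|m. indicator A x * real_cond_exp m (VA pj) f x) = (LINT x|m. indicator A x * f x)"
   using S.real_cond_exp_intA[OF fi A] by (simp add: set_lebesgue_integral_def)
   also have "ennreal (LINT x|m. indicator A x * f x) = (\<integral>\<^sup>+x. ennreal (indicator A x * f x) \<partial>m)"
   using f(2) by (intro nn_integral_eq_integral[OF ii[OF fi], symmetric]) auto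
   also have "... = (\<integral>\<^sup>+x. indicator A x * ennreal (f x) \<partial>m)"
   by (intro nn_integral_cong) (auto simp: indicator_def)
   also have "... = (\<integral>\<^sup>+x. ennreal (f x) \<partial>?M)" using fm by (simp add: nn_integral_density)
   finally show "(\<integral>\<^sup>+x. ennreal (f x) \<partial>?B) = (\<integral>\<^sup>+x. ennreal (f x) \<partial>?M)" .
  qed
  hence "em ?B X = em ?M X" by simp
  thus ?thesis using emB[OF X] X m(2) emeasure_restricted[OF Am, of X] by simp
 qed
 \<comment> \<open>The masses are at most 1 and integrate to the full mass of \<open>m\<close>, so
   the defect vanishes almost everywhere.\<close>
 have one: "AE x in m. em (k0 x) UNIV = 1"
 proof -
  have [measurable]: "(%x. em (k0 x) UNIV) \<in> bm m" by (rule idm[OF measurable_emeasure_radon[OF k0m]]) simp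
  have "(\<integral>\<^sup>+x. em (k0 x) UNIV \<partial>m) = em m UNIV"
   using main[of UNIV UNIV] VA_set[OF lin, of UNIV] by simp
  moreover have "(\<integral>\<^sup>+x. 1 - em (k0 x) UNIV \<partial>m) = (\<integral>\<^sup>+x. 1 \<partial>m) - (\<integral>\<^sup>+x. em (k0 x) UNIV \<partial>m)"
   using k0r(2) emeasure_finite[of UNIV] calculation by (intro nn_integral_diff) auto
  ultimately have "(\<integral>\<^sup>+x. 1 - em (k0 x) UNIV \<partial>m) = 0" using sp emeasure_finite[of UNIV] by simp
  hence "AE x in m. 1 - em (k0 x) UNIV = 0" by (subst (asm) nn_integral_0_iff_AE) measurable
  thus ?thesis
  proof eventually_elim
   case (elim x)
   hence "1 <= em (k0 x) UNIV" by (simp add: diff_eq_0_iff_ennreal)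
   thus ?case using k0r(2)[of x] by (rule antisym[rotated])
  qed
 qed
 \<comment> \<open>A probability measure is required for every \<open>x\<close>, hence the Dirac
   measure on the exceptional set.\<close>
 define ka where "ka x = (if em (k0 x) UNIV = 1 then k0 x else return borel 0)" for x
 have kas: "sets (ka x) = sets borel" for x using radon_sets[OF k0r(1)] by (simp add: ka_def)
 have "ka \<in> VA pj \<rightarrow>\<^sub>M prob_algebra borel"
 proof (rule measurable_prob_algebraI)
  show "prob_space (ka x)" for x
   using radon_space[OF k0r(1)] by (auto simp: ka_def intro!: prob_spaceI prob_space_return)
  have "(%x. em (k0 x) UNIV) \<in> bm (VA pj)" by (rule measurable_emeasure_radon[OF k0m]) simp
  hence P: "{x\<in>space (VA pj). em (k0 x) UNIV = 1} \<in> sets (VA pj)" by measurable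
  have "return borel (0 :: real ^ 'd) \<in> space (subprob_algebra borel)"
   using prob_space_return[of 0 "borel :: (real ^ 'd) measure"] by (simp add: space_subprob_algebra prob_space_imp_subprob_space)
  thus "ka \<in> VA pj \<rightarrow>\<^sub>M subprob_algebra borel"
   unfolding ka_def by (intro measurable_If[OF k0s measurable_const P])
 qed
 moreover have "AE x in m. em (ka x) (fiber pj x) = 1"
  using one CAE
 proof eventually_elim
  case (elim x)
  have r: "k0 x \<in> radon_on (fiber pj x)" using Qk[OF elim(2)] by (simp add: Q_def)
  have "em (k0 x) (fiber pj x \<union> - fiber pj x) = em (k0 x) (fiber pj x)"
   using r radon_sets[OF r] by (intro emeasure_Un_null_set) (auto simp: radon_on_def null_sets_def)
  thus ?case using elim(1) by (simp add: ka_def)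
 qed
 moreover have "(\<integral>\<^sup>+x. indicator A x * em (ka x) X \<partial>m) = em m (A Int X)" if "A \<in> sets (VA pj)" "X \<in> sets borel" for A X
  using main[OF that] one by (subst nn_integral_cong_AE[where v="%x. indicator A x * em (k0 x) X"]) (auto elim!: eventually_mono simp: ka_def)
 ultimately show ?thesis by blast
qed

end

section \<open>Conditional measures of Radon measures\<close>

text \<open>\<open>mw mu\<close> is a finite measure equivalent to \<open>mu\<close>. Its disintegration \<open>kap\<close> gives the conditional measures \<open>fm\<close> of \<open>mu\<close> after removal of the weight.\<close>

definition wt :: "(real ^ 'd) measure => real ^ 'd => real" where
 "wt mu x = (1 / 2) ^ nat \<lceil>infnorm x\<rceil> / (1 + measure mu (sup_cball (real (nat \<lceil>infnorm x\<rceil>)) 0))"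

definition mw :: "(real ^ 'd) measure => (real ^ 'd) measure" where
 "mw mu = density mu (%x. ennreal (wt mu x))"

definition kap :: "(real ^ 'd => real ^ 'k) => (real ^ 'd) measure => real ^ 'd => (real ^ 'd) measure" where
 "kap pj mu = (SOME ka. ka \<in> VA pj \<rightarrow>\<^sub>M prob_algebra borel & (AE x in mw mu. em (ka x) (fiber pj x) = 1) &
  (ALL A:sets (VA pj). ALL X:sets borel. (\<integral>\<^sup>+x. indicator A x * em (ka x) X \<partial>mw mu) = em (mw mu) (A Int X)))"

definition fm :: "(real ^ 'd => real ^ 'k) => (real ^ 'd) measure => real ^ 'd => (real ^ 'd) measure" where
 "fm pj mu x = density (kap pj mu x) (%y. ennreal (1 / wt mu y))"

text \<open>The support condition excludes the zero measure, which would otherwise arise as a limit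
  for rapidly decaying \<open>c\<close>, and thereby makes the limit unique up to a scalar.\<close>

definition fconv :: "(real ^ 'd => real ^ 'k) => (real ^ 'd) measure => real ^ 'd => (real ^ 'd) measure => bool" where
 "fconv pj mu x nu \<longleftrightarrow> nu \<in> radon_on (fiber pj x) & x \<in> msupp nu &
  (EX c. (ALL r>0. c r > (0 :: real)) &
   (ALL f:Cc. ((%r. c r * (LINT y|mu. tI pj x r y * f y)) \<longlongrightarrow> (LINT y|nu. f y)) at0))"

lemma wt_borel [measurable]: "wt mu \<in> bm borel"
proof -
 have m: "(%x :: real ^ 'a. nat \<lceil>infnorm x\<rceil>) \<in> borel \<rightarrow>\<^sub>M count_space UNIV" by measurable
 have "(%n. (1 / 2) ^ n / (1 + measure mu (cb n))) \<in> count_space UNIV \<rightarrow>\<^sub>M (borel :: real measure)" by simp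
 from measurable_compose[OF m this] show ?thesis unfolding wt_def[abs_def] .
qed

lemma wt_pos [simp]: "wt mu x > 0"
 unfolding wt_def by (intro divide_pos_pos add_pos_nonneg) auto

lemma wt_inverse_bound:
 assumes "mu \<in> radon_on A" "infnorm x <= real N"
 shows "1 / wt mu x <= 2 ^ N * (1 + measure mu (cb N))"
proof -
 let ?n = "nat \<lceil>infnorm x\<rceil>"
 have n: "?n <= N" using assms(2) by (simp add: ceiling_le_iff)
 have "measure mu (sup_cball (real ?n) 0) <= measure mu (cb N)"
  using radon_ball[OF assms(1), of "real N" 0] n radon_sets[OF assms(1)]
  by (intro measure_mono_fmeasurable sup_cball_mono) (auto simp: fmeasurable_def)
 moreover have "(2 :: real) ^ ?n <= 2 ^ N" using n by (intro power_increasing) auto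
 ultimately have "2 ^ ?n * (1 + measure mu (sup_cball (real ?n) 0)) <= 2 ^ N * (1 + measure mu (cb N))"
  by (intro mult_mono) auto
 thus ?thesis unfolding wt_def by (simp add: power_one_over)
qed

lemma mw_sets: "mu \<in> radon_on A ==> sets (mw mu) = sets borel"
 using radon_sets by (auto simp: mw_def)

text \<open>Where the rounded norm is \<open>n\<close>, the weight is \<open>(1 / 2) ^ n\<close>
  divided by more than the mass of the ball of radius \<open>n\<close>, so this shell contributes at
  most \<open>(1 / 2) ^ n\<close>.\<close>

lemma mw_finite:
 assumes mu: "mu \<in> radon_on A" shows "finite_measure (mw mu)"
proof
 note [simp] = radon_sets[OF mu] radon_space[OF mu]
 let ?a = "%n. (1 / 2) ^ n / (1 + measure mu (cb n))"
 let ?B = "%n. sup_cball (real n) (0 :: real ^ 'a)"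
 have a0: "?a n >= 0" for n by simp
 have [measurable]: "wt mu \<in> bm mu" using wt_borel[of mu] by (simp cong: mcs)
 have [measurable]: "?B n \<in> sets mu" for n by simp
 have "em (mw mu) (space (mw mu)) = (\<integral>\<^sup>+x. ennreal (wt mu x) \<partial>mu)"
  unfolding mw_def by (subst emeasure_density) auto
 also have "... <= (\<integral>\<^sup>+x. (\<Sum>n. ennreal (?a n) * indicator (?B n) x) \<partial>mu)"
 proof (rule nn_integral_mono)
  fix x :: "real ^ 'a"
  let ?n = "nat \<lceil>infnorm x\<rceil>"
  have "infnorm x <= real ?n" by (rule real_nat_ceiling_ge)
  hence e: "ennreal (wt mu x) = ennreal (?a ?n) * indicator (?B ?n) x" by (simp add: wt_def mem_sup_cball)
  have gs: "g k <= (\<Sum>n. g n)" for g :: "nat => ennreal" and k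
   using sum_le_suminf[of g "{k}"] by simp
  note e
  also have "ennreal (?a ?n) * indicator (?B ?n) x <= (\<Sum>n. ennreal (?a n) * indicator (?B n) x)"
   by (rule gs[of "%n. ennreal (?a n) * indicator (?B n) x"])
  finally show "ennreal (wt mu x) <= (\<Sum>n. ennreal (?a n) * indicator (?B n) x)" .
 qed
 also have "... = (\<Sum>n. \<integral>\<^sup>+x. ennreal (?a n) * indicator (?B n) x \<partial>mu)"
  by (rule nn_integral_suminf) measurable
 also have "... <= (\<Sum>n. ennreal ((1 / 2) ^ n))"
 proof (rule suminf_le)
  fix n
  have "(\<integral>\<^sup>+x. ennreal (?a n) * indicator (?B n) x \<partial>mu) = ennreal (?a n) * em mu (?B n)"
   by (subst nn_integral_cmult_indicator) auto
  also have "... = ennreal (?a n * measure mu (?B n))"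
   using radon_ball[OF mu, of "real n" 0] unfolding ennreal_mult[OF a0 measure_nonneg]
   using emeasure_eq_ennreal_measure[of mu "?B n"] by (simp add: less_top[symmetric])
  also have "?a n * measure mu (?B n) <= (1 / 2) ^ n"
  proof -
   have p: "1 + measure mu (?B n) > 0" by (intro add_pos_nonneg) auto
   have "(1 / 2 :: real) ^ n * measure mu (?B n) <= (1 / 2) ^ n * (1 + measure mu (?B n))" by (intro mult_left_mono) auto
   thus ?thesis using p by (simp add: divide_le_eq)
  qed
  finally show "(\<integral>\<^sup>+x. ennreal (?a n) * indicator (?B n) x \<partial>mu) <= ennreal ((1 / 2) ^ n)" by (simp add: ennreal_leI)
 qed auto
 also have "... = ennreal (\<Sum>n. (1 / 2) ^ n)" by (rule suminf_ennreal2) (auto simp: summable_geometric)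
 also have "... < \<infinity>" by simp
 finally show "em (mw mu) (space (mw mu)) ~= \<infinity>" by simp
qed

lemma mw_AE: assumes "mu \<in> radon_on A" shows "(AE x in mw mu. P x) \<longleftrightarrow> (AE x in mu. P x)"
 using wt_borel[of mu] radon_sets[OF assms] unfolding mw_def
 by (subst AE_density) (auto cong: mcs)

text \<open>Quotients by the integral of one bump function around \<open>x\<close> eliminate the
  constants; the support condition makes that integral positive.\<close>

lemma fconv_unique:
 assumes "fconv pj mu x nu" "fconv pj mu x nu'" shows "proportional nu nu'"
proof -
 obtain c where r: "nu \<in> radon_on (fiber pj x)" "x \<in> msupp nu" and c: "!!r. r > 0 ==> c r > 0"
  "!!f. f \<in> Cc ==> ((%r. c r * (LINT y|mu. tI pj x r y * f y)) \<longlongrightarrow> (LINT y|nu. f y)) at0"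
  using assms(1) unfolding fconv_def by blast
 obtain c' where r': "nu' \<in> radon_on (fiber pj x)" "x \<in> msupp nu'" and c': "!!r. r > 0 ==> c' r > 0"
  "!!f. f \<in> Cc ==> ((%r. c' r * (LINT y|mu. tI pj x r y * f y)) \<longlongrightarrow> (LINT y|nu'. f y)) at0"
  using assms(2) unfolding fconv_def by blast
 let ?I = "%f r. \<integral>y. tI pj x r y * f y \<partial>mu"
 define t where "t = (%y. tent 1 (y - x))"
 have t: "t \<in> Cc" using Cc_comp_affine[OF tent_Cc[of 1], of 1 "- x"] by (simp add: t_def)
 have pos: "(LINT y|\<sigma>. t y) > 0" if s: "\<sigma> \<in> radon_on (fiber pj x)" "x \<in> msupp \<sigma>" for \<sigma>
 proof (rule ccontr)
  assume "\<not> (LINT y|\<sigma>. t y) > 0"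
  moreover have "(LINT y|\<sigma>. t y) >= 0" by (rule Bochner_Integration.integral_nonneg) (simp add: t_def)
  ultimately have "(LINT y|\<sigma>. t y) = 0" by simp
  hence AE: "AE y in \<sigma>. t y = 0"
   using integral_nonneg_eq_0_iff_AE[OF Cc_integrable[OF s(1) t]] by (simp add: t_def)
  have o: "open {y. t y > 0}" by (intro open_Collect_less continuous_intros Cc_cont t)
  have "em \<sigma> {y. t y > 0} = 0"
  proof -
   have "em \<sigma> {y\<in>space \<sigma>. \<not> t y = 0} = 0"
   using AE_E2[OF AE] Cc_borel[OF t] radon_sets[OF s(1)] by (simp add: pred_def cong: mcs)
   moreover have "{y. t y > 0} = {y\<in>space \<sigma>. \<not> t y = 0}"
   using radon_space[OF s(1)] tent_nonneg[of 1] unfolding t_def by (auto simp: less_le)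
   ultimately show ?thesis by simp
  qed
  moreover have "x \<in> {y. t y > 0}" by (simp add: t_def tent_pos)
  ultimately show False using s(2) o unfolding msupp_def by (metis (mono_tags, lifting) less_irrefl mem_Collect_eq)
 qed
 note p = pos[OF r] and p' = pos[OF r']
 let ?q = "(LINT y|nu. t y) / (LINT y|nu'. t y)"
 have q: "?q > 0" using p p' by simp
 have lim: "((%r. ?I f r / ?I t r) \<longlongrightarrow> (LINT y|\<sigma>. f y) / (LINT y|\<sigma>. t y)) at0"
  if f: "f \<in> Cc" and cc: "!!r. r > 0 ==> d r > 0"
  "!!f. f \<in> Cc ==> ((%r. d r * ?I f r) \<longlongrightarrow> (LINT y|\<sigma>. f y)) at0" and ps: "(LINT y|\<sigma>. t y) > 0" for f d \<sigma>
 proof -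
  have "((%r. (d r * ?I f r) / (d r * ?I t r)) \<longlongrightarrow> (LINT y|\<sigma>. f y) / (LINT y|\<sigma>. t y)) at0"
   using ps by (intro tendsto_divide cc f t) auto
  moreover have "eventually (%r. (d r * ?I f r) / (d r * ?I t r) = ?I f r / ?I t r) at0"
   using eventually_at_right_less[of 0] by eventually_elim (use cc(1) in \<open>force\<close>)
  ultimately show ?thesis by (rule Lim_transform_eventually)
 qed
 have eq: "(LINT y|nu. f y) = ?q * (LINT y|nu'. f y)" if f: "f \<in> Cc" for f
 proof -
  have "(LINT y|nu. f y) / (LINT y|nu. t y) = (LINT y|nu'. f y) / (LINT y|nu'. t y)"
   using lim[OF f c p] lim[OF f c' p'] by (intro tendsto_unique[of "at_right (0 :: real)"]) auto
  thus ?thesis using p p' by (simp add: field_simps)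
 qed
 have "nu = scale_measure (ennreal ?q) nu'"
 proof (rule radon_eqI[OF r(1) radon_scale[OF r'(1)]])
  fix f :: "real ^ 'a => real" assume f: "f \<in> Cc"
  show "(LINT x|nu. f x) = (LINT x|scale_measure (ennreal ?q) nu'. f x)"
   using q eq[OF f] Cc_borel[OF f] radon_sets[OF r'(1)]
   by (subst integral_scale_measure) (auto cong: mcs)
 qed simp
 thus ?thesis using q unfolding proportional_def by blast
qed

context
 fixes pj :: "real ^ 'd => real ^ 'k" and mu :: "(real ^ 'd) measure"
 assumes lin: "linear pj" and mu: "mu \<in> radon_on UNIV"
begin

lemma kap:
 "kap pj mu \<in> VA pj \<rightarrow>\<^sub>M prob_algebra borel" "AE x in mw mu. em (kap pj mu x) (fiber pj x) = 1"
 "!!A X. A \<in> sets (VA pj) ==> X \<in> sets borel ==> (\<integral>\<^sup>+x. indicator A x * em (kap pj mu x) X \<partial>mw mu) = em (mw mu) (A Int X)"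
 using someI_ex[OF disintegration[OF lin mw_finite[OF mu] mw_sets[OF mu]], folded kap_def] by blast+

lemma kap_prob: "prob_space (kap pj mu x)" and kap_sets: "sets (kap pj mu x) = sets borel" and kap_space: "space (kap pj mu x) = UNIV"
proof -
 have k: "kap pj mu x \<in> space (prob_algebra borel)" using measurable_space[OF kap(1), of x] by simp
 thus "prob_space (kap pj mu x)" "sets (kap pj mu x) = sets borel" by (auto simp: space_prob_algebra)
 thus "space (kap pj mu x) = UNIV" using sets_eq_imp_space_eq by fastforce
qed

lemma VA_mw: "u \<in> VA pj \<rightarrow>\<^sub>M N ==> u \<in> mw mu \<rightarrow>\<^sub>M N"
 using VA_borel_measurable[OF lin] mw_sets[OF mu] by (simp cong: mcs)

lemma kap_nn_measurable:
 assumes "F \<in> bm borel"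
 shows "(%x. \<integral>\<^sup>+y. F y \<partial>kap pj mu x) \<in> bm (VA pj)"
 by (rule measurable_compose[OF measurable_prob_algebraD[OF kap(1)] nn_integral_measurable_subprob_algebra[OF assms]])

lemma kap_nn_integral:
 assumes A: "A \<in> sets (VA pj)" and F: "F \<in> bm borel"
 shows "(\<integral>\<^sup>+x. indicator A x * (\<integral>\<^sup>+y. F y \<partial>kap pj mu x) \<partial>mw mu) = (\<integral>\<^sup>+x. indicator A x * F x \<partial>mw mu)"
proof -
 let ?m = "mw mu"
 note s = mw_sets[OF mu]
 have Am [measurable]: "A \<in> sets ?m" using VA_sub[OF lin A] s by simp
 have sp: "space ?m = UNIV" using sets_eq_imp_space_eq[OF s] by simp
 let ?M = "density ?m (indicator A)"
 have spM: "space ?M ~= {}" using sp by simp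
 have kM: "kap pj mu \<in> ?M \<rightarrow>\<^sub>M subprob_algebra borel"
  using VA_mw[OF measurable_prob_algebraD[OF kap(1)]] by (simp cong: mcs)
 have "?M \<bind> kap pj mu = ?M"
 proof (rule measure_eqI)
  show sB: "sets (?M \<bind> kap pj mu) = sets ?M"
   using s by (subst sets_bind[OF _ spM, of _ borel]) (auto simp: kap_sets)
  fix Y assume "Y \<in> sets (?M \<bind> kap pj mu)"
  hence Y: "Y \<in> sets borel" using sB s by simp
  have [measurable]: "(%x. em (kap pj mu x) Y) \<in> bm ?m"
  proof (rule VA_mw)
   have "(%x. \<integral>\<^sup>+y. indicator Y y \<partial>kap pj mu x) \<in> bm (VA pj)" by (rule kap_nn_measurable) (use Y in simp)
   thus "(%x. em (kap pj mu x) Y) \<in> bm (VA pj)" using Y by (simp add: kap_sets)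
  qed
  have "em (?M \<bind> kap pj mu) Y = (\<integral>\<^sup>+x. em (kap pj mu x) Y \<partial>?M)" by (rule emeasure_bind[OF spM kM Y])
  also have "... = em ?m (A Int Y)" using kap(3)[OF A Y] by (simp add: nn_integral_density)
  finally show "em (?M \<bind> kap pj mu) Y = em ?M Y" using emeasure_restricted[OF Am, of Y] Y s by simp
 qed
 hence "(\<integral>\<^sup>+x. F x \<partial>(?M \<bind> kap pj mu)) = (\<integral>\<^sup>+x. F x \<partial>?M)" by simp
 moreover have "(\<integral>\<^sup>+x. F x \<partial>(?M \<bind> kap pj mu)) = (\<integral>\<^sup>+x. \<integral>\<^sup>+y. F y \<partial>kap pj mu x \<partial>?M)"
  by (rule nn_integral_bind[OF F kM])
 moreover have "F \<in> bm ?m" using F s by (simp cong: mcs)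
 ultimately show ?thesis using VA_mw[OF kap_nn_measurable[OF F]] by (simp add: nn_integral_density)
qed

text \<open>The sign condition is there because the kernel formulas are stated for nonnegative
  integrals; \<open>kap_differentiation\<close> removes it by splitting into positive and negative
  parts.\<close>

lemma kap_differentiation_nonneg:
 assumes F: "F \<in> bm borel" "!!x. 0 <= F x" "!!x. F x <= K"
 shows "AE x in mw mu. ((%r. tavg pj (mw mu) F x r) \<longlongrightarrow> (LINT y|kap pj mu x. F y)) at0"
proof (rule tube_differentiation[OF lin mw_finite[OF mu] mw_sets[OF mu] F(1)])
 interpret m: finite_measure "mw mu" by (rule mw_finite[OF mu])
 show "\<bar>F x\<bar> <= K" for x using F(2,3)[of x] by simp
 let ?h = "%x. \<integral>y. F y \<partial>kap pj mu x"
 have Fk: "F \<in> bm (kap pj mu x)" for x using F(1) by (simp add: kap_sets cong: mcs)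
 have Fi: "integrable (kap pj mu x) F" for x
 proof -
  interpret prob_space "kap pj mu x" by (rule kap_prob)
  show ?thesis using F Fk by (intro integrable_const_bound[of _ K]) (auto simp: abs_le_iff intro: order_trans)
 qed
 have h: "ennreal (?h x) = (\<integral>\<^sup>+y. ennreal (F y) \<partial>kap pj mu x)" for x
  using nn_integral_eq_integral[OF Fi] F(2) by simp
 have h': "?h x = enn2real (\<integral>\<^sup>+y. ennreal (F y) \<partial>kap pj mu x)" for x
  unfolding h[symmetric] using F(2) by simp
 have Fe: "(%y. ennreal (F y)) \<in> bm borel" using F(1) by measurable
 show hm: "?h \<in> bm (VA pj)"
  unfolding h' using kap_nn_measurable[OF Fe] by measurable
 have hb: "0 <= ?h x" "?h x <= K" for x
 proof -
  interpret prob_space "kap pj mu x" by (rule kap_prob)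
  show "0 <= ?h x" using F(2) by (rule Bochner_Integration.integral_nonneg)
  show "?h x <= K" using Fi F(3) by (intro integral_le_const) auto
 qed
 have hm': "?h \<in> bm (mw mu)" by (rule VA_mw[OF hm])
 show hi: "integrable (mw mu) ?h"
  using hb hm' by (intro m.integrable_const_bound[of _ K]) auto
 have Fm: "F \<in> bm (mw mu)" using F(1) mw_sets[OF mu] by (simp cong: mcs)
 have Fmi: "integrable (mw mu) F" using F Fm by (intro m.integrable_const_bound[of _ K]) auto
 fix A assume A: "A \<in> sets (VA pj)"
 have Am: "A \<in> sets (mw mu)" using VA_sub[OF lin A] mw_sets[OF mu] by simp
 have e: "ennreal (LINT y|mw mu. indicator A y * g y) = (\<integral>\<^sup>+y. indicator A y * ennreal (g y) \<partial>mw mu)"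
  if g: "integrable (mw mu) g" "!!y. g y >= 0" for g
 proof -
  have "(\<integral>\<^sup>+y. ennreal (indicator A y * g y) \<partial>mw mu) = ennreal (LINT y|mw mu. indicator A y * g y)"
   using integrable_mult_indicator[OF Am g(1)] g(2) by (intro nn_integral_eq_integral) auto
  moreover have "(\<integral>\<^sup>+y. ennreal (indicator A y * g y) \<partial>mw mu) = (\<integral>\<^sup>+y. indicator A y * ennreal (g y) \<partial>mw mu)"
   by (intro nn_integral_cong) (auto simp: indicator_def)
  ultimately show ?thesis by simp
 qed
 have "ennreal (LINT y|mw mu. indicator A y * F y) = ennreal (LINT y|mw mu. indicator A y * ?h y)"
  unfolding e[OF Fmi F(2)] e[OF hi hb(1)] h by (rule kap_nn_integral[OF A Fe, symmetric])
 thus "(LINT y|mw mu. indicator A y * F y) = (LINT y|mw mu. indicator A y * ?h y)"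
  using F(2) hb(1) by (subst (asm) ennreal_inj) (auto intro!: Bochner_Integration.integral_nonneg)
qed

lemma kap_differentiation:
 assumes F: "F \<in> bm borel" "!!x. \<bar>F x\<bar> <= K"
 shows "AE x in mw mu. ((%r. tavg pj (mw mu) F x r) \<longlongrightarrow> (LINT y|kap pj mu x. F y)) at0"
proof -
 interpret m: finite_measure "mw mu" by (rule mw_finite[OF mu])
 let ?P = "%y. max 0 (F y)" and ?N = "%y. max 0 (- F y)"
 have K0: "K >= 0" using F(2)[of 0] by linarith
 have PN: "?P \<in> bm borel" "?N \<in> bm borel" using F(1) by measurable
 have b: "0 <= ?P x" "?P x <= K" "0 <= ?N x" "?N x <= K" for x using F(2)[of x] K0 by auto
 have i: "integrable M ?P" "integrable M ?N" if M: "finite_measure M" "sets M = sets borel" for M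
 proof -
  interpret finite_measure M by fact
  have "?P \<in> bm M" "?N \<in> bm M" using PN M(2) by (simp_all cong: mcs)
  thus "integrable M ?P" "integrable M ?N" using b by (auto intro!: integrable_const_bound[of _ K])
 qed
 have FPN: "F = (%y. ?P y - ?N y)" by (auto simp: max_def)
 show ?thesis
  using kap_differentiation_nonneg[OF PN(1) b(1,2)] kap_differentiation_nonneg[OF PN(2) b(3,4)]
 proof eventually_elim
  case (elim x)
  have t: "tavg pj (mw mu) F x r = tavg pj (mw mu) ?P x r - tavg pj (mw mu) ?N x r" for r
  proof -
   have T: "tube pj x r \<in> sets (mw mu)" using tube_borel[OF lin] mw_sets[OF mu] by simp
   have "(LINT y|mw mu. tI pj x r y * F y) = (LINT y|mw mu. tI pj x r y * ?P y - tI pj x r y * ?N y)"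
   by (intro Bochner_Integration.integral_cong) (auto simp: max_def)
   also have "... = (LINT y|mw mu. tI pj x r y * ?P y) - (LINT y|mw mu. tI pj x r y * ?N y)"
   using integrable_mult_indicator[OF T i(1)[OF mw_finite[OF mu] mw_sets[OF mu]]]
   integrable_mult_indicator[OF T i(2)[OF mw_finite[OF mu] mw_sets[OF mu]]] by (intro Bochner_Integration.integral_diff) auto
   finally show ?thesis by (simp add: tavg_def diff_divide_distrib)
  qed
  have kf: "finite_measure (kap pj mu x)" using kap_prob prob_space.finite_measure by blast
  have "(LINT y|kap pj mu x. F y) = (LINT y|kap pj mu x. ?P y) - (LINT y|kap pj mu x. ?N y)"
   using i[OF kf kap_sets] by (subst FPN) (rule Bochner_Integration.integral_diff)
  thus ?case unfolding t using tendsto_diff[OF elim] by simp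
 qed
qed

end

lemma emeasure_fin: "em M X < \<infinity> ==> em M X = ennreal (measure M X)"
 by (simp add: emeasure_eq_ennreal_measure less_top[symmetric])

lemma measure_posI: "0 < em M X ==> em M X < \<infinity> ==> 0 < measure M X"
 by (simp add: measure_def enn2real_positive_iff)

lemma proportional_sym: assumes "proportional mu nu" shows "proportional nu mu"
proof -
 obtain c :: real where c: "c > 0" "mu = scale_measure (ennreal c) nu" using assms by (auto simp: proportional_def)
 have "ennreal (1 / c) * ennreal c = 1" using c(1) by (simp flip: ennreal_mult)
 hence "nu = scale_measure (ennreal (1 / c)) mu" by (simp add: c(2))
 thus ?thesis using c(1) unfolding proportional_def by (intro exI[of _ "1 / c"]) auto
qed

lemma proportional_trans: assumes "proportional mu nu" "proportional nu \<rho>" shows "proportional mu \<rho>"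
proof -
 obtain c d :: real where c: "c > 0" "mu = scale_measure (ennreal c) nu" and d: "d > 0" "nu = scale_measure (ennreal d) \<rho>"
  using assms by (auto simp: proportional_def)
 have "mu = scale_measure (ennreal (c * d)) \<rho>" using c d by (simp add: ennreal_mult)
 thus ?thesis using c d unfolding proportional_def by (intro exI[of _ "c * d"]) auto
qed

lemma emeasure_restr:
 assumes "sets nu = sets borel" "B \<in> sets borel" "X \<in> sets borel"
 shows "em (restr nu B) X = em nu (B Int X)"
 using emeasure_restricted[of B nu X] assms by (simp add: restr_def)

lemma sets_restr [simp]: "sets (restr nu B) = sets nu"
 by (simp add: restr_def)

lemma uniform_proportional:
 assumes nu: "nu \<in> radon_on A" and BC: "B \<subseteq> C" "B \<in> sets borel" "C \<in> sets borel" "em nu B > 0" "em nu C < \<infinity>"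
 shows "proportional (restr (uniform_measure nu C) B) (uniform_measure nu B)" "proportional (restr nu B) (uniform_measure nu B)"
proof -
 note [simp] = radon_sets[OF nu]
 have le: "em nu B <= em nu C" using BC by (intro emeasure_mono) auto
 have fin: "em nu B < \<infinity>" using le BC(5) by (rule order_le_less_trans)
 define b where "b = measure nu B"
 define c where "c = measure nu C"
 have b: "em nu B = ennreal b" "b > 0"
  unfolding b_def by (rule emeasure_fin[OF fin], rule measure_posI[OF BC(4) fin])
 have c: "em nu C = ennreal c" unfolding c_def by (rule emeasure_fin[OF BC(5)])
 have c0: "c > 0" unfolding c_def by (rule measure_posI[OF order_less_le_trans[OF BC(4) le] BC(5)])
 have u: "em (uniform_measure nu B) X = ennreal (1 / b) * em nu (B Int X)" if "X \<in> sets borel" for X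
  using that b BC by (simp add: divide_ennreal_def inverse_ennreal mult.commute inverse_eq_divide)
 show "proportional (restr nu B) (uniform_measure nu B)"
  unfolding proportional_def
 proof (intro exI[of _ b] conjI b(2) measure_eqI)
  fix X assume "X \<in> sets (restr nu B)"
  hence X: "X \<in> sets borel" by simp
  have "ennreal b * (ennreal (1 / b) * em nu (B Int X)) = em nu (B Int X)"
   using b(2) by (simp flip: mult.assoc ennreal_mult)
  thus "em (restr nu B) X = em (scale_measure (ennreal b) (uniform_measure nu B)) X"
   using u[OF X] emeasure_restr[of nu B X] BC X by simp
 qed simp
 show "proportional (restr (uniform_measure nu C) B) (uniform_measure nu B)"
  unfolding proportional_def
 proof (intro exI[of _ "b / c"] conjI measure_eqI)
  show "b / c > 0" using b c0 by simp
  fix X assume "X \<in> sets (restr (uniform_measure nu C) B)"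
  hence X: "X \<in> sets borel" by simp
  have "C Int (B Int X) = B Int X" using BC(1) by auto
  hence "em (restr (uniform_measure nu C) B) X = ennreal (1 / c) * em nu (B Int X)"
   using X BC c c0 by (simp add: emeasure_restr divide_ennreal_def inverse_ennreal mult.commute inverse_eq_divide)
  also have "... = ennreal (b / c) * (ennreal (1 / b) * em nu (B Int X))"
   using b(2) c0 by (simp flip: mult.assoc ennreal_mult)
  finally show "em (restr (uniform_measure nu C) B) X = em (scale_measure (ennreal (b / c)) (uniform_measure nu B)) X"
   using u[OF X] by simp
 qed simp
qed

lemma msupp_basis:
 assumes nu: "nu \<in> radon_on A" and B: "topological_basis \<B>" "!!O'. O' \<in> \<B> ==> x \<in> O' ==> em nu O' > 0"
 shows "x \<in> msupp nu"
 unfolding msupp_def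
proof (intro CollectI allI impI)
 fix U :: "(real ^ 'a) set" assume U: "open U" "x \<in> U"
 then obtain O' where O': "O' \<in> \<B>" "x \<in> O'" "O' \<subseteq> U" using B(1) by (metis topological_basisE)
 have "em nu O' <= em nu U" using O'(3) U(1) radon_sets[OF nu] by (intro emeasure_mono) auto
 thus "em nu U > 0" using B(2)[OF O'(1,2)] by (rule order_less_le_trans[rotated])
qed

context
 fixes pj :: "real ^ 'd => real ^ 'k" and mu :: "(real ^ 'd) measure"
 assumes lin: "linear pj" and mu: "mu \<in> radon_on UNIV"
begin

lemma tube_eq: "sup_nhd (fiber pj x) r = tube pj x r"
 by (simp add: tube_def)

lemma fm_sets: "sets (fm pj mu x) = sets borel"
 by (simp add: fm_def kap_sets[OF lin mu])

lemma iw_kap [measurable]: "(%y. ennreal (1 / wt mu y)) \<in> bm (kap pj mu x)"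
 using wt_borel[of mu] by (simp add: kap_sets[OF lin mu] cong: mcs)

lemma fm_emeasure:
 "X \<in> sets borel ==> em (fm pj mu x) X = (\<integral>\<^sup>+y. ennreal (1 / wt mu y) * indicator X y \<partial>kap pj mu x)"
 unfolding fm_def by (subst emeasure_density) (auto simp: kap_sets[OF lin mu])

lemma fm_ball: "em (fm pj mu x) (cb N) < \<infinity>"
proof -
 interpret prob_space "kap pj mu x" by (rule kap_prob[OF lin mu])
 let ?K = "2 ^ N * (1 + measure mu (cb N))"
 have "em (fm pj mu x) (cb N) = (\<integral>\<^sup>+y. ennreal (1 / wt mu y) * indicator (cb N) y \<partial>kap pj mu x)"
  by (rule fm_emeasure) simp
 also have "... <= (\<integral>\<^sup>+y. ennreal ?K \<partial>kap pj mu x)"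
  using wt_inverse_bound[OF mu, of _ N] by (intro nn_integral_mono) (auto simp: mem_sup_cball intro!: ennreal_leI split: split_indicator)
 also have "... < \<infinity>" by (simp add: emeasure_space_1)
 finally show ?thesis .
qed

lemma fm_radon_UNIV: "fm pj mu x \<in> radon_on UNIV"
 by (rule radon_onI) (use fm_sets fm_ball in auto)

lemma fm_radon:
 assumes "em (kap pj mu x) (fiber pj x) = 1" shows "fm pj mu x \<in> radon_on (fiber pj x)"
proof (rule radon_onI[OF fm_sets fm_ball])
 interpret prob_space "kap pj mu x" by (rule kap_prob[OF lin mu])
 have "AE y in kap pj mu x. y \<in> fiber pj x"
  using assms by (intro AE_prob_1) (simp add: emeasure_eq_measure)
 hence z: "AE y in kap pj mu x. ennreal (1 / wt mu y) * indicator (- fiber pj x) y = 0" by eventually_elim simp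
 have "- fiber pj x \<in> sets borel" using fiber_borel[OF lin, of x] by (rule borel_comp)
 hence "em (fm pj mu x) (- fiber pj x) = (\<integral>\<^sup>+y. 0 \<partial>kap pj mu x)"
  unfolding fm_emeasure[OF \<open>- fiber pj x \<in> sets borel\<close>] by (intro nn_integral_cong_AE z)
 thus "em (fm pj mu x) (- fiber pj x) = 0" by simp
qed

lemma fm_integral:
 fixes f :: "real ^ 'd => real"
 shows "f \<in> bm borel ==> (LINT y|fm pj mu x. f y) = (LINT y|kap pj mu x. (1 / wt mu y) * f y)"
 unfolding fm_def using wt_borel[of mu]
 by (subst integral_density) (auto simp: kap_sets[OF lin mu] less_imp_le cong: mcs)

text \<open>The weight cancels: an average over \<open>mw mu\<close> of \<open>f / wt\<close> is a
  tube integral over \<open>mu\<close>, divided by the mass of the tube under \<open>mw mu\<close>.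
  This divisor provides the constants in \<open>fconv\<close>.\<close>

lemma mw_tavg:
 fixes f :: "real ^ 'd => real"
 assumes f: "f \<in> bm borel"
 shows "tavg pj (mw mu) (%y. (1 / wt mu y) * f y) x r = (LINT y|mu. tI pj x r y * f y) / measure (mw mu) (tube pj x r)"
proof -
 have T [measurable]: "tube pj x r \<in> sets borel" by (rule tube_borel[OF lin])
 have "(%y. tI pj x r y * ((1 / wt mu y) * f y)) \<in> bm borel"
  using f by measurable
 hence g: "(%y. tI pj x r y * ((1 / wt mu y) * f y)) \<in> bm mu"
  by (simp only: mcs[OF radon_sets[OF mu] refl])
 have w: "wt mu \<in> bm mu" using wt_borel[of mu] by (simp only: mcs[OF radon_sets[OF mu] refl])
 have "(LINT y|mw mu. tI pj x r y * ((1 / wt mu y) * f y)) = (LINT y|mu. wt mu y *\<^sub>R (tI pj x r y * ((1 / wt mu y) * f y)))"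
  unfolding mw_def by (rule integral_density[OF g w]) (simp add: less_imp_le)
 also have "... = (LINT y|mu. tI pj x r y * f y)"
  using less_imp_neq[OF wt_pos, of mu] by (intro Bochner_Integration.integral_cong) (auto simp: field_simps)
 finally show ?thesis by (simp add: tavg_def)
qed

lemma fm_tavg_limit:
 fixes f :: "real ^ 'd => real"
 assumes f: "f \<in> bm borel" "!!y. \<bar>f y\<bar> <= K" "!!y. infnorm y > real N ==> f y = 0"
 shows "AE x in mu. ((%r. (LINT y|mu. tI pj x r y * f y) / measure (mw mu) (tube pj x r)) \<longlongrightarrow> (LINT y|fm pj mu x. f y)) at0"
proof -
 let ?K = "2 ^ N * (1 + measure mu (cb N))"
 have K: "K >= 0" using f(2)[of 0] by linarith
 have b: "\<bar>(1 / wt mu y) * f y\<bar> <= ?K * K" for y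
 proof (cases "infnorm y <= real N")
  case True
  have "\<bar>(1 / wt mu y) * f y\<bar> = (1 / wt mu y) * \<bar>f y\<bar>" by (simp add: abs_mult abs_of_pos)
  also have "... <= ?K * K" using wt_inverse_bound[OF mu True] f(2)[of y] wt_pos[of mu y] by (intro mult_mono) (auto simp: less_imp_le)
  finally show ?thesis .
 next
  case False thus ?thesis using f(3)[of y] K by simp
 qed
 have m: "(%y. (1 / wt mu y) * f y) \<in> bm borel" using f(1) by measurable
 show ?thesis
  using kap_differentiation[OF lin mu m b] unfolding mw_AE[OF mu] mw_tavg[OF f(1)] fm_integral[OF f(1)] .
qed

text \<open>The points whose conditional measure misses \<open>O'\<close> form a union of fibers,
  and by the disintegration formula its intersection with \<open>O'\<close> is null.\<close>

lemma fm_pos_AE: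
 assumes O: "O' \<in> sets borel"
 shows "AE x in mu. x \<in> O' --> em (fm pj mu x) O' > 0"
proof -
  let ?A = "{x. em (kap pj mu x) O' = 0}"
  have km: "(%x. \<integral>\<^sup>+y. indicator O' y \<partial>kap pj mu x) \<in> bm (VA pj)" by (rule kap_nn_measurable[OF lin mu]) (use O in simp)
  hence "{x\<in>space (VA pj). (\<integral>\<^sup>+y. indicator O' y \<partial>kap pj mu x) = 0} \<in> sets (VA pj)" by measurable
  hence A: "?A \<in> sets (VA pj)" using O by (simp add: kap_sets[OF lin mu])
  have "em (mw mu) (?A Int O') = (\<integral>\<^sup>+x. indicator ?A x * em (kap pj mu x) O' \<partial>mw mu)"
   by (rule kap(3)[OF lin mu A O, symmetric])
  also have "... = (\<integral>\<^sup>+x. 0 \<partial>mw mu)" by (intro nn_integral_cong) (auto simp: indicator_def)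
  finally have "?A Int O' \<in> null_sets (mw mu)" using VA_sub[OF lin A] O mw_sets[OF mu] by (auto simp: null_sets_def)
  hence "AE x in mw mu. x \<notin> ?A Int O'" by (rule AE_not_in)
  hence "AE x in mu. x \<notin> ?A Int O'" by (simp only: mw_AE[OF mu])
  thus ?thesis
  proof eventually_elim
   case (elim x)
   show ?case
   proof
   assume "x \<in> O'"
   hence nz: "em (kap pj mu x) O' ~= 0" using elim by blast
   show "em (fm pj mu x) O' > 0"
   proof (rule ccontr)
   assume "\<not> em (fm pj mu x) O' > 0"
   hence "(\<integral>\<^sup>+y. ennreal (1 / wt mu y) * indicator O' y \<partial>kap pj mu x) = 0" using fm_emeasure[OF O] by (simp add: zero_less_iff_neq_zero)
   hence "AE y in kap pj mu x. ennreal (1 / wt mu y) * indicator O' y = 0"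
   proof (subst (asm) nn_integral_0_iff_AE)
   have [measurable]: "O' \<in> sets (kap pj mu x)" using O kap_sets[OF lin mu] by simp
   show "(%y. ennreal (1 / wt mu y) * indicator O' y) \<in> bm (kap pj mu x)" by measurable
   qed
   hence "AE y in kap pj mu x. y \<notin> O'"
   proof eventually_elim
   case (elim y)
   have nz: "ennreal (1 / wt mu y) ~= 0" by (simp add: ennreal_eq_0_iff not_le)
   show ?case
   proof
   assume "y \<in> O'"
   hence "ennreal (1 / wt mu y) = 0" using elim by (simp only: indicator_simps mult_1_right)
   with nz show False by contradiction
   qed
   qed
   hence "em (kap pj mu x) O' = 0"
   using AE_iff_measurable[of O' "kap pj mu x" "%y. y \<notin> O'"] O by (auto simp: kap_sets[OF lin mu] kap_space[OF lin mu])
   thus False using nz by simp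
   qed
   qed
  qed
qed

lemma fm_msupp_AE: "AE x in mu. x \<in> msupp (fm pj mu x)"
proof -
 obtain \<B> :: "(real ^ 'd) set set" where \<B>: "countable \<B>" "topological_basis \<B>" using ex_countable_basis by blast
 have "AE x in mu. x \<in> O' --> em (fm pj mu x) O' > 0" if "O' \<in> \<B>" for O'
  by (rule fm_pos_AE) (use topological_basis_open[OF \<B>(2) that] in simp)
 hence "AE x in mu. ALL O':\<B>. x \<in> O' --> em (fm pj mu x) O' > 0"
  by (subst AE_ball_countable[OF \<B>(1)]) blast
 thus ?thesis by eventually_elim (use msupp_basis[OF fm_radon_UNIV \<B>(2)] in blast)
qed

text \<open>Differentiation needs only bounded Borel functions, so it also applies to test functions
  multiplied by the indicators of the countably many integer balls. At almost every point
  convergence on balls therefore holds without any condition on their boundaries. At the origin it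
  has to be earned separately, since translation moves the balls.\<close>

theorem fm_AE:
 "AE x in mu. fconv pj mu x (fm pj mu x) &
  (ALL R. em (fm pj mu x) (cb R) > 0 --> tube_limit pj mu x R (uniform_measure (fm pj mu x) (cb R)))"
proof -
 let ?B = "%R. sup_cball (real R) (0 :: real ^ 'd)"
 let ?L = "%f x. ((%r. (LINT y|mu. tI pj x r y * f y) / measure (mw mu) (tube pj x r)) \<longlongrightarrow> (LINT y|fm pj mu x. f y)) at0"
 interpret mw: finite_measure "mw mu" by (rule mw_finite[OF mu])
 have a1: "AE x in mu. ALL f:Dc. ?L f x"
 proof (subst AE_ball_countable[OF countable_Dc], rule ballI)
  fix f :: "real ^ 'd => real" assume "f \<in> Dc"
  hence f: "f \<in> Cc" by (rule Dc_Cc)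
  obtain K where K: "!!x. \<bar>f x\<bar> <= K" using Cc_bounded[OF f] by blast
  obtain N :: nat where "ALL x. f x ~= 0 --> infnorm x <= real N" using f by (auto simp: Cc_iff)
  hence N: "real N < infnorm x ==> f x = 0" for x by (meson not_less)
  show "AE x in mu. ?L f x" by (rule fm_tavg_limit[OF Cc_borel[OF f] K N])
 qed
 have a2: "AE x in mu. ALL f:Dc. ALL R. ?L (%y. indicator (?B R) y * f y) x"
 proof (subst AE_ball_countable[OF countable_Dc], rule ballI, subst AE_all_countable, rule allI)
  fix f :: "real ^ 'd => real" and R assume "f \<in> Dc"
  hence f: "f \<in> Cc" by (rule Dc_Cc)
  obtain K where K: "K > 0" "!!x. \<bar>f x\<bar> <= K" using Cc_bounded[OF f] by blast
  show "AE x in mu. ?L (%y. indicator (?B R) y * f y) x"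
  proof (rule fm_tavg_limit)
   show "(%y. indicator (?B R) y * f y) \<in> bm borel" using Cc_borel[OF f] by measurable
   show "\<bar>indicator (?B R) y * f y\<bar> <= K" for y using K(2)[of y] K(1) by (auto simp: indicator_def)
   show "indicator (?B R) y * f y = 0" if "real R < infnorm y" for y using that by (simp add: mem_sup_cball)
  qed
 qed
 have a3: "AE x in mu. ALL R. ?L (%y. indicator (?B R) y) x"
 proof (subst AE_all_countable, rule allI, rule fm_tavg_limit)
  fix R
  show "indicator (?B R) y = (0 :: real)" if "real R < infnorm y" for y :: "real ^ 'd" using that by (simp add: mem_sup_cball)
  show "\<bar>indicator (?B R) y :: real\<bar> <= 1" for y by simp
 qed simp
 have a4: "AE x in mu. em (kap pj mu x) (fiber pj x) = 1" using kap(2)[OF lin mu] by (simp only: mw_AE[OF mu])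
 have a5: "AE x in mu. ALL r>0. em (mw mu) (tube pj x r) > 0"
  using tube_positive_AE[OF lin mw_sets[OF mu]] by (simp only: mw_AE[OF mu])
 show ?thesis using a1 a2 a3 a4 a5 fm_msupp_AE
 proof eventually_elim
  case (elim x)
  let ?nu = "fm pj mu x"
  note mus = radon_sets[OF mu]
  have T: "tube pj x r \<in> sets borel" for r by (rule tube_borel[OF lin])
  have nu: "?nu \<in> radon_on (fiber pj x)" by (rule fm_radon[OF elim(4)])
  let ?c = "%r. 1 / measure (mw mu) (tube pj x r)"
  have c: "?c r > 0" if "r > 0" for r using elim(5) that by (simp add: mw.emeasure_eq_measure)
  let ?M = "%r. scale_measure (ennreal (?c r)) (density mu (indicator (tube pj x r)))"
  have Mint: "(LINT y|?M r. f y) = ?c r * (LINT y|mu. tI pj x r y * f y)" if "f \<in> Cc" for f r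
  proof -
   have fb: "f \<in> bm mu" using Cc_borel[OF that] mus by (simp cong: mcs)
   have "(LINT y|density mu (%y. ennreal (tI pj x r y)). f y) = (LINT y|mu. tI pj x r y *\<^sub>R f y)"
   proof -
   have [measurable]: "tube pj x r \<in> sets mu" using T[of r] mus by simp
   show ?thesis by (rule integral_density[OF fb]) auto
   qed
   hence "(LINT y|density mu (indicator (tube pj x r)). f y) = (LINT y|mu. tI pj x r y * f y)" by (simp add: ennreal_indicator)
   thus ?thesis using fb by (subst integral_scale_measure) auto
  qed
  have Mrad: "?M r \<in> radon_on UNIV" for r
  proof (rule radon_scale)
   show "density mu (indicator (tube pj x r)) \<in> radon_on UNIV"
   proof (rule radon_onI)
   fix N
   have "em (density mu (indicator (tube pj x r))) (?B N) = em mu (tube pj x r Int ?B N)"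
   using T[of r] mus by (simp add: emeasure_restricted)
   also have "... <= em mu (?B N)" using T[of r] mus by (intro emeasure_mono) auto
   finally show "em (density mu (indicator (tube pj x r))) (?B N) < \<infinity>" using radon_ball[OF mu] by (rule order_le_less_trans)
   qed (use mus in auto)
  qed simp
  have conv: "((%r. ?c r * (LINT y|mu. tI pj x r y * f y)) \<longlongrightarrow> (LINT y|?nu. f y)) at0" if f: "f \<in> Cc" for f
  proof -
   have "((%r. \<integral>y. f y \<partial>?M r) \<longlongrightarrow> (LINT y|?nu. f y)) at0"
   proof (rule vague_upgrade[OF nu always_eventually[OF allI[OF Mrad]] _ f])
   fix g :: "real ^ 'd => real" assume "g \<in> Dc"
   thus "((%r. \<integral>y. g y \<partial>?M r) \<longlongrightarrow> (LINT y|?nu. g y)) at0"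
   using elim(1) unfolding Mint[OF Dc_Cc[OF \<open>g \<in> Dc\<close>]] by simp
   qed
   thus ?thesis unfolding Mint[OF f] .
  qed
  have "tube_limit pj mu x R (uniform_measure ?nu (?B R))" if p: "em ?nu (?B R) > 0" for R
  proof -
   let ?U = "%r. uniform_measure mu (?B R Int tube pj x r)"
   have BT: "?B R Int tube pj x r \<in> sets borel" for r using T[of r] by auto
   have fin: "em mu (?B R Int tube pj x r) < \<infinity>" for r
   proof -
   have "em mu (?B R Int tube pj x r) <= em mu (?B R)" using mus by (intro emeasure_mono) auto
   thus ?thesis using radon_ball[OF mu] by (rule order_le_less_trans)
   qed
   have p': "measure ?nu (?B R) > 0" by (rule measure_posI[OF p fm_ball])
   have mB: "(LINT y|mu. tI pj x r y * indicator (?B R) y) = measure mu (?B R Int tube pj x r)" for r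
   using BT[of r] mus by (simp add: Int_commute flip: indicator_inter_arith)
   have l1: "((%r. measure mu (?B R Int tube pj x r) / measure (mw mu) (tube pj x r)) \<longlongrightarrow> measure ?nu (?B R)) at0"
   using elim(3)[rule_format, of R] fm_sets unfolding mB by simp
   have "em mu (?B R Int tube pj x r) > 0" if "r > 0" for r
   proof -
   have "eventually (%r. measure mu (?B R Int tube pj x r) / measure (mw mu) (tube pj x r) > 0) at0"
   by (rule order_tendstoD(1)[OF l1 p'])
   then obtain b where b: "b > 0" "!!s. 0 < s ==> s < b ==> measure mu (?B R Int tube pj x s) / measure (mw mu) (tube pj x s) > 0"
   unfolding eventually_at_right_field by auto
   obtain s where s: "0 < s" "s < min b r" using dense[of 0 "min b r"] b(1) \<open>r > 0\<close> by auto
   hence "measure mu (?B R Int tube pj x s) ~= 0" using b(2)[of s] by auto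
   hence "em mu (?B R Int tube pj x s) > 0" by (auto simp: measure_def zero_less_iff_neq_zero)
   also have "... <= em mu (?B R Int tube pj x r)"
   using BT[of r] mus s tube_mono[OF lin, of s r x] by (intro emeasure_mono) auto
   finally show ?thesis .
   qed
   moreover have "limitin (weak_topology UNIV) ?U (uniform_measure ?nu (?B R)) at0"
   unfolding limitin_weak_iff
   proof (intro conjI ballI)
   show u1: "uniform_measure ?nu (?B R) \<in> radon_on UNIV" by (rule uniform_measure_radon[OF fm_sets]) simp
   have ur: "?U r \<in> radon_on UNIV" for r by (rule uniform_measure_radon[OF mus BT])
   thus "eventually (%r. ?U r \<in> radon_on UNIV) at0" by simp
   fix f :: "real ^ 'd => real" assume f: "f \<in> Cc"
   show "((%r. \<integral>y. f y \<partial>?U r) \<longlongrightarrow> (LINT y|uniform_measure ?nu (?B R). f y)) at0"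
   proof (rule vague_upgrade[OF u1 always_eventually[OF allI[OF ur]] _ f])
   fix g :: "real ^ 'd => real" assume g: "g \<in> Dc"
   have gb: "g \<in> bm mu" "g \<in> bm ?nu" using Cc_borel[OF Dc_Cc[OF g]] mus fm_sets by (simp_all cong: mcs)
   have e1: "(LINT y|?U r. g y) = (LINT y|mu. tI pj x r y * (indicator (?B R) y * g y)) / measure mu (?B R Int tube pj x r)" for r
   proof -
   have "(LINT y|?U r. g y) = (LINT y|mu. indicator (?B R Int tube pj x r) y * g y) / measure mu (?B R Int tube pj x r)"
   by (rule integral_uniform_measure[OF _ fin gb(1)]) (use BT[of r] mus in simp)
   thus ?thesis by (simp add: indicator_inter_arith mult_ac)
   qed
   have e2: "(LINT y|uniform_measure ?nu (?B R). g y) = (LINT y|?nu. indicator (?B R) y * g y) / measure ?nu (?B R)"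
   by (rule integral_uniform_measure[OF _ fm_ball gb(2)]) (simp add: fm_sets)
   have "((%r. ((LINT y|mu. tI pj x r y * (indicator (?B R) y * g y)) / measure (mw mu) (tube pj x r)) /
   (measure mu (?B R Int tube pj x r) / measure (mw mu) (tube pj x r))) \<longlongrightarrow> (LINT y|?nu. indicator (?B R) y * g y) / measure ?nu (?B R)) at0"
   using elim(2) g p' by (intro tendsto_divide l1) auto
   moreover have "eventually (%r. ((LINT y|mu. tI pj x r y * (indicator (?B R) y * g y)) / measure (mw mu) (tube pj x r)) /
   (measure mu (?B R Int tube pj x r) / measure (mw mu) (tube pj x r)) = (LINT y|?U r. g y)) at0"
   using eventually_at_right_less[of 0] by eventually_elim (use c in \<open>force simp: e1\<close>)
   ultimately show "((%r. \<integral>y. g y \<partial>?U r) \<longlongrightarrow> (LINT y|uniform_measure ?nu (?B R). g y)) at0"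
   unfolding e2 by (rule Lim_transform_eventually)
   qed
   qed
   ultimately show ?thesis unfolding tube_limit_def tube_eq by blast
  qed
  moreover have "fconv pj mu x ?nu"
   unfolding fconv_def using nu elim(6) c conv by (intro conjI exI[of _ ?c]) auto
  ultimately show ?case by blast
 qed
qed

end

section \<open>Gluing the limits on balls\<close>

lemma tube_limit_unique:
 assumes "tube_limit pj mu x R et" "tube_limit pj mu x R et'" shows "et = et'"
proof -
 let ?m = "%ep. uniform_measure mu (cb R Int sup_nhd (fiber pj x) ep)"
 have l: "et \<in> radon_on UNIV" "!!f. f \<in> Cc ==> ((%ep. \<integral>y. f y \<partial>?m ep) \<longlongrightarrow> (LINT y|et. f y)) at0"
  using assms(1) unfolding tube_limit_def limitin_weak_iff by auto
 have l': "et' \<in> radon_on UNIV" "!!f. f \<in> Cc ==> ((%ep. \<integral>y. f y \<partial>?m ep) \<longlongrightarrow> (LINT y|et'. f y)) at0"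
  using assms(2) unfolding tube_limit_def limitin_weak_iff by auto
 show ?thesis
  by (rule radon_eqI[OF l(1) l'(1)]) (rule tendsto_unique[OF _ l(2) l'(2)], auto)
qed

lemma restr_radon: assumes "nu \<in> radon_on A" "B \<in> sets borel" shows "restr nu B \<in> radon_on UNIV"
proof (rule radon_onI)
 note [simp] = radon_sets[OF assms(1)]
 show "em (restr nu B) (cb N) < \<infinity>" for N
 proof -
  have "em (restr nu B) (cb N) <= em nu (cb N)"
   using assms(2) by (subst emeasure_restr) (auto intro: emeasure_mono)
  thus ?thesis using radon_ball[OF assms(1)] by (rule order_le_less_trans)
 qed
qed (use radon_sets[OF assms(1)] in auto)

lemma proportional_emeasure:
 assumes "proportional mu nu" obtains c :: real where "c > 0" "ALL X. em mu X = ennreal c * em nu X"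
 using assms unfolding proportional_def by auto

context
 fixes pj :: "real ^ 'd => real ^ 'k" and mu :: "(real ^ 'd) measure"
 assumes lin: "linear pj" and mu: "mu \<in> radon_on UNIV"
begin

lemma tube_limit_props:
 assumes t: "tube_limit pj mu x R et"
 shows "et \<in> radon_on (fiber pj x)" "em et (- cb R) = 0" "em et (cb R) > 0"
proof -
 let ?B = "sup_cball (real R) (0 :: real ^ 'd)"
 let ?m = "%ep. uniform_measure mu (?B Int tube pj x ep)"
 have et: "et \<in> radon_on UNIV" and lim: "!!f. f \<in> Cc ==> ((%ep. \<integral>y. f y \<partial>?m ep) \<longlongrightarrow> (LINT y|et. f y)) at0"
  and pos: "!!ep. ep > 0 ==> em mu (?B Int tube pj x ep) > 0"
  using t unfolding tube_limit_def limitin_weak_iff tube_def by auto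
 note ets = radon_sets[OF et] and mus = radon_sets[OF mu]
 have BT: "?B Int tube pj x ep \<in> sets mu" for ep using tube_borel[OF lin] mus by auto
 have fin: "em mu (?B Int tube pj x ep) < \<infinity>" for ep
  using emeasure_mono[of "?B Int tube pj x ep" ?B mu] mus radon_ball[OF mu, of "real R" 0] by (auto intro: order_le_less_trans)
 have int: "(LINT y|?m ep. f y) = (LINT y|mu. indicator (?B Int tube pj x ep) y * f y) / measure mu (?B Int tube pj x ep)" if "f \<in> Cc" for f ep
  using Cc_borel[OF that] mus by (intro integral_uniform_measure[OF BT fin]) (simp cong: mcs)
 have zero: "(LINT y|et. f y) = 0" if f: "f \<in> Cc" and d: "d > 0" "!!y. y \<in> ?B ==> y \<in> tube pj x d ==> f y = 0" for f d
 proof -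
  have "(LINT y|?m r. f y) = 0" if "r < d" for r
  proof -
   have "indicator (?B Int tube pj x r) y * f y = 0" for y
   using d(2)[of y] tube_mono[OF lin, of r d x] that by (auto simp: indicator_def)
   hence "(%y. indicator (?B Int tube pj x r) y * f y) = (%_. 0)" by (intro ext)
   thus ?thesis unfolding int[OF f] by (simp only: integral_zero div_0)
  qed
  hence "eventually (%r. (LINT y|?m r. f y) = 0) at0"
   using d(1) unfolding eventually_at_right_field by auto
  hence "((%r. \<integral>y. f y \<partial>?m r) \<longlongrightarrow> 0) at0" by (rule tendsto_eventually)
  thus ?thesis using tendsto_unique[OF _ lim[OF f]] by simp
 qed
 show "et \<in> radon_on (fiber pj x)"
  by (rule fiber_support[OF lin et]) (use zero in blast)
 let ?f = "%n :: nat. %y :: real ^ 'd. cut n y * max 0 (infnorm y - real R)"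
 have fC: "?f n \<in> Cc" for n by (intro Cc_mult cut_Cc continuous_intros)
 have "(LINT y|et. ?f n y) = 0" for n
  by (rule zero[OF fC, of 1]) (auto simp: mem_sup_cball)
 hence "AE y in et. ?f n y = 0" for n
  using integral_nonneg_eq_0_iff_AE[OF Cc_integrable[OF et fC], of n] by simp
 hence "AE y in et. ALL n. ?f n y = 0" unfolding AE_all_countable by (rule allI)
 hence AEB: "AE y in et. y \<in> ?B"
 proof eventually_elim
  case (elim y)
  obtain k :: nat where k: "infnorm y <= real k" using real_arch_simple by blast
  have "max 0 (infnorm y - real R) = 0" using elim[rule_format, of k] cut_eq1[OF k] by simp
  thus ?case by (simp add: mem_sup_cball)
 qed
 thus out: "em et (- ?B) = 0"
  using AE_iff_measurable[of "- ?B" et "%y. y \<in> ?B"] ets radon_space[OF et] by auto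
 show "em et ?B > 0"
 proof (rule ccontr)
  assume "\<not> em et ?B > 0"
  hence "em et ?B = 0" by (simp add: zero_less_iff_neq_zero)
  hence "AE y in et. y \<notin> ?B" using ets by (intro AE_not_in) (simp add: null_sets_def)
  hence "AE y in et. cut R y = 0" using AEB by eventually_elim simp
  hence z: "(LINT y|et. cut R y) = 0" by (rule integral_eq_zero_AE)
  \<comment> \<open>All approximating measures live on one compact ball, so no mass can escape: the
    function \<open>cut R\<close> is 1 there and has integral 1 along the whole family.\<close>
  have "(LINT y|?m r. cut R y) = 1" if "r > 0" for r
  proof -
   have "(%y. indicator (?B Int tube pj x r) y * cut R y) = (indicator (?B Int tube pj x r) :: real ^ 'd => real)"
   using cut_eq1[of _ R] by (auto simp: indicator_def mem_sup_cball cut_eq1)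
   thus ?thesis unfolding int[OF cut_Cc] using measure_posI[OF pos[OF that] fin] BT by (simp add: less_imp_neq[symmetric])
  qed
  hence "eventually (%r. (LINT y|?m r. cut R y) = 1) at0"
   using eventually_at_right_less[of 0] by (auto elim: eventually_mono)
  hence "((%r. \<integral>y. cut R y \<partial>?m r) \<longlongrightarrow> 1) at0" by (rule tendsto_eventually)
  hence "(LINT y|et. cut R y) = 1" using tendsto_unique[OF _ lim[OF cut_Cc]] by simp
  thus False using z by simp
 qed
qed

text \<open>Rescaling every limit to mass 1 on the smallest ball \<open>?B R0\<close> turns
  consistency up to scalars into equality, as \<open>glue_measures\<close> requires.\<close>

lemma glued_exists:
 assumes "fiber_measure_defined pj mu x" shows "EX nu. glued_fiber_measure pj mu x nu"
proof -
 obtain R0 et where T: "tube_limits_from pj mu x R0 et" using assms by (auto simp: fiber_measure_defined_def)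
 let ?B = "%R :: nat. sup_cball (real R) (0 :: real ^ 'd)"
 have t: "tube_limit pj mu x R (et R)" if "R >= R0" for R using T that by (simp add: tube_limits_from_def)
 have pr: "proportional (restr (et R') (?B R)) (et R)" if "R >= R0" "R' > R" for R R' using T that by (simp add: tube_limits_from_def)
 note tp = tube_limit_props[OF t]
 have s: "sets (et R) = sets borel" if "R >= R0" for R using radon_sets[OF tp(1)[OF that]] .
 have mono: "?B R \<subseteq> ?B R'" if "R <= R'" for R R' using that by (intro sup_cball_mono) simp
 have scal: "EX c>0. ALL X:sets borel. X \<subseteq> ?B R --> em (et R') X = ennreal c * em (et R) X" if R: "R >= R0" "R' > R" for R R'
 proof -
  obtain c :: real where c: "c > 0" "ALL X. em (restr (et R') (?B R)) X = ennreal c * em (et R) X"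
   using pr[OF R] by (rule proportional_emeasure)
  have "em (et R') X = ennreal c * em (et R) X" if X: "X \<in> sets borel" "X \<subseteq> ?B R" for X
  proof -
   have "em (restr (et R') (?B R)) X = em (et R') (?B R Int X)" using s[of R'] R X by (intro emeasure_restr) auto
   also have "?B R Int X = X" using X by auto
   finally show ?thesis using c(2) by simp
  qed
  with c(1) show ?thesis by blast
 qed
 define e where "e R = measure (et R) (?B R0)" for R
 have e: "em (et R) (?B R0) = ennreal (e R)" "e R > 0" if R: "R >= R0" for R
 proof -
  have "em (et R) (?B R0) > 0"
  proof (cases "R = R0")
   case True thus ?thesis using tp(3)[of R0] by simp
  next
   case False
   then obtain c :: real where c: "c > 0" "em (et R) (?B R0) = ennreal c * em (et R0) (?B R0)"
   using scal[of R0 R] R by auto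
   thus ?thesis using tp(3)[of R0] by (simp add: ennreal_zero_less_mult_iff)
  qed
  thus "e R > 0" "em (et R) (?B R0) = ennreal (e R)"
   unfolding e_def using measure_posI emeasure_fin radon_ball[OF tp(1)[OF R]] by blast+
 qed
 \<comment> \<open>The index starts at \<open>R0\<close>, from where on the limits exist;
   \<open>nu n\<close> belongs to the ball of radius \<open>R0 + n\<close>, which contains the ball
   of radius \<open>n\<close> on which it is used.\<close>
 define nu where "nu n = scale_measure (ennreal (1 / e (R0 + n))) (et (R0 + n))" for n
 obtain \<sigma> where \<sigma>: "\<sigma> \<in> radon_on UNIV" "ALL n. ALL A:sets borel. A \<subseteq> ?B n --> em \<sigma> A = em (nu n) A"
 proof (rule glue_measures[of nu])
  show "sets (nu n) = sets borel" for n by (simp add: nu_def s)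
  show "em (nu n) (?B n) < \<infinity>" for n
   using radon_ball[OF tp(1)[of "R0 + n"], of "real n" 0] by (simp add: nu_def ennreal_mult_less_top)
  fix n A assume A: "A \<in> sets borel" "A \<subseteq> ?B n"
  obtain c :: real where c: "c > 0" "ALL X:sets borel. X \<subseteq> ?B (R0 + n) --> em (et (Suc (R0 + n))) X = ennreal c * em (et (R0 + n)) X"
   using scal[of "R0 + n" "Suc (R0 + n)"] by auto
  have "ennreal (e (Suc (R0 + n))) = ennreal (c * e (R0 + n))"
   using c(2)[rule_format, of "?B R0"] mono[of R0 "R0 + n"] e(1)[of "R0 + n"] e(1)[of "Suc (R0 + n)"] c(1) e(2)[of "R0 + n"]
   by (simp add: ennreal_mult)
  hence ee: "e (Suc (R0 + n)) = c * e (R0 + n)" using c(1) e(2)[of "R0 + n"] e(2)[of "Suc (R0 + n)"] by (simp add: less_imp_le)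
  have "em (nu (Suc n)) A = ennreal (1 / (c * e (R0 + n))) * (ennreal c * em (et (R0 + n)) A)"
   using c(2) A mono[of n "R0 + n"] ee by (auto simp: nu_def)
  also have "... = em (nu n) A"
   using c(1) e(2)[of "R0 + n"] by (simp add: nu_def flip: mult.assoc ennreal_mult)
  finally show "em (nu (Suc n)) A = em (nu n) A" .
 qed blast
 note \<sigma>s = radon_sets[OF \<sigma>(1)]
 have nf: "em (nu n) (- fiber pj x) = 0" for n
  using tp(1)[of "R0 + n"] by (simp add: nu_def radon_on_def)
 have "\<sigma> \<in> radon_on (fiber pj x)"
 proof -
  have fb: "- fiber pj x \<in> sets borel" using fiber_borel[OF lin] by (rule borel_comp)
  have "em \<sigma> (- fiber pj x Int ?B n) = 0" for n
  proof -
   have "em \<sigma> (- fiber pj x Int ?B n) = em (nu n) (- fiber pj x Int ?B n)" using \<sigma>(2) fb by auto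
   also have "... <= em (nu n) (- fiber pj x)" using fb s[of "R0 + n"] by (intro emeasure_mono) (auto simp: nu_def)
   finally show ?thesis using nf by simp
  qed
  hence "em \<sigma> (- fiber pj x) = 0" using radon_SUP_ball[OF \<sigma>(1) fb] by simp
  thus ?thesis using \<sigma>(1) by (simp add: radon_on_def)
 qed
 moreover have "proportional (restr \<sigma> (?B R)) (et R)" if R: "R >= R0" for R
 proof -
  let ?S = "R0 + Suc R"
  obtain c :: real where c: "c > 0" "ALL X:sets borel. X \<subseteq> ?B R --> em (et ?S) X = ennreal c * em (et R) X"
   using scal[of R ?S] R by auto
  show ?thesis
   unfolding proportional_def
  proof (intro exI[of _ "c / e ?S"] conjI measure_eqI)
   show "c / e ?S > 0" using c(1) e(2)[of ?S] by simp
   show "sets (restr \<sigma> (?B R)) = sets (scale_measure (ennreal (c / e ?S)) (et R))" using s[OF R] \<sigma>s by simp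
   fix X assume "X \<in> sets (restr \<sigma> (?B R))"
   hence X: "X \<in> sets borel" using \<sigma>s by simp
   have "em (restr \<sigma> (?B R)) X = em \<sigma> (?B R Int X)" using \<sigma>s X by (intro emeasure_restr) auto
   also have "... = em (nu (Suc R)) (?B R Int X)"
   proof (rule \<sigma>(2)[rule_format])
   show "?B R Int X \<subseteq> ?B (Suc R)" using mono[OF le_SucI[OF order_refl], of R] by blast
   qed (use X in auto)
   also have "... = ennreal (1 / e ?S) * (ennreal c * em (et R) (?B R Int X))"
   using c(2)[rule_format, of "?B R Int X"] X by (simp add: nu_def)
   also have "em (et R) (?B R Int X) = em (et R) X"
   proof -
   have "em (et R) (X - - ?B R) = em (et R) X"
   using tp(2)[OF R] s[OF R] X by (intro emeasure_Diff_null_set) (auto simp: null_sets_def)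
   moreover have "X - - ?B R = ?B R Int X" by auto
   ultimately show ?thesis by simp
   qed
   also have "ennreal (1 / e ?S) * (ennreal c * em (et R) X) = ennreal (c / e ?S) * em (et R) X"
   using c(1) e(2)[of ?S] by (simp flip: mult.assoc ennreal_mult)
   finally show "em (restr \<sigma> (?B R)) X = em (scale_measure (ennreal (c / e ?S)) (et R)) X" by simp
  qed
 qed
 ultimately show ?thesis unfolding glued_fiber_measure_def using T by blast
qed

text \<open>On each large ball both measures are proportional to the same limit. The factors for
  different balls agree because the ball \<open>?B M\<close> already has positive mass.\<close>

lemma glued_unique:
 assumes "glued_fiber_measure pj mu x nu" "glued_fiber_measure pj mu x nu'" shows "proportional nu nu'"
proof -
 let ?B = "%R :: nat. sup_cball (real R) (0 :: real ^ 'd)"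
 obtain R0 et where T: "nu \<in> radon_on (fiber pj x)" "tube_limits_from pj mu x R0 et" "ALL R>=R0. proportional (restr nu (?B R)) (et R)"
  using assms(1) unfolding glued_fiber_measure_def by blast
 obtain R0' et' where T': "nu' \<in> radon_on (fiber pj x)" "tube_limits_from pj mu x R0' et'" "ALL R>=R0'. proportional (restr nu' (?B R)) (et' R)"
  using assms(2) unfolding glued_fiber_measure_def by blast
 note s = radon_sets[OF T(1)] and s' = radon_sets[OF T'(1)]
 define M where "M = max R0 R0'"
 have p: "proportional (restr nu (?B R)) (restr nu' (?B R))" if R: "R >= M" for R
 proof -
  have "tube_limit pj mu x R (et R)" "tube_limit pj mu x R (et' R)" using T(2) T'(2) R by (auto simp: tube_limits_from_def M_def)
  hence e: "et R = et' R" by (rule tube_limit_unique)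
  have "proportional (restr nu (?B R)) (et R)" "proportional (restr nu' (?B R)) (et R)"
   unfolding e using T(3) T'(3) R e by (auto simp: M_def)
  thus ?thesis using proportional_trans proportional_sym by blast
 qed
 have c: "EX c>0. ALL X:sets borel. X \<subseteq> ?B R --> em nu X = ennreal c * em nu' X" if R: "R >= M" for R
 proof -
  obtain c :: real where c: "c > 0" "ALL X. em (restr nu (?B R)) X = ennreal c * em (restr nu' (?B R)) X"
   using p[OF R] by (rule proportional_emeasure)
  have "em nu X = ennreal c * em nu' X" if X: "X \<in> sets borel" "X \<subseteq> ?B R" for X
  proof -
   have "?B R Int X = X" using X by auto
   thus ?thesis using c(2)[rule_format, of X] emeasure_restr[OF s sup_cball_borel X(1)] emeasure_restr[OF s' sup_cball_borel X(1)] by simp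
  qed
  with c(1) show ?thesis by blast
 qed
 obtain a :: real where a: "a > 0" "ALL X:sets borel. X \<subseteq> ?B M --> em nu X = ennreal a * em nu' X" using c[of M] by auto
 have pos: "em nu' (?B M) > 0"
 proof -
  have tl: "tube_limit pj mu x M (et' M)" using T'(2) by (simp add: tube_limits_from_def M_def)
  obtain c :: real where c: "c > 0" "ALL X. em (restr nu' (?B M)) X = ennreal c * em (et' M) X"
   using T'(3) proportional_emeasure[of "restr nu' (?B M)" "et' M"] by (auto simp: M_def)
  have "em nu' (?B M) = ennreal c * em (et' M) (?B M)"
   using c(2)[rule_format, of "?B M"] emeasure_restr[OF s' sup_cball_borel sup_cball_borel, of "real M" 0 "real M" 0] by simp
  thus ?thesis using c(1) tube_limit_props(3)[OF tl] by (simp add: ennreal_zero_less_mult_iff)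
 qed
 have eq: "em nu X = ennreal a * em nu' X" if R: "R >= M" and X: "X \<in> sets borel" "X \<subseteq> ?B R" for R X
 proof -
  obtain b :: real where b: "b > 0" "ALL X:sets borel. X \<subseteq> ?B R --> em nu X = ennreal b * em nu' X" using c[OF R] by auto
  have "?B M \<subseteq> ?B R" using R by (intro sup_cball_mono) simp
  hence "ennreal b * em nu' (?B M) = ennreal a * em nu' (?B M)" using a(2) b(2) by auto
  hence "ennreal (b * measure nu' (?B M)) = ennreal (a * measure nu' (?B M))"
   using emeasure_fin[OF radon_ball[OF T'(1), of "real M" 0]] a(1) b(1) by (simp add: ennreal_mult)
  hence "b * measure nu' (?B M) = a * measure nu' (?B M)" using a(1) b(1) by (subst (asm) ennreal_inj) auto
  hence "ennreal b = ennreal a" using measure_posI[OF pos radon_ball[OF T'(1)]] by simp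
  thus ?thesis using b(2) X by simp
 qed
 have "nu = scale_measure (ennreal a) nu'"
 proof (rule measure_eqI)
  fix X assume "X \<in> sets nu"
  hence X: "X \<in> sets borel" using s by simp
  have r: "scale_measure (ennreal a) nu' \<in> radon_on (fiber pj x)" by (rule radon_scale[OF T'(1)]) simp
  have le: "em nu (X Int ?B N) = em (scale_measure (ennreal a) nu') (X Int ?B N)" for N
   using eq[of "max M N" "X Int ?B N"] X sup_cball_mono[of "real N" "real (max M N)" "0 :: real ^ 'd"] by auto
  show "em nu X = em (scale_measure (ennreal a) nu') X"
   unfolding radon_SUP_ball[OF T(1) X] radon_SUP_ball[OF r X] le ..
 qed (simp add: s s')
 thus ?thesis using a(1) unfolding proportional_def by blast
qed

lemma fiber_measure_eq:
 assumes "glued_fiber_measure pj mu x nu"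
 shows "fiber_measure_defined pj mu x" "glued_fiber_measure pj mu x (fiber_measure pj mu x)" "proportional (fiber_measure pj mu x) nu"
proof -
 show d: "fiber_measure_defined pj mu x"
  using assms unfolding glued_fiber_measure_def fiber_measure_defined_def by blast
 show g: "glued_fiber_measure pj mu x (fiber_measure pj mu x)"
  using d assms unfolding fiber_measure_def by (simp add: someI_ex[of "glued_fiber_measure pj mu x"] exI[of _ nu] someI)
 show "proportional (fiber_measure pj mu x) nu" by (rule glued_unique[OF g assms])
qed

lemma fiber_measure_radon: "fiber_measure pj mu x \<in> radon_on (fiber pj x)"
proof (cases "fiber_measure_defined pj mu x")
 case True
 then obtain nu where "glued_fiber_measure pj mu x nu" using glued_exists by blast
 thus ?thesis using fiber_measure_eq(2) unfolding glued_fiber_measure_def by blast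
next
 case False
 thus ?thesis by (simp add: fiber_measure_def radon_on_def)
qed

lemma glued_from_limits:
 assumes nu: "nu \<in> radon_on (fiber pj x)" and p: "em nu (sup_cball (real R0) 0) > 0"
  and l: "!!R. R >= R0 ==> tube_limit pj mu x R (uniform_measure nu (cb R))"
 shows "glued_fiber_measure pj mu x nu"
proof -
 let ?B = "%R :: nat. sup_cball (real R) (0 :: real ^ 'd)"
 have mono: "?B R \<subseteq> ?B R'" if "R <= R'" for R R' using that by (intro sup_cball_mono) simp
 have pR: "em nu (?B R) > 0" if "R >= R0" for R
  using p emeasure_mono[OF mono[OF that], of nu] radon_sets[OF nu] by (auto intro: order_less_le_trans)
 have "tube_limits_from pj mu x R0 (%R. uniform_measure nu (?B R))"
  unfolding tube_limits_from_def
  using l uniform_proportional(1)[OF nu mono _ _ pR radon_ball[OF nu]] by auto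
 moreover have "ALL R>=R0. proportional (restr nu (?B R)) (uniform_measure nu (?B R))"
  using uniform_proportional(2)[OF nu order_refl _ _ pR radon_ball[OF nu]] by auto
 ultimately show ?thesis unfolding glued_fiber_measure_def using nu by blast
qed

theorem fiber_measure_AE:
 "AE x in mu. fiber_measure_defined pj mu x & proportional (fiber_measure pj mu x) (fm pj mu x) & fconv pj mu x (fm pj mu x)"
 using fm_AE[OF lin mu]
proof eventually_elim
 case (elim x)
 let ?B = "%R :: nat. sup_cball (real R) (0 :: real ^ 'd)"
 have nu: "fm pj mu x \<in> radon_on (fiber pj x)" and sx: "x \<in> msupp (fm pj mu x)" using elim by (auto simp: fconv_def)
 have "em (fm pj mu x) UNIV > 0" using sx unfolding msupp_def by auto
 then obtain R0 where R0: "em (fm pj mu x) (?B R0) > 0"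
  using radon_SUP_ball[OF nu, of UNIV] by (auto simp: less_SUP_iff)
 have "em (fm pj mu x) (?B R) > 0" if "R >= R0" for R
  using R0 emeasure_mono[OF sup_cball_mono[of "real R0" "real R" 0], of "fm pj mu x"] that radon_sets[OF nu] by (auto intro: order_less_le_trans)
 hence "glued_fiber_measure pj mu x (fm pj mu x)" using elim by (intro glued_from_limits[OF nu R0]) blast
 thus ?case using fiber_measure_eq elim by blast
qed

end

section \<open>Null sets of conditional measures and the glued disintegration\<close>

context
 fixes pj :: "real ^ 'd => real ^ 'k" and mu :: "(real ^ 'd) measure"
 assumes lin: "linear pj" and mu: "mu \<in> radon_on UNIV"
begin

lemma kap_pullout:
 assumes u: "u \<in> bm (VA pj)" and F: "F \<in> bm borel"
 shows "(\<integral>\<^sup>+x. u x * (\<integral>\<^sup>+y. F y \<partial>kap pj mu x) \<partial>mw mu) = (\<integral>\<^sup>+x. u x * F x \<partial>mw mu)"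
 using u
proof (induction rule: borel_measurable_induct)
 case (cong f g)
 hence "f = g" by auto
 thus ?case using cong by simp
next
 case (set A)
 thus ?case by (rule kap_nn_integral[OF lin mu _ F])
next
 case (mult u c)
 have [measurable]: "u \<in> bm (mw mu)" "(%x. \<integral>\<^sup>+y. F y \<partial>kap pj mu x) \<in> bm (mw mu)" "F \<in> bm (mw mu)"
  using VA_mw[OF lin mu mult(2)] VA_mw[OF lin mu kap_nn_measurable[OF lin mu F]] F mw_sets[OF mu] by (simp_all cong: mcs)
 show ?case using mult by (simp add: mult.assoc nn_integral_cmult)
next
 case (add u v)
 have [measurable]: "u \<in> bm (mw mu)" "v \<in> bm (mw mu)" "(%x. \<integral>\<^sup>+y. F y \<partial>kap pj mu x) \<in> bm (mw mu)" "F \<in> bm (mw mu)"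
  using VA_mw[OF lin mu add(1)] VA_mw[OF lin mu add(3)] VA_mw[OF lin mu kap_nn_measurable[OF lin mu F]] F mw_sets[OF mu] by (simp_all cong: mcs)
 show ?case using add by (simp add: distrib_right nn_integral_add)
next
 case (seq U)
 have [measurable]: "!!i. U i \<in> bm (mw mu)" "(%x. \<integral>\<^sup>+y. F y \<partial>kap pj mu x) \<in> bm (mw mu)" "F \<in> bm (mw mu)"
  using VA_mw[OF lin mu seq(1)] VA_mw[OF lin mu kap_nn_measurable[OF lin mu F]] F mw_sets[OF mu] by (simp_all cong: mcs)
 have e: "(\<integral>\<^sup>+x. (SUP i. U i) x * G x \<partial>mw mu) = (SUP i. \<integral>\<^sup>+x. U i x * G x \<partial>mw mu)" if [measurable]: "G \<in> bm (mw mu)" for G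
 proof -
  have "(\<integral>\<^sup>+x. (SUP i. U i) x * G x \<partial>mw mu) = (\<integral>\<^sup>+x. (SUP i. U i x * G x) \<partial>mw mu)"
   by (simp add: SUP_mult_right_ennreal image_comp)
  also have "... = (SUP i. \<integral>\<^sup>+x. U i x * G x \<partial>mw mu)"
   using \<open>incseq U\<close> by (intro nn_integral_monotone_convergence_SUP) (auto simp: incseq_def le_fun_def intro!: mult_right_mono)
  finally show ?thesis .
 qed
 have u: "u = (SUP i. U i)" by fact
 have m1: "(%x. \<integral>\<^sup>+y. F y \<partial>kap pj mu x) \<in> bm (mw mu)" and m2: "F \<in> bm (mw mu)" by measurable
 show ?case by (simp only: u e[OF m1] e[OF m2] seq.IH)
qed

lemma mw_nn:
 assumes "F \<in> bm borel"
 shows "(\<integral>\<^sup>+x. F x \<partial>mu) = (\<integral>\<^sup>+x. ennreal (1 / wt mu x) * F x \<partial>mw mu)"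
proof -
 have [measurable]: "F \<in> bm mu" "wt mu \<in> bm mu"
  using assms wt_borel[of mu] radon_sets[OF mu] by (simp_all cong: mcs)
 have "(\<integral>\<^sup>+x. ennreal (1 / wt mu x) * F x \<partial>mw mu) = (\<integral>\<^sup>+x. ennreal (wt mu x) * (ennreal (1 / wt mu x) * F x) \<partial>mu)"
  unfolding mw_def by (rule nn_integral_density) measurable
 also have "... = (\<integral>\<^sup>+x. F x \<partial>mu)"
 proof (rule nn_integral_cong)
  fix x
  have "ennreal (wt mu x) * ennreal (1 / wt mu x) = 1"
   using wt_pos[of mu x] by (simp add: less_imp_le less_imp_neq[symmetric] flip: ennreal_mult)
  thus "ennreal (wt mu x) * (ennreal (1 / wt mu x) * F x) = F x" by (simp flip: mult.assoc)
 qed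
 finally show ?thesis by simp
qed

lemma fm_emeasure_measurable:
 assumes "X \<in> sets borel" shows "(%x. em (fm pj mu x) X) \<in> bm (VA pj)"
 unfolding fm_emeasure[OF lin mu assms]
 by (rule kap_nn_measurable[OF lin mu]) (use assms wt_borel[of mu] in measurable)

text \<open>Division of \<open>kap\<close> by the weight converts the outer integral over
  \<open>mw mu\<close> into one over \<open>mu\<close>; factors that are constant on fibers pass
  through.\<close>

lemma fm_pullout:
 assumes u: "u \<in> bm (VA pj)" and X: "X \<in> sets borel"
 shows "(\<integral>\<^sup>+x. u x * em (fm pj mu x) X \<partial>mw mu) = (\<integral>\<^sup>+x. u x * indicator X x \<partial>mu)"
proof -
 have m: "(%y. ennreal (1 / wt mu y) * indicator X y) \<in> bm borel" using X wt_borel[of mu] by measurable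
 have um: "(%x. u x * indicator X x) \<in> bm borel" using VA_borel_measurable[OF lin u] X by measurable
 show ?thesis
  unfolding fm_emeasure[OF lin mu X] kap_pullout[OF u m] mw_nn[OF um] by (simp add: mult_ac)
qed

lemma fm_null_AE:
 assumes E: "E \<in> sets borel" "em mu E = 0" shows "AE y in mu. em (fm pj mu y) E = 0"
proof -
 have "(\<integral>\<^sup>+x. 1 * em (fm pj mu x) E \<partial>mw mu) = (\<integral>\<^sup>+x. 1 * indicator E x \<partial>mu)" by (rule fm_pullout[OF _ E(1)]) simp
 hence "(\<integral>\<^sup>+x. em (fm pj mu x) E \<partial>mw mu) = 0" using E radon_sets[OF mu] by simp
 hence "AE y in mw mu. em (fm pj mu y) E = 0"
  using VA_mw[OF lin mu fm_emeasure_measurable[OF E(1)]] by (subst (asm) nn_integral_0_iff_AE) auto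
 thus ?thesis by (simp only: mw_AE[OF mu])
qed

text \<open>Countably many pieces of diameter at most \<open>d\<close> cover \<open>E\<close>, and
  by \<open>fm_pos_AE\<close> almost every point of a piece gives it positive conditional mass. The
  local form is needed because the quasi-Palm property speaks about arbitrarily small neighbourhoods
  of 0.\<close>

lemma fm_local_null:
 assumes E: "E \<in> sets borel" and d: "d > 0" and z: "AE y in mu. em (fm pj mu y) (E Int sup_cball d y) = 0"
 shows "em mu E = 0"
proof -
 obtain D :: "(real ^ 'd) set" where D: "countable D" "!!X. open X ==> X ~= {} ==> EX d:D. d \<in> X"
  using countable_dense_setE by blast
 have cover: "EX q:D. y \<in> sup_cball (d / 2) q" for y
 proof -
  obtain q where "q \<in> D" "q \<in> ball y (d / 2)" using D(2)[of "ball y (d / 2)"] d by auto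
  thus ?thesis using infnorm_le_norm[of "y - q"] by (intro bexI[of _ q]) (auto simp: mem_sup_cball dist_norm)
 qed
 have "em mu (E Int sup_cball (d / 2) q) = 0" for q
 proof -
  let ?X = "E Int sup_cball (d / 2) q"
  have X: "?X \<in> sets borel" using E by auto
  have "AE y in mu. y \<notin> ?X"
   using fm_pos_AE[OF lin mu X] z
  proof eventually_elim
   case (elim y)
   show ?case
   proof
   assume y: "y \<in> ?X"
   have "?X \<subseteq> E Int sup_cball d y"
   proof
   fix v assume v: "v \<in> ?X"
   have "infnorm (v - y) <= infnorm (v - q) + infnorm (q - y)" using infnorm_triangle[of "v - q" "q - y"] by simp
   thus "v \<in> E Int sup_cball d y" using v y infnorm_sub[of q y] by (auto simp: mem_sup_cball)
   qed
   hence "em (fm pj mu y) ?X <= em (fm pj mu y) (E Int sup_cball d y)"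
   using E fm_sets[OF lin mu] by (intro emeasure_mono) auto
   thus False using elim y by simp
   qed
  qed
  thus ?thesis using AE_iff_measurable[of ?X mu "%y. y \<notin> ?X"] X radon_sets[OF mu] radon_space[OF mu] by auto
 qed
 hence "(\<Union>q\<in>D. E Int sup_cball (d / 2) q) \<in> null_sets mu"
  using E radon_sets[OF mu] by (intro null_sets_UN'[OF D(1)]) (auto simp: null_sets_def)
 moreover have "(\<Union>q\<in>D. E Int sup_cball (d / 2) q) = E" using cover by blast
 ultimately show ?thesis by auto
qed

lemma uniform_restr_AE:
 assumes "em mu (cb R) > 0" "AE x in mu. x \<in> cb R --> Q x"
 shows "AE x in uniform_measure mu (cb R). Q x"
 using assms radon_ball[OF mu, of "real R" 0] radon_sets[OF mu]
 by (intro AE_uniform_measureI) auto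

text \<open>On a ball the conditional probabilities are the normalised restrictions of
  \<open>fm\<close>. The normalising factor \<open>e\<close> is constant on fibers, so
  \<open>fm_pullout\<close> can be used in both directions and the auxiliary measure
  \<open>mw mu\<close> drops out.\<close>

theorem glued_disintegration_fiber_measure: "glued_disintegration pj mu (fiber_measure pj mu)"
 unfolding glued_disintegration_def
proof (intro conjI allI impI)
 show "AE x in mu. fiber_measure pj mu x \<in> radon_on (fiber pj x)" by (intro AE_I2 fiber_measure_radon[OF lin mu])
 fix R :: nat
 let ?B = "sup_cball (real R) (0 :: real ^ 'd)"
 assume pB: "em mu ?B > 0"
 define e where "e x = em (fm pj mu x) ?B" for x
 define k where "k x = (if e x > 0 then uniform_measure (fm pj mu x) ?B else return borel 0)" for x
 note fs = fm_sets[OF lin mu] and mus = radon_sets[OF mu]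
 have fin: "e x < \<infinity>" for x unfolding e_def by (rule fm_ball[OF lin mu])
 have em: "e \<in> bm (VA pj)" unfolding e_def by (rule fm_emeasure_measurable) simp
 have kX: "em (k x) X = (if e x > 0 then em (fm pj mu x) (?B Int X) / e x else indicator X 0)" if "X \<in> sets borel" for x X
  using that fs by (simp add: k_def e_def)
 have kXm: "(%x. em (k x) X) \<in> bm (VA pj)" if X: "X \<in> sets borel" for X
 proof -
  have [measurable]: "e \<in> bm (VA pj)" "(%x. em (fm pj mu x) (?B Int X)) \<in> bm (VA pj)"
   using em fm_emeasure_measurable[of "?B Int X"] X by auto
  show ?thesis unfolding kX[OF X] by measurable
 qed
 have kp: "prob_space (k x)" for x
  using fin[of x] fs by (auto simp: k_def e_def less_top[symmetric] intro!: prob_space_uniform_measure prob_space_return)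
 have km: "k \<in> VA pj \<rightarrow>\<^sub>M prob_algebra borel"
  by (intro measurable_prob_algebraI measurable_subprob_algebra kp kXm prob_space_imp_subprob_space) (auto simp: k_def fs)
 have posB: "AE x in mu. x \<in> ?B --> e x > 0" unfolding e_def by (rule fm_pos_AE[OF lin mu]) simp
 have f1: "AE x in mu. x \<in> ?B --> em (k x) (fiber pj x) = 1"
  using posB fiber_measure_AE[OF lin mu]
 proof eventually_elim
  case (elim x)
  show ?case
  proof
   assume "x \<in> ?B"
   hence ex: "e x > 0" using elim by blast
   have r: "fm pj mu x \<in> radon_on (fiber pj x)" using elim by (simp add: fconv_def)
   have fb: "fiber pj x \<in> sets borel" by (rule fiber_borel[OF lin])
   have "em (fm pj mu x) (?B - - fiber pj x) = em (fm pj mu x) ?B"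
   using r fs fb by (intro emeasure_Diff_null_set) (auto simp: radon_on_def null_sets_def)
   moreover have "?B - - fiber pj x = ?B Int fiber pj x" by auto
   ultimately show "em (k x) (fiber pj x) = 1"
   using kX[OF fb, of x] ex fin[of x] by (simp add: e_def ennreal_divide_self)
  qed
 qed
 have f2: "em (uniform_measure mu ?B) A = (\<integral>\<^sup>+x. em (k x) A \<partial>uniform_measure mu ?B)" if A: "A \<in> sets borel" for A
 proof -
  have [measurable]: "(%x. em (k x) A) \<in> bm mu" "?B \<in> sets mu"
   using VA_borel_measurable[OF lin kXm[OF A]] mus by (simp_all cong: mcs)
  have ue: "em (k x) A * e x = em (fm pj mu x) (?B Int A)" for x
  proof (cases "e x > 0")
   case True
   thus ?thesis using kX[OF A] fin[of x] by (simp add: ennreal_divide_times ennreal_mult_divide_eq less_top[symmetric])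
  next
   case False
   hence "e x = 0" by (simp add: zero_less_iff_neq_zero)
   moreover have "em (fm pj mu x) (?B Int A) <= e x" unfolding e_def using fs A by (intro emeasure_mono) auto
   ultimately show ?thesis by simp
  qed
  have "(\<integral>\<^sup>+x. em (k x) A * indicator ?B x \<partial>mu) = (\<integral>\<^sup>+x. em (k x) A * e x \<partial>mw mu)"
   unfolding e_def by (rule fm_pullout[OF kXm[OF A], symmetric]) simp
  also have "... = (\<integral>\<^sup>+x. 1 * em (fm pj mu x) (?B Int A) \<partial>mw mu)" unfolding ue by simp
  also have "... = (\<integral>\<^sup>+x. 1 * indicator (?B Int A) x \<partial>mu)" by (rule fm_pullout) (use A in auto)
  also have "... = em mu (?B Int A)" using A mus by simp
  finally have I: "(\<integral>\<^sup>+x. em (k x) A * indicator ?B x \<partial>mu) = em mu (?B Int A)" .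
  have "(\<integral>\<^sup>+x. em (k x) A \<partial>uniform_measure mu ?B) = (\<integral>\<^sup>+x. em (k x) A * indicator ?B x \<partial>mu) / em mu ?B"
   by (rule nn_integral_uniform_measure) measurable
  thus ?thesis using I A mus by simp
 qed
 have f3: "AE x in mu. x \<in> ?B --> proportional (restr (fiber_measure pj mu x) ?B) (k x)"
  using posB fiber_measure_AE[OF lin mu]
 proof eventually_elim
  case (elim x)
  show ?case
  proof
   assume "x \<in> ?B"
   hence ex: "e x > 0" using elim by blast
   obtain c :: real where c: "c > 0" "fiber_measure pj mu x = scale_measure (ennreal c) (fm pj mu x)"
   using elim by (auto simp: proportional_def)
   have "restr (fiber_measure pj mu x) ?B = scale_measure (ennreal c) (restr (fm pj mu x) ?B)"
   proof (rule measure_eqI)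
   fix X assume "X \<in> sets (restr (fiber_measure pj mu x) ?B)"
   hence X: "X \<in> sets borel" by (simp add: c(2) fs)
   show "em (restr (fiber_measure pj mu x) ?B) X = em (scale_measure (ennreal c) (restr (fm pj mu x) ?B)) X"
   using X by (simp add: emeasure_restr c(2) fs)
   qed (simp add: c(2))
   hence "proportional (restr (fiber_measure pj mu x) ?B) (restr (fm pj mu x) ?B)"
   using c(1) unfolding proportional_def by blast
   moreover have "proportional (restr (fm pj mu x) ?B) (k x)"
   using uniform_proportional(2)[OF fm_radon_UNIV[OF lin mu] order_refl, of ?B x] ex fin[of x] by (simp add: k_def e_def)
   ultimately show "proportional (restr (fiber_measure pj mu x) ?B) (k x)" by (rule proportional_trans)
  qed
 qed
 show "EX ka. fiber_disintegration pj (uniform_measure mu ?B) ka &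
   (AE x in mu. x \<in> ?B --> proportional (restr (fiber_measure pj mu x) ?B) (ka x))"
  using km uniform_restr_AE[OF pB f1] f2 f3
  unfolding fiber_disintegration_def VA_def by (intro exI[of _ k]) blast
qed

end

section \<open>Normalised push-forwards and supports\<close>

lemma star_proportional: assumes "proportional nu nu'" shows "star nu = star nu'"
proof -
 obtain c :: real where c: "c > 0" "nu = scale_measure (ennreal c) nu'" using assms by (auto simp: proportional_def)
 let ?m = "measure nu' (sup_cball 1 0)"
 have m: "measure nu (sup_cball 1 0) = c * ?m" using c by simp
 show ?thesis
 proof (cases "?m = 0")
  case True thus ?thesis using m by (simp add: star_def c(2))
 next
  case False
  hence "ennreal (1 / (c * ?m)) * ennreal c = ennreal (1 / ?m)"
   using c(1) by (simp flip: ennreal_mult)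
  thus ?thesis unfolding star_def m by (simp add: c(2))
 qed
qed

lemma star_scale: "c > 0 ==> star (scale_measure (ennreal c) nu) = star nu"
 by (rule star_proportional) (auto simp: proportional_def)

lemma distr_scale_measure:
 "f \<in> M \<rightarrow>\<^sub>M N ==> distr (scale_measure c M) N f = scale_measure c (distr M N f)"
 by (rule measure_eqI) (auto simp: emeasure_distr space_scale_measure cong: mcs)

lemma msupp_scale: "c > 0 ==> x \<in> msupp nu ==> x \<in> msupp (scale_measure (ennreal c) nu)"
 by (auto simp: msupp_def ennreal_zero_less_mult_iff)

lemma msupp_ball:
 assumes nu: "nu \<in> radon_on A" and x: "x \<in> msupp nu" and r: "r > 0"
 shows "em nu (sup_cball r x) > 0" "measure nu (sup_cball r x) > 0"
proof -
 have "open {y. infnorm (y - x) < r}" by (intro open_Collect_less continuous_intros)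
 hence "em nu {y. infnorm (y - x) < r} > 0" using x r unfolding msupp_def by auto
 also have "em nu {y. infnorm (y - x) < r} <= em nu (sup_cball r x)"
  using radon_sets[OF nu] by (intro emeasure_mono) (auto simp: mem_sup_cball)
 finally show e: "em nu (sup_cball r x) > 0" .
 show "measure nu (sup_cball r x) > 0" by (rule measure_posI[OF e radon_ball[OF nu]])
qed

lemma msuppI:
 assumes nu: "nu \<in> radon_on A" and "!!r. r > 0 ==> em nu {y. infnorm (y - x) < r} > 0"
 shows "x \<in> msupp nu"
 unfolding msupp_def
proof (intro CollectI allI impI)
 fix U :: "(real ^ 'a) set" assume U: "open U" "x \<in> U"
 then obtain d where d: "d > 0" "ALL y. infnorm (y - x) < d --> y \<in> U" by (rule open_infnorm_ball)
 have "em nu {y. infnorm (y - x) < d} <= em nu U"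
  using d U radon_sets[OF nu] by (intro emeasure_mono) auto
 thus "em nu U > 0" using assms(2)[OF d(1)] by (rule order_less_le_trans[rotated])
qed

text \<open>For the identity map tubes are open sup-norm balls, so the covering theorems also yield
  the classical facts on supports and density points.\<close>

lemma qn_id: "qn (%x. x) z = infnorm (z :: real ^ 'd)"
 by (simp add: qn_def)

lemma linear_id': "linear (%x :: real ^ 'd. x)"
 by (simp add: linear_iff)

lemma mem_tube_id: "y \<in> tube (%x. x) x r \<longleftrightarrow> infnorm (y - x :: real ^ 'd) < r"
 by (simp add: mem_tube[OF linear_id'] qn_id)

lemma msupp_AE: assumes "mu \<in> radon_on A" shows "AE x in (mu :: (real ^ 'd) measure). x \<in> msupp mu"
 using tube_positive_AE[OF linear_id' radon_sets[OF assms]]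
proof eventually_elim
 case (elim x)
 show ?case
 proof (rule msuppI[OF assms])
  fix r :: real assume "r > 0"
  moreover have "tube (%x. x) x r = {y. infnorm (y - x) < r}" using mem_tube_id[of _ x r] by auto
  ultimately show "em mu {y. infnorm (y - x) < r} > 0" using elim by metis
 qed
qed

text \<open>Common form of the translations (\<open>s = 1\<close>) and of the scalings
  (\<open>s = exp t\<close>, \<open>x = 0\<close>), so that both are transported at once.\<close>

definition aff :: "real => real ^ 'd => real ^ 'd => real ^ 'd" where "aff s x y = s *\<^sub>R (y - x)"

lemma aff_borel [measurable]: "aff s x \<in> bm borel"
 unfolding aff_def[abs_def] by measurable

lemma aff_cont: "continuous_on UNIV (aff s x)"
 unfolding aff_def[abs_def] by (intro continuous_intros)

lemma aff_alt: "aff s x = (%y. s *\<^sub>R y + - (s *\<^sub>R x))"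
 by (auto simp: aff_def scaleR_diff_right)

lemma trans_star_aff: "trans_star x mu = star (distr mu borel (aff 1 x))"
 by (simp add: trans_star_def aff_def[abs_def])

lemma scale_star_aff: "scale_star t mu = star (distr mu borel (aff (exp t) 0))"
 by (simp add: scale_star_def aff_def[abs_def])

lemma aff_measurable: "mu \<in> radon_on A ==> aff s x \<in> mu \<rightarrow>\<^sub>M borel"
 by (subst mcs[OF radon_sets refl]) (assumption, rule aff_borel)

lemma aff_radon:
 assumes "mu \<in> radon_on A" "s > 0" "!!y. y \<in> A ==> aff s x y \<in> B" "A \<in> sets borel" "B \<in> sets borel"
 shows "distr mu borel (aff s x) \<in> radon_on B"
 unfolding aff_alt using assms by (intro distr_affine_radon[where A=A]) (auto simp: aff_alt)

lemma aff_msupp: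
 assumes mu: "mu \<in> radon_on A" and z: "z \<in> msupp mu"
 shows "aff s x z \<in> msupp (distr mu borel (aff s x))"
 unfolding msupp_def
proof (intro CollectI allI impI)
 fix U :: "(real ^ 'a) set" assume U: "open U" "aff s x z \<in> U"
 hence o: "open (aff s x -` U)" using continuous_on_open_vimage[OF open_UNIV, of "aff s x"] aff_cont by auto
 have "em (distr mu borel (aff s x)) U = em mu (aff s x -` U)"
  using U radon_space[OF mu] by (subst emeasure_distr[OF aff_measurable[OF mu]]) auto
 also have "... > 0" using z o U unfolding msupp_def by auto
 finally show "em (distr mu borel (aff s x)) U > 0" .
qed

lemma aff_ball:
 assumes mu: "mu \<in> radon_on A" and s: "s > 0"
 shows "em (distr mu borel (aff s x)) (sup_cball r 0) = em mu (sup_cball (r / s) x)"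
proof -
 have "infnorm (s *\<^sub>R (y - x)) = s * infnorm (y - x)" for y using s by (simp add: infnorm_mul)
 hence "aff s x -` sup_cball r 0 = sup_cball (r / s) x"
  using s by (auto simp: aff_def mem_sup_cball pos_le_divide_eq mult.commute simp del: scaleR_diff_right)
 thus ?thesis using radon_space[OF mu] by (subst emeasure_distr[OF aff_measurable[OF mu]]) auto
qed

lemma star_star_space:
 assumes nu: "nu \<in> radon_on V" and z: "0 \<in> msupp nu" shows "star nu \<in> star_space V"
proof -
 let ?m = "measure nu (sup_cball 1 0)"
 have m: "?m > 0" by (rule msupp_ball(2)[OF nu z]) simp
 have "em (star nu) (sup_cball 1 0) = ennreal (1 / ?m) * ennreal ?m"
  unfolding star_def using emeasure_fin[OF radon_ball[OF nu, of 1 0]] by simp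
 also have "... = 1" using m by (simp flip: ennreal_mult)
 finally have "em (star nu) (sup_cball 1 0) = 1" .
 moreover have "0 \<in> msupp (star nu)" unfolding star_def using m z by (intro msupp_scale) auto
 ultimately show ?thesis using star_radon[OF nu] by (simp add: star_space_def)
qed

lemma star_id: "nu \<in> star_space V ==> star nu = nu"
 by (simp add: star_space_def star_def measure_def)

lemma distr_star:
 assumes "nu \<in> radon_on A" "0 \<in> msupp nu"
 shows "star (distr (star nu) borel (aff s x)) = star (distr nu borel (aff s x))"
proof -
 have m: "1 / measure nu (sup_cball 1 0) > 0" using msupp_ball(2)[OF assms, of 1] by simp
 show ?thesis
  unfolding star_def[of nu] distr_scale_measure[OF aff_measurable[OF assms(1)]] by (rule star_scale[OF m])
qed

lemma scale_star_space:
 assumes V: "subspace V" and nu: "nu \<in> star_space V" shows "scale_star t nu \<in> star_space V"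
proof -
 have Vb: "V \<in> sets borel" by (intro borel_closed closed_subspace V)
 have r: "nu \<in> radon_on V" and z: "0 \<in> msupp nu" using nu by (auto simp: star_space_def)
 have "distr nu borel (aff (exp t) 0) \<in> radon_on V"
  by (rule aff_radon[OF r _ _ Vb Vb]) (auto simp: aff_def subspace_scale[OF V])
 moreover have "0 \<in> msupp (distr nu borel (aff (exp t) 0))" using aff_msupp[OF r z, of "exp t" 0] by (simp add: aff_def)
 ultimately show ?thesis unfolding scale_star_aff by (rule star_star_space)
qed

lemma scale_star_add:
 assumes nu: "nu \<in> star_space V" shows "scale_star s (scale_star t nu) = scale_star (s + t) nu"
proof -
 have r: "nu \<in> radon_on UNIV" and z: "0 \<in> msupp nu" using nu radon_UNIV by (auto simp: star_space_def)
 have r': "distr nu borel (aff (exp t) 0) \<in> radon_on UNIV" by (rule aff_radon[OF r]) auto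
 have z': "0 \<in> msupp (distr nu borel (aff (exp t) 0))" using aff_msupp[OF r z, of "exp t" 0] by (simp add: aff_def)
 have "distr (distr nu borel (aff (exp t) 0)) borel (aff (exp s) 0) = distr nu borel (aff (exp (s + t)) 0)"
  using aff_measurable[OF r] by (subst distr_distr) (auto simp: o_def aff_def exp_add intro!: distr_cong)
 thus ?thesis unfolding scale_star_aff distr_star[OF r' z'] by simp
qed

lemma scale_star_0: assumes "nu \<in> star_space V" shows "scale_star 0 nu = nu"
proof -
 have r: "nu \<in> radon_on V" using assms by (simp add: star_space_def)
 have "distr nu borel (%y. y) = nu" using radon_sets[OF r] by (intro distr_id2) simp
 thus ?thesis using star_id[OF assms] by (simp add: scale_star_def)
qed

lemma scale_star_measure:
 assumes nu: "nu \<in> star_space V"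
 shows "measure (scale_star t nu) (sup_cball r 0) = measure nu (sup_cball (r * exp (- t)) 0) / measure nu (sup_cball (exp (- t)) 0)"
proof -
 have r: "nu \<in> radon_on V" using nu by (simp add: star_space_def)
 have "measure (distr nu borel (aff (exp t) 0)) (sup_cball r 0) = measure nu (sup_cball (r * exp (- t)) 0)" for r
  using aff_ball[OF r, of "exp t" 0 r] by (simp add: measure_def exp_minus divide_inverse)
 thus ?thesis unfolding scale_star_aff star_def by simp
qed

context
 fixes pj :: "real ^ 'd => real ^ 'k"
 assumes lin: "linear pj"
begin

lemma subspace_fiber: "subspace (fiber pj 0)"
 using linear_subspace_vimage[OF lin subspace_single_0] linear_0[OF lin] by (simp add: fiber_def)

lemma fconv_aff:
 assumes c: "fconv pj mu x nu" and mu: "mu \<in> radon_on UNIV" and s: "s > 0"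
 shows "fconv pj (distr mu borel (aff s x)) 0 (distr nu borel (aff s x))"
proof -
 obtain c where nu: "nu \<in> radon_on (fiber pj x)" "x \<in> msupp nu" and c: "!!r. r > 0 ==> c r > 0"
  "!!f. f \<in> Cc ==> ((%r. c r * (LINT y|mu. tI pj x r y * f y)) \<longlongrightarrow> (LINT y|nu. f y)) at0"
  using c unfolding fconv_def by blast
 have "distr nu borel (aff s x) \<in> radon_on (fiber pj 0)"
  by (rule aff_radon[OF nu(1) s]) (use lin in \<open>auto simp: mem_fiber aff_def linear_scale linear_diff linear_0 fiber_borel[OF lin]\<close>)
 moreover have "0 \<in> msupp (distr nu borel (aff s x))" using aff_msupp[OF nu, of s x] by (simp add: aff_def)
 moreover have "EX c'. (ALL r>0. c' r > 0) & (ALL f:Cc. ((%r. c' r * (LINT y|distr mu borel (aff s x). tI pj 0 r y * f y)) \<longlongrightarrow> (LINT y|distr nu borel (aff s x). f y)) at0)"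
 \<comment> \<open>Expansion by \<open>s\<close> maps tubes of radius \<open>r / s\<close> to tubes
   of radius \<open>r\<close>, which determines the new constants.\<close>
 proof (intro exI[of _ "%r. c (r / s)"] conjI ballI allI impI)
  fix r :: real assume "r > 0" thus "c (r / s) > 0" using s by (intro c(1)) simp
 next
  fix f :: "real ^ 'd => real" assume f: "f \<in> Cc"
  have fa: "(%y. f (aff s x y)) \<in> Cc" unfolding aff_alt using f s by (intro Cc_comp_affine) auto
  have ta: "aff s x y \<in> tube pj 0 r \<longleftrightarrow> y \<in> tube pj x (r / s)" for y r
  proof -
   have "qn pj (s *\<^sub>R (y - x)) = s * qn pj (y - x)" using s by (simp add: qn_scale[OF lin] del: scaleR_diff_right)
   thus ?thesis using s by (simp add: mem_tube[OF lin] aff_def pos_less_divide_eq mult.commute del: scaleR_diff_right)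
  qed
  have fl: "filterlim (%r. r / s) at0 at0"
  proof -
   have "((%r. r / s) \<longlongrightarrow> 0 / s) at0" by (intro tendsto_intros) (use s in auto)
   thus ?thesis using s eventually_at_right_less[of "0 :: real"] by (auto simp: filterlim_at elim: eventually_mono)
  qed
  have fb: "f \<in> bm borel" by (rule Cc_borel[OF f])
  have tb: "tube pj 0 r \<in> sets borel" for r by (rule tube_borel[OF lin])
  have i1: "(LINT y|distr mu borel (aff s x). tI pj 0 r y * f y) = (LINT y|mu. indicator (tube pj x (r / s)) y * f (aff s x y))" for r
  proof -
   have "(%y. tI pj 0 r y * f y) \<in> bm borel" using fb tb by measurable
   hence "(LINT y|distr mu borel (aff s x). tI pj 0 r y * f y) = (LINT y|mu. indicator (tube pj 0 r) (aff s x y) * f (aff s x y))"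
   by (rule integral_distr[OF aff_measurable[OF mu]])
   thus ?thesis using ta by (simp add: indicator_def)
  qed
  have i2: "(LINT y|distr nu borel (aff s x). f y) = (LINT y|nu. f (aff s x y))"
   by (rule integral_distr[OF aff_measurable[OF nu(1)] fb])
  show "((%r. c (r / s) * (LINT y|distr mu borel (aff s x). tI pj 0 r y * f y)) \<longlongrightarrow> (LINT y|distr nu borel (aff s x). f y)) at0"
   unfolding i1 i2 by (rule filterlim_compose[OF c(2)[OF fa] fl])
 qed
 ultimately show ?thesis unfolding fconv_def by blast
qed

lemma fconv_scale:
 assumes c: "fconv pj mu x nu" and a: "a > 0" and mu: "mu \<in> radon_on UNIV" shows "fconv pj (scale_measure (ennreal a) mu) x nu"
proof -
 obtain c where nu: "nu \<in> radon_on (fiber pj x)" "x \<in> msupp nu" and c: "!!r. r > 0 ==> c r > 0"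
  "!!f. f \<in> Cc ==> ((%r. c r * (LINT y|mu. tI pj x r y * f y)) \<longlongrightarrow> (LINT y|nu. f y)) at0"
  using c unfolding fconv_def by blast
 have "((%r. (c r / a) * (LINT y|scale_measure (ennreal a) mu. tI pj x r y * f y)) \<longlongrightarrow> (LINT y|nu. f y)) at0" if f: "f \<in> Cc" for f
 proof -
  have "(LINT y|scale_measure (ennreal a) mu. tI pj x r y * f y) = a * (LINT y|mu. tI pj x r y * f y)" for r
  proof (rule integral_scale_measure)
   have "f \<in> bm mu" "tube pj x r \<in> sets mu"
   using Cc_borel[OF f] tube_borel[OF lin] radon_sets[OF mu] by (simp_all cong: mcs)
   thus "(%y. tI pj x r y * f y) \<in> bm mu" by measurable
  qed (use a in simp)
  thus ?thesis using c(2)[OF f] a by simp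
 qed
 thus ?thesis unfolding fconv_def using nu c(1) a by (intro conjI exI[of _ "%r. c r / a"]) auto
qed

lemma fconv_star:
 assumes "fconv pj mu x nu" "mu \<in> radon_on UNIV" "measure mu (sup_cball 1 0) > 0" shows "fconv pj (star mu) x nu"
 unfolding star_def using assms by (intro fconv_scale) auto

lemma fconv_trans_star:
 assumes "fconv pj mu x nu" "mu \<in> radon_on UNIV" "x \<in> msupp mu"
 shows "fconv pj (trans_star x mu) 0 (distr nu borel (aff 1 x))"
proof -
 have r: "distr mu borel (aff 1 x) \<in> radon_on UNIV" by (rule aff_radon[OF assms(2)]) auto
 have "0 \<in> msupp (distr mu borel (aff 1 x))" using aff_msupp[OF assms(2,3), of 1 x] by (simp add: aff_def)
 thus ?thesis unfolding trans_star_aff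
  by (intro fconv_star[OF fconv_aff[OF assms(1,2)] r] msupp_ball(2)[OF r]) auto
qed

lemma fconv_scale_star:
 assumes "fconv pj mu 0 nu" "mu \<in> radon_on UNIV" "0 \<in> msupp mu"
 shows "fconv pj (scale_star t mu) 0 (distr nu borel (aff (exp t) 0))"
proof -
 have r: "distr mu borel (aff (exp t) 0) \<in> radon_on UNIV" by (rule aff_radon[OF assms(2)]) auto
 have "0 \<in> msupp (distr mu borel (aff (exp t) 0))" using aff_msupp[OF assms(2,3), of "exp t" 0] by (simp add: aff_def)
 thus ?thesis unfolding scale_star_aff
  by (intro fconv_star[OF fconv_aff[OF assms(1,2)] r] msupp_ball(2)[OF r]) auto
qed

end

section \<open>The limit map at the origin\<close>

definition tint :: "(real ^ 'd => real ^ 'k) => (real ^ 'd => real) => real => (real ^ 'd) measure => real" where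
 "tint pj f r mu = (LINT y|mu. tI pj 0 r y * f y)"

text \<open>Dividing by the integral of the fixed function \<open>tent 1\<close> replaces the
  unknown constants in \<open>fconv\<close> by explicit ones; existence of the limits thereby
  becomes a measurable condition on \<open>mu\<close>.\<close>

definition nratio :: "(real ^ 'd => real ^ 'k) => (real ^ 'd => real) => real => (real ^ 'd) measure => real" where
 "nratio pj f r mu = tint pj f r mu / tint pj (tent 1) r mu"

abbreviation stent :: "nat => real ^ 'd => real" where "stent n \<equiv> tent (rs n)"

text \<open>The testing functions in the definition form a countable set, which makes it measurable; for \<open>mu\<close> in \<open>GG\<close> all ratios converge along all radii, and \<open>N1\<close> is the limit.\<close>

definition GG :: "(real ^ 'd => real ^ 'k) => (real ^ 'd) measure set" where
 "GG pj = {mu \<in> radon_on UNIV. (ALL g:Dc \<union> range stent. EX l. ((%r. nratio pj g r mu) \<longlongrightarrow> l) at0) &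
   (ALL n. lim (%k. nratio pj (stent n) (rs k) mu) > 0)}"

definition N1 :: "(real ^ 'd => real ^ 'k) => (real ^ 'd) measure => (real ^ 'd) measure" where
 "N1 pj mu = (if mu \<in> GG pj then SOME nu. nu \<in> radon_on (fiber pj 0) & 0 \<in> msupp nu &
   (ALL f:Cc. ((%r. nratio pj f r mu) \<longlongrightarrow> (LINT y|nu. f y)) at0) else null_measure borel)"

definition F0 :: "(real ^ 'd => real ^ 'k) => (real ^ 'd) measure => (real ^ 'd) measure" where
 "F0 pj mu = star (N1 pj mu)"

lemma tent_integral_pos:
 assumes "nu \<in> radon_on A" "0 \<in> msupp nu" "r > 0" shows "(LINT y|nu. tent r y) > 0"
proof (rule ccontr)
 assume "\<not> ?thesis"
 moreover have "(LINT y|nu. tent r y) >= 0" by (rule Bochner_Integration.integral_nonneg) simp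
 ultimately have "(LINT y|nu. tent r y) = 0" by linarith
 hence "AE y in nu. tent r y = 0"
  using Cc_integrable[OF assms(1) tent_Cc] by (subst (asm) integral_nonneg_eq_0_iff_AE) auto
 hence "AE y in nu. y \<notin> {y. infnorm (y - 0) < r}" by eventually_elim (use tent_pos[of r] in force)
 moreover have o: "open {y :: real ^ 'a. infnorm (y - 0) < r}" by (intro open_Collect_less continuous_intros)
 ultimately have "em nu {y. infnorm (y - 0) < r} = 0"
  using radon_sets[OF assms(1)] radon_space[OF assms(1)] by (subst (asm) AE_iff_null_sets[symmetric]) auto
 moreover have "em nu {y. infnorm (y - 0) < r} > 0" using o assms(2,3) unfolding msupp_def by (auto simp: infnorm_0)
 ultimately show False by simp
qed

lemma star_space_sets: "star_space V \<in> sets (radon_borel V)"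
proof -
 have m: "{mu \<in> space (radon_borel V). em mu (sup_cball 1 0) = 1 & (ALL n. em mu {y. infnorm (y - 0) < rs n} > 0)} \<in> sets (radon_borel V)"
 proof -
  have [measurable]: "{y :: real ^ 'a. infnorm (y - 0) < rs n} \<in> sets borel" for n
   by (intro borel_open open_Collect_less continuous_intros)
  show ?thesis by measurable
 qed
 have iff: "(ALL n. em mu {y. infnorm (y - 0) < rs n} > 0) \<longleftrightarrow> 0 \<in> msupp mu" if mu: "mu \<in> radon_on V" for mu
 proof
  assume p: "ALL n. em mu {y. infnorm (y - 0) < rs n} > 0"
  show "0 \<in> msupp mu"
  proof (rule msuppI[OF mu])
   fix r :: real assume "r > 0"
   then obtain n where n: "rs n < r" using nat_approx_posE by blast
   show "em mu {y. infnorm (y - 0) < r} > 0"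
   by (rule order_less_le_trans[OF p[rule_format, of n]], rule emeasure_mono) (use n radon_sets[OF mu] in auto)
  qed
 next
  assume z: "0 \<in> msupp mu"
  show "ALL n. em mu {y. infnorm (y - 0) < rs n} > 0"
  proof
   fix n
   have "open {y :: real ^ 'a. infnorm (y - 0) < rs n}" by (intro open_Collect_less continuous_intros)
   thus "em mu {y. infnorm (y - 0) < rs n} > 0" using z unfolding msupp_def by (auto simp: infnorm_0)
  qed
 qed
 have "star_space V = {mu \<in> space (radon_borel V). em mu (sup_cball 1 0) = 1 & (ALL n. em mu {y. infnorm (y - 0) < rs n} > 0)}"
  unfolding star_space_def space_radon_borel using iff by blast
 with m show ?thesis by (simp only:)
qed

context
 fixes pj :: "real ^ 'd => real ^ 'k"
 assumes lin: "linear pj"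
begin

lemma tint_measurable: assumes f: "f \<in> Cc" shows "tint pj f r \<in> bm (radon_borel UNIV)"
proof -
 let ?h = "%y. tI pj 0 r y * f y"
 have [measurable]: "f \<in> bm borel" by (rule Cc_borel[OF f])
 have [measurable]: "tube pj 0 r \<in> sets borel" by (rule tube_borel[OF lin])
 have "tint pj f r mu = enn2real (\<integral>\<^sup>+y. ennreal (?h y) \<partial>mu) - enn2real (\<integral>\<^sup>+y. ennreal (- ?h y) \<partial>mu)" if "mu \<in> radon_on UNIV" for mu
  unfolding tint_def
  by (rule real_lebesgue_integral_def)
   (use integrable_mult_indicator[OF _ Cc_integrable[OF that f], of "tube pj 0 r"] radon_sets[OF that] tube_borel[OF lin] in simp)
 moreover have "(%mu. enn2real (\<integral>\<^sup>+y. ennreal (?h y) \<partial>mu) - enn2real (\<integral>\<^sup>+y. ennreal (- ?h y) \<partial>mu)) \<in> bm (radon_borel UNIV)"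
  by (intro borel_measurable_diff borel_measurable_enn2real nn_integral_radon_kernel[where A=UNIV and G="%x. x"]) measurable
 ultimately show ?thesis by (subst measurable_cong) auto
qed

lemma nratio_measurable: "f \<in> Cc ==> nratio pj f r \<in> bm (radon_borel UNIV)"
 unfolding nratio_def[abs_def] by (intro borel_measurable_divide tint_measurable tent_Cc)

lemma nratio_lim_measurable: "f \<in> Cc ==> (%mu. lim (%k. nratio pj f (rs k) mu)) \<in> bm (radon_borel UNIV)"
 by (intro borel_measurable_lim_metric nratio_measurable)

lemma GG_sets: "GG pj \<in> sets (radon_borel UNIV)"
proof -
 have c: "countable (Dc \<union> range stent :: (real ^ 'd => real) set)" using countable_Dc by simp
 have DC: "g \<in> Cc" if "g \<in> Dc \<union> range stent" for g :: "real ^ 'd => real" using that Dc_Cc tent_Cc by auto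
 have "{mu \<in> space (radon_borel UNIV). EX l. ((%r. nratio pj g r mu) \<longlongrightarrow> l) at0} \<in> sets (radon_borel UNIV)" if g: "g \<in> Dc \<union> range stent" for g
 proof (rule lim_at_right_measurable)
  show "nratio pj g r \<in> bm (radon_borel UNIV)" for r by (rule nratio_measurable[OF DC[OF g]])
  show "((%s. nratio pj g s om) \<longlongrightarrow> nratio pj g r om) (at_left r)" if w: "om \<in> space (radon_borel UNIV)" for om r
   unfolding nratio_def tint_def
   by (rule tube_ratio_left[OF lin]) (use w radon_sets[of om UNIV] Cc_integrable[of om UNIV] DC[OF g] tent_Cc in auto)
 qed
 hence 1: "(\<Inter>g\<in>Dc \<union> range stent. {mu \<in> space (radon_borel UNIV). EX l. ((%r. nratio pj g r mu) \<longlongrightarrow> l) at0}) \<in> sets (radon_borel UNIV)"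
  by (intro sets.countable_INT'[OF c]) auto
 have [measurable]: "(%mu. lim (%k. nratio pj (stent n) (rs k) mu)) \<in> bm (radon_borel UNIV)" for n
  by (rule nratio_lim_measurable[OF tent_Cc])
 have 2: "{mu \<in> space (radon_borel UNIV). ALL n. lim (%k. nratio pj (stent n) (rs k) mu) > 0} \<in> sets (radon_borel UNIV)"
  by measurable
 have "GG pj = (\<Inter>g\<in>Dc \<union> range stent. {mu \<in> space (radon_borel UNIV). EX l. ((%r. nratio pj g r mu) \<longlongrightarrow> l) at0}) Int   {mu \<in> space (radon_borel UNIV). ALL n. lim (%k. nratio pj (stent n) (rs k) mu) > 0}"
  unfolding GG_def by auto
 thus ?thesis using sets.Int[OF 1 2] by simp
qed

text \<open>Convergence of the ratios for \<open>Dc\<close> produces the measure; the strictly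
  positive limits for the shrinking tents put the origin into its support.\<close>

lemma GG_limit:
 assumes g: "mu \<in> GG pj"
 shows "EX nu. nu \<in> radon_on (fiber pj 0) & 0 \<in> msupp nu & (ALL f:Cc. ((%r. nratio pj f r mu) \<longlongrightarrow> (LINT y|nu. f y)) at0)"
proof -
 have mu: "mu \<in> radon_on UNIV" using g by (simp add: GG_def)
 define m where "m r = scale_measure (ennreal (1 / tint pj (tent 1) r mu)) (restr mu (tube pj 0 r))" for r
 have t0: "tint pj (tent 1) r mu >= 0" for r unfolding tint_def by (rule Bochner_Integration.integral_nonneg) simp
 have mr: "m r \<in> radon_on UNIV" for r
  unfolding m_def using restr_radon[OF mu tube_borel[OF lin]] radon_UNIV by (intro radon_scale) auto
 have mi: "(LINT y|m r. f y) = nratio pj f r mu" if "f \<in> Cc" for f r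
 proof -
  have [measurable]: "f \<in> bm mu" "tube pj 0 r \<in> sets mu"
   using Cc_borel[OF that] tube_borel[OF lin] radon_sets[OF mu] by (simp_all cong: mcs)
  have e: "restr mu (tube pj 0 r) = density mu (%y. ennreal (tI pj 0 r y))"
   unfolding restr_def by (intro density_cong) (auto simp: indicator_def)
  have "(LINT y|restr mu (tube pj 0 r). f y) = tint pj f r mu"
   unfolding tint_def e by (subst integral_density) auto
  moreover have "f \<in> bm (restr mu (tube pj 0 r))" unfolding restr_def by simp
  ultimately show ?thesis unfolding m_def nratio_def using t0[of r] by (subst integral_scale_measure) auto
 qed
 have "EX l. ((%r. \<integral>y. f y \<partial>m r) \<longlongrightarrow> l) at0" if "f \<in> Dc" for f
  unfolding mi[OF Dc_Cc[OF that]] using g that unfolding GG_def by blast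
 then obtain nu where nu: "nu \<in> radon_on UNIV" "ALL f:Cc. ((%r. \<integral>y. f y \<partial>m r) \<longlongrightarrow> (LINT y|nu. f y)) at0"
  using vague_limit_exists[of m UNIV] mr by auto
 have l: "((%r. nratio pj f r mu) \<longlongrightarrow> (LINT y|nu. f y)) at0" if "f \<in> Cc" for f
  using nu(2) that mi[OF that] by auto
 have "nu \<in> radon_on (fiber pj 0)"
 proof (rule fiber_support[OF lin nu(1)])
  fix f :: "real ^ 'd => real" and d :: real assume f: "f \<in> Cc" "d > 0" "!!y. y \<in> tube pj 0 d ==> f y = 0"
  have "nratio pj f r mu = 0" if "r < d" for r
  proof -
   have "tI pj 0 r y * f y = 0" for y
   using f(3)[of y] tube_mono[OF lin, of r d 0] that by (auto simp: indicator_def)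
   hence "tint pj f r mu = 0" unfolding tint_def by (intro integral_eq_zero_AE AE_I2)
   thus ?thesis by (simp add: nratio_def)
  qed
  hence "eventually (%r. nratio pj f r mu = 0) at0"
   using f(2) unfolding eventually_at_right_field by blast
  hence "((%r. nratio pj f r mu) \<longlongrightarrow> 0) at0" by (rule tendsto_eventually)
  from tendsto_unique[OF _ l[OF f(1)] this] show "(LINT y|nu. f y) = 0" by simp
 qed
 moreover have "0 \<in> msupp nu"
 proof (rule msuppI[OF nu(1)])
  fix r :: real assume "r > 0"
  then obtain n where n: "rs n < r" using nat_approx_posE by blast
  have "(%k. nratio pj (stent n) (rs k) mu) \<longlonglongrightarrow> (LINT y|nu. stent n y)"
   by (rule filterlim_compose[OF l[OF tent_Cc] inverse_Suc_at_right])
  hence "lim (%k. nratio pj (stent n) (rs k) mu) = (LINT y|nu. stent n y)" by (rule limI)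
  moreover have "lim (%k. nratio pj (stent n) (rs k) mu) > 0" using g unfolding GG_def by blast
  ultimately have p: "(LINT y|nu. stent n y) > 0" by simp
  show "em nu {y. infnorm (y - 0) < r} > 0"
  proof (rule ccontr)
   assume "\<not> ?thesis"
   hence z: "em nu {y. infnorm (y - 0) < r} = 0" by simp
   have "open {y :: real ^ 'd. infnorm (y - 0) < r}" by (intro open_Collect_less continuous_intros)
   hence "AE y in nu. y \<notin> {y. infnorm (y - 0) < r}" using z radon_sets[OF nu(1)] by (intro AE_not_in) (auto simp: null_sets_def)
   hence "AE y in nu. stent n y = 0" by eventually_elim (use n in \<open>auto simp: tent_def\<close>)
   hence "(LINT y|nu. stent n y) = 0" by (rule integral_eq_zero_AE)
   thus False using p by simp
  qed
 qed
 ultimately show ?thesis using l by blast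
qed

lemma N1_limit:
 assumes "mu \<in> GG pj"
 shows "N1 pj mu \<in> radon_on (fiber pj 0)" "0 \<in> msupp (N1 pj mu)"
  "f \<in> Cc ==> ((%r. nratio pj f r mu) \<longlongrightarrow> (LINT y|N1 pj mu. f y)) at0"
 using someI_ex[OF GG_limit[OF assms]] assms unfolding N1_def by auto

lemma N1_fconv: assumes g: "mu \<in> GG pj" shows "fconv pj mu 0 (N1 pj mu)"
proof -
 let ?t = "%r. tint pj (tent 1) r mu"
 have t0: "?t r >= 0" for r unfolding tint_def by (rule Bochner_Integration.integral_nonneg) simp
 have "eventually (%r. nratio pj (tent 1) r mu > 0) at0"
  by (rule order_tendstoD(1)[OF N1_limit(3)[OF g tent_Cc]]) (rule tent_integral_pos[OF N1_limit(1,2)[OF g]], simp)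
 hence ev: "eventually (%r. ?t r ~= 0) at0" by eventually_elim (auto simp: nratio_def)
 \<comment> \<open>\<open>fconv\<close> asks for positive constants at every radius. The value 1 is
   a filler for a vanishing denominator, which does not occur close to 0.\<close>
 define c where "c r = (if ?t r = 0 then 1 else 1 / ?t r)" for r
 have "((%r. c r * (LINT y|mu. tI pj 0 r y * f y)) \<longlongrightarrow> (LINT y|N1 pj mu. f y)) at0" if "f \<in> Cc" for f
 proof (rule Lim_transform_eventually[OF N1_limit(3)[OF g that]])
  show "eventually (%r. nratio pj f r mu = c r * (LINT y|mu. tI pj 0 r y * f y)) at0"
   using ev by eventually_elim (simp add: nratio_def c_def tint_def)
 qed
 moreover have "c r > 0" for r using t0[of r] by (simp add: c_def less_le)
 ultimately show ?thesis unfolding fconv_def using N1_limit(1,2)[OF g] by blast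
qed

text \<open>Two views of one set: \<open>GG\<close> is accessible to measurability, existence of
  some \<open>fconv\<close> limit to equivariance. Each argument uses the convenient side.\<close>

lemma GG_iff: "mu \<in> GG pj \<longleftrightarrow> mu \<in> radon_on UNIV & (EX nu. fconv pj mu 0 nu)"
proof
 assume "mu \<in> GG pj" thus "mu \<in> radon_on UNIV & (EX nu. fconv pj mu 0 nu)" using N1_fconv by (auto simp: GG_def)
next
 assume "mu \<in> radon_on UNIV & (EX nu. fconv pj mu 0 nu)"
 then obtain nu c where mu: "mu \<in> radon_on UNIV" and nu: "nu \<in> radon_on (fiber pj 0)" "0 \<in> msupp nu" and c: "!!r. r > 0 ==> c r > 0"
  "!!f. f \<in> Cc ==> ((%r. c r * (LINT y|mu. tI pj 0 r y * f y)) \<longlongrightarrow> (LINT y|nu. f y)) at0"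
  unfolding fconv_def by blast
 note p = tent_integral_pos[OF nu]
 have l: "((%r. nratio pj f r mu) \<longlongrightarrow> (LINT y|nu. f y) / (LINT y|nu. tent 1 y)) at0" if "f \<in> Cc" for f
 proof (rule Lim_transform_eventually[OF tendsto_divide[OF c(2)[OF that] c(2)[OF tent_Cc[of 1]]]])
  show "(LINT y|nu. tent 1 y) ~= 0" using p[of 1] by simp
  have "eventually (%r. r > 0) (at_right (0 :: real))" by (rule eventually_at_right_less)
  thus "eventually (%r. c r * (LINT y|mu. tI pj 0 r y * f y) / (c r * (LINT y|mu. tI pj 0 r y * tent 1 y)) = nratio pj f r mu) at0"
   by eventually_elim (use c(1) in \<open>force simp: nratio_def tint_def\<close>)
 qed
 have "lim (%k. nratio pj (stent n) (rs k) mu) > 0" for n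
 proof -
  have "(%k. nratio pj (stent n) (rs k) mu) \<longlonglongrightarrow> (LINT y|nu. stent n y) / (LINT y|nu. tent 1 y)"
   by (rule filterlim_compose[OF l[OF tent_Cc] inverse_Suc_at_right])
  hence "lim (%k. nratio pj (stent n) (rs k) mu) = (LINT y|nu. stent n y) / (LINT y|nu. tent 1 y)" by (rule limI)
  thus ?thesis using p[of 1] p[of "rs n"] by simp
 qed
 thus "mu \<in> GG pj" unfolding GG_def using mu l Dc_Cc tent_Cc by blast
qed

lemma N1_radon: "N1 pj mu \<in> radon_on (fiber pj 0)"
 by (cases "mu \<in> GG pj") (simp add: N1_limit, simp add: N1_def radon_on_def)

lemma F0_measurable: "F0 pj \<in> radon_borel UNIV \<rightarrow>\<^sub>M radon_borel (fiber pj 0)"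
proof -
 have "N1 pj \<in> radon_borel UNIV \<rightarrow>\<^sub>M radon_borel (fiber pj 0)"
 proof (rule measurable_radon_borelI[OF N1_radon])
  fix g :: "real ^ 'd => real" assume g: "g \<in> Cc"
  have [measurable]: "(%mu. lim (%k. nratio pj g (rs k) mu)) \<in> bm (radon_borel UNIV)"
   by (rule nratio_lim_measurable[OF g])
  note GG_sets[measurable]
  have "(LINT y|N1 pj mu. g y) = (if mu \<in> GG pj then lim (%k. nratio pj g (rs k) mu) else 0)" for mu
  proof (cases "mu \<in> GG pj")
   case True
   thus ?thesis using limI[OF filterlim_compose[OF N1_limit(3)[OF True g] inverse_Suc_at_right]] by simp
  next
   case False thus ?thesis by (simp add: N1_def)
  qed
  thus "(%mu. \<integral>y. g y \<partial>N1 pj mu) \<in> bm (radon_borel UNIV)" by simp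
 qed
 thus ?thesis unfolding F0_def[abs_def] by measurable
qed

lemma F0_fconv: assumes "mu \<in> radon_on UNIV" "fconv pj mu 0 nu" shows "F0 pj mu = star nu"
proof -
 have "mu \<in> GG pj" using assms GG_iff by blast
 thus ?thesis unfolding F0_def by (intro star_proportional fconv_unique[OF N1_fconv assms(2)])
qed

lemma F0_space: "mu \<in> GG pj ==> F0 pj mu \<in> star_space (fiber pj 0)"
 unfolding F0_def by (intro star_star_space N1_limit)

lemma F0_scale:
 assumes g: "mu \<in> GG pj" and z: "0 \<in> msupp mu"
 shows "scale_star t mu \<in> GG pj" "F0 pj (scale_star t mu) = scale_star t (F0 pj mu)"
proof -
 have mu: "mu \<in> radon_on UNIV" using g by (simp add: GG_def)
 have r: "scale_star t mu \<in> radon_on UNIV" unfolding scale_star_aff by (intro star_radon aff_radon[OF mu]) auto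
 note c = fconv_scale_star[OF lin N1_fconv[OF g] mu z, of t]
 show "scale_star t mu \<in> GG pj" using GG_iff r c by blast
 show "F0 pj (scale_star t mu) = scale_star t (F0 pj mu)"
  unfolding F0_fconv[OF r c] unfolding scale_star_aff F0_def by (rule distr_star[OF N1_limit(1,2)[OF g], symmetric])
qed

lemma F0_trans:
 assumes "fconv pj mu x nu" "mu \<in> radon_on UNIV" "x \<in> msupp mu"
 shows "trans_star x mu \<in> GG pj" "F0 pj (trans_star x mu) = trans_star x nu"
proof -
 have r: "trans_star x mu \<in> radon_on UNIV" unfolding trans_star_aff by (intro star_radon aff_radon[OF assms(2)]) auto
 note c = fconv_trans_star[OF lin assms]
 show "trans_star x mu \<in> GG pj" using GG_iff r c by blast
 show "F0 pj (trans_star x mu) = trans_star x nu"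
  unfolding F0_fconv[OF r c] by (simp add: trans_star_aff)
qed

text \<open>Points of one fiber have the same tubes, so only the support condition refers to the
  base point.\<close>

lemma fconv_move_fiber:
 assumes "fconv pj mu x nu" "y \<in> fiber pj x" "y \<in> msupp nu" shows "fconv pj mu y nu"
proof -
 have p: "pj y = pj x" using assms(2) by (simp add: mem_fiber)
 have "fiber pj y = fiber pj x" using p by (simp add: fiber_def)
 thus ?thesis using assms(1,3) tube_cong[OF lin p] unfolding fconv_def by simp
qed

end

section \<open>The quasi-Palm property in terms of almost every point\<close>

context
 fixes V :: "(real ^ 'd) set" and P :: "(real ^ 'd) measure measure"
 assumes V: "subspace V" and sP: "sets P = sets (radon_borel V)"
begin

lemma space_P: "space P = radon_on V"
 using sets_eq_imp_space_eq[OF sP] by simp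

lemma V_borel: "V \<in> sets borel"
 by (intro borel_closed closed_subspace V)

lemma trans_star_in: "x \<in> V ==> mu \<in> radon_on V ==> trans_star x mu \<in> radon_on V"
 using measurable_space[OF trans_star_measurable[OF V, of "%_. x" "radon_borel V" "%mu. mu"], of mu] by simp

lemma hit_measurable:
 assumes A: "A \<in> sets P" and U: "U \<in> sets borel" "U \<subseteq> V"
 shows "(%mu. \<integral>\<^sup>+x\<in>U. indicator A (trans_star x mu) \<partial>mu) \<in> bm P"
  and "mu \<in> radon_on V ==> (%x. indicator A (trans_star x mu) * indicator U x :: ennreal) \<in> bm borel"
proof -
 \<comment> \<open>Translation by a point off \<open>V\<close> can leave \<open>radon_on V\<close>.
   Sending such points to 0 makes the map total and changes nothing on \<open>U\<close>.\<close>
 let ?p = "%x. if x \<in> V then x else 0"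
 note V_borel[measurable] U(1)[measurable]
 have id: "(%mu. mu) \<in> P \<rightarrow>\<^sub>M radon_borel V" using measurable_ident_sets[OF sP] by simp
 have h: "?p \<in> borel \<rightarrow>\<^sub>M borel" by measurable
 have "(%(mu, x). trans_star (?p x) mu) \<in> P \<Otimes>\<^sub>M borel \<rightarrow>\<^sub>M radon_borel V"
  using trans_star_measurable[OF V measurable_compose[OF measurable_snd h] measurable_compose[OF measurable_fst id]]
   subspace_0[OF V] by (simp add: split_beta')
 hence "(%(mu, x). trans_star (?p x) mu) \<in> P \<Otimes>\<^sub>M borel \<rightarrow>\<^sub>M P" by (simp cong: mcs add: sP)
 from measurable_compose[OF this borel_measurable_indicator[OF A]]
 have [measurable]: "(%(mu, x). indicator A (trans_star (?p x) mu) :: ennreal) \<in> bm (P \<Otimes>\<^sub>M borel)"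
  by (simp add: split_beta')
 have e: "indicator A (trans_star x mu) * indicator U x = (indicator A (trans_star (?p x) mu) * indicator U x :: ennreal)" for x mu
  using U(2) by (auto simp: indicator_def)
 have j: "(%(mu, x). indicator A (trans_star (?p x) mu) * indicator U x :: ennreal) \<in> bm (P \<Otimes>\<^sub>M borel)"
  unfolding split_beta' by measurable
 show "(%mu. \<integral>\<^sup>+x\<in>U. indicator A (trans_star x mu) \<partial>mu) \<in> bm P"
  unfolding e by (rule nn_integral_radon_kernel[OF j id])
 show "(%x. indicator A (trans_star x mu) * indicator U x :: ennreal) \<in> bm borel" if "mu \<in> radon_on V"
  unfolding e using measurable_Pair2[OF j, of mu] that space_P by simp
qed

lemma hit_AE:
 assumes A: "A \<in> sets P" and U: "U \<in> sets borel" "U \<subseteq> V" and mu: "mu \<in> radon_on V"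
 shows "(\<integral>\<^sup>+x\<in>U. indicator A (trans_star x mu) \<partial>mu) = 0 \<longleftrightarrow> (AE x in mu. x \<in> U --> trans_star x mu \<notin> A)"
proof -
 have "(%x. indicator A (trans_star x mu) * indicator U x :: ennreal) \<in> bm mu"
  using hit_measurable(2)[OF A U mu] radon_sets[OF mu] by (simp cong: mcs)
 thus ?thesis by (subst nn_integral_0_iff_AE) (auto simp: indicator_def intro!: AE_cong)
qed

lemma palm_AE:
 assumes A: "A \<in> sets P" and U: "U \<in> sets borel" "U \<subseteq> V"
 shows "(\<integral>\<^sup>+mu. (\<integral>\<^sup>+x\<in>U. indicator A (trans_star x mu) \<partial>mu) \<partial>P) = 0 \<longleftrightarrow>
  (AE mu in P. AE x in mu. x \<in> U --> trans_star x mu \<notin> A)"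
 using hit_AE[OF assms] space_P by (subst nn_integral_0_iff_AE[OF hit_measurable(1)[OF assms]]) (auto intro!: AE_cong)

lemma openin_borel: assumes "openin (top_of_set V) U" shows "U \<in> sets borel" "U \<subseteq> V"
 using assms V_borel by (auto simp: openin_open)

lemma qp_iff:
 assumes q: "quasi_palm V P" and A: "A \<in> sets P"
 shows "em P A = 0 \<longleftrightarrow> (AE mu in P. AE x in mu. x \<in> V --> trans_star x mu \<notin> A)"
proof -
 define U where "U n = V Int ball 0 (real (Suc n))" for n
 have U: "openin (top_of_set V) (U n)" for n by (simp add: U_def openin_open_Int)
 have "bounded (U n)" "0 \<in> U n" for n using subspace_0[OF V] by (auto simp: U_def)
 hence n: "em P A = 0 \<longleftrightarrow> (AE mu in P. AE x in mu. x \<in> U n --> trans_star x mu \<notin> A)" for n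
  using q U A palm_AE[OF A openin_borel[OF U]] unfolding quasi_palm_def by blast
 show ?thesis
 proof
  assume "em P A = 0"
  hence "AE mu in P. ALL n. AE x in mu. x \<in> U n --> trans_star x mu \<notin> A"
   unfolding AE_all_countable using n by blast
  thus "AE mu in P. AE x in mu. x \<in> V --> trans_star x mu \<notin> A"
  proof eventually_elim
   case (elim mu)
   hence "AE x in mu. ALL n. x \<in> U n --> trans_star x mu \<notin> A" by (subst AE_all_countable)
   thus ?case
   proof eventually_elim
   case (elim x)
   obtain n where "norm x < real n" using reals_Archimedean2 by blast
   hence "norm x < real (Suc n)" by simp
   thus ?case using elim[rule_format, of n] by (auto simp: U_def)
   qed
  qed
 next
  assume "AE mu in P. AE x in mu. x \<in> V --> trans_star x mu \<notin> A"
  hence "AE mu in P. AE x in mu. x \<in> U 0 --> trans_star x mu \<notin> A"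
   by eventually_elim (auto simp: U_def elim!: eventually_mono)
  thus "em P A = 0" using n[of 0] by blast
 qed
qed

lemma AE_V: assumes mu: "mu \<in> radon_on V" shows "AE x in mu. x \<in> V"
 by (rule radon_AE[OF mu]) (rule V_borel)

text \<open>The passage from the origin to typical points: a measurable null set containing the
  exceptions is enough in this direction.\<close>

lemma qp_AE:
 assumes q: "quasi_palm V P" and R: "AE mu in P. R mu"
 shows "AE mu in P. AE x in mu. x \<in> V & R (trans_star x mu)"
proof -
 obtain N where N: "N \<in> sets P" "em P N = 0" "{mu \<in> space P. \<not> R mu} \<subseteq> N" using AE_E[OF R] by blast
 have "AE mu in P. AE x in mu. x \<in> V --> trans_star x mu \<notin> N" using qp_iff[OF q N(1)] N(2) by blast
 moreover have "AE mu in P. mu \<in> radon_on V" using space_P by (intro AE_I2) simp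
 ultimately show ?thesis
 proof eventually_elim
  case (elim mu)
  show ?case using elim(1) AE_V[OF elim(2)]
   by eventually_elim (use N(3) trans_star_in elim(2) space_P in auto)
 qed
qed

text \<open>The passage from typical points to the origin. The exceptional set itself must be
  measurable here, because a larger measurable set could be hit by typical translates.\<close>

lemma qp_AE_rev:
 assumes q: "quasi_palm V P" and R: "{mu \<in> space P. \<not> R mu} \<in> sets P"
  and p: "AE mu in P. AE x in mu. x \<in> V --> R (trans_star x mu)"
 shows "AE mu in P. R mu"
proof -
 have "AE mu in P. AE x in mu. x \<in> V --> trans_star x mu \<notin> {mu \<in> space P. \<not> R mu}"
  using p by eventually_elim (auto elim!: eventually_mono)
 hence "em P {mu \<in> space P. \<not> R mu} = 0" using qp_iff[OF q R] by blast
 thus ?thesis using AE_iff_measurable[OF R] by blast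
qed

end

section \<open>The push-forward is an ergodic fractal distribution\<close>

context
 fixes pj :: "real ^ 'd => real ^ 'k" and P :: "(real ^ 'd) measure measure"
 assumes lin: "linear pj" and E: "ergodic_fractal_distribution UNIV P"
begin

abbreviation "QD \<equiv> distr P (radon_borel (fiber pj 0)) (F0 pj)"

lemma EP: "prob_space P" "sets P = sets (radon_borel UNIV)" "quasi_palm UNIV P" "S_ergodic UNIV P"
  "AE mu in P. mu \<in> star_space UNIV" "distr P (radon_borel UNIV) (scale_star t) = P"
 using E unfolding ergodic_fractal_distribution_def fractal_distribution_def S_invariant_def by auto

lemma spaceP: "space P = radon_on UNIV" using sets_eq_imp_space_eq[OF EP(2)] by simp

lemma F0_P [measurable]: "F0 pj \<in> P \<rightarrow>\<^sub>M radon_borel (fiber pj 0)"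
 using F0_measurable[OF lin] by (simp cong: mcs add: EP(2))

lemma trans_good:
 assumes mu: "mu \<in> radon_on UNIV"
 shows "AE x in mu. fconv pj mu x (fm pj mu x) & trans_star x mu \<in> GG pj & F0 pj (trans_star x mu) = trans_star x (fm pj mu x)"
 using fm_AE[OF lin mu] msupp_AE[OF mu] by eventually_elim (use F0_trans[OF lin] mu in blast)

text \<open>The complement of the support is an open null set, and almost every conditional measure
  gives mass 0 to a null set. This permits moving the base point along a fiber later.\<close>

lemma fm_in_msupp_AE:
 assumes mu: "mu \<in> radon_on UNIV" shows "AE x in mu. AE y in fm pj mu x. y \<in> msupp mu"
proof -
 have "open (- msupp mu)"
 proof (subst open_subopen, intro ballI)
  fix x assume "x \<in> - msupp mu"
  then obtain U where U: "open U" "x \<in> U" "\<not> em mu U > 0" unfolding msupp_def by blast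
  hence "U \<subseteq> - msupp mu" unfolding msupp_def by blast
  thus "EX T. open T & x \<in> T & T \<subseteq> - msupp mu" using U by blast
 qed
 hence b: "- msupp mu \<in> sets borel" by simp
 hence "em mu (- msupp mu) = 0"
  using msupp_AE[OF mu] radon_sets[OF mu] radon_space[OF mu] AE_iff_measurable[of "- msupp mu" mu "%x. x \<in> msupp mu"] by auto
 from fm_null_AE[OF lin mu b this] show ?thesis
  by eventually_elim (rule AE_I[where N="- msupp mu"], use b fm_sets[OF lin mu] in auto)
qed

text \<open>Differentiation yields existence of the limit at typical points of any Radon measure,
  and measurability of \<open>GG\<close> permits the passage to the origin.\<close>

lemma P_GG: "AE mu in P. mu \<in> GG pj"
proof (rule qp_AE_rev[OF subspace_UNIV EP(2,3)])
 show "{mu \<in> space P. mu \<notin> GG pj} \<in> sets P" using sets.compl_sets[OF GG_sets[OF lin]] EP(2) spaceP by (simp add: set_diff_eq)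
 show "AE mu in P. AE x in mu. x \<in> UNIV --> trans_star x mu \<in> GG pj"
  by (rule AE_I2) (use trans_good spaceP in \<open>auto elim!: eventually_mono\<close>)
qed

lemma P_good: "AE mu in P. mu \<in> GG pj Int star_space UNIV"
 using P_GG EP(5) by eventually_elim simp

lemma QD_prob: "prob_space QD"
 by (rule prob_space.prob_space_distr[OF EP(1) F0_P])

lemma good_zero: "mu \<in> star_space UNIV ==> 0 \<in> msupp mu"
 by (simp add: star_space_def)

lemma QD_invariant: "S_invariant (fiber pj 0) QD"
 unfolding S_invariant_def
proof (intro conjI allI)
 have "{nu \<in> space (radon_borel (fiber pj 0)). nu \<in> star_space (fiber pj 0)} \<in> sets (radon_borel (fiber pj 0))"
  using star_space_sets[of "fiber pj 0"] by (simp add: star_space_def)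
 thus "AE nu in QD. nu \<in> star_space (fiber pj 0)"
  using P_GG F0_space[OF lin] by (subst AE_distr_iff[OF F0_P]) (auto elim!: eventually_mono)
 fix t
 have S: "scale_star t \<in> radon_borel (fiber pj 0) \<rightarrow>\<^sub>M radon_borel (fiber pj 0)"
  by (rule scale_star_measurable[OF subspace_fiber[OF lin]])
 have S': "scale_star t \<in> P \<rightarrow>\<^sub>M radon_borel UNIV"
  using scale_star_measurable[OF subspace_UNIV, of t] by (simp cong: mcs add: EP(2))
 have "distr QD (radon_borel (fiber pj 0)) (scale_star t) = distr P (radon_borel (fiber pj 0)) (%mu. scale_star t (F0 pj mu))"
  using S by (subst distr_distr[OF _ F0_P]) (auto simp: o_def)
 also have "... = distr P (radon_borel (fiber pj 0)) (%mu. F0 pj (scale_star t mu))"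
 proof (rule distr_cong_AE[OF refl refl])
  show "AE mu in P. scale_star t (F0 pj mu) = F0 pj (scale_star t mu)"
   using P_good by eventually_elim (simp add: F0_scale(2)[OF lin] good_zero)
  show "(%mu. scale_star t (F0 pj mu)) \<in> P \<rightarrow>\<^sub>M radon_borel (fiber pj 0)" by (rule measurable_compose[OF F0_P S])
  show "(%mu. F0 pj (scale_star t mu)) \<in> P \<rightarrow>\<^sub>M radon_borel (fiber pj 0)" by (rule measurable_compose[OF S' F0_measurable[OF lin]])
 qed
 also have "... = distr (distr P (radon_borel UNIV) (scale_star t)) (radon_borel (fiber pj 0)) (F0 pj)"
  by (subst distr_distr[OF F0_measurable[OF lin] S']) (simp add: o_def)
 finally show "distr QD (radon_borel (fiber pj 0)) (scale_star t) = QD" by (simp add: EP(6))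
qed

lemma QD_ergodic: "S_ergodic (fiber pj 0) QD"
 unfolding S_ergodic_def
proof (intro ballI impI)
 fix A assume A: "A \<in> sets QD" "A \<subseteq> star_space (fiber pj 0)" and inv: "ALL t. scale_star t -` A Int star_space (fiber pj 0) = A"
 let ?G = "GG pj Int star_space UNIV"
 \<comment> \<open>Equivariance of \<open>F0\<close> is available only on the good set; intersecting
   with it makes \<open>B\<close> strictly invariant, as the definition of ergodicity
   requires.\<close>
 define B where "B = (F0 pj -` A Int space P) Int ?G"
 have Gs: "?G \<in> sets P" using GG_sets[OF lin] star_space_sets EP(2) by auto
 have FA: "F0 pj -` A Int space P \<in> sets P" using A(1) by (intro measurable_sets[OF F0_P]) simp
 have B: "B \<in> sets P" unfolding B_def by (intro sets.Int FA Gs)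
 have iB: "scale_star t -` B Int star_space UNIV = B" for t
 proof -
  have fw: "scale_star s mu \<in> ?G" if "mu \<in> ?G" for mu s
   using that by (auto intro!: F0_scale(1)[OF lin] scale_star_space[OF subspace_UNIV] good_zero)
  have iff: "F0 pj (scale_star t mu) \<in> A \<longleftrightarrow> F0 pj mu \<in> A" if "mu \<in> ?G" for mu
  proof -
   have "F0 pj (scale_star t mu) = scale_star t (F0 pj mu)" using that by (simp add: F0_scale(2)[OF lin] good_zero)
   thus ?thesis using inv F0_space[OF lin, of mu] that by auto
  qed
  \<comment> \<open>Goodness of the scaled measure returns to the measure itself by scaling with
    \<open>- t\<close>.\<close>
  have bk: "mu \<in> GG pj" if "mu \<in> star_space UNIV" "scale_star t mu \<in> ?G" for mu
   using fw[OF that(2), of "- t"] scale_star_add[OF that(1)] scale_star_0[OF that(1)] by simp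
  have Bi: "mu \<in> B \<longleftrightarrow> mu \<in> ?G & F0 pj mu \<in> A" for mu unfolding B_def spaceP GG_def by blast
  show ?thesis
  proof (rule set_eqI)
   fix mu
   show "mu \<in> scale_star t -` B Int star_space UNIV \<longleftrightarrow> mu \<in> B"
   unfolding Int_iff vimage_eq Bi using fw[of mu t] iff[of mu] bk[of mu] by blast
  qed
 qed
 have "B \<subseteq> star_space UNIV" unfolding B_def by blast
 hence "em P B = 0 \<or> em P B = 1"
  using EP(4)[unfolded S_ergodic_def, rule_format, OF B] iB by simp
 moreover have "em QD A = em P B"
  unfolding emeasure_distr[OF F0_P A(1)[simplified]]
 proof (rule emeasure_eq_AE[OF _ FA B])
  show "AE mu in P. mu \<in> F0 pj -` A Int space P \<longleftrightarrow> mu \<in> B" using P_good by eventually_elim (auto simp: B_def)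
 qed
 ultimately show "em QD A = 0 \<or> em QD A = 1" by simp
qed

lemma fiber_tile:
 assumes U: "openin (top_of_set (fiber pj 0)) U" and z: "0 \<in> U"
 obtains d where "d > 0" "ALL x y. y \<in> fiber pj x & infnorm (y - x) <= d --> y - x \<in> U"
proof -
 obtain W where W: "open W" "U = fiber pj 0 Int W" using U by (auto simp: openin_open)
 then obtain d where d: "d > 0" "ALL y. infnorm (y - 0) < d --> y \<in> W" using z by (elim open_infnorm_ball) auto
 show ?thesis
 proof (rule that[of "d / 2"])
  show "ALL x y. y \<in> fiber pj x & infnorm (y - x) <= d / 2 --> y - x \<in> U"
   using d lin by (auto simp: W(2) mem_fiber linear_diff linear_0)
 qed (use d in simp)
qed

text \<open>Translating the conditional measure of \<open>x\<close> further by \<open>z\<close>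
  yields the conditional measure centred at \<open>y = x + z\<close>, which is \<open>F0\<close> of
  \<open>mu\<close> translated to \<open>y\<close>. The hypothesis \<open>ms\<close> puts almost
  every such \<open>y\<close> into the support of \<open>mu\<close>, where \<open>F0_trans\<close>
  applies.\<close>

lemma fiber_hit:
 assumes mu: "mu \<in> radon_on UNIV" and c: "fconv pj mu x (fm pj mu x)" and ms: "AE y in fm pj mu x. y \<in> msupp mu"
 shows "(AE z in trans_star x (fm pj mu x). z \<in> U --> trans_star z (trans_star x (fm pj mu x)) \<notin> A) \<longleftrightarrow>
  (AE y in fm pj mu x. y - x \<in> U --> F0 pj (trans_star y mu) \<notin> A)"
proof -
 let ?nu = "fm pj mu x" and ?d = "distr (fm pj mu x) borel (aff 1 x)"
 have nu: "?nu \<in> radon_on (fiber pj x)" "x \<in> msupp ?nu" using c unfolding fconv_def by auto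
 have nuU: "?nu \<in> radon_on UNIV" by (rule fm_radon_UNIV[OF lin mu])
 have d: "?d \<in> radon_on UNIV" "0 \<in> msupp ?d"
  using aff_radon[OF nuU, of 1 x UNIV] aff_msupp[OF nu(1,2), of 1 x] by (auto simp: aff_def)
 have m: "1 / measure ?d (sup_cball 1 0) > 0" using msupp_ball(2)[OF d, of 1] by simp
 have tt: "trans_star z (trans_star x ?nu) = trans_star (z + x) ?nu" for z
 proof -
  have "distr ?d borel (aff 1 z) = distr ?nu borel (aff 1 (z + x))"
   using aff_measurable[OF nu(1)] by (subst distr_distr) (auto simp: o_def aff_def algebra_simps intro!: distr_cong)
  thus ?thesis unfolding trans_star_aff distr_star[OF d] by simp
 qed
 have AEs: "(AE z in trans_star x ?nu. R z) \<longleftrightarrow> (AE y in ?nu. R (y - x))" for R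
 proof -
  have "(AE z in trans_star x ?nu. R z) \<longleftrightarrow> (AE z in ?d. R z)"
   unfolding trans_star_aff star_def scale_measure_density using m
   by (subst AE_density) auto
  also have "... \<longleftrightarrow> (AE y in ?nu. R (y - x))"
  proof
   assume "AE z in ?d. R z" thus "AE y in ?nu. R (y - x)"
   using AE_distrD[OF aff_measurable[OF nu(1), of 1 x], of R] by (simp add: aff_def)
  next
   assume a: "AE y in ?nu. R (y - x)"
   have e: "distr ?d borel (aff 1 (- x)) = ?nu"
   using aff_measurable[OF nu(1)] distr_id2[of borel ?nu] radon_sets[OF nu(1)] by (subst distr_distr) (auto simp: o_def aff_def)
   have "AE y in distr ?d borel (aff 1 (- x)). R (y - x)" unfolding e by (rule a)
   from AE_distrD[OF aff_measurable[OF d(1)] this] show "AE z in ?d. R z" by (simp add: aff_def)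
  qed
  finally show ?thesis .
 qed
 have "AE y in ?nu. F0 pj (trans_star y mu) = trans_star y ?nu"
  using ms msupp_AE[OF nu(1)] radon_AE[OF nu(1) fiber_borel[OF lin]]
  by eventually_elim (use F0_trans(2)[OF lin fconv_move_fiber[OF lin c] mu] in blast)
 hence "AE y in ?nu. (y - x \<in> U --> trans_star y ?nu \<notin> A) \<longleftrightarrow> (y - x \<in> U --> F0 pj (trans_star y mu) \<notin> A)"
  by eventually_elim simp
 from eventually_subst[OF this] show ?thesis unfolding AEs tt by simp
qed

text \<open>The quasi-Palm property of \<open>P\<close> moves the question to typical points
  \<open>x\<close> of \<open>mu\<close>. There the inner integral vanishes iff the conditional
  measure of \<open>x\<close> does not charge the part of \<open>E\<close> seen through
  \<open>U\<close>. By \<open>fm_null_AE\<close> and \<open>fm_local_null\<close> this holds for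
  almost all \<open>x\<close> iff \<open>E\<close> is null for \<open>mu\<close>. A second use of
  the property returns to the origin.\<close>

lemma QD_quasi_palm: "quasi_palm (fiber pj 0) QD"
 unfolding quasi_palm_def
proof (intro allI impI ballI)
 fix U A assume U: "openin (top_of_set (fiber pj 0)) U" "bounded U" "0 \<in> U" and A: "A \<in> sets QD"
 let ?V = "fiber pj 0"
 note V = subspace_fiber[OF lin]
 have sQ: "sets QD = sets (radon_borel ?V)" by simp
 note Ub = openin_borel[OF V sQ U(1)]
 obtain d where d: "d > 0" "ALL x y. y \<in> fiber pj x & infnorm (y - x) <= d --> y - x \<in> U"
  by (rule fiber_tile[OF U(1,3)])
 define R where "R mu \<longleftrightarrow> (AE z in F0 pj mu. z \<in> U --> trans_star z (F0 pj mu) \<notin> A)" for mu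
 have hm: "(%nu. \<integral>\<^sup>+x\<in>U. indicator A (trans_star x nu) \<partial>nu) \<in> bm (radon_borel ?V)"
  using hit_measurable(1)[OF V sQ A Ub] by simp
 have FV: "F0 pj mu \<in> radon_on ?V" for mu unfolding F0_def by (rule star_radon[OF N1_radon[OF lin]])
 have Rm: "{mu \<in> space P. \<not> R mu} \<in> sets P"
 proof -
  have "{mu \<in> space P. \<not> (\<integral>\<^sup>+x\<in>U. indicator A (trans_star x (F0 pj mu)) \<partial>F0 pj mu) = 0} \<in> sets P"
   using measurable_compose[OF F0_P hm] by measurable
  thus ?thesis unfolding R_def by (simp only: hit_AE[OF V sQ A Ub FV])
 qed
 let ?B = "F0 pj -` A Int space P"
 have B: "?B \<in> sets P" using A by (intro measurable_sets[OF F0_P]) simp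
 have sp: "trans_star x mu \<in> space P" if "mu \<in> radon_on UNIV" for x mu
  using trans_star_in[OF subspace_UNIV EP(2), of x mu] that spaceP by simp
 have "(\<integral>\<^sup>+nu. (\<integral>\<^sup>+x\<in>U. indicator A (trans_star x nu) \<partial>nu) \<partial>QD) = (\<integral>\<^sup>+mu. (\<integral>\<^sup>+x\<in>U. indicator A (trans_star x (F0 pj mu)) \<partial>F0 pj mu) \<partial>P)"
  using hm by (subst nn_integral_distr[OF F0_P]) auto
 hence "(\<integral>\<^sup>+nu. (\<integral>\<^sup>+x\<in>U. indicator A (trans_star x nu) \<partial>nu) \<partial>QD) = 0 \<longleftrightarrow> (AE mu in P. R mu)"
  using measurable_compose[OF F0_P hm] unfolding R_def
  by (simp only: nn_integral_0_iff_AE hit_AE[OF V sQ A Ub FV])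
 also have "... \<longleftrightarrow> (AE mu in P. AE x in mu. R (trans_star x mu))"
 proof
  assume "AE mu in P. R mu" from qp_AE[OF subspace_UNIV EP(2,3) this]
  show "AE mu in P. AE x in mu. R (trans_star x mu)" by simp
 next
  assume "AE mu in P. AE x in mu. R (trans_star x mu)"
  thus "AE mu in P. R mu" by (intro qp_AE_rev[OF subspace_UNIV EP(2,3) Rm]) simp
 qed
 also have "... \<longleftrightarrow> (AE mu in P. AE x in mu. x \<in> UNIV --> trans_star x mu \<notin> ?B)"
 proof (rule AE_cong)
  fix mu assume "mu \<in> space P"
  hence mu: "mu \<in> radon_on UNIV" by (simp add: spaceP)
  define E where "E = {x. trans_star x mu \<in> ?B}"
  have "(%x. indicator ?B (trans_star x mu) * indicator UNIV x :: ennreal) \<in> bm borel"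
   by (rule hit_measurable(2)[OF subspace_UNIV EP(2) B _ _ mu]) auto
  from measurable_sets[OF this, of "{1}"] have Eb: "E \<in> sets borel" by (simp add: E_def indicator_def vimage_def)
  have "AE x in mu. AE y in fm pj mu x. y \<in> msupp mu" by (rule fm_in_msupp_AE[OF mu])
  hence "AE x in mu. R (trans_star x mu) \<longleftrightarrow> em (fm pj mu x) (E Int {y. y - x \<in> U}) = 0"
   using trans_good[OF mu]
  proof eventually_elim
   case (elim x)
   have nu: "fm pj mu x \<in> radon_on UNIV" by (rule fm_radon_UNIV[OF lin mu])
   have [measurable]: "U \<in> sets borel" by (rule Ub)
   have s: "E Int {y. y - x \<in> U} \<in> sets borel" using Eb by measurable
   have Fx: "F0 pj (trans_star x mu) = trans_star x (fm pj mu x)" using elim(2) by blast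
   have "R (trans_star x mu) \<longleftrightarrow> (AE y in fm pj mu x. y - x \<in> U --> F0 pj (trans_star y mu) \<notin> A)"
   unfolding R_def Fx by (rule fiber_hit[OF mu _ elim(1)]) (use elim(2) in blast)
   also have "... \<longleftrightarrow> (AE y in fm pj mu x. y \<notin> E Int {y. y - x \<in> U})"
   by (intro AE_cong) (use sp[OF mu] in \<open>auto simp: E_def\<close>)
   also have "... \<longleftrightarrow> em (fm pj mu x) (E Int {y. y - x \<in> U}) = 0"
   using s radon_sets[OF nu] radon_space[OF nu] by (subst AE_iff_null_sets[symmetric]) (auto simp: null_sets_def)
   finally show ?case .
  qed
  hence "(AE x in mu. R (trans_star x mu)) \<longleftrightarrow> (AE x in mu. em (fm pj mu x) (E Int {y. y - x \<in> U}) = 0)"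
   by (rule eventually_subst)
  also have "... \<longleftrightarrow> em mu E = 0"
  proof
   assume z: "AE x in mu. em (fm pj mu x) (E Int {y. y - x \<in> U}) = 0"
   show "em mu E = 0"
   proof (rule fm_local_null[OF lin mu Eb d(1)])
   show "AE y in mu. em (fm pj mu y) (E Int sup_cball d y) = 0"
   using z trans_good[OF mu]
   proof eventually_elim
   case (elim x)
   have nu: "fm pj mu x \<in> radon_on (fiber pj x)" using elim(2) by (simp add: fconv_def)
   have [measurable]: "U \<in> sets borel" by (rule Ub)
   have s: "E Int {y. y - x \<in> U} \<in> sets borel" using Eb by measurable
   have "em (fm pj mu x) (E Int sup_cball d x) <= em (fm pj mu x) (E Int {y. y - x \<in> U} \<union> - fiber pj x)"
   using s d(2) fiber_borel[OF lin, of x] radon_sets[OF nu] by (intro emeasure_mono) (auto simp: mem_sup_cball)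
   also have "... <= em (fm pj mu x) (E Int {y. y - x \<in> U}) + em (fm pj mu x) (- fiber pj x)"
   using s fiber_borel[OF lin, of x] radon_sets[OF nu] by (intro emeasure_subadditive) auto
   also have "... = 0" using elim(1) nu by (simp add: radon_on_def)
   finally show ?case by simp
   qed
   qed
  next
   assume "em mu E = 0"
   from fm_null_AE[OF lin mu Eb this] show "AE x in mu. em (fm pj mu x) (E Int {y. y - x \<in> U}) = 0"
   proof eventually_elim
   case (elim x)
   have "em (fm pj mu x) (E Int {y. y - x \<in> U}) <= em (fm pj mu x) E"
   using Eb fm_sets[OF lin mu] by (intro emeasure_mono) auto
   thus ?case using elim by simp
   qed
  qed
  also have "... \<longleftrightarrow> (AE x in mu. x \<notin> E)"
   using Eb radon_sets[OF mu] radon_space[OF mu] by (subst AE_iff_null_sets[symmetric]) (auto simp: null_sets_def)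
  finally show "(AE x in mu. R (trans_star x mu)) \<longleftrightarrow> (AE x in mu. x \<in> UNIV --> trans_star x mu \<notin> ?B)"
   by (simp add: E_def)
 qed
 also have "... \<longleftrightarrow> em P ?B = 0" by (rule qp_iff[OF subspace_UNIV EP(2,3) B, symmetric])
 also have "em P ?B = em QD A" using A by (subst emeasure_distr[OF F0_P]) auto
 finally show "em QD A = 0 \<longleftrightarrow> (\<integral>\<^sup>+nu. (\<integral>\<^sup>+x\<in>U. indicator A (trans_star x nu) \<partial>nu) \<partial>QD) = 0" by blast
qed

lemma QD_efd: "ergodic_fractal_distribution (fiber pj 0) QD"
 unfolding ergodic_fractal_distribution_def fractal_distribution_def
 using QD_prob QD_invariant QD_ergodic QD_quasi_palm by simp

end

section \<open>Hyperplanes off the origin and spheres are not charged\<close>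

lemma star_distr_emeasure:
 assumes nu: "nu \<in> radon_on A" and z: "z \<in> msupp nu" and s: "s > 0"
 obtains c :: real where "c > 0" "ALL X:sets borel. em (star (distr nu borel (aff s z))) X = ennreal c * em nu (aff s z -` X)"
proof -
 let ?d = "distr nu borel (aff s z)"
 have d: "?d \<in> radon_on UNIV" by (rule aff_radon[OF radon_UNIV[OF nu] s]) auto
 have z0: "0 \<in> msupp ?d" using aff_msupp[OF nu z, of s z] by (simp add: aff_def)
 show ?thesis
 proof (rule that[of "1 / measure ?d (sup_cball 1 0)"])
  show "1 / measure ?d (sup_cball 1 0) > 0" using msupp_ball(2)[OF d z0, of 1] by simp
  show "ALL X:sets borel. em (star ?d) X = ennreal (1 / measure ?d (sup_cball 1 0)) * em nu (aff s z -` X)"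
   unfolding star_def using radon_space[OF nu] by (auto simp: emeasure_distr[OF aff_measurable[OF nu]])
 qed
qed

text \<open>The radii \<open>exp (- n)\<close> are those seen at integer times of the scaling flow;
  the balls are open in order to be tubes of the identity map.\<close>

definition oball :: "real ^ 'd => nat => (real ^ 'd) set" where "oball x n = {y. infnorm (y - x) < exp (- real n)}"

lemma open_oball: "open (oball x n)"
 unfolding oball_def by (intro open_Collect_less continuous_intros)

lemma oball_borel [measurable]: "oball x n \<in> sets borel"
 by (rule borel_open[OF open_oball])

lemma oball_fin: "nu \<in> radon_on A ==> em nu (oball x n) < \<infinity>"
proof -
 assume nu: "nu \<in> radon_on A"
 have "em nu (oball x n) <= em nu (sup_cball (exp (- real n)) x)"
  using radon_sets[OF nu] by (intro emeasure_mono) (auto simp: oball_def mem_sup_cball)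
 thus ?thesis using radon_ball[OF nu] by (rule order_le_less_trans)
qed

lemma oball_fin': "nu \<in> radon_on A ==> em nu (oball x n Int X) < \<infinity>"
proof -
 assume nu: "nu \<in> radon_on A"
 have "em nu (oball x n Int X) <= em nu (oball x n)" using radon_sets[OF nu] by (intro emeasure_mono) auto
 thus ?thesis using oball_fin[OF nu] by (rule order_le_less_trans)
qed

lemma measure_split:
 assumes nu: "nu \<in> radon_on A" and X: "X \<in> sets borel"
 shows "measure nu (oball x n) = measure nu (oball x n Int X) + measure nu (oball x n - X)"
proof -
 have "measure nu ((oball x n Int X) \<union> (oball x n - X)) = measure nu (oball x n Int X) + measure nu (oball x n - X)"
  using oball_fin'[OF nu, of x n X] oball_fin'[OF nu, of x n "- X"] radon_sets[OF nu] X
  by (intro measure_Union) (auto simp: Diff_eq less_top)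
 thus ?thesis by (simp add: Int_Diff_Un)
qed

lemma exp_neg_lim: "(%n. exp (- real n)) \<longlonglongrightarrow> 0"
 by (rule filterlim_compose[OF exp_at_bot]) (simp add: filterlim_uminus_at_bot filterlim_real_sequentially)

lemma filterlim_exp_neg: "filterlim (%n. exp (- real n)) at0 sequentially"
 using exp_neg_lim by (auto simp: filterlim_at intro!: always_eventually)

text \<open>Density along tubes is stated for finite measures, so \<open>mu\<close> is restricted to
  balls. A ball of radius at least \<open>infnorm y + 1\<close> contains every
  \<open>oball y n\<close>, and there the restriction is invisible.\<close>

lemma oball_density:
 fixes mu :: "(real ^ 'd) measure"
 assumes mu: "mu \<in> radon_on A" and E: "E \<in> sets borel"
 shows "AE y in mu. y \<in> E --> (ALL et>0. eventually (%n. measure mu (oball y n - E) <= et * measure mu (oball y n)) sequentially)"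
proof -
 note [simp] = radon_sets[OF mu]
 let ?D = "%m y. y \<in> E --> (ALL et>0. eventually (%n. measure m (oball y n - E) <= et * measure m (oball y n)) sequentially)"
 have "AE y in mu. y \<in> cb N --> ?D (restr mu (cb N)) y" for N :: nat
 proof -
  let ?m = "restr mu (cb N)"
  have B: "cb N \<in> sets (borel :: (real ^ 'd) measure)" by (rule sup_cball_borel)
  have "em ?m (space ?m) < \<infinity>"
   using emeasure_restr[OF radon_sets[OF mu] B, of UNIV] radon_ball[OF mu, of "real N" 0] radon_space[OF mu]
   by (simp add: restr_def)
  hence f: "finite_measure ?m" by (intro finite_measureI) (simp add: less_top[symmetric])
  have EV: "E \<in> sets (VA (%x. x))" by (rule VA_set[OF linear_id' E]) simp
  have s: "sets ?m = sets borel" by simp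
  from tube_density[OF linear_id' f s EV] have d: "AE y in ?m. ?D ?m y"
  proof eventually_elim
   case (elim y)
   have t: "tube (%x. x) y (exp (- real n)) = oball y n" for n by (auto simp: mem_tube_id oball_def)
   show ?case
   proof (intro impI allI)
   fix et :: real assume "y \<in> E" "et > 0"
   with elim have "eventually (%r. measure ?m (tube (%x. x) y r - E) <= et * measure ?m (tube (%x. x) y r)) at0" by blast
   from eventually_compose_filterlim[OF this filterlim_exp_neg]
   show "eventually (%n. measure ?m (oball y n - E) <= et * measure ?m (oball y n)) sequentially" by (simp add: t)
   qed
  qed
  have im: "(indicator (cb N) :: real ^ 'd => ennreal) \<in> bm mu" using B by (intro borel_measurable_indicator) simp
  have e: "?m = density mu (indicator (cb N))" by (simp add: restr_def)
  from d have "AE y in density mu (indicator (cb N)). ?D ?m y" by (subst e[symmetric])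
  thus ?thesis by (subst (asm) AE_density[OF im]) (auto simp: indicator_def elim!: eventually_mono)
 qed
 hence "AE y in mu. ALL N::nat. y \<in> cb N --> ?D (restr mu (cb N)) y"
  unfolding AE_all_countable by (rule allI)
 thus ?thesis
 proof eventually_elim
  case (elim y)
  obtain N :: nat where N: "infnorm y + 1 <= real N" using real_arch_simple by blast
  let ?m = "restr mu (cb N)"
  have sub: "oball y n \<subseteq> cb N" for n
  proof
   fix z assume "z \<in> oball y n"
   hence "infnorm (z - y) < 1" by (auto simp: oball_def intro: order_less_le_trans)
   thus "z \<in> cb N" using N infnorm_triangle[of "z - y" y] by (simp add: mem_sup_cball)
  qed
  have e: "measure ?m X = measure mu X" if "X \<in> sets borel" "X \<subseteq> oball y n" for X n
  proof -
   have "cb N Int X = X" using sub[of n] that(2) by blast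
   thus ?thesis using emeasure_restr[OF radon_sets[OF mu] sup_cball_borel that(1)] by (simp add: measure_def)
  qed
  have "y \<in> cb N" using N by (simp add: mem_sup_cball)
  moreover have "measure ?m (oball y n - E) = measure mu (oball y n - E)" "measure ?m (oball y n) = measure mu (oball y n)" for n
   using e[of "oball y n - E" n] e[of "oball y n" n] E by auto
  ultimately show ?case using elim[rule_format, of N] by simp
 qed
qed

text \<open>Pushed to the line by the inner product with \<open>b\<close>, a charged hyperplane
  becomes an atom, and a finite measure has only countably many. One null set of exceptions then
  serves a whole family of parallel hyperplanes.\<close>

lemma countable_atoms:
 assumes mu: "mu \<in> radon_on A"
 shows "countable {c :: real. em mu {y. y \<bullet> b = c} > 0}"
proof -
 note [simp] = radon_sets[OF mu] radon_space[OF mu]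
 let ?B = "%N. cb N"
 let ?M = "%N. distr (restr mu (?B N)) borel (%y. y \<bullet> b)"
 have M: "(%y. y \<bullet> b) \<in> restr mu (?B N) \<rightarrow>\<^sub>M borel" for N unfolding restr_def by (simp cong: mcs)
 have "em (restr mu (?B N)) UNIV < \<infinity>" for N
  using emeasure_restr[OF radon_sets[OF mu] sup_cball_borel, of UNIV "real N" 0] radon_ball[OF mu, of "real N" 0] by simp
 hence fr: "finite_measure (restr mu (?B N))" for N
  by (intro finite_measureI) (simp add: restr_def less_top[symmetric])
 have f: "finite_measure (?M N)" for N by (rule finite_measure.finite_measure_distr[OF fr M])
 have sr: "space (restr mu (?B N)) = UNIV" for N by (simp add: restr_def)
 have "countable (\<Union>N. {c. measure (?M N) {c} ~= 0})"
  by (intro countable_UN) (use finite_measure.countable_support[OF f] in auto)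
 moreover have "{c. em mu {y. y \<bullet> b = c} > 0} \<subseteq> (\<Union>N. {c. measure (?M N) {c} ~= 0})"
 proof (rule subsetI, rule ccontr)
  fix c assume c: "c \<in> {c. em mu {y. y \<bullet> b = c} > 0}" and n: "c \<notin> (\<Union>N. {c. measure (?M N) {c} ~= 0})"
  have p: "em mu {y. y \<bullet> b = c} > 0" using c by simp
  have E: "{y. y \<bullet> b = c} \<in> sets borel" by (intro borel_closed closed_Collect_eq continuous_intros)
  have "em mu ({y. y \<bullet> b = c} Int ?B N) = 0" for N
  proof -
   have "em (?M N) {c} = 0" using n finite_measure.emeasure_eq_measure[OF f, of N] by auto
   moreover have "(%y. y \<bullet> b) -` {c} = {y. y \<bullet> b = c}" by auto
   ultimately show ?thesis
   using emeasure_restr[OF radon_sets[OF mu] sup_cball_borel E, of "real N" 0] by (simp add: emeasure_distr[OF M] sr Int_commute)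
  qed
  thus False using p radon_SUP_ball[OF mu E] by simp
 qed
 ultimately show ?thesis by (rule countable_subset[rotated])
qed

context
 fixes V :: "(real ^ 'd) set" and Q :: "(real ^ 'd) measure measure" and b :: "real ^ 'd"
 assumes V: "subspace V" and Q: "fractal_distribution V Q"
begin

lemma Q0: "prob_space Q" "sets Q = sets (radon_borel V)" "quasi_palm V Q"
  "AE nu in Q. nu \<in> star_space V" "distr Q (radon_borel V) (scale_star t) = Q"
 using Q unfolding fractal_distribution_def S_invariant_def by auto

lemma scale_Q: "scale_star t \<in> Q \<rightarrow>\<^sub>M radon_borel V"
 using scale_star_measurable[OF V, of t] by (simp cong: mcs add: Q0(2))

lemma scale_AE: assumes "AE nu in Q. R nu" shows "AE nu in Q. R (scale_star t nu)"
proof -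
 have "AE nu in distr Q (radon_borel V) (scale_star t). R nu" unfolding Q0(5) by (rule assms)
 thus ?thesis by (rule AE_distrD[OF scale_Q])
qed

lemma scale_integral: assumes "f \<in> bm (radon_borel V)" shows "(LINT nu|Q. f (scale_star t nu)) = (LINT nu|Q. (f nu :: real))"
 using integral_distr[OF scale_Q assms, of t] by (simp add: Q0(5))

lemma Q_id: "(%nu. nu) \<in> Q \<rightarrow>\<^sub>M radon_borel V"
 using measurable_ident_sets[OF Q0(2)] by simp

abbreviation "H \<equiv> {y. y \<bullet> b = 0}"

lemma H_borel: "{y. y \<bullet> b = c} \<in> sets borel"
 by (intro borel_closed closed_Collect_eq continuous_intros)

text \<open>Either the hyperplane is a null set, or the origin is a density point of it along \<open>exp (- n)\<close>.\<close>

definition KK :: "(real ^ 'd) measure => bool" where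
 "KK nu \<longleftrightarrow> em nu H = 0 \<or> (ALL k. EX N. ALL n>=N. measure nu (oball 0 n - H) * real (Suc k) <= measure nu (oball 0 n))"

text \<open>Each point lies on exactly one hyperplane of the family. If that one is charged, it is
  among countably many, and almost all its points are density points of it; translation moves it to
  \<open>H\<close>.\<close>

lemma KK_trans:
 assumes mu: "mu \<in> radon_on V" shows "AE y in mu. KK (trans_star y mu)"
proof -
 have "AE y in mu. ALL c:{c. em mu {y. y \<bullet> b = c} > 0}. y \<in> {y. y \<bullet> b = c} -->
   (ALL et>0. eventually (%n. measure mu (oball y n - {y. y \<bullet> b = c}) <= et * measure mu (oball y n)) sequentially)"
  unfolding AE_ball_countable[OF countable_atoms[OF mu]] by (intro ballI oball_density[OF mu H_borel])
 thus ?thesis using msupp_AE[OF mu]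
 proof eventually_elim
  case (elim y)
  let ?E = "{z. z \<bullet> b = y \<bullet> b}"
  obtain c :: real where c: "c > 0" "ALL X:sets borel. em (trans_star y mu) X = ennreal c * em mu (aff 1 y -` X)"
   using star_distr_emeasure[OF mu elim(2), of 1] unfolding trans_star_aff by auto
  have p: "aff 1 y -` H = ?E" "aff 1 y -` oball 0 n = oball y n" "aff 1 y -` (oball 0 n - H) = oball y n - ?E" for n
   by (auto simp: aff_def oball_def inner_diff_left)
  have m: "measure (trans_star y mu) X = c * measure mu (aff 1 y -` X)" if "X \<in> sets borel" for X
   using c that by (simp add: measure_def enn2real_mult)
  show ?case
  proof (cases "em mu ?E > 0")
   case False
   hence "em (trans_star y mu) H = 0" using c(2) H_borel[of 0] p by simp
   thus ?thesis by (simp add: KK_def)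
  next
   case True
   have "EX N. ALL n>=N. measure (trans_star y mu) (oball 0 n - H) * real (Suc k) <= measure (trans_star y mu) (oball 0 n)" for k
   proof -
   have "ALL et>0. eventually (%n. measure mu (oball y n - ?E) <= et * measure mu (oball y n)) sequentially"
   using bspec[OF elim(1), of "y \<bullet> b"] True by simp
   hence "eventually (%n. measure mu (oball y n - ?E) <= rs k * measure mu (oball y n)) sequentially"
   by (elim allE[of _ "rs k"] impE) simp
   then obtain N where N: "!!n. n >= N ==> measure mu (oball y n - ?E) <= rs k * measure mu (oball y n)"
   unfolding eventually_sequentially by blast
   show ?thesis
   proof (intro exI[of _ N] allI impI)
   fix n assume "n >= N"
   from N[OF this] have "measure mu (oball y n - ?E) * real (Suc k) <= measure mu (oball y n)" by (simp add: field_simps)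
   thus "measure (trans_star y mu) (oball 0 n - H) * real (Suc k) <= measure (trans_star y mu) (oball 0 n)"
   using c(1) H_borel[of 0] by (simp add: m p mult.assoc)
   qed
   qed
   thus ?thesis by (simp add: KK_def)
  qed
 qed
qed

lemma KK_AE: "AE nu in Q. KK nu"
proof (rule qp_AE_rev[OF V Q0(2,3)])
 note [measurable] = Q_id H_borel
 have "{nu \<in> space Q. KK nu} \<in> sets Q" unfolding KK_def by measurable
 hence "space Q - {nu \<in> space Q. KK nu} \<in> sets Q" by (rule sets.compl_sets)
 moreover have "space Q - {nu \<in> space Q. KK nu} = {nu \<in> space Q. \<not> KK nu}" by blast
 ultimately show "{nu \<in> space Q. \<not> KK nu} \<in> sets Q" by simp
 show "AE mu in Q. AE x in mu. x \<in> V --> KK (trans_star x mu)"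
 proof (rule AE_I2)
  fix mu assume "mu \<in> space Q"
  hence "AE x in mu. KK (trans_star x mu)" using KK_trans space_P[OF V Q0(2)] by simp
  thus "AE x in mu. x \<in> V --> KK (trans_star x mu)" by eventually_elim simp
 qed
qed

definition psi :: "(real ^ 'd) measure => real" where
 "psi nu = measure nu (oball 0 0 Int H) / measure nu (oball 0 0)"

lemma star_ob: assumes "nu \<in> star_space V" shows "measure nu (oball 0 n) > 0"
proof -
 have r: "nu \<in> radon_on V" and z: "0 \<in> msupp nu" using assms by (auto simp: star_space_def)
 have "(0 :: real ^ 'd) \<in> oball 0 n" by (simp add: oball_def infnorm_0)
 hence "em nu (oball 0 n) > 0" using z open_oball unfolding msupp_def by blast
 thus ?thesis by (rule measure_posI[OF _ oball_fin[OF r]])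
qed

lemma scale_prop:
 assumes nu: "nu \<in> star_space V"
 obtains c where "c > 0" "ALL X:sets borel. em (scale_star t nu) X = ennreal c * em nu (aff (exp t) 0 -` X)"
 using star_distr_emeasure[of nu V 0 "exp t"] nu unfolding scale_star_aff star_space_def by auto

lemma psi_scale:
 assumes nu: "nu \<in> star_space V"
 shows "psi (scale_star (real n) nu) = measure nu (oball 0 n Int H) / measure nu (oball 0 n)"
proof -
 obtain c where c: "c > 0" "ALL X:sets borel. em (scale_star (real n) nu) X = ennreal c * em nu (aff (exp (real n)) 0 -` X)"
  using scale_prop[OF nu] by blast
 have p: "aff (exp (real n)) 0 -` oball 0 0 = oball 0 n" "aff (exp (real n)) 0 -` (oball 0 0 Int H) = oball 0 n Int H"
  by (auto simp: aff_def oball_def infnorm_mul exp_minus field_simps)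
 have m: "measure (scale_star (real n) nu) X = c * measure nu (aff (exp (real n)) 0 -` X)" if "X \<in> sets borel" for X
  using c that by (simp add: measure_def enn2real_mult)
 have "measure (scale_star (real n) nu) (oball 0 0) = c * measure nu (oball 0 n)"
  "measure (scale_star (real n) nu) (oball 0 0 Int H) = c * measure nu (oball 0 n Int H)"
  using m[of "oball 0 0"] m[of "oball 0 0 Int H"] H_borel[of 0] by (simp_all only: p sets.Int oball_borel)
 thus ?thesis using c(1) by (simp add: psi_def)
qed

lemma psi_bound: "0 <= psi nu" "nu \<in> radon_on V ==> psi nu <= 1"
proof -
 show "0 <= psi nu" by (simp add: psi_def)
 assume r: "nu \<in> radon_on V"
 have "measure nu (oball 0 0 Int H) <= measure nu (oball 0 0)"
  using radon_sets[OF r] oball_fin[OF r] by (intro measure_mono_fmeasurable) (auto simp: fmeasurable_def H_borel)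
 thus "psi nu <= 1" by (simp add: psi_def divide_le_eq_1 measure_nonneg less_le)
qed

text \<open>Along the orbit at integer times the share \<open>psi\<close> of the hyperplane in the
  unit ball tends to \<open>chi\<close>, by \<open>KK_AE\<close>. Invariance keeps the integral of
  \<open>psi\<close> constant, so it equals that of \<open>chi\<close>. Since
  \<open>psi <= chi\<close>, both agree almost everywhere, and a charged hyperplane carries the
  whole unit ball.\<close>

lemma H_dichotomy: "AE nu in Q. em nu H > 0 --> em nu (- H) = 0"
proof -
 interpret prob_space Q by (rule Q0(1))
 note [measurable] = Q_id H_borel
 define chi where "chi nu = (if em nu H = 0 then 0 else 1 :: real)" for nu
 have [measurable]: "psi \<in> bm (radon_borel V)" unfolding psi_def[abs_def] by measurable
 have pm [measurable]: "psi \<in> bm Q" unfolding psi_def[abs_def] by measurable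
 have cm [measurable]: "chi \<in> bm Q" unfolding chi_def[abs_def] by measurable
 have r: "nu \<in> space Q ==> nu \<in> radon_on V" for nu using space_P[OF V Q0(2)] by simp
 have ip: "integrable Q psi" using psi_bound r by (intro integrable_const_bound[where B=1] AE_I2) auto
 have ic: "integrable Q chi" by (intro integrable_const_bound[where B=1] AE_I2) (auto simp: chi_def)
 have "(%n. \<integral>nu. psi (scale_star (real n) nu) \<partial>Q) \<longlonglongrightarrow> (LINT nu|Q. chi nu)"
 proof (rule integral_dominated_convergence[where w="%_. 1"])
  show "(%nu. psi (scale_star (real n) nu)) \<in> bm Q" for n by (rule measurable_compose[OF scale_Q]) simp
  show "AE nu in Q. norm (psi (scale_star (real n) nu)) <= 1" for n
   using Q0(4) by eventually_elim (use psi_bound scale_star_space[OF V] in \<open>auto simp: star_space_def\<close>)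
  show "AE nu in Q. (%n. psi (scale_star (real n) nu)) \<longlonglongrightarrow> chi nu"
   using KK_AE Q0(4)
  proof eventually_elim
   case (elim nu)
   have rr: "nu \<in> radon_on V" using elim by (simp add: star_space_def)
   note [simp] = radon_sets[OF rr]
   show ?case
   proof (cases "em nu H = 0")
   case True
   have "em nu (oball 0 n Int H) = 0" for n
   using emeasure_mono[of "oball 0 n Int H" H nu] True H_borel[of 0] by simp
   thus ?thesis using True by (simp add: chi_def psi_scale[OF elim(2)] measure_def)
   next
   case False
   have sp: "measure nu (oball 0 n) = measure nu (oball 0 n Int H) + measure nu (oball 0 n - H)" for n
   by (rule measure_split[OF rr H_borel])
   have "(%n. 1 - measure nu (oball 0 n Int H) / measure nu (oball 0 n)) \<longlonglongrightarrow> 0"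
   proof (rule LIMSEQ_I)
   fix e :: real assume "e > 0"
   then obtain k where k: "rs k < e" using nat_approx_posE by blast
   obtain N where N: "ALL n>=N. measure nu (oball 0 n - H) * real (Suc k) <= measure nu (oball 0 n)"
   using elim(1) False unfolding KK_def by blast
   show "EX N. ALL n>=N. norm (1 - measure nu (oball 0 n Int H) / measure nu (oball 0 n) - 0) < e"
   proof (intro exI[of _ N] allI impI)
   fix n assume "n >= N"
   note p = star_ob[OF elim(2), of n]
   have "1 - measure nu (oball 0 n Int H) / measure nu (oball 0 n) = measure nu (oball 0 n - H) / measure nu (oball 0 n)"
   using p sp[of n] by (simp add: field_simps)
   moreover have "measure nu (oball 0 n - H) / measure nu (oball 0 n) <= rs k"
   using N[rule_format, OF \<open>n >= N\<close>] p by (simp add: field_simps)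
   ultimately show "norm (1 - measure nu (oball 0 n Int H) / measure nu (oball 0 n) - 0) < e" using k p by simp
   qed
   qed
   from tendsto_diff[OF tendsto_const[of 1] this] show ?thesis using False by (simp add: chi_def psi_scale[OF elim(2)])
   qed
  qed
 qed auto
 moreover have "(LINT nu|Q. psi (scale_star (real n) nu)) = (LINT nu|Q. psi nu)" for n by (rule scale_integral) measurable
 ultimately have "(LINT nu|Q. chi nu) = (LINT nu|Q. psi nu)" by (simp add: LIMSEQ_const_iff)
 hence z: "(LINT nu|Q. chi nu - psi nu) = 0" using ip ic by simp
 have le: "psi nu <= chi nu" if "nu \<in> radon_on V" for nu
 proof (cases "em nu H = 0")
  case True
  hence "em nu (oball 0 0 Int H) = 0"
   using emeasure_mono[of "oball 0 0 Int H" H nu] radon_sets[OF that] H_borel[of 0] by simp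
  thus ?thesis by (simp add: psi_def chi_def measure_def)
 qed (use psi_bound(2)[OF that] in \<open>simp add: chi_def\<close>)
 have "AE nu in Q. chi nu - psi nu = 0"
  using z ip ic le r by (subst (asm) integral_nonneg_eq_0_iff_AE) auto
 hence "AE nu in Q. em nu H > 0 --> em nu (oball 0 0 - H) = 0"
  using Q0(4)
 proof eventually_elim
  case (elim nu)
  have rr: "nu \<in> radon_on V" using elim by (simp add: star_space_def)
  show ?case
  proof
   assume "em nu H > 0"
   hence "measure nu (oball 0 0 Int H) = measure nu (oball 0 0)"
   using elim(1) star_ob[OF elim(2), of 0] by (simp add: chi_def psi_def field_simps split: if_splits)
   hence "measure nu (oball 0 0 - H) = 0" using measure_split[OF rr H_borel, of 0 0 0] by simp
   moreover have "em nu (oball 0 0 - H) < \<infinity>" using oball_fin'[OF rr, of 0 0 "- H"] by (simp add: Diff_eq)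
   ultimately show "em nu (oball 0 0 - H) = 0" using emeasure_fin by fastforce
  qed
 qed
 \<comment> \<open>Scaling by negative times extends the conclusion from the unit ball to balls of
   any size; \<open>H\<close> passes through the origin and is unchanged.\<close>
 hence "AE nu in Q. em (scale_star (- real n) nu) H > 0 --> em (scale_star (- real n) nu) (oball 0 0 - H) = 0" for n
  by (rule scale_AE)
 hence "AE nu in Q. ALL n. em (scale_star (- real n) nu) H > 0 --> em (scale_star (- real n) nu) (oball 0 0 - H) = 0"
  unfolding AE_all_countable by (rule allI)
 thus ?thesis using Q0(4)
 proof eventually_elim
  case (elim nu)
  have rr: "nu \<in> radon_on V" using elim by (simp add: star_space_def)
  show ?case
  proof
   assume p: "em nu H > 0"
   let ?X = "%n. aff (exp (- real n)) 0 -` (oball 0 0 - H)"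
   have sb: "oball 0 0 - H \<in> sets borel" using H_borel[of 0] by auto
   have "em nu (?X n) = 0" for n
   proof -
   obtain c where c: "c > 0" "ALL X:sets borel. em (scale_star (- real n) nu) X = ennreal c * em nu (aff (exp (- real n)) 0 -` X)"
   using scale_prop[OF elim(2)] by blast
   have "aff (exp (- real n)) 0 -` H = H" by (auto simp: aff_def)
   hence "em (scale_star (- real n) nu) H > 0" using c p H_borel[of 0] by (simp add: ennreal_zero_less_mult_iff)
   hence "em (scale_star (- real n) nu) (oball 0 0 - H) = 0" using elim(1) by blast
   thus ?thesis using c sb by simp
   qed
   moreover have "?X n \<in> sets nu" for n
   using measurable_sets_borel[OF aff_borel sb] radon_sets[OF rr] by simp
   ultimately have "em nu (\<Union>n. ?X n) = 0" by (intro emeasure_UN_eq_0) auto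
   moreover have "- H = (\<Union>n. ?X n)"
   proof -
   have "EX n::nat. exp (- real n) * infnorm y < 1" for y :: "real ^ 'd"
   proof -
   have "(%n. exp (- real n) * infnorm y) \<longlonglongrightarrow> 0" using tendsto_mult_left_zero[OF exp_neg_lim] by simp
   hence "eventually (%n. exp (- real n) * infnorm y < 1) sequentially" by (rule order_tendstoD) simp
   thus ?thesis by (auto simp: eventually_sequentially)
   qed
   thus ?thesis by (auto simp: aff_def oball_def infnorm_mul)
   qed
   ultimately show "em nu (- H) = 0" by simp
  qed
 qed
qed

text \<open>If a parallel hyperplane off the origin were charged, the dichotomy at a typical point
  of it would concentrate the measure there, against the origin being in the support. Hyperplanes
  through the origin are not excluded by this argument.\<close>

lemma hyperplane_null: "AE nu in Q. ALL c. c ~= 0 --> em nu {y. y \<bullet> b = c} = 0"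
 using qp_AE[OF V Q0(2,3) H_dichotomy] Q0(4)
proof eventually_elim
 case (elim nu)
 have r: "nu \<in> radon_on V" and z: "0 \<in> msupp nu" using elim by (auto simp: star_space_def)
 note [simp] = radon_sets[OF r] radon_space[OF r]
 show ?case
 proof (intro allI impI, rule ccontr)
  fix c :: real assume c: "c ~= 0" "em nu {y. y \<bullet> b = c} ~= 0"
  let ?E = "{y. y \<bullet> b = c}"
  have "EX y:?E. y \<in> msupp nu & (em (trans_star y nu) H > 0 --> em (trans_star y nu) (- H) = 0)"
  proof (rule ccontr)
   assume "\<not> ?thesis"
   hence "AE y in nu. y \<notin> ?E" using elim(1) msupp_AE[OF r] by (auto elim!: eventually_elim2)
   thus False using c(2) H_borel[of c] by (subst (asm) AE_iff_null_sets[symmetric]) (auto simp: null_sets_def)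
  qed
  then obtain y where y: "y \<in> ?E" "y \<in> msupp nu" "em (trans_star y nu) H > 0 --> em (trans_star y nu) (- H) = 0" by blast
  obtain a :: real where a: "a > 0" "ALL X:sets borel. em (trans_star y nu) X = ennreal a * em nu (aff 1 y -` X)"
   using star_distr_emeasure[OF r y(2), of 1] unfolding trans_star_aff by auto
  have p: "aff 1 y -` H = ?E" "aff 1 y -` (- H) = - ?E" using y(1) by (auto simp: aff_def inner_diff_left)
  have "em (trans_star y nu) H > 0" using a c(2) H_borel[of 0] p by (simp add: ennreal_zero_less_mult_iff zero_less_iff_neq_zero)
  hence "em nu (- ?E) = 0" using y(3) a H_borel[of 0] p by simp
  moreover have "open (- ?E)" "0 \<in> - ?E" using c(1) by (auto intro!: closed_Collect_eq continuous_intros)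
  ultimately show False using z unfolding msupp_def by fastforce
 qed
qed

end

text \<open>Here the choice of norm matters: a sup-norm sphere around 0 lies in finitely many
  coordinate hyperplanes off the origin.\<close>

lemma sphere_null:
 fixes V :: "(real ^ 'd) set"
 assumes V: "subspace V" and Q: "fractal_distribution V Q"
 shows "AE nu in Q. ALL r>0. em nu {y. infnorm y = r} = 0"
proof -
 have "AE nu in Q. ALL b:Basis. ALL c. c ~= 0 --> em nu {y :: real ^ 'd. y \<bullet> b = c} = 0"
  using hyperplane_null[OF V Q] by (subst AE_ball_countable) (auto intro: countable_finite)
 thus ?thesis using AE_space
 proof eventually_elim
  case (elim nu)
  hence r: "nu \<in> radon_on V" using space_P[OF V] Q by (auto simp: fractal_distribution_def)
  note [simp] = radon_sets[OF r]
  show ?case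
  proof (intro allI impI)
   fix r :: real assume "r > 0"
   let ?E = "%b c. {y :: real ^ 'd. y \<bullet> b = c}"
   have E: "?E b c \<in> sets borel" for b c by (intro borel_closed closed_Collect_eq continuous_intros)
   have "{y. infnorm y = r} \<subseteq> (\<Union>b\<in>Basis. ?E b r \<union> ?E b (- r))"
   proof
   fix y :: "real ^ 'd" assume "y \<in> {y. infnorm y = r}"
   moreover have "infnorm y \<in> (%b. \<bar>y \<bullet> b\<bar>) ` Basis" unfolding infnorm_Max by (rule Max_in) auto
   ultimately show "y \<in> (\<Union>b\<in>Basis. ?E b r \<union> ?E b (- r))" by (auto simp: abs_if split: if_splits)
   qed
   hence "em nu {y. infnorm y = r} <= em nu (\<Union>b\<in>Basis. ?E b r \<union> ?E b (- r))"
   using E by (intro emeasure_mono sets.finite_UN) auto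
   also have "... = 0"
   proof -
   have "(\<Union>b\<in>Basis. ?E b r \<union> ?E b (- r)) \<in> null_sets nu"
   using elim(1) \<open>r > 0\<close> E by (intro null_sets_UN' countable_finite null_sets.Un) (auto simp: null_sets_def)
   thus ?thesis by auto
   qed
   finally show "em nu {y. infnorm y = r} = 0" by simp
  qed
 qed
qed

section \<open>From vague limits to limits on balls\<close>

context
 fixes pj :: "real ^ 'd => real ^ 'k"
 assumes lin: "linear pj"
begin

lemma tube_ball_integral:
 assumes mu: "mu \<in> radon_on UNIV" and B: "B \<in> sets borel" and f: "f \<in> Cc"
 shows "integrable mu (%y. tI pj x r y * (indicator B y * f y) :: real)"
proof -
 have "integrable mu (%y. indicator (tube pj x r Int B) y *\<^sub>R f y)"
  using integrable_mult_indicator[OF _ Cc_integrable[OF mu f]] tube_borel[OF lin] B radon_sets[OF mu] by blast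
 thus ?thesis by (simp add: indicator_inter_arith mult.assoc)
qed

text \<open>The portmanteau argument: \<open>h n\<close> is a continuous approximation of the
  indicator of the ball, and the error is dominated by the bump \<open>k n\<close> around the
  boundary sphere, whose integral against \<open>nu\<close> is small because the sphere is null. The
  bump is itself a test function, so the error is also small before the limit.\<close>

lemma fconv_ball:
 assumes mu: "mu \<in> radon_on UNIV" and nu: "nu \<in> radon_on A" and c0: "!!r. r > 0 ==> c r > 0"
  and c: "!!f. f \<in> Cc ==> ((%r. c r * (LINT y|mu. tI pj x r y * f y)) \<longlongrightarrow> (LINT y|nu. f y)) at0"
  and z: "em nu {y. infnorm y = R} = 0" and f: "f \<in> Cc"
 shows "((%r. c r * (LINT y|mu. tI pj x r y * (indicator (sup_cball R 0) y * f y))) \<longlongrightarrow>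
  (LINT y|nu. indicator (sup_cball R 0) y * f y)) at0"
proof (rule tendstoI)
 fix e :: real assume e: "e > 0"
 let ?I = "%y :: real ^ 'd. indicator (sup_cball R 0) y :: real"
 obtain B where B: "B > 0" "!!y. \<bar>f y\<bar> <= B" using Cc_bounded[OF f] by blast
 define k where "k n y = max 0 (2 - \<bar>infnorm y - R\<bar> * real (Suc n))" for n :: nat and y :: "real ^ 'd"
 define h where "h n y = min 1 (max 0 ((R - infnorm y) * real (Suc n) + 1))" for n :: nat and y :: "real ^ 'd"
 have k0: "k n y >= 0" "k n y <= 2" for n y by (auto simp: k_def)
 have kC: "k n \<in> Cc" for n
 proof (rule CcI[where r="R + 2"])
  show "continuous_on UNIV (k n)" unfolding k_def[abs_def] by (intro continuous_intros)
  fix y :: "real ^ 'd" assume "infnorm y > R + 2"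
  hence "2 * 1 <= \<bar>infnorm y - R\<bar> * real (Suc n)" by (intro mult_mono) auto
  thus "k n y = 0" unfolding k_def by simp
 qed
 have hC: "(%y. f y * h n y) \<in> Cc" for n
  by (rule Cc_mult[OF f]) (unfold h_def[abs_def], intro continuous_intros)
 have hk: "\<bar>?I y - h n y\<bar> <= k n y" for n y
 proof -
  have p: "real (Suc n) > 0" by simp
  consider "infnorm y <= R" | "infnorm y > R" "(infnorm y - R) * real (Suc n) <= 1" | "(infnorm y - R) * real (Suc n) > 1" "infnorm y > R" by linarith
  thus ?thesis
  proof cases
   case 1
   hence "(R - infnorm y) * real (Suc n) >= 0" by simp
   thus ?thesis using 1 k0 by (simp add: h_def mem_sup_cball indicator_def)
  next
   case 2
   thus ?thesis by (simp add: h_def k_def mem_sup_cball indicator_def algebra_simps)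
  next
   case 3
   hence "h n y = 0" by (simp add: h_def algebra_simps)
   thus ?thesis using 3 k0 by (simp add: mem_sup_cball indicator_def)
  qed
 qed
 have "(%n. \<integral>y. k n y \<partial>nu) \<longlonglongrightarrow> (LINT y|nu. 0)"
 proof (rule integral_dominated_convergence[where w="%y. k 0 y"])
  show "k n \<in> bm nu" for n using Cc_borel[OF kC] radon_sets[OF nu] by (simp cong: mcs)
  show "integrable nu (k 0)" by (rule Cc_integrable[OF nu kC])
  have "closed {y :: real ^ 'd. infnorm y = R}" by (intro closed_Collect_eq continuous_intros)
  hence "AE y in nu. y \<notin> {y. infnorm y = R}" using z radon_sets[OF nu] by (intro AE_not_in) (auto simp: null_sets_def)
  thus "AE y in nu. (%n. k n y) \<longlonglongrightarrow> 0"
  proof eventually_elim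
   case (elim y)
   obtain N :: nat where N: "2 / \<bar>infnorm y - R\<bar> <= real N" using real_arch_simple by blast
   have "k n y = 0" if "n >= N" for n
   proof -
   have "2 / \<bar>infnorm y - R\<bar> <= real (Suc n)" using N that by linarith
   hence "2 <= \<bar>infnorm y - R\<bar> * real (Suc n)" using elim by (simp add: pos_divide_le_eq mult.commute)
   thus ?thesis unfolding k_def by simp
   qed
   thus ?case by (intro tendsto_eventually) (auto simp: eventually_sequentially)
  qed
  show "AE y in nu. norm (k n y) <= k 0 y" for n
  proof (rule AE_I2)
   fix y :: "real ^ 'd"
   have "\<bar>infnorm y - R\<bar> * 1 <= \<bar>infnorm y - R\<bar> * real (Suc n)" by (intro mult_left_mono) auto
   thus "norm (k n y) <= k 0 y" unfolding k_def by simp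
  qed
 qed simp
 hence "eventually (%n. (LINT y|nu. k n y) < e / (4 * B)) sequentially"
  by (rule order_tendstoD(2)) (use e B in simp)
 then obtain n where n: "(LINT y|nu. k n y) < e / (4 * B)" unfolding eventually_sequentially by auto
 have l1: "eventually (%r. c r * (LINT y|mu. tI pj x r y * k n y) < e / (4 * B)) at0"
  by (rule order_tendstoD(2)[OF c[OF kC] n])
 have l2: "eventually (%r. dist (c r * (LINT y|mu. tI pj x r y * (f y * h n y))) (LINT y|nu. f y * h n y) < e / 4) at0"
  by (rule tendstoD[OF c[OF hC]]) (use e in simp)
 have fk: "\<bar>?I y * f y - f y * h n y\<bar> <= B * k n y" for y
 proof -
  have "\<bar>?I y * f y - f y * h n y\<bar> = \<bar>f y\<bar> * \<bar>?I y - h n y\<bar>" by (simp add: abs_mult[symmetric] algebra_simps)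
  also have "... <= B * k n y" using B hk k0 by (intro mult_mono) auto
  finally show ?thesis .
 qed
 have b: "sup_cball R 0 \<in> sets (borel :: (real ^ 'd) measure)" by (rule sup_cball_borel)
 have i1: "integrable nu (%y. ?I y * f y)"
  using integrable_mult_indicator[OF _ Cc_integrable[OF nu f], of "sup_cball R 0"] b radon_sets[OF nu] by simp
 have "\<bar>(LINT y|nu. ?I y * f y) - (LINT y|nu. f y * h n y)\<bar> <= (LINT y|nu. B * k n y)"
 proof -
  have "\<bar>\<integral>y. ?I y * f y - f y * h n y \<partial>nu\<bar> <= (LINT y|nu. B * k n y)"
   by (rule integral_abs_bound_integral) (use i1 Cc_integrable[OF nu hC] Cc_integrable[OF nu kC] fk in auto)
  thus ?thesis using i1 Cc_integrable[OF nu hC] by simp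
 qed
 also have "... < e / 4" using n B(1) by (simp add: field_simps)
 finally have d1: "\<bar>(LINT y|nu. ?I y * f y) - (LINT y|nu. f y * h n y)\<bar> < e / 4" .
 have gt: "eventually (%r. r > 0) (at_right (0 :: real))" by (rule eventually_at_right_less)
 show "eventually (%r. dist (c r * (LINT y|mu. tI pj x r y * (?I y * f y))) (LINT y|nu. ?I y * f y) < e) at0"
  using l1 l2 gt
 proof eventually_elim
  case (elim r)
  let ?T = "indicator (tube pj x r) :: _ => real"
  have j: "integrable mu (%y. ?T y * g y)" if "g \<in> Cc" for g
   using integrable_mult_indicator[OF _ Cc_integrable[OF mu that], of "tube pj x r"] tube_borel[OF lin] radon_sets[OF mu] by simp
  have "\<bar>\<integral>y. ?T y * (?I y * f y) - ?T y * (f y * h n y) \<partial>mu\<bar> <= (LINT y|mu. B * (?T y * k n y))"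
  proof (rule integral_abs_bound_integral)
   fix y
   show "\<bar>?T y * (?I y * f y) - ?T y * (f y * h n y)\<bar> <= B * (?T y * k n y)" using fk[of y] by (simp add: indicator_def)
  qed (use j hC kC tube_ball_integral[OF mu b f] in auto)
  hence "\<bar>(LINT y|mu. ?T y * (?I y * f y)) - (LINT y|mu. ?T y * (f y * h n y))\<bar> <= B * (LINT y|mu. ?T y * k n y)"
   using j[OF hC] tube_ball_integral[OF mu b f] by simp
  hence "c r * \<bar>(LINT y|mu. ?T y * (?I y * f y)) - (LINT y|mu. ?T y * (f y * h n y))\<bar> <= c r * (B * (LINT y|mu. ?T y * k n y))"
   using c0[OF elim(3)] by (intro mult_left_mono) auto
  also have "... = B * (c r * (LINT y|mu. ?T y * k n y))" by simp
  also have "... < B * (e / (4 * B))" using elim(1) B(1) by (intro mult_strict_left_mono) auto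
  also have "... = e / 4" using B(1) by simp
  finally have "\<bar>c r * (LINT y|mu. ?T y * (?I y * f y)) - c r * (LINT y|mu. ?T y * (f y * h n y))\<bar> < e / 4"
   using c0[OF elim(3)] by (simp add: abs_mult right_diff_distrib[symmetric])
  thus ?case using elim(2) d1 e unfolding dist_real_def by linarith
 qed
qed

text \<open>Testing with \<open>cut R\<close>, which is 1 on the ball, gives convergence of the
  masses of the truncated tubes. Dividing by them removes the constants and leaves the conditioned
  measures of \<open>tube_limit\<close>.\<close>

lemma fconv_glued:
 assumes c: "fconv pj mu 0 nu" and mu: "mu \<in> radon_on UNIV" and z: "ALL r>0. em nu {y. infnorm y = r} = 0"
 shows "glued_fiber_measure pj mu 0 nu"
proof -
 obtain c where nu: "nu \<in> radon_on (fiber pj 0)" "0 \<in> msupp nu" and c: "!!r. r > 0 ==> c r > 0"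
  "!!f. f \<in> Cc ==> ((%r. c r * (LINT y|mu. tI pj 0 r y * f y)) \<longlongrightarrow> (LINT y|nu. f y)) at0"
  using c unfolding fconv_def by blast
 note [simp] = radon_sets[OF mu] radon_sets[OF nu(1)]
 show ?thesis
 proof (rule glued_from_limits[OF lin mu nu(1), of 1])
  show "em nu (sup_cball (real 1) 0) > 0" by (rule msupp_ball(1)[OF nu]) simp
  fix R :: nat assume R: "R >= 1"
  let ?B = "cb R :: (real ^ 'd) set"
  have bs: "?B \<in> sets borel" by (rule sup_cball_borel)
  have tb: "tube pj 0 r \<in> sets borel" for r by (rule tube_borel[OF lin])
  have fin: "em mu (?B Int tube pj 0 r) < \<infinity>" for r
   using radon_bounded[OF mu, of "?B Int tube pj 0 r"] bounded_Int compact_imp_bounded[OF compact_sup_cball] by blast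
  have lim: "((%r. c r * (LINT y|mu. tI pj 0 r y * (indicator ?B y * f y))) \<longlongrightarrow> (LINT y|nu. indicator ?B y * f y)) at0"
   if "f \<in> Cc" for f
   by (rule fconv_ball[OF mu nu(1) c _ that]) (use z R in auto)
  have one: "indicator ?B y * cut R y = (indicator ?B y :: real)" for y by (auto simp: indicator_def mem_sup_cball cut_eq1)
  have m1: "(LINT y|mu. tI pj 0 r y * (indicator ?B y * cut R y)) = measure mu (?B Int tube pj 0 r)" for r
  proof -
   have "(LINT y|mu. tI pj 0 r y * (indicator ?B y * cut R y)) = (LINT y|mu. indicator (?B Int tube pj 0 r) y)"
   unfolding one by (intro Bochner_Integration.integral_cong) (auto simp: indicator_def)
   thus ?thesis using radon_space[OF mu] by simp
  qed
  have m2: "(LINT y|nu. indicator ?B y * cut R y) = measure nu ?B" unfolding one using radon_space[OF nu(1)] by simp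
  have lm: "((%r. c r * measure mu (?B Int tube pj 0 r)) \<longlongrightarrow> measure nu ?B) at0" using lim[OF cut_Cc[of R]] unfolding m1 m2 .
  have pB: "measure nu ?B > 0" by (rule msupp_ball(2)[OF nu]) (use R in simp)
  have pe: "em nu ?B > 0" by (rule msupp_ball(1)[OF nu]) (use R in simp)
  have gt: "eventually (%r. r > 0) (at_right (0 :: real))" by (rule eventually_at_right_less)
  have ev: "eventually (%r. measure mu (?B Int tube pj 0 r) > 0) at0"
   using order_tendstoD(1)[OF lm pB] gt
  proof eventually_elim
   case (elim r)
   show ?case by (rule zero_less_mult_pos[OF elim(1) c(1)[OF elim(2)]])
  qed
  have pos: "em mu (?B Int tube pj 0 ep) > 0" if "ep > 0" for ep
  proof -
   obtain d where d: "d > 0" "!!r. 0 < r ==> r < d ==> measure mu (?B Int tube pj 0 r) > 0"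
   using ev unfolding eventually_at_right_field by auto
   define r where "r = min (d / 2) ep"
   have r: "0 < r" "r < d" "r <= ep" using d(1) that by (auto simp: r_def)
   have "em mu (?B Int tube pj 0 r) ~= 0" using d(2)[OF r(1,2)] by (auto simp: measure_def)
   moreover have "em mu (?B Int tube pj 0 r) <= em mu (?B Int tube pj 0 ep)"
   using tube_mono[OF lin r(3), of 0] bs tb by (intro emeasure_mono) auto
   ultimately show ?thesis by (auto simp: zero_less_iff_neq_zero)
  qed
  have u: "(LINT y|uniform_measure mu (?B Int tube pj 0 r). f y) =
   (LINT y|mu. tI pj 0 r y * (indicator ?B y * f y)) / measure mu (?B Int tube pj 0 r)" if "f \<in> Cc" "r > 0" for f r
  proof -
   have "f \<in> bm mu" using Cc_borel[OF that(1)] by (simp cong: mcs)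
   hence "(LINT y|uniform_measure mu (?B Int tube pj 0 r). f y) = (LINT y|mu. indicator (?B Int tube pj 0 r) y * f y) / measure mu (?B Int tube pj 0 r)"
   using bs tb fin by (intro integral_uniform_measure) auto
   thus ?thesis by (simp add: indicator_inter_arith mult_ac)
  qed
  have v: "(LINT y|uniform_measure nu ?B. f y) = (LINT y|nu. indicator ?B y * f y) / measure nu ?B" if "f \<in> Cc" for f
  proof -
   have "f \<in> bm nu" using Cc_borel[OF that(1)] by (simp cong: mcs)
   thus ?thesis using bs radon_ball[OF nu(1)] by (intro integral_uniform_measure) auto
  qed
  have "((%r. \<integral>y. f y \<partial>uniform_measure mu (?B Int tube pj 0 r)) \<longlongrightarrow> (LINT y|uniform_measure nu ?B. f y)) at0" if "f \<in> Cc" for f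
   unfolding v[OF that]
  proof (rule Lim_transform_eventually[OF tendsto_divide[OF lim[OF that] lm]])
   show "measure nu ?B ~= 0" using pB by simp
   show "eventually (%r. c r * (LINT y|mu. tI pj 0 r y * (indicator ?B y * f y)) / (c r * measure mu (?B Int tube pj 0 r)) =
   (LINT y|uniform_measure mu (?B Int tube pj 0 r). f y)) at0"
   using gt
   proof eventually_elim
   case (elim r)
   thus ?case using c(1)[OF elim] unfolding u[OF that elim] by simp
   qed
  qed
  moreover have "uniform_measure nu ?B \<in> radon_on UNIV" by (rule uniform_measure_radon) (use bs in auto)
  moreover have "uniform_measure mu (?B Int tube pj 0 r) \<in> radon_on UNIV" for r by (rule uniform_measure_radon) (use bs tb in auto)
  ultimately show "tube_limit pj mu 0 R (uniform_measure nu ?B)"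
   unfolding tube_limit_def limitin_weak_iff tube_def[symmetric] using pos by auto
 qed
qed

end

section \<open>Transfer of local dimensions\<close>

lemma local_dim_transfer:
 assumes nu: "nu \<in> radon_on A" and y: "y \<in> msupp nu" and c: "c > 0"
  and m: "!!r. measure nu' (sup_cball r z) = c * measure nu (sup_cball r y)"
  and l: "((%r. ln (measure nu' (sup_cball r z)) / ln r) \<longlongrightarrow> al) at0"
 shows "((%r. ln (measure nu (sup_cball r y)) / ln r) \<longlongrightarrow> al) at0"
proof -
 \<comment> \<open>A factor \<open>c\<close> in the mass changes the quotient by
   \<open>ln c / ln r\<close>, which vanishes in the limit.\<close>
 have "((%r. inverse (ln r)) \<longlongrightarrow> 0) (at_right (0 :: real))"
  using tendsto_inverse_0 filterlim_mono[OF ln_at_0 at_bot_le_at_infinity order_refl] by (rule filterlim_compose)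
 from tendsto_diff[OF l tendsto_mult_right_zero[OF this, of "ln c"]]
 have "((%r. ln (measure nu' (sup_cball r z)) / ln r - ln c * inverse (ln r)) \<longlongrightarrow> al) at0" by simp
 moreover have "eventually (%r. r > 0) (at_right (0 :: real))" by (rule eventually_at_right_less)
 hence "eventually (%r. ln (measure nu' (sup_cball r z)) / ln r - ln c * inverse (ln r) = ln (measure nu (sup_cball r y)) / ln r) at0"
 proof eventually_elim
  case (elim r)
  have "measure nu (sup_cball r y) > 0" by (rule msupp_ball(2)[OF nu y elim])
  thus ?case unfolding m using c by (simp add: ln_mult divide_inverse algebra_simps)
 qed
 ultimately show ?thesis by (rule Lim_transform_eventually)
qed

lemma exact_dim_transfer:
 assumes nu: "nu \<in> radon_on A" and nu': "nu' \<in> radon_on B" and c: "c > 0"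
  and e: "!!X. X \<in> sets borel ==> em nu' X = ennreal c * em nu (aff 1 x -` X)"
  and d: "exact_dimensional nu' al"
 shows "exact_dimensional nu al"
proof -
 note [simp] = radon_sets[OF nu] radon_space[OF nu] radon_sets[OF nu'] radon_space[OF nu']
 let ?L = "%m y. ((%r. ln (measure m (sup_cball r y)) / ln r) \<longlongrightarrow> al) at0"
 obtain N where N: "{z \<in> space nu'. \<not> ?L nu' z} \<subseteq> N" "em nu' N = 0" "N \<in> sets nu'"
  using d unfolding exact_dimensional_def by (elim AE_E)
 have Nb: "N \<in> sets borel" using N(3) by simp
 have "em nu (aff 1 x -` N) = 0" using e[OF Nb] N(2) c by simp
 hence "AE y in nu. y \<notin> aff 1 x -` N"
  using measurable_sets_borel[OF aff_borel Nb] by (intro AE_not_in) (auto simp: null_sets_def)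
 thus ?thesis unfolding exact_dimensional_def using msupp_AE[OF nu]
 proof eventually_elim
  case (elim y)
  hence l: "?L nu' (aff 1 x y)" and ym: "y \<in> msupp nu" using N(1) by auto
  have b: "aff 1 x -` sup_cball r (aff 1 x y) = sup_cball r y" for r
   by (auto simp: aff_def mem_sup_cball)
  have m: "measure nu' (sup_cball r (aff 1 x y)) = c * measure nu (sup_cball r y)" for r
   using e[OF sup_cball_borel[of r "aff 1 x y"]] c unfolding b by (simp add: measure_def enn2real_mult)
  show ?case by (rule local_dim_transfer[OF nu ym c m l])
 qed
qed

lemma exact_dim_proportional:
 assumes nu: "nu \<in> radon_on A" and nu': "nu' \<in> radon_on B" and p: "proportional nu' nu" and d: "exact_dimensional nu' al"
 shows "exact_dimensional nu al"
proof -
 obtain c :: real where c: "c > 0" "nu' = scale_measure (ennreal c) nu" using p by (auto simp: proportional_def)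
 show ?thesis
  by (rule exact_dim_transfer[OF nu nu' c(1) _ d, where x=0]) (simp add: c(2) aff_def vimage_def)
qed

lemma exact_dim_trans_star:
 assumes nu: "nu \<in> radon_on A" and x: "x \<in> msupp nu" and d: "exact_dimensional (trans_star x nu) al"
 shows "exact_dimensional nu al"
proof -
 obtain c :: real where c: "c > 0" "ALL X:sets borel. em (trans_star x nu) X = ennreal c * em nu (aff 1 x -` X)"
  using star_distr_emeasure[OF nu x, of 1] unfolding trans_star_aff by auto
 have "trans_star x nu \<in> radon_on UNIV"
  unfolding trans_star_aff by (intro star_radon aff_radon[OF radon_UNIV[OF nu]]) auto
 from exact_dim_transfer[OF nu this c(1) _ d, where x=x] c(2) show ?thesis by blast
qed

section \<open>The fiber map as a factor map\<close>

context
 fixes pj :: "real ^ 'd => real ^ 'k" and P :: "(real ^ 'd) measure measure"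
 assumes lin: "linear pj" and E: "ergodic_fractal_distribution UNIV P"
begin

abbreviation "QQ \<equiv> distr P (radon_borel (fiber pj 0)) (F0 pj)"

definition good :: "(real ^ 'd) measure => bool" where
 "good mu \<longleftrightarrow> mu \<in> GG pj & mu \<in> star_space UNIV & (ALL r>0. em (F0 pj mu) {y. infnorm y = r} = 0)"

lemma good_AE: "AE mu in P. good mu"
proof -
 have "fractal_distribution (fiber pj 0) QQ" using QD_efd[OF lin E] by (simp add: ergodic_fractal_distribution_def)
 from AE_distrD[OF F0_P[OF lin E] sphere_null[OF subspace_fiber[OF lin] this]] P_good[OF lin E]
 show ?thesis by eventually_elim (simp add: good_def)
qed

text \<open>Scalings map spheres around 0 to such spheres, so \<open>good\<close> is preserved at
  all times at once. A single null set then serves every \<open>t\<close>, as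
  \<open>factor_map\<close> demands.\<close>

lemma good_scale: assumes g: "good mu" shows "good (scale_star t mu)" "F0 pj (scale_star t mu) = scale_star t (F0 pj mu)"
proof -
 have G: "mu \<in> GG pj" "mu \<in> star_space UNIV" and n: "!!r. r > 0 ==> em (F0 pj mu) {y. infnorm y = r} = 0" using g by (auto simp: good_def)
 have z: "0 \<in> msupp mu" using G(2) by (simp add: star_space_def)
 note F0_scale[OF lin G(1) z, of t]
 moreover have "em (scale_star t (F0 pj mu)) {y. infnorm y = r} = 0" if "r > 0" for r
 proof -
  have F: "F0 pj mu \<in> radon_on (fiber pj 0)" "0 \<in> msupp (F0 pj mu)" using F0_space[OF lin G(1)] by (auto simp: star_space_def)
  obtain c :: real where c: "c > 0" "ALL X:sets borel. em (scale_star t (F0 pj mu)) X = ennreal c * em (F0 pj mu) (aff (exp t) 0 -` X)"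
   using star_distr_emeasure[OF F, of "exp t"] unfolding scale_star_aff by auto
  have p: "aff (exp t) 0 -` {y. infnorm y = r} = {y. infnorm y = r * exp (- t)}" by (auto simp: aff_def infnorm_mul exp_minus field_simps)
  have b: "{y :: real ^ 'd. infnorm y = r} \<in> sets borel" by (intro borel_closed closed_Collect_eq continuous_intros)
  show ?thesis using n[of "r * exp (- t)"] that unfolding bspec[OF c(2) b] p by simp
 qed
 ultimately show "good (scale_star t mu)" "F0 pj (scale_star t mu) = scale_star t (F0 pj mu)"
  using scale_star_space[OF subspace_UNIV G(2)] by (auto simp: good_def)
qed

lemma good_fiber_measure:
 assumes g: "good mu"
 shows "fiber_measure_defined pj mu 0" "fiber_map pj mu = F0 pj mu" "proportional (F0 pj mu) (fiber_measure pj mu 0)"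
proof -
 have G: "mu \<in> GG pj" and n: "!!r. r > 0 ==> em (F0 pj mu) {y. infnorm y = r} = 0" using g by (auto simp: good_def)
 have mu: "mu \<in> radon_on UNIV" using G by (simp add: GG_def)
 note N = N1_limit(1,2)[OF lin G]
 have c: "1 / measure (N1 pj mu) (sup_cball 1 0) > 0" using msupp_ball(2)[OF N, of 1] by simp
 have p: "proportional (F0 pj mu) (N1 pj mu)" unfolding F0_def star_def proportional_def using c by blast
 have "em (N1 pj mu) {y. infnorm y = r} = 0" if "r > 0" for r
  using n[OF that] c unfolding F0_def star_def by simp
 hence gl: "glued_fiber_measure pj mu 0 (N1 pj mu)" by (intro fconv_glued[OF lin N1_fconv[OF lin G] mu]) simp
 note f = fiber_measure_eq[OF lin mu gl]
 show "fiber_measure_defined pj mu 0" by (rule f(1))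
 show "fiber_map pj mu = F0 pj mu" unfolding fiber_map_def F0_def by (rule star_proportional[OF f(3)])
 show "proportional (F0 pj mu) (fiber_measure pj mu 0)" by (rule proportional_trans[OF p proportional_sym[OF f(3)]])
qed

lemma fiber_map_measurable: "fiber_map pj \<in> completion P \<rightarrow>\<^sub>M radon_borel (fiber pj 0)"
proof (rule measurableI)
 have sp: "space P = radon_on UNIV" by (rule spaceP[OF lin E])
 show "fiber_map pj mu \<in> space (radon_borel (fiber pj 0))" if "mu \<in> space (completion P)" for mu
  using that fiber_measure_radon[OF lin, of mu 0] star_radon by (simp add: fiber_map_def sp)
 fix A assume A: "A \<in> sets (radon_borel (fiber pj 0))"
 let ?F = "F0 pj -` A Int space P" and ?G = "fiber_map pj -` A Int space P"
 have F: "?F \<in> sets (completion P)" using measurable_sets[OF F0_P[OF lin E] A] by simp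
 have "AE mu in P. mu \<in> ?F \<longleftrightarrow> mu \<in> ?G" using good_AE by eventually_elim (simp add: good_fiber_measure)
 hence "AE mu in completion P. mu \<in> ?F \<longleftrightarrow> mu \<in> ?G" by (rule AE_completion)
 from completion.in_sets_AE[OF this F] show "fiber_map pj -` A Int space (completion P) \<in> sets (completion P)" by simp
qed

lemma fiber_distribution_eq: "fiber_distribution pj P = QQ"
proof -
 have "fiber_distribution pj P = distr (completion P) (radon_borel (fiber pj 0)) (F0 pj)"
  unfolding fiber_distribution_def
  by (intro distr_cong_AE refl AE_completion fiber_map_measurable measurable_completion F0_P[OF lin E])
   (use good_AE in eventually_elim, simp add: good_fiber_measure)
 also have "... = QQ" by (rule distr_completion[OF F0_P[OF lin E]])
 finally show ?thesis .
qed

lemma fiber_factor_map: "factor_map P (fiber_distribution pj P) (fiber_map pj)"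
 unfolding factor_map_def
proof (intro conjI)
 show "fiber_map pj \<in> completion P \<rightarrow>\<^sub>M fiber_distribution pj P"
  using fiber_map_measurable by (simp add: fiber_distribution_def)
 have "distr (completion P) (fiber_distribution pj P) (fiber_map pj) = distr (completion P) (radon_borel (fiber pj 0)) (fiber_map pj)"
  by (intro distr_cong) (auto simp: fiber_distribution_def)
 thus "distr (completion P) (fiber_distribution pj P) (fiber_map pj) = fiber_distribution pj P"
  by (simp add: fiber_distribution_def)
 show "AE mu in P. ALL t. fiber_map pj (scale_star t mu) = scale_star t (fiber_map pj mu)"
  using good_AE by eventually_elim (simp add: good_fiber_measure good_scale)
qed

text \<open>At a typical point \<open>x\<close>, \<open>F0\<close> of the translated measure is the
  conditional measure of \<open>x\<close> up to translation and a scalar, and neither of these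
  affects exact dimensionality.\<close>

lemma fiber_dimension:
 assumes d: "AE nu in QQ. exact_dimensional nu al"
 shows "AE mu in P. exact_dimensional (fiber_measure pj mu 0) al & glued_disintegration pj mu (fiber_measure pj mu) &
  (AE x in mu. fiber_measure_defined pj mu x & exact_dimensional (fiber_measure pj mu x) al)"
proof -
 have F: "AE mu in P. exact_dimensional (F0 pj mu) al" by (rule AE_distrD[OF F0_P[OF lin E] d])
 note EP = EP[OF lin E]
 from qp_AE[OF subspace_UNIV EP(2,3) F]
 have "AE mu in P. AE x in mu. exact_dimensional (F0 pj (trans_star x mu)) al" by simp
 thus ?thesis using F good_AE
 proof eventually_elim
  case (elim mu)
  have mu: "mu \<in> radon_on UNIV" using elim(3) by (simp add: good_def GG_def)
  have "F0 pj mu \<in> radon_on (fiber pj 0)"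
   using F0_space[OF lin, of mu] elim(3) by (simp add: good_def star_space_def)
  from exact_dim_proportional[OF fiber_measure_radon[OF lin mu] this good_fiber_measure(3)[OF elim(3)] elim(2)]
  have "exact_dimensional (fiber_measure pj mu 0) al" .
  moreover have "AE x in mu. fiber_measure_defined pj mu x & exact_dimensional (fiber_measure pj mu x) al"
   using elim(1) trans_good[OF lin E mu] fiber_measure_AE[OF lin mu]
  proof eventually_elim
   case (elim x)
   hence "fm pj mu x \<in> radon_on (fiber pj x)" "x \<in> msupp (fm pj mu x)" by (auto simp: fconv_def)
   hence "exact_dimensional (fm pj mu x) al" using exact_dim_trans_star elim by metis
   hence "exact_dimensional (fiber_measure pj mu x) al"
   using exact_dim_proportional[OF fiber_measure_radon[OF lin mu] _ proportional_sym] elim \<open>fm pj mu x \<in> radon_on (fiber pj x)\<close> by blast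
   thus ?case using elim by blast
  qed
  ultimately show ?case using glued_disintegration_fiber_measure[OF lin mu] by blast
 qed
qed

end

section \<open>An integral inequality for orbits cut into blocks\<close>

lemma block_sum:
 fixes b :: "nat => real"
 assumes T: "T >= 0" "!!i. b i <= T"
  and bl: "!!i. i \<notin> D ==> EX n. 1 <= n & n <= N & (\<Sum>j<n. b (i + j)) <= 0"
 shows "k <= M ==> (\<Sum>i\<in>{k..<M}. b i) <= T * (real (card (D Int {k..<M})) + real N)"
proof (induction "M - k" arbitrary: k rule: less_induct)
 case less
 show ?case
 \<comment> \<open>From \<open>k\<close> the sum advances either by one index, paying
   \<open>T\<close> for an index in \<open>D\<close>, or by a whole block with nonpositive sum. A
   final stretch of length at most \<open>N\<close>, where a block might not fit, costs
   \<open>T * N\<close>.\<close>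
 proof (cases "M - k <= N")
  case True
  have "(\<Sum>i\<in>{k..<M}. b i) <= real (card {k..<M}) * T" by (rule sum_bounded_above) (rule T)
  also have "... <= real N * T" using True T by (intro mult_right_mono) auto
  also have "... <= T * (real (card (D Int {k..<M})) + real N)" using T by (simp add: algebra_simps)
  finally show ?thesis .
 next
  case False
  show ?thesis
  proof (cases "k \<in> D")
   case True
   have k: "k < M" using False by simp
   have e: "{k..<M} = insert k {Suc k..<M}" using k by auto
   have "card (D Int {k..<M}) = Suc (card (D Int {Suc k..<M}))" unfolding e using True by simp
   moreover have "(\<Sum>i\<in>{Suc k..<M}. b i) <= T * (real (card (D Int {Suc k..<M})) + real N)" using k by (intro less) auto
   moreover have "(\<Sum>i\<in>{k..<M}. b i) = b k + (\<Sum>i\<in>{Suc k..<M}. b i)" unfolding e by simp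
   ultimately show ?thesis using T(2)[of k] by (simp add: algebra_simps)
  next
   case kD: False
   obtain n where n: "1 <= n" "n <= N" "(\<Sum>j<n. b (k + j)) <= 0" using bl[OF kD] by blast
   have "(\<Sum>i\<in>{k..<M}. b i) = (\<Sum>i\<in>{k..<k+n}. b i) + (\<Sum>i\<in>{k+n..<M}. b i)"
   using n False by (intro sum.atLeastLessThan_concat[symmetric]) auto
   also have "(\<Sum>i\<in>{k..<k+n}. b i) = (\<Sum>j<n. b (k + j))"
   using sum.shift_bounds_nat_ivl[of b 0 k n] by (simp add: atLeast0LessThan add.commute)
   finally have s: "(\<Sum>i\<in>{k..<M}. b i) <= (\<Sum>i\<in>{k+n..<M}. b i)" using n(3) by simp
   also have "... <= T * (real (card (D Int {k+n..<M})) + real N)" using n False by (intro less) auto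
   also have "... <= T * (real (card (D Int {k..<M})) + real N)"
   using T by (intro mult_left_mono add_right_mono) (auto intro!: card_mono)
   finally show ?thesis .
  qed
 qed
qed

context prob_space
begin

text \<open>Stopping-time proof of the ergodic theorem after Katznelson and Weiss: orbits are cut into blocks with nonpositive sums.\<close>

lemma nonpos_blocks:
 fixes f :: "'a => real"
 assumes th: "\<theta> \<in> M \<rightarrow>\<^sub>M M" and inv: "distr M M \<theta> = M"
  and f: "integrable M f" and T: "T >= 0" "!!x. x \<in> space M ==> f x <= T"
  and b: "AE x in M. EX n>=1. (\<Sum>i<n. f ((\<theta> ^^ i) x)) <= 0"
 shows "expectation f <= 0"
proof -
 have thi [measurable]: "\<theta> ^^ i \<in> M \<rightarrow>\<^sub>M M" for i by (rule measurable_compose_n[OF th])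
 have invi: "distr M M (\<theta> ^^ i) = M" for i
 proof (induction i)
  case 0 thus ?case by (simp add: distr_id2 id_def)
 next
  case (Suc i)
  have "distr M M (\<theta> ^^ Suc i) = distr (distr M M (\<theta> ^^ i)) M \<theta>" by (subst distr_distr[OF th thi]) simp
  thus ?case by (simp only: Suc inv)
 qed
 have [measurable]: "f \<in> bm M" using f by auto
 have It: "expectation (%x. g ((\<theta> ^^ i) x)) = expectation g" "integrable M (%x. g ((\<theta> ^^ i) x))" if "integrable M g" for g :: "'a => real" and i
 proof -
  have g: "g \<in> bm M" using that by auto
  show "expectation (%x. g ((\<theta> ^^ i) x)) = expectation g" using integral_distr[OF thi g] by (simp add: invi)
  show "integrable M (%x. g ((\<theta> ^^ i) x))" using that integrable_distr_eq[OF thi g] by (simp add: invi)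
 qed
 \<comment> \<open>No block of length at most \<open>N\<close> may start at these points. Almost
   every point leaves the decreasing sets eventually, so their probability tends to 0.\<close>
 define bad where "bad N = {x \<in> space M. ALL n:{1..N}. (\<Sum>i<n. f ((\<theta> ^^ i) x)) > 0}" for N :: nat
 have bm [measurable]: "bad N \<in> events" for N unfolding bad_def by measurable
 have "decseq bad" by (force simp: decseq_def bad_def)
 hence "(%N. prob (bad N)) \<longlonglongrightarrow> prob (\<Inter>N. bad N)" using bm by (intro finite_Lim_measure_decseq) auto
 moreover have "prob (\<Inter>N. bad N) = 0"
 proof -
  have "AE x in M. x \<notin> (\<Inter>N. bad N)" using b
  proof eventually_elim
   case (elim x)
   then obtain n where n: "n >= 1" "(\<Sum>i<n. f ((\<theta> ^^ i) x)) <= 0" by blast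
   hence "x \<notin> bad n" unfolding bad_def by force
   thus ?case by blast
  qed
  thus ?thesis by (subst prob_eq_0) auto
 qed
 ultimately have lim: "(%N. prob (bad N)) \<longlonglongrightarrow> 0" by simp
 show ?thesis
 proof (rule field_le_epsilon)
  fix e :: real assume e: "e > 0"
  have "eventually (%N. prob (bad N) < e / (2 * (T + 1))) sequentially" using e T by (intro order_tendstoD[OF lim]) simp
  then obtain N where N: "prob (bad N) < e / (2 * (T + 1))" by (auto simp: eventually_sequentially)
  \<comment> \<open>The orbit length \<open>m\<close> makes the boundary term \<open>T * N\<close>
    at most \<open>m * e / 2\<close>; the choice of \<open>N\<close> has done the same for the bad
    points.\<close>
  obtain m0 :: nat where m0: "2 * T * real N / e <= real m0" using real_arch_simple by blast
  define m where "m = Suc m0"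
  have m: "2 * T * real N <= e * real m" "m > 0" using m0 e by (auto simp: m_def field_simps)
  let ?I = "indicator (bad N) :: 'a => real"
  have ib: "integrable M ?I" by (rule integrable_real_indicator) (auto simp: less_top[symmetric])
  have path: "(\<Sum>i<m. f ((\<theta> ^^ i) x)) <= T * ((\<Sum>i<m. ?I ((\<theta> ^^ i) x)) + real N)" if x: "x \<in> space M" for x
  proof -
   have sp: "(\<theta> ^^ i) x \<in> space M" for i using measurable_space[OF thi x] .
   let ?D = "{i. (\<theta> ^^ i) x \<in> bad N}"
   have "(\<Sum>i\<in>{0..<m}. f ((\<theta> ^^ i) x)) <= T * (real (card (?D Int {0..<m})) + real N)"
   proof (rule block_sum)
   fix i assume "i \<notin> ?D"
   then obtain n where n: "n \<in> {1..N}" "(\<Sum>j<n. f ((\<theta> ^^ j) ((\<theta> ^^ i) x))) <= 0" using sp[of i] unfolding bad_def by fastforce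
   have "(\<theta> ^^ j) ((\<theta> ^^ i) x) = (\<theta> ^^ (i + j)) x" for j by (simp add: funpow_add[symmetric] add.commute flip: comp_apply[of "\<theta> ^^ j"])
   thus "EX n. 1 <= n & n <= N & (\<Sum>j<n. f ((\<theta> ^^ (i + j)) x)) <= 0" using n by auto
   qed (use T sp in auto)
   moreover have "(\<Sum>i<m. ?I ((\<theta> ^^ i) x)) = real (card (?D Int {0..<m}))"
   proof -
   have "(\<Sum>i<m. ?I ((\<theta> ^^ i) x)) = real (card ({..<m} Int ?D))" by (simp add: indicator_def)
   thus ?thesis by (simp only: atLeast0LessThan Int_commute[of _ ?D])
   qed
   ultimately show ?thesis by (simp add: atLeast0LessThan)
  qed
  have "expectation (%x. \<Sum>i<m. f ((\<theta> ^^ i) x)) <= expectation (%x. T * ((\<Sum>i<m. ?I ((\<theta> ^^ i) x)) + real N))"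
   using It[OF f] It[OF ib] path by (intro integral_mono) auto
  moreover have "expectation (%x. \<Sum>i<m. f ((\<theta> ^^ i) x)) = real m * expectation f"
   using It[OF f] by (subst Bochner_Integration.integral_sum) auto
  moreover have "expectation (%x. T * ((\<Sum>i<m. ?I ((\<theta> ^^ i) x)) + real N)) = T * (real m * prob (bad N) + real N)"
  proof -
   have "expectation (%x. \<Sum>i<m. ?I ((\<theta> ^^ i) x)) = real m * prob (bad N)"
   using It[OF ib] by (subst Bochner_Integration.integral_sum) auto
   moreover have "integrable M (%x. \<Sum>i<m. ?I ((\<theta> ^^ i) x))" using It(2)[OF ib] by (intro Bochner_Integration.integrable_sum)
   ultimately show ?thesis by (simp add: prob_space)
  qed
  ultimately have "real m * expectation f <= T * (real m * prob (bad N) + real N)" by (simp only:)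
  also have "... = real m * (T * prob (bad N)) + T * real N" by (simp add: algebra_simps)
  also have "... <= real m * (e / 2) + real m * (e / 2)"
  proof (rule add_mono)
   have "T * prob (bad N) * 2 + prob (bad N) * 2 < e" using N T by (simp add: pos_less_divide_eq algebra_simps)
   hence "T * prob (bad N) <= e / 2" using measure_nonneg[of M "bad N"] by linarith
   thus "real m * (T * prob (bad N)) <= real m * (e / 2)" by (intro mult_left_mono) auto
   have "T * real N * 2 <= real m * e" using m(1) by (simp add: mult_ac)
   thus "T * real N <= real m * (e / 2)" by simp
  qed
  also have "... = real m * e" by (simp add: field_simps)
  finally show "expectation f <= 0 + e" using m(2) by simp
 qed
qed

end

section \<open>Growth rates along orbits\<close>

definition lowg :: "(real => real) => real => bool" where
 "lowg g c \<longleftrightarrow> (EX k::nat. ALL m::nat. EX n>=m. g (real n) < (c - rs k) * real n)"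

definition highg :: "(real => real) => real => bool" where
 "highg g c \<longleftrightarrow> (EX k::nat. ALL m::nat. EX n>=m. g (real n) > (c + rs k) * real n)"

text \<open>\<open>lowg g c\<close> expresses that the limit inferior of \<open>g n / n\<close> is
  below \<open>c\<close>, by countably many inequalities at integer times. Passing from the margin
  \<open>1 / (k + 1)\<close> to \<open>1 / (k + 2)\<close> leaves room that is linear in
  \<open>n\<close> and absorbs the shift by a real \<open>t\<close> and the constant
  \<open>C\<close>; monotonicity takes care of the rounding.\<close>

lemma lowg_shift:
 assumes g: "mono g" "!!n::nat. g (real n) >= 0" and l: "lowg g c" shows "lowg (%s. g (s + t) - C) c"
proof -
 obtain k where k: "!!m. EX n>=m. g (real n) < (c - rs k) * real n" using l unfolding lowg_def by blast
 let ?q = "c - rs k" and ?q' = "c - 1 / real (Suc (Suc k))"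
 have "1 / real (Suc (Suc k)) < rs k" by (rule divide_strict_left_mono) auto
 hence d: "?q' - ?q > 0" by linarith
 have q: "?q > 0"
 proof -
  obtain n where n: "g (real n) < ?q * real n" using k[of 0] by blast
  hence "0 < ?q * real n" using g(2)[of n] by (rule order_le_less_trans[rotated])
  thus ?thesis by (simp add: zero_less_mult_iff)
 qed
 have "EX n>=m. g (real n + t) - C < ?q' * real n" for m
 proof -
  obtain j :: nat where j: "(?q' * (t + 1) - C) / (?q' - ?q) <= real j" using real_arch_simple by blast
  obtain i :: nat where i: "real m + t + 1 <= real i" using real_arch_simple by blast
  obtain n where n: "n >= max i j" "g (real n) < ?q * real n" using k by blast
  define p where "p = nat \<lfloor>real n - t\<rfloor>"
  have nt: "real n - t >= real m + 1" using i n(1) by linarith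
  hence p: "real p <= real n - t" "real n - t < real p + 1" unfolding p_def by linarith+
  have "g (real p + t) <= g (real n)" using p by (intro monoD[OF g(1)]) simp
  also note n(2)
  also have "?q * real n <= ?q' * real p + C"
  proof -
   have "(?q' * (t + 1) - C) / (?q' - ?q) <= real n" using j n(1) by linarith
   hence "?q' * (t + 1) - C <= (?q' - ?q) * real n" using d by (simp only: pos_divide_le_eq mult.commute)
   moreover have "?q' * (real n - t) <= ?q' * (real p + 1)" using q d p by (intro mult_left_mono) linarith+
   ultimately show ?thesis by (simp only: distrib_left left_diff_distrib right_diff_distrib)
  qed
  finally have "g (real p + t) - C < ?q' * real p" by simp
  moreover have "p >= m" using p nt by linarith
  ultimately show ?thesis by blast
 qed
 thus ?thesis unfolding lowg_def by blast
qed

lemma highg_shift: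
 assumes g: "mono g" and c: "c >= 0" and l: "highg g c" shows "highg (%s. g (s + t) - C) c"
proof -
 obtain k where k: "!!m. EX n>=m. g (real n) > (c + rs k) * real n" using l unfolding highg_def by blast
 let ?q = "c + rs k" and ?q' = "c + 1 / real (Suc (Suc k))"
 have "1 / real (Suc (Suc k)) < rs k" by (rule divide_strict_left_mono) auto
 hence d: "?q - ?q' > 0" by linarith
 have "1 / real (Suc (Suc k)) > 0" by simp
 hence q: "?q' >= 0" using c by linarith
 have "EX n>=m. g (real n + t) - C > ?q' * real n" for m
 proof -
  obtain j :: nat where j: "(?q' * (1 - t) + C) / (?q - ?q') <= real j" using real_arch_simple by blast
  obtain i :: nat where i: "real m + t + 1 <= real i" using real_arch_simple by blast
  obtain n where n: "n >= max i j" "g (real n) > ?q * real n" using k by blast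
  define p where "p = nat \<lceil>real n - t\<rceil>"
  have nt: "real n - t >= real m + 1" using i n(1) by linarith
  hence p: "real p >= real n - t" "real p < real n - t + 1" unfolding p_def by linarith+
  have "?q' * real p + C <= ?q * real n"
  proof -
   have "(?q' * (1 - t) + C) / (?q - ?q') <= real n" using j n(1) by linarith
   hence "?q' * (1 - t) + C <= (?q - ?q') * real n" using d by (simp only: pos_divide_le_eq mult.commute)
   moreover have "?q' * real p <= ?q' * (real n - t + 1)" using q p by (intro mult_left_mono) linarith+
   ultimately show ?thesis by (simp only: distrib_left left_diff_distrib right_diff_distrib)
  qed
  also note n(2)
  also have "g (real n) <= g (real p + t)" using p by (intro monoD[OF g(1)]) simp
  finally have "g (real p + t) - C > ?q' * real p" by simp
  moreover have "p >= m" using p nt by linarith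
  ultimately show ?thesis by blast
 qed
 thus ?thesis unfolding highg_def by blast
qed

text \<open>Monotonicity interpolates between the integers. The hypotheses and the definitions of
  the growth events each contribute one margin \<open>1 / (k + 1)\<close>, hence the bound
  \<open>e / 6\<close> for a total of \<open>e / 3\<close>.\<close>

lemma growth_limit:
 assumes g: "mono g" and a: "a >= 0"
  and hi: "!!k. \<not> highg g (a + rs k)" and lo: "!!k. \<not> lowg g (a - rs k)"
 shows "((%s. g s / s) \<longlongrightarrow> a) at_top"
proof (rule tendstoI)
 fix e :: real assume e: "e > 0"
 obtain k where k: "rs k < e / 6" using nat_approx_posE[of "e / 6"] e by auto
 obtain m where m: "!!n. n >= m ==> g (real n) <= (a + rs k + rs k) * real n"
  using hi[of k] unfolding highg_def by (meson not_le)
 obtain m' where m': "!!n. n >= m' ==> g (real n) >= (a - rs k - rs k) * real n"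
  using lo[of k] unfolding lowg_def by (meson not_le)
 let ?d = "e / 3"
 have up: "g (real n) <= (a + ?d) * real n" if "n >= m" for n
  by (rule order_trans[OF m[OF that] mult_right_mono]) (use k in linarith)+
 have dn: "g (real n) >= (a - ?d) * real n" if "n >= m'" for n
  by (rule order_trans[OF mult_right_mono m'[OF that]]) (use k in linarith)+
 have "eventually (%s. s >= max (real (max m m') + 1) (3 * (a + e) / e)) at_top" by (rule eventually_ge_at_top)
 thus "eventually (%s. dist (g s / s) a < e) at_top"
 proof eventually_elim
  case (elim s)
  define n where "n = nat \<lfloor>s\<rfloor>"
  have s: "s >= 1" "s >= real (max m m') + 1" "3 * (a + e) / e <= s" using elim by auto
  hence n: "real n <= s" "s < real n + 1" unfolding n_def by linarith+
  have nm: "n >= m" "n >= m'" using n s(2) by linarith+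
  have big: "3 * (a + e) <= s * e" using s(3) e by (simp add: pos_divide_le_eq)
  have "g s <= g (real (Suc n))" using n by (intro monoD[OF g]) simp
  also have "... <= (a + ?d) * real (Suc n)" using nm by (intro up) simp
  also have "... <= (a + ?d) * (s + 1)" using n a e by (intro mult_left_mono) auto
  finally have u: "g s <= (a + ?d) * (s + 1)" .
  have "a * (s - 1) - ?d * s <= a * real n - ?d * real n" using n a e by (intro diff_mono mult_left_mono) auto
  also have "... = (a - ?d) * real n" by (simp add: algebra_simps)
  also have "... <= g (real n)" by (rule dn[OF nm(2)])
  also have "... <= g s" using n by (intro monoD[OF g]) simp
  finally have l: "a * (s - 1) - ?d * s <= g s" .
  have es: "e * s >= 3 * a + 3 * e" using big by (simp add: mult.commute distrib_left)
  have "(a + ?d) * (s + 1) = a * s + a + e * s / 3 + e / 3" by (simp add: algebra_simps)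
  hence "g s < a * s + e * s" using u es e a by linarith
  hence 1: "g s < (a + e) * s" by (simp add: distrib_right)
  have "a * (s - 1) - ?d * s = a * s - a - e * s / 3" by (simp add: algebra_simps)
  hence "g s > a * s - e * s" using l es e a by linarith
  hence 2: "g s > (a - e) * s" by (simp add: left_diff_distrib)
  show ?case using 1 2 s(1) by (simp add: dist_real_def abs_less_iff field_simps)
 qed
qed

section \<open>A uniform bound for local dimensions\<close>

lemma ball_cover:
 "EX K::nat. ALL R>0. ALL x :: real ^ 'd. EX Z. finite Z & card Z <= K & sup_cball R x \<subseteq> (\<Union>z\<in>Z. sup_cball (R * exp (- 1)) z)"
proof -
 have op: "open {y :: real ^ 'd. infnorm (y - z) < exp (- 1)}" for z by (intro open_Collect_less continuous_intros)
 have "sup_cball 1 0 \<subseteq> (\<Union>z\<in>UNIV. {y :: real ^ 'd. infnorm (y - z) < exp (- 1)})"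
 proof
  fix y :: "real ^ 'd"
  have "infnorm (y - y) < exp (- 1)" by (simp add: infnorm_0)
  thus "y \<in> (\<Union>z\<in>UNIV. {y. infnorm (y - z) < exp (- 1)})" by blast
 qed
 then obtain C where "C \<subseteq> UNIV" and C: "finite C" "sup_cball 1 0 \<subseteq> (\<Union>z\<in>C. {y :: real ^ 'd. infnorm (y - z) < exp (- 1)})"
  by (rule compactE_image[OF compact_sup_cball op])
 show ?thesis
 \<comment> \<open>The cover of the unit ball is carried to every other ball by an affine map, so
   the number of balls does not depend on \<open>R\<close> and \<open>x\<close>.\<close>
 proof (intro exI[of _ "card C"] allI impI)
  fix R :: real and x :: "real ^ 'd" assume R: "R > 0"
  let ?Z = "(%z. x + R *\<^sub>R z) ` C"
  have "sup_cball R x \<subseteq> (\<Union>z\<in>?Z. sup_cball (R * exp (- 1)) z)"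
  proof
   fix y assume "y \<in> sup_cball R x"
   hence "infnorm ((1 / R) *\<^sub>R (y - x)) <= 1" using R by (simp only: infnorm_mul mem_sup_cball) (simp add: field_simps)
   then obtain z where z: "z \<in> C" "infnorm ((1 / R) *\<^sub>R (y - x) - z) < exp (- 1)" using C(2) by (auto simp: mem_sup_cball)
   have "y - (x + R *\<^sub>R z) = R *\<^sub>R ((1 / R) *\<^sub>R (y - x) - z)" using R by (simp add: algebra_simps)
   hence "infnorm (y - (x + R *\<^sub>R z)) = R * infnorm ((1 / R) *\<^sub>R (y - x) - z)" using R by (simp only: infnorm_mul)
   also have "... <= R * exp (- 1)" using z(2) R by (intro mult_left_mono) auto
   finally show "y \<in> (\<Union>z\<in>?Z. sup_cball (R * exp (- 1)) z)" using z(1) by (auto simp: mem_sup_cball)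
  qed
  moreover have "finite ?Z" "card ?Z <= card C" using C(1) card_image_le by auto
  ultimately show "EX Z. finite Z & card Z <= card C & sup_cball R x \<subseteq> (\<Union>z\<in>Z. sup_cball (R * exp (- 1)) z)" by blast
 qed
qed

lemma ball_cover_n:
 obtains K :: nat where "K > 0"
  "ALL n R. ALL x :: real ^ 'd. R > 0 --> (EX Z. finite Z & card Z <= K ^ n & sup_cball R x \<subseteq> (\<Union>z\<in>Z. sup_cball (R * exp (- real n)) z))"
proof -
 obtain K0 :: nat where K0: "ALL R>0. ALL x :: real ^ 'd. EX Z. finite Z & card Z <= K0 & sup_cball R x \<subseteq> (\<Union>z\<in>Z. sup_cball (R * exp (- 1)) z)"
  using ball_cover by blast
 \<comment> \<open>The added 1 makes the base positive, so that its logarithm can be used.\<close>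
 let ?K = "K0 + 1"
 have "EX Z. finite Z & card Z <= ?K ^ n & sup_cball R x \<subseteq> (\<Union>z\<in>Z. sup_cball (R * exp (- real n)) z)" if R: "R > 0" for n R and x :: "real ^ 'd"
 proof (induction n)
  case 0 thus ?case by (intro exI[of _ "{x}"]) simp
 next
  case (Suc n)
  then obtain Z where Z: "finite Z" "card Z <= ?K ^ n" "sup_cball R x \<subseteq> (\<Union>z\<in>Z. sup_cball (R * exp (- real n)) z)" by blast
  have "R * exp (- real n) > 0" using R by simp
  hence "ALL z :: real ^ 'd. EX Z. finite Z & card Z <= K0 & sup_cball (R * exp (- real n)) z \<subseteq> (\<Union>w\<in>Z. sup_cball (R * exp (- real n) * exp (- 1)) w)"
   using K0 by blast
  from choice[OF this] obtain W where W: "ALL z :: real ^ 'd. finite (W z) & card (W z) <= K0 & sup_cball (R * exp (- real n)) z \<subseteq> (\<Union>w\<in>W z. sup_cball (R * exp (- real n) * exp (- 1)) w)"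
   by (elim exE)
  have e: "R * exp (- real n) * exp (- 1) = R * exp (- real (Suc n))" by (simp add: exp_add[symmetric])
  have "card (\<Union>z\<in>Z. W z) <= (\<Sum>z\<in>Z. card (W z))" by (rule card_UN_le[OF Z(1)])
  also have "... <= (\<Sum>z\<in>Z. ?K)" using W by (intro sum_mono) (simp add: le_SucI)
  also have "... = card Z * ?K" by simp
  also have "... <= ?K ^ n * ?K" using Z(2) by (rule mult_right_mono) simp
  also have "... = ?K ^ Suc n" by simp
  finally have "card (\<Union>z\<in>Z. W z) <= ?K ^ Suc n" .
  moreover have "finite (\<Union>z\<in>Z. W z)" using Z(1) W by blast
  moreover have "sup_cball R x \<subseteq> (\<Union>w\<in>(\<Union>z\<in>Z. W z). sup_cball (R * exp (- real (Suc n))) w)"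
  proof
   fix y assume "y \<in> sup_cball R x"
   then obtain z where z: "z \<in> Z" "y \<in> sup_cball (R * exp (- real n)) z" using Z(3) by blast
   then obtain w where "w \<in> W z" "y \<in> sup_cball (R * exp (- real n) * exp (- 1)) w" using W[rule_format, of z] by blast
   thus "y \<in> (\<Union>w\<in>(\<Union>z\<in>Z. W z). sup_cball (R * exp (- real (Suc n))) w)" unfolding e using z(1) by blast
  qed
  ultimately show ?case by (intro exI[of _ "\<Union>z\<in>Z. W z"] conjI)
 qed
 hence "ALL n R. ALL x :: real ^ 'd. R > 0 --> (EX Z. finite Z & card Z <= ?K ^ n & sup_cball R x \<subseteq> (\<Union>z\<in>Z. sup_cball (R * exp (- real n)) z))"
  by (intro allI impI)
 thus ?thesis by (rule that[rotated]) simp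
qed

text \<open>Borel-Cantelli for the sets \<open>X n\<close> of points \<open>y\<close> in a fixed
  ball at which \<open>oball y n\<close> is too light. The ball is covered by at most
  \<open>K ^ (n + j)\<close> small balls, and each that meets \<open>X n\<close> lies in
  \<open>oball y n\<close> for some \<open>y\<close> in \<open>X n\<close>; so the mass of
  \<open>X n\<close> is at most \<open>K ^ (n + j) * exp (- D * n)\<close>.\<close>

lemma local_dim_bound:
 obtains D :: real where "D >= 0"
  "ALL A. ALL mu:radon_on A. AE y in (mu :: (real ^ 'd) measure). eventually (%n. measure mu (oball y n) >= exp (- D * real n)) sequentially"
proof -
 obtain K :: nat where K: "K > 0"
  "ALL n R. ALL x :: real ^ 'd. R > 0 --> (EX Z. finite Z & card Z <= K ^ n & sup_cball R x \<subseteq> (\<Union>z\<in>Z. sup_cball (R * exp (- real n)) z))"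
  by (rule ball_cover_n)
 \<comment> \<open>The logarithm compensates the growing number of covering balls, the 1 leaves the
   summable factor \<open>exp (- n)\<close>.\<close>
 define D where "D = ln (real K) + 1"
 have D: "D >= 0" using K(1) by (simp add: D_def)
 have eD: "exp (- D * real n) * real K ^ n = exp (- real n)" for n
 proof -
  have "real K ^ n = exp (ln (real K) * real n)" using K(1) by (simp add: exp_of_nat2_mult)
  thus ?thesis by (simp add: exp_add[symmetric] D_def algebra_simps)
 qed
 have "AE y in mu. eventually (%n. measure mu (oball y n) >= exp (- D * real n)) sequentially" if mu: "mu \<in> radon_on A" for A and mu :: "(real ^ 'd) measure"
 proof -
  note [simp] = radon_sets[OF mu] radon_space[OF mu]
  have "AE y in mu. y \<in> cb N --> eventually (%n. measure mu (oball y n) >= exp (- D * real n)) sequentially" for N :: nat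
  proof -
   \<comment> \<open>\<open>j\<close> extra subdivisions bring the radius of the covering balls
     below \<open>exp (- 1) * exp (- n)\<close>. Their diameter is then less than
     \<open>exp (- n)\<close>, because \<open>2 * exp (- 1) < 1\<close>.\<close>
   have "eventually (%j. exp (- real j) < exp (- 1) / (real N + 1)) sequentially" by (rule order_tendstoD(2)[OF exp_neg_lim]) simp
   then obtain j where j: "exp (- real j) < exp (- 1) / (real N + 1)" by (auto simp: eventually_sequentially)
   define X where "X n = {y \<in> cb N. measure mu (oball y n) < exp (- D * real n)}" for n
   have Xb: "X n \<in> sets borel" for n
   proof -
   let ?B = "sup_cball (real N + 1) 0 :: (real ^ 'd) set"
   let ?m = "restr mu ?B"
   have sB: "?B \<in> sets borel" by (rule sup_cball_borel)
   have "em ?m UNIV < \<infinity>" using emeasure_restr[OF radon_sets[OF mu] sB, of UNIV] radon_ball[OF mu, of "real N + 1" 0] by simp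
   hence f: "finite_measure ?m" by (intro finite_measureI) (simp add: restr_def less_top[symmetric])
   have t: "tube (%x. x) y (exp (- real n)) = oball y n" for y :: "real ^ 'd" by (auto simp: mem_tube_id oball_def)
   have [measurable]: "(%y. em ?m (oball y n)) \<in> bm borel"
   using emeasure_tube_measurable[OF linear_id' f, of "exp (- real n)"] by (simp add: t)
   have "{y. measure ?m (oball y n) < exp (- D * real n)} \<in> sets borel" unfolding measure_def by measurable
   hence s: "cb N Int {y. measure ?m (oball y n) < exp (- D * real n)} \<in> sets borel"
   using sup_cball_borel[of "real N" 0] by (rule sets.Int[rotated])
   have e: "measure ?m (oball y n) = measure mu (oball y n)" if "y \<in> cb N" for y
   proof -
   have "oball y n \<subseteq> ?B"
   proof
   fix z assume "z \<in> oball y n"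
   hence "infnorm (z - y) < 1" by (auto simp: oball_def intro: order_less_le_trans)
   thus "z \<in> ?B" using that infnorm_triangle[of "z - y" y] by (simp add: mem_sup_cball)
   qed
   hence "?B Int oball y n = oball y n" by blast
   thus ?thesis using emeasure_restr[OF radon_sets[OF mu] sB oball_borel, of y n] by (simp add: measure_def)
   qed
   have "X n = cb N Int {y. measure ?m (oball y n) < exp (- D * real n)}"
   using e by (auto simp: X_def)
   thus ?thesis using s by simp
   qed
   have bound: "em mu (X n) <= ennreal (real K ^ j * exp (- real n))" for n
   proof -
   have "real N + 1 > 0" by simp
   then obtain Z where Z: "finite Z" "card Z <= K ^ (n + j)" "sup_cball (real N + 1) (0 :: real ^ 'd) \<subseteq> (\<Union>z\<in>Z. sup_cball ((real N + 1) * exp (- real (n + j))) z)"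
   using K(2) by blast
   let ?C = "%z. X n Int sup_cball ((real N + 1) * exp (- real (n + j))) z"
   have r: "(real N + 1) * exp (- real (n + j)) < exp (- 1) * exp (- real n)"
   proof -
   have "(real N + 1) * exp (- real j) < exp (- 1)" using j by (simp add: pos_less_divide_eq mult.commute)
   hence "(real N + 1) * exp (- real j) * exp (- real n) < exp (- 1) * exp (- real n)" by (rule mult_strict_right_mono) simp
   thus ?thesis by (simp add: mult.assoc exp_add[symmetric] add.commute)
   qed
   have h: "2 * exp (- 1 :: real) < 1" using exp_lower_Taylor_quadratic[of 1] by (simp add: exp_minus field_simps)
   have c: "em mu (?C z) <= ennreal (exp (- D * real n))" for z
   proof (cases "?C z = {}")
   case False
   then obtain y where y: "y \<in> X n" "infnorm (y - z) <= (real N + 1) * exp (- real (n + j))" by (auto simp: mem_sup_cball)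
   have "?C z \<subseteq> oball y n"
   proof
   fix w assume "w \<in> ?C z"
   hence "infnorm (w - z) <= (real N + 1) * exp (- real (n + j))" by (simp add: mem_sup_cball)
   moreover have "infnorm (w - y) <= infnorm (w - z) + infnorm (y - z)"
   using infnorm_triangle[of "w - z" "z - y"] infnorm_sub[of z y] by simp
   ultimately have "infnorm (w - y) < 2 * exp (- 1) * exp (- real n)" using y(2) r by linarith
   also have "... <= 1 * exp (- real n)" using h by (intro mult_right_mono) auto
   finally show "w \<in> oball y n" by (simp add: oball_def)
   qed
   hence "em mu (?C z) <= em mu (oball y n)" by (intro emeasure_mono) auto
   also have "... = ennreal (measure mu (oball y n))" by (rule emeasure_fin[OF oball_fin[OF mu]])
   also have "... <= ennreal (exp (- D * real n))" using y(1) by (intro ennreal_leI) (simp add: X_def)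
   finally show ?thesis .
   qed simp
   have "X n \<subseteq> (\<Union>z\<in>Z. ?C z)" using Z(3) sup_cball_mono[of "real N" "real N + 1" 0] by (auto simp: X_def)
   hence "em mu (X n) <= em mu (\<Union>z\<in>Z. ?C z)" using Xb Z(1) by (intro emeasure_mono) auto
   also have "... <= (\<Sum>z\<in>Z. em mu (?C z))" using Xb Z(1) by (intro emeasure_subadditive_finite) auto
   also have "... <= (\<Sum>z\<in>Z. ennreal (exp (- D * real n)))" by (intro sum_mono c)
   also have "... = ennreal (real (card Z) * exp (- D * real n))" by (simp add: ennreal_mult ennreal_of_nat_eq_real_of_nat)
   also have "... <= ennreal (real (K ^ (n + j)) * exp (- D * real n))" using Z(2) by (intro ennreal_leI mult_right_mono) (auto simp del: of_nat_power)
   also have "real (K ^ (n + j)) * exp (- D * real n) = real K ^ j * (exp (- D * real n) * real K ^ n)" by (simp add: power_add mult_ac)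
   also have "exp (- D * real n) * real K ^ n = exp (- real n)" by (rule eD)
   finally show ?thesis .
   qed
   have "AE y in mu. eventually (%n. y \<in> space mu - X n) sequentially"
   proof (rule borel_cantelli_AE1)
   show "X n \<in> sets mu" for n using Xb by simp
   show f: "em mu (X n) < \<infinity>" for n using order_le_less_trans[OF bound[of n] ennreal_less_top] by simp
   have "summable (%n. real K ^ j * exp (- real n))"
   proof -
   have "summable (%n. exp (- 1 :: real) ^ n)" by (rule summable_geometric) simp
   thus ?thesis by (intro summable_mult) (simp add: exp_of_nat_mult[symmetric])
   qed
   thus "summable (%n. measure mu (X n))"
   proof (rule summable_comparison_test'[where N=0])
   fix n
   have "measure mu (X n) <= real K ^ j * exp (- real n)"
   unfolding measure_def using bound[of n] by (intro enn2real_leI) auto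
   thus "norm (measure mu (X n)) <= real K ^ j * exp (- real n)" by simp
   qed
   qed
   thus ?thesis
   proof eventually_elim
   case (elim y)
   show ?case
   proof
   assume "y \<in> cb N"
   thus "eventually (%n. measure mu (oball y n) >= exp (- D * real n)) sequentially"
   using elim by (auto simp: X_def elim!: eventually_mono)
   qed
   qed
  qed
  hence "AE y in mu. ALL N::nat. y \<in> cb N --> eventually (%n. measure mu (oball y n) >= exp (- D * real n)) sequentially"
   unfolding AE_all_countable by (rule allI)
  thus ?thesis
  proof eventually_elim
   case (elim y)
   obtain N :: nat where "infnorm y <= real N" using real_arch_simple by blast
   thus ?case using elim[rule_format, of N] by (simp add: mem_sup_cball)
  qed
 qed
 thus ?thesis using that[OF D] by blast
qed

section \<open>Exact dimension of ergodic fractal distributions\<close>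

definition gg :: "(real ^ 'd) measure => real => real" where
 "gg nu s = - ln (measure nu (sup_cball (exp (- s)) 0))"

context
 fixes V :: "(real ^ 'd) set" and Q :: "(real ^ 'd) measure measure"
 assumes V: "subspace V" and E: "ergodic_fractal_distribution V Q"
begin

lemma fQ: "fractal_distribution V Q"
 using E by (simp add: ergodic_fractal_distribution_def)

lemma ball_pos: "nu \<in> star_space V ==> r > 0 ==> measure nu (sup_cball r 0) > 0"
 by (rule msupp_ball(2)[of _ V]) (auto simp: star_space_def)

lemma gg_mono: assumes "nu \<in> star_space V" shows "mono (gg nu)"
proof (rule monoI)
 fix s t :: real assume "s <= t"
 have r: "nu \<in> radon_on V" using assms by (simp add: star_space_def)
 have "em nu (sup_cball (exp (- t)) 0) <= em nu (sup_cball (exp (- s)) 0)"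
  using \<open>s <= t\<close> radon_sets[OF r] by (intro emeasure_mono sup_cball_mono) auto
 hence "measure nu (sup_cball (exp (- t)) 0) <= measure nu (sup_cball (exp (- s)) 0)"
  unfolding measure_def using radon_ball[OF r] by (intro enn2real_mono) auto
 thus "gg nu s <= gg nu t" using ball_pos[OF assms] by (simp add: gg_def)
qed

lemma gg_0: "nu \<in> star_space V ==> gg nu 0 = 0"
 by (simp add: gg_def star_space_def measure_def)

lemma gg_nonneg: "nu \<in> star_space V ==> s >= 0 ==> gg nu s >= 0"
 using monoD[OF gg_mono, of nu 0 s] by (simp add: gg_0)

text \<open>Normalisation after scaling divides by the mass of the ball of radius
  \<open>exp (- t)\<close>; the logarithm turns this into the cocycle identity.\<close>

lemma gg_scale: assumes nu: "nu \<in> star_space V" shows "gg (scale_star t nu) = (%s. gg nu (s + t) - gg nu t)"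
proof
 fix s
 show "gg (scale_star t nu) s = gg nu (s + t) - gg nu t"
  unfolding gg_def scale_star_measure[OF nu]
  using ball_pos[OF nu, of "exp (- t)"] ball_pos[OF nu, of "exp (- s) * exp (- t)"] by (simp add: ln_div exp_add[symmetric])
qed

lemma iter_scale: assumes nu: "nu \<in> star_space V" shows "(scale_star 1 ^^ i) nu = scale_star (real i) nu"
proof (induction i)
 case 0 thus ?case by (simp add: scale_star_0[OF nu])
next
 case (Suc i) thus ?case by (simp add: scale_star_add[OF nu] add.commute)
qed

lemma gg_sum: assumes nu: "nu \<in> star_space V" shows "(\<Sum>i<n. gg ((scale_star 1 ^^ i) nu) 1) = gg nu (real n)"
proof -
 have "(\<Sum>i<n. gg ((scale_star 1 ^^ i) nu) 1) = (\<Sum>i<n. gg nu (real (Suc i)) - gg nu (real i))"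
  by (simp add: iter_scale[OF nu] gg_scale[OF nu])
 also have "... = gg nu (real n) - gg nu 0" by (subst sum_lessThan_telescope) simp
 finally show ?thesis by (simp add: gg_0[OF nu])
qed

lemma gg_measurable [measurable]: "(%nu. gg nu s) \<in> bm Q"
proof -
 note Q_id[OF V fQ, measurable]
 show ?thesis unfolding gg_def by measurable
qed

text \<open>\<open>t\<close> also takes negative values, so the one-sided invariance in
  \<open>inv\<close> upgrades to the equality of sets that ergodicity refers to.\<close>

lemma zero_one:
 assumes m: "{nu \<in> space Q. R nu} \<in> sets Q"
  and inv: "!!nu t. nu \<in> star_space V ==> R nu ==> R (scale_star t nu)"
 shows "(AE nu in Q. R nu) \<or> (AE nu in Q. \<not> R nu)"
proof -
 note Q0 = Q0[OF V fQ]
 interpret prob_space Q by (rule Q0)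
 let ?A = "star_space V Int {nu \<in> space Q. R nu}"
 have A: "?A \<in> sets Q" using star_space_sets[of V] m Q0(2) by auto
 have sp: "star_space V \<subseteq> space Q" using space_P[OF V Q0(2)] by (auto simp: star_space_def)
 have "scale_star t -` ?A Int star_space V = ?A" for t
 proof (rule set_eqI)
  fix nu
  have "R (scale_star t nu) \<longleftrightarrow> R nu" if n: "nu \<in> star_space V"
  proof
   assume "R (scale_star t nu)"
   from inv[OF scale_star_space[OF V n] this, of "- t"] show "R nu" by (simp add: scale_star_add[OF n] scale_star_0[OF n])
  qed (rule inv[OF n])
  moreover have "nu \<in> star_space V ==> scale_star t nu \<in> star_space V" by (rule scale_star_space[OF V])
  ultimately show "nu \<in> scale_star t -` ?A Int star_space V \<longleftrightarrow> nu \<in> ?A" using sp by blast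
 qed
 hence "em Q ?A = 0 \<or> em Q ?A = 1"
  using E A unfolding ergodic_fractal_distribution_def S_ergodic_def by blast
 hence "(AE nu in Q. nu \<notin> ?A) \<or> (AE nu in Q. nu \<in> ?A)"
  using A by (auto simp: emeasure_eq_measure prob_eq_0 prob_eq_1)
 moreover have "AE nu in Q. \<not> R nu" if "AE nu in Q. nu \<notin> ?A"
  using that Q0(4) by eventually_elim (use sp in blast)
 moreover have "AE nu in Q. R nu" if "AE nu in Q. nu \<in> ?A"
  using that by eventually_elim blast
 ultimately show ?thesis by blast
qed

lemma lowg_sets: "{nu \<in> space Q. lowg (gg nu) c} \<in> sets Q"
 unfolding lowg_def by measurable

lemma highg_sets: "{nu \<in> space Q. highg (gg nu) c} \<in> sets Q"
 unfolding highg_def by measurable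

lemma lowg_01: "(AE nu in Q. lowg (gg nu) c) \<or> (AE nu in Q. \<not> lowg (gg nu) c)"
 by (rule zero_one[OF lowg_sets]) (simp add: gg_scale lowg_shift gg_mono gg_nonneg)

lemma highg_01: "c >= 0 ==> (AE nu in Q. highg (gg nu) c) \<or> (AE nu in Q. \<not> highg (gg nu) c)"
 by (rule zero_one[OF highg_sets]) (simp add: gg_scale highg_shift gg_mono)

text \<open>On \<open>star_space V\<close> this is just \<open>gg nu 1\<close>; the maximum makes it
  nonnegative everywhere and not only almost everywhere.\<close>

definition phi :: "(real ^ 'd) measure => real" where "phi nu = max 0 (gg nu 1)"

lemma phi_measurable [measurable]: "phi \<in> bm Q"
 unfolding phi_def[abs_def] by measurable

lemma phi_sum: assumes nu: "nu \<in> star_space V" shows "(\<Sum>i<n. phi ((scale_star 1 ^^ i) nu)) = gg nu (real n)"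
proof -
 have "phi ((scale_star 1 ^^ i) nu) = gg ((scale_star 1 ^^ i) nu) 1" for i
  using gg_nonneg[OF scale_star_space[OF V nu, of "real i"], of 1] by (simp add: phi_def iter_scale[OF nu])
 thus ?thesis using gg_sum[OF nu] by simp
qed

lemma theta: "scale_star 1 \<in> Q \<rightarrow>\<^sub>M Q" "distr Q Q (scale_star 1) = Q"
proof -
 show "scale_star 1 \<in> Q \<rightarrow>\<^sub>M Q" using scale_Q[OF V fQ, of 1] by (simp cong: mcs add: Q0(2)[OF V fQ])
 have "distr Q Q (scale_star 1) = distr Q (radon_borel V) (scale_star 1)" by (intro distr_cong) (auto simp: Q0(2)[OF V fQ])
 thus "distr Q Q (scale_star 1) = Q" by (simp add: Q0(5)[OF V fQ])
qed

lemma trunc_integrable: "integrable Q (%nu. min (phi nu) T)" if "T >= 0"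
proof -
 interpret prob_space Q by (rule Q0[OF V fQ])
 show ?thesis using that by (intro integrable_const_bound[where B=T] AE_I2) (auto simp: phi_def)
qed

text \<open>Truncation makes the function integrable before \<open>phi\<close> is known to be. A low
  growth rate yields times at which the orbit sum of \<open>phi - c\<close> is nonpositive, and
  truncating only lowers that sum.\<close>

lemma low_integral:
 assumes l: "AE nu in Q. lowg (gg nu) c" and T: "T >= 0" shows "(LINT nu|Q. min (phi nu) T) <= c"
proof -
 interpret prob_space Q by (rule Q0[OF V fQ])
 have "expectation (%nu. min (phi nu) T - c) <= 0"
 proof (rule nonpos_blocks[OF theta, where T="max 0 (T - c)"])
  show "integrable Q (%nu. min (phi nu) T - c)" using trunc_integrable[OF T] by simp
  show "AE nu in Q. EX n>=1. (\<Sum>i<n. min (phi ((scale_star 1 ^^ i) nu)) T - c) <= 0"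
   using l Q0(4)[OF V fQ]
  proof eventually_elim
   case (elim nu)
   obtain k n where n: "n >= (1 :: nat)" "gg nu (real n) < (c - rs k) * real n" using elim(1) unfolding lowg_def by blast
   have "(\<Sum>i<n. min (phi ((scale_star 1 ^^ i) nu)) T - c) <= (\<Sum>i<n. phi ((scale_star 1 ^^ i) nu) - c)" by (intro sum_mono) simp
   also have "... = gg nu (real n) - c * real n" by (simp add: sum_subtractf phi_sum[OF elim(2)])
   also have "... <= (c - rs k) * real n - c * real n" using n(2) by simp
   also have "... = - (rs k * real n)" by (simp only: left_diff_distrib)
   also have "... <= 0" by simp
   finally show ?case using n(1) by blast
  qed
 qed auto
 thus ?thesis using trunc_integrable[OF T] by (simp add: prob_space)
qed

text \<open>With the roles exchanged, \<open>c - phi\<close> is bounded above by \<open>c\<close>,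
  so no truncation is required; instead \<open>phi\<close> has to be integrable.\<close>

lemma high_integral:
 assumes h: "AE nu in Q. highg (gg nu) c" and i: "integrable Q phi" shows "c <= (LINT nu|Q. phi nu)"
proof -
 interpret prob_space Q by (rule Q0[OF V fQ])
 have "expectation (%nu. c - phi nu) <= 0"
 proof (rule nonpos_blocks[OF theta, where T="max 0 c"])
  show "integrable Q (%nu. c - phi nu)" using i by simp
  show "c - phi nu <= max 0 c" for nu by (simp add: phi_def)
  show "AE nu in Q. EX n>=1. (\<Sum>i<n. c - phi ((scale_star 1 ^^ i) nu)) <= 0"
   using h Q0(4)[OF V fQ]
  proof eventually_elim
   case (elim nu)
   obtain k n where n: "n >= (1 :: nat)" "gg nu (real n) > (c + rs k) * real n" using elim(1) unfolding highg_def by blast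
   have "(\<Sum>i<n. c - phi ((scale_star 1 ^^ i) nu)) = c * real n - gg nu (real n)" by (simp add: sum_subtractf phi_sum[OF elim(2)])
   also have "... <= c * real n - (c + rs k) * real n" using n(2) by simp
   also have "... = - (rs k * real n)" by (simp only: distrib_right)
   also have "... <= 0" by simp
   finally show ?case using n(1) by blast
  qed
 qed auto
 thus ?thesis using i by (simp add: prob_space)
qed

text \<open>Integrability of \<open>phi\<close> is not given in advance. The covering bound supplies
  a finite lower growth rate, at typical points first and then at the origin.\<close>

lemma low_AE: "EX c. AE nu in Q. lowg (gg nu) c"
proof -
 obtain D :: real where D: "D >= 0"
  "ALL A. ALL mu:radon_on A. AE y in (mu :: (real ^ 'd) measure). eventually (%n. measure mu (oball y n) >= exp (- D * real n)) sequentially"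
  by (rule local_dim_bound)
 have "AE mu in Q. lowg (gg mu) (D + 1)"
 proof (rule qp_AE_rev[OF V Q0(2,3)[OF V fQ]])
  have "space Q - {nu \<in> space Q. lowg (gg nu) (D + 1)} \<in> sets Q" by (rule sets.compl_sets[OF lowg_sets])
  moreover have "space Q - {nu \<in> space Q. lowg (gg nu) (D + 1)} = {mu \<in> space Q. \<not> lowg (gg mu) (D + 1)}" by blast
  ultimately show "{mu \<in> space Q. \<not> lowg (gg mu) (D + 1)} \<in> sets Q" by simp
  show "AE mu in Q. AE x in mu. x \<in> V --> lowg (gg (trans_star x mu)) (D + 1)"
  proof (rule AE_I2)
   fix mu assume "mu \<in> space Q"
   hence r: "mu \<in> radon_on V" using space_P[OF V Q0(2)[OF V fQ]] by simp
   have "AE y in mu. eventually (%n. measure mu (oball y n) >= exp (- D * real n)) sequentially" using D(2) r by blast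
   thus "AE x in mu. x \<in> V --> lowg (gg (trans_star x mu)) (D + 1)" using msupp_AE[OF r]
   proof eventually_elim
   case (elim y)
   obtain a :: real where a: "a > 0" "ALL X:sets borel. em (trans_star y mu) X = ennreal a * em mu (aff 1 y -` X)"
   using star_distr_emeasure[OF r elim(2), of 1] unfolding trans_star_aff by auto
   obtain n0 where n0: "!!n. n >= n0 ==> measure mu (oball y n) >= exp (- D * real n)" using elim(1) unfolding eventually_sequentially by blast
   have g: "gg (trans_star y mu) (real n) <= D * real n - ln a" if "n >= n0" for n
   proof -
   have "aff 1 y -` sup_cball (exp (- real n)) 0 = sup_cball (exp (- real n)) y" by (auto simp: aff_def mem_sup_cball)
   hence m: "measure (trans_star y mu) (sup_cball (exp (- real n)) 0) = a * measure mu (sup_cball (exp (- real n)) y)"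
   using bspec[OF a(2) sup_cball_borel[of "exp (- real n)" 0]] a(1) by (simp add: measure_def enn2real_mult)
   have "em mu (oball y n) <= em mu (sup_cball (exp (- real n)) y)"
   using radon_sets[OF r] by (intro emeasure_mono) (auto simp: oball_def mem_sup_cball)
   hence "measure mu (oball y n) <= measure mu (sup_cball (exp (- real n)) y)"
   unfolding measure_def using radon_ball[OF r] by (intro enn2real_mono) auto
   hence ge: "exp (- D * real n) <= measure mu (sup_cball (exp (- real n)) y)" using n0[OF that] by linarith
   have p: "measure mu (sup_cball (exp (- real n)) y) > 0" by (rule order_less_le_trans[OF _ ge]) simp
   have "- D * real n <= ln (measure mu (sup_cball (exp (- real n)) y))" using ln_mono[OF ge] p by simp
   thus ?thesis using a(1) p by (simp add: gg_def m ln_mult)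
   qed
   have "EX n>=m. gg (trans_star y mu) (real n) < (D + 1 - rs 1) * real n" for m
   proof -
   \<comment> \<open>The margin \<open>rs 1\<close> equals 1/2, so \<open>n\<close> must exceed
     \<open>2 * (- ln a)\<close> for \<open>D * n - ln a\<close> to lie below
     \<open>(D + 1 / 2) * n\<close>.\<close>
   obtain j :: nat where j: "2 * (- ln a) + 1 <= real j" using real_arch_simple by blast
   define n where "n = max m (max n0 j)"
   have n: "n >= m" "n >= n0" "real j <= real n" by (auto simp: n_def)
   have "(D + 1 - rs 1) * real n = D * real n + real n / 2" by (simp add: algebra_simps)
   hence "gg (trans_star y mu) (real n) < (D + 1 - rs 1) * real n" using g[OF n(2)] j n(3) by linarith
   thus ?thesis using n(1) by blast
   qed
   thus ?case unfolding lowg_def by blast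
   qed
  qed
 qed
 thus ?thesis by blast
qed

text \<open>The integrals of the truncations are bounded by the rate \<open>c\<close>, independently
  of the level, and monotone convergence applies.\<close>

lemma phi_integrable: "integrable Q phi"
proof -
 interpret prob_space Q by (rule Q0[OF V fQ])
 obtain c where c: "AE nu in Q. lowg (gg nu) c" using low_AE by blast
 let ?I = "%n. (LINT nu|Q. min (phi nu) (real n))"
 have "incseq ?I" by (rule incseq_SucI) (intro integral_mono trunc_integrable, auto)
 moreover have "?I n <= c" for n by (rule low_integral[OF c]) simp
 ultimately obtain L where L: "?I \<longlonglongrightarrow> L" using incseq_convergent by metis
 show ?thesis
 proof (rule integrable_monotone_convergence[OF _ _ _ L])
  show "integrable Q (%nu. min (phi nu) (real n))" for n by (rule trunc_integrable) simp
  show "AE nu in Q. mono (%n. min (phi nu) (real n))" by (intro AE_I2 monoI) auto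
  show "AE nu in Q. (%n. min (phi nu) (real n)) \<longlonglongrightarrow> phi nu"
  proof (rule AE_I2)
   fix nu
   obtain N :: nat where N: "phi nu <= real N" using real_arch_simple by blast
   have "eventually (%n. min (phi nu) (real n) = phi nu) sequentially"
   unfolding eventually_sequentially by (rule exI[of _ N]) (use N in auto)
   thus "(%n. min (phi nu) (real n)) \<longlonglongrightarrow> phi nu" by (rule tendsto_eventually)
  qed
 qed measurable
qed

text \<open>The dimension is the integral of \<open>phi\<close>. By ergodicity each growth event
  holds almost everywhere or fails almost everywhere, and a rate different from the integral would
  contradict one of the two integral inequalities.\<close>

theorem efd_exact_dimensional: "EX al. AE nu in Q. exact_dimensional nu al"
proof (rule exI)
 interpret prob_space Q by (rule Q0[OF V fQ])
 let ?a = "\<integral>nu. phi nu \<partial>Q"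
 have a0: "?a >= 0" by (rule Bochner_Integration.integral_nonneg) (simp add: phi_def)
 have notriv: "\<not> (AE nu in Q. False)" using AE_False emeasure_space_1 by simp
 have hi: "AE nu in Q. \<not> highg (gg nu) (?a + rs k)" for k
 proof (rule ccontr)
  assume "\<not> ?thesis"
  moreover have "?a + rs k >= 0" using a0 by simp
  ultimately have "AE nu in Q. highg (gg nu) (?a + rs k)" using highg_01 by blast
  from high_integral[OF this phi_integrable] show False by (simp add: field_simps)
 qed
 have lo: "AE nu in Q. \<not> lowg (gg nu) (?a - rs k)" for k
 proof (rule ccontr)
  assume "\<not> ?thesis"
  hence l: "AE nu in Q. lowg (gg nu) (?a - rs k)" using lowg_01 by blast
  have "(%n. \<integral>nu. min (phi nu) (real n) \<partial>Q) \<longlonglongrightarrow> ?a"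
  proof (rule integral_dominated_convergence[where w=phi])
   show "AE nu in Q. (%n. min (phi nu) (real n)) \<longlonglongrightarrow> phi nu"
   proof (rule AE_I2)
   fix nu
   obtain N :: nat where N: "phi nu <= real N" using real_arch_simple by blast
   have "eventually (%n. min (phi nu) (real n) = phi nu) sequentially"
   unfolding eventually_sequentially by (rule exI[of _ N]) (use N in auto)
   thus "(%n. min (phi nu) (real n)) \<longlonglongrightarrow> phi nu" by (rule tendsto_eventually)
   qed
  qed (auto simp: phi_integrable phi_def)
  hence "?a <= ?a - rs k" by (rule LIMSEQ_le_const2) (use low_integral[OF l] in auto)
  thus False by (simp add: field_simps)
 qed
 have "AE nu in Q. ALL k. \<not> highg (gg nu) (?a + rs k)" unfolding AE_all_countable using hi by blast
 moreover have "AE nu in Q. ALL k. \<not> lowg (gg nu) (?a - rs k)" unfolding AE_all_countable using lo by blast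
 ultimately have zero: "AE nu in Q. ((%r. ln (measure nu (sup_cball r 0)) / ln r) \<longlongrightarrow> ?a) at0"
  using Q0(4)[OF V fQ]
 proof eventually_elim
  case (elim nu)
  have l: "((%s. gg nu s / s) \<longlongrightarrow> ?a) at_top"
   by (rule growth_limit[OF gg_mono[OF elim(3)] a0]) (use elim in blast)+
  have "filterlim (%r. - ln r) at_top (at_right (0 :: real))"
   using ln_at_0 by (simp add: filterlim_uminus_at_top)
  from filterlim_compose[OF l this] show ?case
  proof (rule Lim_transform_eventually)
   have "eventually (%r. r > 0) (at_right (0 :: real))" by (rule eventually_at_right_less)
   thus "eventually (%r. gg nu (- ln r) / - ln r = ln (measure nu (sup_cball r 0)) / ln r) at0"
   by eventually_elim (simp add: gg_def)
  qed
 qed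
 \<comment> \<open>So far the limit is known at the origin of typical measures; the quasi-Palm
   property moves it to their typical points.\<close>
 have "AE nu in Q. nu \<in> radon_on V" using space_P[OF V Q0(2)[OF V fQ]] by (intro AE_I2) simp
 thus "AE nu in Q. exact_dimensional nu ?a"
  using qp_AE[OF V Q0(2,3)[OF V fQ] zero]
 proof eventually_elim
  case (elim nu)
  show ?case unfolding exact_dimensional_def using elim(2) msupp_AE[OF elim(1)]
  proof eventually_elim
   case (elim y)
   have r: "nu \<in> radon_on V" by fact
   obtain c :: real where c: "c > 0" "ALL X:sets borel. em (trans_star y nu) X = ennreal c * em nu (aff 1 y -` X)"
   using star_distr_emeasure[OF r elim(2), of 1] unfolding trans_star_aff by auto
   have m: "measure (trans_star y nu) (sup_cball r 0) = c * measure nu (sup_cball r y)" for r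
   proof -
   have "aff 1 y -` sup_cball r 0 = sup_cball r y" by (auto simp: aff_def mem_sup_cball)
   thus ?thesis using bspec[OF c(2) sup_cball_borel[of r 0]] c(1) by (simp add: measure_def enn2real_mult)
   qed
   show ?case by (rule local_dim_transfer[OF r elim(2) c(1) m]) (use elim(1) in blast)
  qed
 qed
qed

end

theorem proposition1p28:
  fixes P :: "(real ^ 'd) measure measure" and \<pi> :: "real ^ 'd \<Rightarrow> real ^ 'k"
  assumes "ergodic_fractal_distribution UNIV P"
    and "linear \<pi>"
  shows "(AE \<mu> in P. fiber_measure_defined \<pi> \<mu> 0) \<and>
    ergodic_fractal_distribution (fiber \<pi> 0) (fiber_distribution \<pi> P) \<and>
    factor_map P (fiber_distribution \<pi> P) (fiber_map \<pi>) \<and>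
    (\<exists>\<alpha>. AE \<mu> in P.
       exact_dimensional (fiber_measure \<pi> \<mu> 0) \<alpha> \<and>
       glued_disintegration \<pi> \<mu> (fiber_measure \<pi> \<mu>) \<and>
       (AE x in \<mu>. fiber_measure_defined \<pi> \<mu> x \<and> exact_dimensional (fiber_measure \<pi> \<mu> x) \<alpha>))"
proof -
  note efd = QD_efd[OF assms(2,1)]
  obtain \<alpha> where \<alpha>: "AE \<nu> in distr P (radon_borel (fiber \<pi> 0)) (F0 \<pi>). exact_dimensional \<nu> \<alpha>"
    using efd_exact_dimensional[OF subspace_fiber[OF assms(2)] efd] by blast
  have "AE \<mu> in P. fiber_measure_defined \<pi> \<mu> 0"
    using good_AE[OF assms(2,1)] by eventually_elim (rule good_fiber_measure(1)[OF assms(2,1)])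
  moreover have "ergodic_fractal_distribution (fiber \<pi> 0) (fiber_distribution \<pi> P)"
    using efd by (simp only: fiber_distribution_eq[OF assms(2,1)])
  ultimately show ?thesis
    using fiber_factor_map[OF assms(2,1)] fiber_dimension[OF assms(2,1) \<alpha>] by blast
qed

end
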